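(* There are exactly $9$ rigid isotopy classes of real rational curves of degree $4$ in $\mathbb{RP}^2$ that have only real nodes as singularities.
   Context: **Rational real curves.** A real rational curve $C$ of degree $d$ in the projective plane is a plane projective curve of degree $d$ that is the image of a regular map $\theta:[s:t]\mapsto[p_0(s,t):p_1(s,t):p_2(s,t)]$ of the projective line, where $p_0,p_1,p_2$ are homogeneous polynomials of the same degree $d$ with real coefficients and with no common root (in $\mathbb{CP}^1$). Its map on complex points is $\mathbb{C}\theta:\mathbb{CP}^1\to\mathbb{CP}^2$, with image $\mathbb{C}C$. The real points of $C$ are the points of $\mathbb{C}C\cap\mathbb{RP}^2$. **Nodes.** A point $x\in\mathbb{C}C$ is a node if $\mathbb{C}\theta^{-1}(x)$ consists of exactly two points and the corresponding two branches of $\mathbb{C}C$ at $x$ are transversal. The curve $C$ is nodal (equivalently, generic) if its only singularities (in $\mathbb{CP}^2$) are nodes; then $\mathbb{C}\theta$ is an immersion, injective except over the nodes, and there are $\frac{(d-1)(d-2)}{2}$ nodes (so $3$ when $d=4$). A node is real if it lies in $\mathbb{RP}^2$; a real node is either non-solitary (its preimage under $\mathbb{C}\theta$ consists of two points of $\mathbb{RP}^1$) or solitary (its preimage consists of two complex conjugate points of $\mathbb{CP}^1\setminus\mathbb{RP}^1$). "Only real nodes as singularities" means that the curve is nodal and all of its nodes are real; both solitary and non-solitary ones are allowed. **Rigid isotopy.** A rigid isotopy between nodal rational real plane projective curves of degree $d$ is a continuous one-parameter deformation $C_t$, $t\in[0,1]$, consisting of nodal rational real plane projective curves of the same degree $d$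 (continuity is with respect to the coefficients of the curves). Rigid isotopy is an equivalence relation, and its equivalence classes are the rigid isotopy classes. *)

theory Defs
  imports "HOL-Analysis.Analysis"
begin

section \<open>Complex projective space\<close>

definition hom_equiv :: "complex ^ 'n \<Rightarrow> complex ^ 'n \<Rightarrow> bool" where
  "hom_equiv x y \<longleftrightarrow> x \<noteq> 0 \<and> y \<noteq> 0 \<and> (\<exists>c. c \<noteq> 0 \<and> y = c *s x)"

lemma part_equivp_hom_equiv: "part_equivp (hom_equiv :: complex ^ 'n::finite \<Rightarrow> _)"
proof (rule part_equivpI)
  have "(1 :: complex ^ 'n) \<noteq> 0" by (simp add: vec_eq_iff)
  then have "hom_equiv (1 :: complex ^ 'n) 1"
    unfolding hom_equiv_def by (metis vector_smult_lid zero_neq_one)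
  then show "\<exists>x. hom_equiv (x :: complex ^ 'n) x" ..
  show "symp (hom_equiv :: complex ^ 'n \<Rightarrow> _)"
  proof (rule sympI)
    fix x y :: "complex ^ 'n"
    assume "hom_equiv x y"
    then obtain c where "x \<noteq> 0" "y \<noteq> 0" "c \<noteq> 0" "y = c *s x"
      by (auto simp: hom_equiv_def)
    then have "x = inverse c *s y" by (simp add: vector_smult_assoc)
    with \<open>x \<noteq> 0\<close> \<open>y \<noteq> 0\<close> \<open>c \<noteq> 0\<close> show "hom_equiv y x"
      unfolding hom_equiv_def by (metis inverse_nonzero_iff_nonzero)
  qed
  show "transp (hom_equiv :: complex ^ 'n \<Rightarrow> _)"
  proof (rule transpI)
    fix x y z :: "complex ^ 'n"
    assume "hom_equiv x y" "hom_equiv y z"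
    then obtain c e where "x \<noteq> 0" "z \<noteq> 0" "c \<noteq> 0" "e \<noteq> 0" "z = (e * c) *s x"
      by (auto simp: hom_equiv_def vector_smult_assoc)
    then show "hom_equiv x z"
      unfolding hom_equiv_def by (metis mult_eq_0_iff)
  qed
qed

text \<open>The type \<open>'n cproj\<close> has dimension \<open>CARD('n) - 1\<close>: \<open>2 cproj\<close> is
  the complex projective line and \<open>3 cproj\<close> the complex projective plane.\<close>

quotient_type (overloaded) 'n cproj = "complex ^ 'n::finite" / partial: hom_equiv
  by (rule part_equivp_hom_equiv)

definition real_point :: "'n::finite cproj \<Rightarrow> bool" where
  "real_point x \<longleftrightarrow> (\<exists>y :: real ^ 'n. y \<noteq> 0 \<and> x = abs_cproj (\<chi> i. of_real (y $ i)))"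


section \<open>Plane curves given by an equation\<close>

text \<open>The ternary form of degree \<open>d\<close> in which \<open>c i j\<close> is the coefficient of
  \<open>(x $ 1)^i * (x $ 2)^j * (x $ 3)^(d - i - j)\<close>; the values \<open>c i j\<close> with \<open>i + j > d\<close> play no role.\<close>

definition ternary_form :: "nat \<Rightarrow> (nat \<Rightarrow> nat \<Rightarrow> complex) \<Rightarrow> complex ^ 3 \<Rightarrow> complex" where
  "ternary_form d c x =
     (\<Sum>i\<le>d. \<Sum>j\<le>d - i. c i j * (x $ 1) ^ i * (x $ 2) ^ j * (x $ 3) ^ (d - i - j))"

definition squarefree_form :: "nat \<Rightarrow> (nat \<Rightarrow> nat \<Rightarrow> complex) \<Rightarrow> bool" where
  "squarefree_form d c \<longleftrightarrow>
     (\<exists>x. ternary_form d c x \<noteq> 0) \<and>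
     \<not> (\<exists>e g h. 0 < e \<and> 2 * e \<le> d \<and>
          (\<forall>x. ternary_form d c x = (ternary_form e g x)\<^sup>2 * ternary_form (d - 2 * e) h x))"

text \<open>\<open>C\<close>, a set of complex points, is a real plane projective curve of degree \<open>d\<close> with
  coefficients \<open>c\<close>. Squarefreeness makes \<open>d\<close> the degree of the curve (and \<open>c\<close> unique up to a
  scalar), so that a conic is not also a curve of degree 4 by squaring its equation.\<close>

definition real_plane_curve ::
    "nat \<Rightarrow> (nat \<Rightarrow> nat \<Rightarrow> real) \<Rightarrow> 3 cproj set \<Rightarrow> bool" where
  "real_plane_curve d c C \<longleftrightarrow>
     squarefree_form d (\<lambda>i j. of_real (c i j)) \<and>
     C = {x. ternary_form d (\<lambda>i j. of_real (c i j)) (rep_cproj x) = 0}"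

definition singular_points :: "nat \<Rightarrow> (nat \<Rightarrow> nat \<Rightarrow> real) \<Rightarrow> 3 cproj set" where
  "singular_points d c =
     {x. ternary_form d (\<lambda>i j. of_real (c i j)) (rep_cproj x) = 0 \<and>
         (ternary_form d (\<lambda>i j. of_real (c i j)) has_derivative (\<lambda>_. 0)) (at (rep_cproj x))}"


section \<open>Rational parametrizations\<close>

definition binary_form :: "nat \<Rightarrow> (nat \<Rightarrow> real) \<Rightarrow> complex ^ 2 \<Rightarrow> complex" where
  "binary_form d b w = (\<Sum>k\<le>d. of_real (b k) * (w $ 1) ^ k * (w $ 2) ^ (d - k))"

definition hom_param :: "nat \<Rightarrow> (3 \<Rightarrow> nat \<Rightarrow> real) \<Rightarrow> complex ^ 2 \<Rightarrow> complex ^ 3" where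
  "hom_param d p w = (\<chi> i. binary_form d (p i) w)"

definition no_common_root :: "nat \<Rightarrow> (3 \<Rightarrow> nat \<Rightarrow> real) \<Rightarrow> bool" where
  "no_common_root d p \<longleftrightarrow> (\<forall>w. w \<noteq> 0 \<longrightarrow> hom_param d p w \<noteq> 0)"

text \<open>Meaningful under \<open>no_common_root d p\<close>, and then independent of the representative.\<close>

definition param_map :: "nat \<Rightarrow> (3 \<Rightarrow> nat \<Rightarrow> real) \<Rightarrow> 2 cproj \<Rightarrow> 3 cproj" where
  "param_map d p u = abs_cproj (hom_param d p (rep_cproj u))"

text \<open>By Euler's identity the range of the derivative of \<open>hom_param d p\<close> at a representative of
  \<open>u\<close> contains the line in \<open>\<complex>\<^sup>3\<close> that is the image point, and modulo this line it is the image
  of the differential of \<open>param_map d p\<close> at \<open>u\<close>. So for two points with the same image the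
  condition says that the two differentials together span the tangent plane there, i.e. that
  both branches are immersed and their tangent lines are distinct.\<close>

definition transversal_branches ::
    "nat \<Rightarrow> (3 \<Rightarrow> nat \<Rightarrow> real) \<Rightarrow> 2 cproj \<Rightarrow> 2 cproj \<Rightarrow> bool" where
  "transversal_branches d p u v \<longleftrightarrow>
     {frechet_derivative (hom_param d p) (at (rep_cproj u)) h +
      frechet_derivative (hom_param d p) (at (rep_cproj v)) k | h k. True} = UNIV"

definition node :: "nat \<Rightarrow> (3 \<Rightarrow> nat \<Rightarrow> real) \<Rightarrow> 3 cproj \<Rightarrow> bool" where
  "node d p x \<longleftrightarrow>
     (\<exists>u v. u \<noteq> v \<and> param_map d p -` {x} = {u, v} \<and> transversal_branches d p u v)"


section \<open>Nodal real rational curves and rigid isotopy\<close>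

definition real_rational_curve ::
    "nat \<Rightarrow> (3 \<Rightarrow> nat \<Rightarrow> real) \<Rightarrow> (nat \<Rightarrow> nat \<Rightarrow> real) \<Rightarrow> 3 cproj set \<Rightarrow> bool" where
  "real_rational_curve d p c C \<longleftrightarrow>
     no_common_root d p \<and> real_plane_curve d c C \<and> C = range (param_map d p)"

definition nodal_curve :: "nat \<Rightarrow> 3 cproj set \<Rightarrow> bool" where
  "nodal_curve d C \<longleftrightarrow>
     (\<exists>p c. real_rational_curve d p c C \<and> (\<forall>x\<in>singular_points d c. node d p x))"

definition real_nodal_curve :: "nat \<Rightarrow> 3 cproj set \<Rightarrow> bool" where
  "real_nodal_curve d C \<longleftrightarrow>
     (\<exists>p c. real_rational_curve d p c C \<and>
            (\<forall>x\<in>singular_points d c. node d p x \<and> real_point x))"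

text \<open>Continuity of the coefficient vectors of the equations amounts to continuity of the
  classes in the projective space of real forms, since paths there lift to nonzero vectors.\<close>

definition rigidly_isotopic :: "nat \<Rightarrow> 3 cproj set \<Rightarrow> 3 cproj set \<Rightarrow> bool" where
  "rigidly_isotopic d C D \<longleftrightarrow>
     (\<exists>(\<Gamma> :: real \<Rightarrow> 3 cproj set) (c :: real \<Rightarrow> nat \<Rightarrow> nat \<Rightarrow> real).
        (\<forall>t\<in>{0..1}. nodal_curve d (\<Gamma> t) \<and> real_plane_curve d (c t) (\<Gamma> t)) \<and>
        (\<forall>i j. i + j \<le> d \<longrightarrow> continuous_on {0..1} (\<lambda>t. c t i j)) \<and>
        \<Gamma> 0 = C \<and> \<Gamma> 1 = D)"

definition rigid_isotopy :: "nat \<Rightarrow> (3 cproj set \<times> 3 cproj set) set" where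
  "rigid_isotopy d = {(C, D). rigidly_isotopic d C D}"

end

theory Submission
  imports Defs "HOL-Computational_Algebra.Field_as_Ring" "HOL-Computational_Algebra.Fundamental_Theorem_Algebra"
    "HOL-Computational_Algebra.Polynomial_Factorial"
begin

text \<open>In the frame of its nodes, a quartic with three real nodes is the transform of a real conic
  under the quadratic Cremona map \<open>(x, y, z) \<mapsto> (y*z, x*z, x*y)\<close>. The curve is nodal and rational
  over the reals exactly when the conic is smooth, has real points, avoids the vertices of the
  triangle of nodes and is tangent to none of its sides. Up to permutations and rescalings of the
  coordinates such conics form nine types, distinguished by the signs of the diagonal coefficients,
  of the principal minors and, in one case, of the product of the mixed coefficients; the normalized
  conics of each type form a path connected set. Since the frames of positive determinant are path
  connected and negating a frame does not change the curve, curves of the same type are rigidly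
  isotopic.

  Conversely, the Hessian at a node has rank two, so two nodes cannot collide in a limit that is
  itself nodal. Hence along a rigid isotopy the parameters with real nodes of a given type form a
  closed set, as do the parameters with a nonreal node, and connectedness of the interval makes the
  type an invariant.\<close>

subsection \<open>Polarization of ternary quartics\<close>

text \<open>The hypotheses supply only a set of zeros and a parametrization onto it. That the
  parametrization is generically injective and immersive, that the equation is unique up to a factor
  and that there are three nodes must be derived. The main tool is a count: a general line through a
  point off the curve carries four distinct points of it, while a line pulls back to a binary form
  of degree 4, so each of the four is hit by one parameter, and simply.

  Polarization keeps the later data in one object: \<open>z\<close> is singular when
  \<open>M z z z v\<close> vanishes for all \<open>v\<close>, the Hessian is a multiple of
  \<open>M z z\<close>, and the coefficients of the conic are 6 times values of the form at the
  nodes. All of them are therefore continuous in the quartic and the nodes, which the limit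
  arguments use.

  An equation is determined only up to a nonzero real factor, so a label is read off after fixing
  the sign of the determinant of the conic. An isotopy requires only nodal curves, so nonreal nodes
  along the path cannot be excluded in advance.\<close>

text \<open>The multinomial coefficient is divided out, so that \<open>polar c x x x x\<close> is
  \<open>ternary_form 4 c x\<close>.\<close>

definition ind_coeff :: "(nat \<Rightarrow> nat \<Rightarrow> 'a::field_char_0) \<Rightarrow> 3 \<Rightarrow> 3 \<Rightarrow> 3 \<Rightarrow> 3 \<Rightarrow> 'a" where
  "ind_coeff c i j k l =
     (let m = of_bool (i = 1) + of_bool (j = 1) + of_bool (k = 1) + of_bool (l = 1);
          n = of_bool (i = 2) + of_bool (j = 2) + of_bool (k = 2) + of_bool (l = 2)
      in c m n * (fact m * fact n * fact (4 - m - n)) / 24)"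

definition polar :: "(nat \<Rightarrow> nat \<Rightarrow> 'a::field_char_0) \<Rightarrow> 'a^3 \<Rightarrow> 'a^3 \<Rightarrow> 'a^3 \<Rightarrow> 'a^3 \<Rightarrow> 'a" where
  "polar c x y z w = (\<Sum>i\<in>UNIV. \<Sum>j\<in>UNIV. \<Sum>k\<in>UNIV. \<Sum>l\<in>UNIV.
     ind_coeff c i j k l * x $ i * y $ j * z $ k * w $ l)"

lemma ind_coeff_swap:
  "ind_coeff c i j k l = ind_coeff c j i k l"
  "ind_coeff c i j k l = ind_coeff c i k j l"
  "ind_coeff c i j k l = ind_coeff c i j l k"
  unfolding ind_coeff_def by (simp_all only: ac_simps)

lemma polar_swap:
  "polar c x y z w = polar c y x z w"
  "polar c x y z w = polar c x z y w"
  "polar c x y z w = polar c x y w z"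
proof -
  show "polar c x y z w = polar c y x z w"
    unfolding polar_def
    by (rule trans[OF sum.swap], intro sum.cong refl, subst ind_coeff_swap(1), simp only: ac_simps)
  show "polar c x y z w = polar c x z y w"
    unfolding polar_def
    by (rule sum.cong[OF refl], rule trans[OF sum.swap], intro sum.cong refl, subst ind_coeff_swap(2), simp only: ac_simps)
  show "polar c x y z w = polar c x y w z"
    unfolding polar_def
    by (rule sum.cong[OF refl], rule sum.cong[OF refl], rule trans[OF sum.swap], intro sum.cong refl, subst ind_coeff_swap(3), simp only: ac_simps)
qed

lemma polar_add4: "polar c x y z (w + w') = polar c x y z w + polar c x y z w'"
  unfolding polar_def by (simp add: distrib_left sum.distrib)

lemma polar_scale4: "polar c x y z (a *s w) = a * polar c x y z w"
  unfolding polar_def by (simp add: sum_distrib_left mult_ac)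

lemma polar_add:
  "polar c (x + x') y z w = polar c x y z w + polar c x' y z w"
  "polar c x (y + y') z w = polar c x y z w + polar c x y' z w"
  "polar c x y (z + z') w = polar c x y z w + polar c x y z' w"
  "polar c x y z (w + w') = polar c x y z w + polar c x y z w'"
  by (metis polar_add4 polar_swap)+

lemma polar_scale:
  "polar c (a *s x) y z w = a * polar c x y z w"
  "polar c x (a *s y) z w = a * polar c x y z w"
  "polar c x y (a *s z) w = a * polar c x y z w"
  "polar c x y z (a *s w) = a * polar c x y z w"
  by (metis polar_scale4 polar_swap)+

lemma polar_0 [simp]:
  "polar c 0 y z w = 0" "polar c x 0 z w = 0" "polar c x y 0 w = 0" "polar c x y z 0 = 0"
  unfolding polar_def by simp_all

lemma ind_coeff_of_real: "ind_coeff (\<lambda>i j. of_real (c i j) :: complex) i j k l = of_real (ind_coeff c i j k l)"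
  unfolding ind_coeff_def Let_def by (simp only: of_real_divide of_real_mult of_real_fact of_real_numeral)

lemma polar_of_real:
  "polar (\<lambda>i j. of_real (c i j) :: complex) (\<chi> i. of_real (x $ i)) (\<chi> i. of_real (y $ i))
     (\<chi> i. of_real (z $ i)) (\<chi> i. of_real (w $ i)) = of_real (polar c x y z w)"
  unfolding polar_def ind_coeff_of_real by simp

lemma three_neq [simp]: "(1::3) \<noteq> 2" "(2::3) \<noteq> 1" "(1::3) \<noteq> 3" "(3::3) \<noteq> 1" "(2::3) \<noteq> 3" "(3::3) \<noteq> 2"
  by simp_all

lemma ternary_form_4: "ternary_form 4 c x =
  c 0 0 * (x $ 3)^4 + c 0 1 * x$2 * (x$3)^3 + c 0 2 * (x$2)^2 * (x$3)^2 + c 0 3 * (x$2)^3 * (x$3) + c 0 4 * (x$2)^4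
  + c 1 0 * x$1 * (x$3)^3 + c 1 1 * x$1 * x$2 * (x$3)^2 + c 1 2 * x$1 * (x$2)^2 * x$3 + c 1 3 * x$1 * (x$2)^3
  + c 2 0 * (x$1)^2 * (x$3)^2 + c 2 1 * (x$1)^2 * x$2 * x$3 + c 2 2 * (x$1)^2 * (x$2)^2
  + c 3 0 * (x$1)^3 * x$3 + c 3 1 * (x$1)^3 * x$2 + c 4 0 * (x$1)^4"
proof -
  have *: "{..4::nat} = {0,1,2,3,4}" "{..3::nat} = {0,1,2,3}" "{..2::nat} = {0,1,2}" "{..1::nat} = {0,1}" by auto
  show ?thesis unfolding ternary_form_def
    by (simp add: * )
qed

lemma ternary_form_polar: "ternary_form 4 c x = polar c x x x x"
proof -
  have "polar c x x x x =
    ind_coeff c 3 3 3 3 * (x $ 3)^4 + 4 * ind_coeff c 2 3 3 3 * x$2 * (x$3)^3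
    + 6 * ind_coeff c 2 2 3 3 * (x$2)^2 * (x$3)^2 + 4 * ind_coeff c 2 2 2 3 * (x$2)^3 * (x$3) + ind_coeff c 2 2 2 2 * (x$2)^4
  + 4 * ind_coeff c 1 3 3 3 * x$1 * (x$3)^3 + 12 * ind_coeff c 1 2 3 3 * x$1 * x$2 * (x$3)^2
  + 12 * ind_coeff c 1 2 2 3 * x$1 * (x$2)^2 * x$3 + 4 * ind_coeff c 1 2 2 2 * x$1 * (x$2)^3
  + 6 * ind_coeff c 1 1 3 3 * (x$1)^2 * (x$3)^2 + 12 * ind_coeff c 1 1 2 3 * (x$1)^2 * x$2 * x$3
  + 6 * ind_coeff c 1 1 2 2 * (x$1)^2 * (x$2)^2
  + 4 * ind_coeff c 1 1 1 3 * (x$1)^3 * x$3 + 4 * ind_coeff c 1 1 1 2 * (x$1)^3 * x$2 + ind_coeff c 1 1 1 1 * (x$1)^4"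
  proof -
    define G where "G = ind_coeff c"
    have G: "G i j k l = G j i k l" "G i j k l = G i k j l" "G i j k l = G i j l k" for i j k l
      unfolding G_def by (rule ind_coeff_swap)+
    \<comment> \<open>Rewriting with these rules sorts the indices, so the 81 coefficients collapse
      to the 15 with nondecreasing indices.\<close>
    have 1: "G 2 1 k l = G 1 2 k l" "G 3 1 k l = G 1 3 k l" "G 3 2 k l = G 2 3 k l"
      "G i 2 1 l = G i 1 2 l" "G i 3 1 l = G i 1 3 l" "G i 3 2 l = G i 2 3 l"
      "G i j 2 1 = G i j 1 2" "G i j 3 1 = G i j 1 3" "G i j 3 2 = G i j 2 3" for i j k l
      using G by blast+
    show ?thesis unfolding polar_def sum_3 G_def[symmetric] 1
      by (simp add: power4_eq_xxxx power3_eq_cube power2_eq_square algebra_simps)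
  qed
  moreover have "Suc (Suc 0) = 2" by simp
  ultimately show ?thesis
    unfolding ternary_form_4 ind_coeff_def Let_def by (simp add: fact_numeral)
qed

subsection \<open>Homogeneous coordinates and rational parametrizations\<close>

lemma hom_equiv_refl [simp]: "x \<noteq> 0 \<Longrightarrow> hom_equiv x x"
  unfolding hom_equiv_def by (metis vector_smult_lid zero_neq_one)

lemma hom_equiv_sym: "hom_equiv x y \<Longrightarrow> hom_equiv y x"
  by (rule part_equivp_symp[OF part_equivp_hom_equiv])

lemma hom_equiv_trans: "hom_equiv x y \<Longrightarrow> hom_equiv y z \<Longrightarrow> hom_equiv x z"
  by (rule part_equivp_transp[OF part_equivp_hom_equiv])

lemma hom_equiv_scale: "x \<noteq> 0 \<Longrightarrow> a \<noteq> 0 \<Longrightarrow> hom_equiv x (a *s x)"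
  unfolding hom_equiv_def by auto

lemma equiv_chain: "hom_equiv a x \<Longrightarrow> hom_equiv b z \<Longrightarrow> hom_equiv a b \<Longrightarrow> hom_equiv x z"
  by (rule hom_equiv_trans[OF hom_equiv_sym hom_equiv_trans])

lemma equiv_scaleE:
  assumes "hom_equiv x z"
  obtains k where "k \<noteq> 0" "z = k *s x"
  using assms unfolding hom_equiv_def by blast

lemma rep_cproj_nonzero [simp]: "rep_cproj x \<noteq> 0"
  using Quotient_rep_reflp[OF Quotient_cproj, of x] unfolding hom_equiv_def by blast

lemma abs_rep_cproj [simp]: "abs_cproj (rep_cproj x) = x"
  using Quotient_abs_rep[OF Quotient_cproj] .

lemma abs_cproj_eq_iff: "x \<noteq> 0 \<Longrightarrow> y \<noteq> 0 \<Longrightarrow> abs_cproj x = abs_cproj y \<longleftrightarrow> hom_equiv x y"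
  using Quotient_rel[OF Quotient_cproj, of x y] by auto

lemma rep_abs_cproj: "x \<noteq> 0 \<Longrightarrow> hom_equiv (rep_cproj (abs_cproj x)) x"
  by (subst abs_cproj_eq_iff[symmetric]) auto

lemma vec_nth_has_derivative [derivative_intros]:
  "(f has_derivative f') F \<Longrightarrow> ((\<lambda>x. f x $ i) has_derivative (\<lambda>x. f' x $ i)) F"
  by (rule bounded_linear.has_derivative[OF bounded_linear_vec_nth])

lemma polar_has_derivative:
  fixes X :: "'b::real_normed_vector \<Rightarrow> complex^3"
  assumes "(X has_derivative X') (at t)" "(Y has_derivative Y') (at t)"
    "(Z has_derivative Z') (at t)" "(W has_derivative W') (at t)"
  shows "((\<lambda>t. polar c (X t) (Y t) (Z t) (W t)) has_derivative
    (\<lambda>h. polar c (X' h) (Y t) (Z t) (W t) + polar c (X t) (Y' h) (Z t) (W t)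
       + polar c (X t) (Y t) (Z' h) (W t) + polar c (X t) (Y t) (Z t) (W' h))) (at t)"
  unfolding polar_def sum.distrib[symmetric]
proof (intro has_derivative_sum)
  fix i j k l :: 3
  show "((\<lambda>t. ind_coeff c i j k l * X t $ i * Y t $ j * Z t $ k * W t $ l) has_derivative
     (\<lambda>h. ind_coeff c i j k l * X' h $ i * Y t $ j * Z t $ k * W t $ l +
          ind_coeff c i j k l * X t $ i * Y' h $ j * Z t $ k * W t $ l +
          ind_coeff c i j k l * X t $ i * Y t $ j * Z' h $ k * W t $ l +
          ind_coeff c i j k l * X t $ i * Y t $ j * Z t $ k * W' h $ l)) (at t)"
    by (rule has_derivative_eq_rhs, (rule derivative_intros assms)+) (simp add: algebra_simps)
qed

lemma ternary_form_4_has_derivative: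
  "(ternary_form 4 c has_derivative (\<lambda>h. 4 * polar c x x x h)) (at x)"
proof -
  have "ternary_form 4 c = (\<lambda>x. polar c x x x x)" by (rule ext) (rule ternary_form_polar)
  moreover have "((\<lambda>x. polar c x x x x) has_derivative (\<lambda>h. 4 * polar c x x x h)) (at x)"
    by (rule has_derivative_eq_rhs, rule polar_has_derivative, (rule derivative_intros)+)
       (rule ext, simp add: polar_swap(1)[of c _ x x x] polar_swap(2)[of c x _ x x] polar_swap(3)[of c x x _ x])
  ultimately show ?thesis by simp
qed

text \<open>Taking \<open>v\<close> to be the point itself recovers the equation of the curve
  (Euler), so the gradient condition alone characterizes singular points.\<close>

lemma singular_points_4:
  "x \<in> singular_points 4 c \<longleftrightarrow>
     (\<forall>v. polar (\<lambda>i j. of_real (c i j)) (rep_cproj x) (rep_cproj x) (rep_cproj x) v = (0::complex))"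
  (is "_ \<longleftrightarrow> ?R")
proof -
  have "(ternary_form 4 (\<lambda>i j. of_real (c i j)) has_derivative (\<lambda>_. 0)) (at (rep_cproj x)) \<longleftrightarrow> ?R"
  proof
    assume "(ternary_form 4 (\<lambda>i j. of_real (c i j)) has_derivative (\<lambda>_. 0)) (at (rep_cproj x))"
    from has_derivative_unique[OF this ternary_form_4_has_derivative] show ?R
      by (auto simp: fun_eq_iff)
  next
    assume ?R
    then show "(ternary_form 4 (\<lambda>i j. of_real (c i j)) has_derivative (\<lambda>_. 0)) (at (rep_cproj x))"
      using ternary_form_4_has_derivative[of "\<lambda>i j. of_real (c i j)" "rep_cproj x"] by simp
  qed
  then show ?thesis unfolding singular_points_def by (auto simp: ternary_form_polar)
qed

text \<open>The differential of \<open>hom_param 4 p\<close> at \<open>w\<close> in the direction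
  \<open>h\<close>, written out so that linearity, homogeneity and Euler's identity become ring
  identities.\<close>

definition dparam :: "(3 \<Rightarrow> nat \<Rightarrow> real) \<Rightarrow> complex^2 \<Rightarrow> complex^2 \<Rightarrow> complex^3" where
  "dparam p w h = (\<chi> i. 
     (of_real (p i 1) * (w$2)^3 + 2 * of_real (p i 2) * w$1 * (w$2)^2 + 3 * of_real (p i 3) * (w$1)^2 * w$2
       + 4 * of_real (p i 4) * (w$1)^3) * h$1
   + (4 * of_real (p i 0) * (w$2)^3 + 3 * of_real (p i 1) * w$1 * (w$2)^2 + 2 * of_real (p i 2) * (w$1)^2 * w$2
       + of_real (p i 3) * (w$1)^3) * h$2)"

lemma hom_param_4: "hom_param 4 p w $ i = of_real (p i 0) * (w$2)^4 + of_real (p i 1) * w$1 * (w$2)^3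
   + of_real (p i 2) * (w$1)^2 * (w$2)^2 + of_real (p i 3) * (w$1)^3 * w$2 + of_real (p i 4) * (w$1)^4"
proof -
  have *: "{..4::nat} = {0,1,2,3,4}" by auto
  show ?thesis unfolding hom_param_def binary_form_def by (simp add: *)
qed

lemma has_derivative_vec:
  fixes f :: "'b::real_normed_vector \<Rightarrow> complex^'n"
  assumes "\<And>i. ((\<lambda>x. f x $ i) has_derivative (\<lambda>x. f' x $ i)) (at x)"
  shows "(f has_derivative f') (at x)"
proof (rule iffD2[OF has_derivative_componentwise_within], intro ballI)
  fix b :: "complex^'n" assume "b \<in> Basis"
  then obtain i u where b: "b = axis i u" by (auto simp: Basis_vec_def)
  have "((\<lambda>x. f x $ i \<bullet> u) has_derivative (\<lambda>x. f' x $ i \<bullet> u)) (at x)"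
    by (rule has_derivative_inner_left[OF assms])
  then show "((\<lambda>x. f x \<bullet> b) has_derivative (\<lambda>x. f' x \<bullet> b)) (at x)"
    by (simp add: b inner_axis)
qed

lemma hom_param_4_has_derivative: "(hom_param 4 p has_derivative dparam p w) (at w)"
proof (rule has_derivative_vec)
  fix i
  show "((\<lambda>w. hom_param 4 p w $ i) has_derivative (\<lambda>h. dparam p w h $ i)) (at w)"
    unfolding hom_param_4 dparam_def
    by (rule has_derivative_eq_rhs, (rule derivative_intros)+)
       (simp add: fun_eq_iff algebra_simps power2_eq_square power3_eq_cube power4_eq_xxxx)
qed

lemma frechet_hom_param_4 [simp]: "frechet_derivative (hom_param 4 p) (at w) = dparam p w"
  using frechet_derivative_at[OF hom_param_4_has_derivative] by simp

lemma hom_param_4_scale: "hom_param 4 p (a *s w) = a^4 *s hom_param 4 p w"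
  by (simp add: vec_eq_iff hom_param_4 power_mult_distrib algebra_simps power2_eq_square power3_eq_cube power4_eq_xxxx)

lemma dparam_euler: "dparam p w w = 4 *s hom_param 4 p w"
  by (simp add: vec_eq_iff hom_param_4 dparam_def algebra_simps power2_eq_square power3_eq_cube power4_eq_xxxx)

lemma dparam_add: "dparam p w (h + k) = dparam p w h + dparam p w k"
  by (simp add: vec_eq_iff dparam_def algebra_simps)

lemma dparam_scale: "dparam p w (a *s h) = a *s dparam p w h"
  by (simp add: vec_eq_iff dparam_def algebra_simps)

lemma dparam_scale1: "dparam p (a *s w) h = a^3 *s dparam p w h"
  by (simp add: vec_eq_iff dparam_def algebra_simps power2_eq_square power3_eq_cube)

text \<open>The number \<open>l\<close> is the value at infinity of \<open>f\<close> regarded as a binary form of degree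
  \<open>n\<close>, so \<open>l \<noteq> 0\<close> says that all \<open>n\<close> roots are finite.\<close>

definition plc :: "nat \<Rightarrow> complex \<Rightarrow> (complex \<Rightarrow> complex) \<Rightarrow> bool" where
  "plc n l f \<longleftrightarrow> (\<exists>q. degree q \<le> n \<and> coeff q n = l \<and> f = poly q)"

lemma plc_const: "plc 0 a (\<lambda>s. a)"
  unfolding plc_def by (rule exI[of _ "[:a:]"]) auto

lemma plc_linear: "plc 1 a (\<lambda>s. s * a + b)"
  unfolding plc_def by (rule exI[of _ "[:b, a:]"]) (auto simp: fun_eq_iff)

lemma plc_mult: "plc n l f \<Longrightarrow> plc m k g \<Longrightarrow> plc (n + m) (l * k) (\<lambda>s. f s * g s)"
  unfolding plc_def 
proof clarify
  fix q r :: "complex poly" assume "degree q \<le> n" "degree r \<le> m"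
  then show "\<exists>t. degree t \<le> n + m \<and> coeff t (n + m) = coeff q n * coeff r m \<and> (\<lambda>s. poly q s * poly r s) = poly t"
  proof (intro exI[of _ "q * r"] conjI)
    show "degree (q * r) \<le> n + m"
      using \<open>degree q \<le> n\<close> \<open>degree r \<le> m\<close> degree_mult_le[of q r] by linarith
    have "coeff (q * r) (n + m) = (\<Sum>i\<in>{..n+m}. coeff q i * coeff r (n + m - i))"
      by (rule coeff_mult)
    also have "\<dots> = (\<Sum>i\<in>{n}. coeff q i * coeff r (n + m - i))"
    proof (rule sum.mono_neutral_right)
      show "\<forall>i\<in>{..n + m} - {n}. coeff q i * coeff r (n + m - i) = 0"
      proof
        fix i assume "i \<in> {..n + m} - {n}"
        then consider "degree q < i" | "degree r < n + m - i"
          using \<open>degree q \<le> n\<close> \<open>degree r \<le> m\<close> by (cases "i < n") force+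
        then show "coeff q i * coeff r (n + m - i) = 0" by cases (auto simp: coeff_eq_0)
      qed
    qed auto
    finally show "coeff (q * r) (n + m) = coeff q n * coeff r m" by simp
  qed (simp add: fun_eq_iff)
qed

lemma plc_add: "plc n l f \<Longrightarrow> plc n k g \<Longrightarrow> plc n (l + k) (\<lambda>s. f s + g s)"
  unfolding plc_def
proof clarify
  fix q r :: "complex poly" assume "degree q \<le> n" "degree r \<le> n"
  then show "\<exists>t. degree t \<le> n \<and> coeff t n = coeff q n + coeff r n \<and> (\<lambda>s. poly q s + poly r s) = poly t"
    by (intro exI[of _ "q + r"]) (auto simp: degree_add_le)
qed

lemma plc_sum: "finite A \<Longrightarrow> (\<And>i. i \<in> A \<Longrightarrow> plc n (l i) (f i)) \<Longrightarrow> plc n (\<Sum>i\<in>A. l i) (\<lambda>s. \<Sum>i\<in>A. f i s)"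
proof (induction A rule: finite_induct)
  case empty
  show ?case unfolding plc_def by (intro exI[of _ 0]) (auto simp: fun_eq_iff)
next
  case (insert x F)
  then show ?case using plc_add[of n "l x" "f x" "sum l F"] by simp
qed

lemma plc_power: "plc n l f \<Longrightarrow> plc (n * k) (l ^ k) (\<lambda>s. f s ^ k)"
proof (induction k)
  case 0 then show ?case using plc_const[of 1] by simp
next
  case (Suc k) then show ?case using plc_mult[of n l f "n * k" "l ^ k" "\<lambda>s. f s ^ k"] by simp
qed

lemma plc_cmult: "plc n l f \<Longrightarrow> plc n (a * l) (\<lambda>s. a * f s)"
  using plc_mult[OF plc_const[of a]] by simp

lemma plc_finite: "plc n l f \<Longrightarrow> f s0 \<noteq> 0 \<Longrightarrow> finite {s. f s = 0}"
  unfolding plc_def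
proof clarify
  fix q :: "complex poly" assume "poly q s0 \<noteq> 0"
  then have "q \<noteq> 0" by auto
  then show "finite {s. poly q s = 0}" by (rule poly_roots_finite)
qed

lemma plc_nonzero: "plc n l f \<Longrightarrow> l \<noteq> 0 \<Longrightarrow> \<exists>s. f s \<noteq> 0"
  unfolding plc_def
proof clarify
  fix q :: "complex poly" assume "coeff q n \<noteq> 0"
  then have "q \<noteq> 0" by auto
  then show "\<exists>s. poly q s \<noteq> 0" using poly_all_0_iff_0[of q] by blast
qed

lemma plc_finite': "plc n l f \<Longrightarrow> l \<noteq> 0 \<Longrightarrow> finite {s. f s = 0}"
  using plc_finite plc_nonzero by metis

lemma plc_root: "plc n l f \<Longrightarrow> l \<noteq> 0 \<Longrightarrow> n > 0 \<Longrightarrow> \<exists>s. f s = 0"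
  unfolding plc_def
proof clarify
  fix q :: "complex poly" assume "degree q \<le> n" "coeff q n \<noteq> 0" "0 < n"
  then have "degree q = n" by (simp add: le_antisym le_degree)
  then have "\<not> constant (poly q)" using \<open>0 < n\<close> by (simp add: constant_degree)
  then show "\<exists>s. poly q s = 0" by (rule fundamental_theorem_of_algebra)
qed

lemma plc_card: "plc n l f \<Longrightarrow> l \<noteq> 0 \<Longrightarrow> card {s. f s = 0} \<le> n"
  unfolding plc_def
proof clarify
  fix q :: "complex poly" assume "degree q \<le> n" "coeff q n \<noteq> 0"
  then have "q \<noteq> 0" by auto
  then have "card {s. poly q s = 0} \<le> degree q" by (rule card_poly_roots_bound)
  then show "card {s. poly q s = 0} \<le> n" using \<open>degree q \<le> n\<close> by simp
qed

text \<open>All \<open>n\<close> roots are finite because \<open>l\<close> is nonzero, and without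
  multiple roots the complete factorization has one linear factor per root.\<close>

lemma plc_card_simple:
  assumes "plc n l f" "l \<noteq> 0" "\<And>s. f s = 0 \<Longrightarrow> \<not> (f has_field_derivative 0) (at s)"
  shows "card {s. f s = 0} = n"
proof -
  obtain q where q: "degree q \<le> n" "coeff q n = l" "f = poly q" using assms(1) unfolding plc_def by auto
  have "degree q = n" using q assms(2) le_degree le_antisym by metis
  have "rsquarefree q"
    unfolding rsquarefree_roots
  proof (intro allI notI)
    fix a assume *: "poly q a = 0 \<and> poly (pderiv q) a = 0"
    have "(f has_field_derivative poly (pderiv q) a) (at a)" unfolding q(3) by (rule poly_DERIV)
    with * show False using assms(3)[of a] q(3) by auto
  qed
  then have "degree q = degree (smult (lead_coeff q) (\<Prod>z|poly q z = 0. [:- z, 1:]))"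
    by (simp add: complex_poly_decompose_rsquarefree)
  also have "\<dots> = card {s. poly q s = 0}"
    using assms(2) q(2) by (subst degree_smult_eq) (auto simp: degree_prod_sum_eq)
  finally have "card {s. poly q s = 0} = degree q" by simp
  then show ?thesis using q \<open>degree q = n\<close> by simp
qed

text \<open>On a line \<open>s *s a + b\<close> the vector \<open>a\<close> is the point at
  infinity, so the value at infinity of a polarized expression is the same expression in the leading
  vectors.\<close>

lemma plc_polar:
  assumes "\<And>i. plc n1 (L1 $ i) (\<lambda>s. X s $ i)" "\<And>i. plc n2 (L2 $ i) (\<lambda>s. Y s $ i)"
    "\<And>i. plc n3 (L3 $ i) (\<lambda>s. Z s $ i)" "\<And>i. plc n4 (L4 $ i) (\<lambda>s. W s $ i)"
  shows "plc (n1 + n2 + n3 + n4) (polar c L1 L2 L3 L4) (\<lambda>s. polar c (X s) (Y s) (Z s) (W s))"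
  unfolding polar_def
  by (intro plc_sum plc_mult plc_cmult assms finite_UNIV finite)

lemma plc_vec_linear: "plc 1 (a $ i) (\<lambda>s. (s *s a + b) $ i)"
  using plc_linear[of "a $ i" "b $ i"] by simp

lemma plc_vec_const: "plc 0 (a $ i) (\<lambda>s. a $ i)"
  by (rule plc_const)

lemma plc_hom_param: "plc 4 (hom_param 4 p a $ i) (\<lambda>s. hom_param 4 p (s *s a + b) $ i)"
proof -
  note l1 = plc_vec_linear[of a 1 b] and l2 = plc_vec_linear[of a 2 b]
  show ?thesis unfolding hom_param_4
    apply (intro plc_add)
    using plc_cmult[OF plc_power[OF l2, of 4]] plc_mult[OF plc_cmult[OF l1] plc_power[OF l2, of 3]]
     plc_mult[OF plc_cmult[OF plc_power[OF l1, of 2]] plc_power[OF l2, of 2]]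
     plc_mult[OF plc_cmult[OF plc_power[OF l1, of 3]] l2]
     plc_cmult[OF plc_power[OF l1, of 4]] by simp_all
qed

subsection \<open>Independence of vectors\<close>

lemma hom_equiv_nonzero: "hom_equiv x y \<Longrightarrow> x \<noteq> 0 \<and> y \<noteq> 0"
  unfolding hom_equiv_def by blast

text \<open>The common value at infinity acts as one further point of agreement: the difference
  loses its top coefficient and still has \<open>n\<close> zeros.\<close>

lemma plc_eq:
  assumes "plc n l f" "plc n l g" "card A \<ge> n" "\<And>s. s \<in> A \<Longrightarrow> f s = g s"
  shows "f = g"
proof -
  obtain q r where q: "degree q \<le> n" "coeff q n = l" "f = poly q" and r: "degree r \<le> n" "coeff r n = l" "g = poly r"
    using assms(1,2) unfolding plc_def by auto
  have "q = r"
    by (rule poly_eqI_degree_lead_coeff[where A = A and n = n]) (use q r assms in auto)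
  then show ?thesis using q r by simp
qed

text \<open>A double root uses up two of the \<open>n\<close> linear factors, leaving fewer than
  \<open>n\<close> distinct roots.\<close>

lemma plc_deriv_nonzero:
  assumes "plc n l f" "l \<noteq> 0" "n \<le> card {s. f s = 0}" "f a = 0" "(f has_field_derivative d) (at a)"
  shows "d \<noteq> 0"
proof
  assume "d = 0"
  obtain q where q: "degree q \<le> n" "coeff q n = l" "f = poly q" using assms(1) unfolding plc_def by auto
  have "q \<noteq> 0" using q assms(2) by auto
  have "poly (pderiv q) a = 0"
    using DERIV_unique[OF poly_DERIV[of q a]] assms(5) \<open>d = 0\<close> q(3) by auto
  moreover obtain r where r: "q = [:- a, 1:] * r" using assms(4) q(3) by (auto simp: poly_eq_0_iff_dvd elim: dvdE)
  ultimately have "poly r a = 0" by (simp add: pderiv_mult pderiv_pCons del: mult_pCons_left)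
  then obtain t where t: "r = [:- a, 1:] * t" by (auto simp: poly_eq_0_iff_dvd elim: dvdE)
  have "t \<noteq> 0" "r \<noteq> 0" using t r \<open>q \<noteq> 0\<close> by auto
  have "degree q = degree t + 2" using \<open>t \<noteq> 0\<close> \<open>r \<noteq> 0\<close> r t by (simp add: degree_mult_eq del: mult_pCons_left)
  have "{s. f s = 0} \<subseteq> insert a {s. poly t s = 0}" unfolding q(3) r t by auto
  then have "card {s. f s = 0} \<le> card (insert a {s. poly t s = 0})"
    using poly_roots_finite[OF \<open>t \<noteq> 0\<close>] by (intro card_mono) auto
  also have "\<dots> \<le> Suc (card {s. poly t s = 0})" by (rule card_insert_le_m1) auto
  also have "\<dots> \<le> Suc (degree t)" using card_poly_roots_bound[OF \<open>t \<noteq> 0\<close>] by simp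
  finally show False using assms(3) \<open>degree q = degree t + 2\<close> q(1) by simp
qed

text \<open>A monic quartic without simple roots is the square of the quadratic
  \<open>s^2 + (a/2) * s + (b - a^2/4)/2\<close>; the conclusion compares constant terms.\<close>

lemma quartic_double_roots:
  fixes a b c d :: complex
  assumes "\<And>s. s^4 + a * s^3 + b * s^2 + c * s + d = 0 \<Longrightarrow> 4 * s^3 + 3 * a * s^2 + 2 * b * s + c = 0"
  shows "d = ((b - a^2/4)/2)^2"
proof -
  have "plc 4 1 (poly [:d, c, b, a, 1:])" unfolding plc_def
    by (rule exI[of _ "[:d, c, b, a, 1:]"]) (simp add: numeral_eq_Suc)
  from plc_root[OF this] obtain r where "poly [:d, c, b, a, 1:] r = 0" by auto
  then have r: "r^4 + a * r^3 + b * r^2 + c * r + d = 0"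
    by (simp add: algebra_simps power2_eq_square power3_eq_cube power4_eq_xxxx)
  \<comment> \<open>\<open>s^2 + e * s + k\<close> is the quotient of the quartic by
    \<open>(s - r)^2\<close>.\<close>
  define e k where "e = a + 2 * r" and "k = 3 * r^2 + 2 * a * r + b"
  have "plc 2 1 (poly [:k, e, 1:])" unfolding plc_def
    by (rule exI[of _ "[:k, e, 1:]"]) (simp add: numeral_eq_Suc)
  from plc_root[OF this] obtain r2 where "poly [:k, e, 1:] r2 = 0" by auto
  then have r2: "r2^2 + e * r2 + k = 0" by (simp add: algebra_simps power2_eq_square)
  define r3 where "r3 = - e - r2"
  have a: "a = - (2 * r + r2 + r3)" unfolding r3_def e_def by simp
  have "k = r2 * r3"
  proof -
    have "k - r2 * r3 = r2^2 + e * r2 + k" unfolding r3_def by (simp add: algebra_simps power2_eq_square)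
    then show ?thesis using r2 by simp
  qed
  then have b: "b = r^2 + 2 * r * r2 + 2 * r * r3 + r2 * r3" unfolding k_def a by (simp add: algebra_simps power2_eq_square)
  have "c = - (4 * r^3 + 3 * a * r^2 + 2 * b * r)" using assms[OF r] by (simp add: add_eq_0_iff2)
  then have c: "c = - (r^2 * r2 + r^2 * r3 + 2 * r * r2 * r3)" unfolding a b by (simp add: algebra_simps power2_eq_square power3_eq_cube)
  have "d = - (r^4 + a * r^3 + b * r^2 + c * r)" using r by (simp add: add_eq_0_iff2)
  then have d: "d = r^2 * r2 * r3" unfolding a b c by (simp add: algebra_simps power2_eq_square power3_eq_cube power4_eq_xxxx)
  have f: "s^4 + a * s^3 + b * s^2 + c * s + d = (s - r)^2 * (s - r2) * (s - r3)" for s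
    unfolding a b c d by (simp add: algebra_simps power2_eq_square power3_eq_cube power4_eq_xxxx)
  have f': "4 * s^3 + 3 * a * s^2 + 2 * b * s + c = 2 * (s - r) * (s - r2) * (s - r3) + (s - r)^2 * (s - r3) + (s - r)^2 * (s - r2)" for s
    unfolding a b c d by (simp add: algebra_simps power2_eq_square power3_eq_cube)
  have "(r2 - r)^2 * (r2 - r3) = 0" using assms[of r2] unfolding f f' by simp
  moreover have "(r3 - r)^2 * (r3 - r2) = 0" using assms[of r3] unfolding f f' by simp
  ultimately have "r2 = r3" by auto
  then show ?thesis unfolding a b d by (simp add: field_simps power2_eq_square)
qed

definition det3 :: "complex^3 \<Rightarrow> complex^3 \<Rightarrow> complex^3 \<Rightarrow> complex" where
  "det3 x y z = x$1 * (y$2 * z$3 - y$3 * z$2) - x$2 * (y$1 * z$3 - y$3 * z$1) + x$3 * (y$1 * z$2 - y$2 * z$1)"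

lemma det3_add:
  "det3 (x + x') y z = det3 x y z + det3 x' y z"
  "det3 x (y + y') z = det3 x y z + det3 x y' z"
  "det3 x y (z + z') = det3 x y z + det3 x y z'"
  unfolding det3_def by (simp_all add: algebra_simps)

lemma det3_scale:
  "det3 (a *s x) y z = a * det3 x y z"
  "det3 x (a *s y) z = a * det3 x y z"
  "det3 x y (a *s z) = a * det3 x y z"
  unfolding det3_def by (simp_all add: algebra_simps)

lemma det3_refl [simp]: "det3 x x z = 0" "det3 x y x = 0" "det3 x y y = 0" "det3 0 y z = 0" "det3 x 0 z = 0" "det3 x y 0 = 0"
  unfolding det3_def by (simp_all add: algebra_simps)

lemma det3_swap: "det3 x z y = - det3 x y z" "det3 y x z = - det3 x y z"
  unfolding det3_def by (simp_all add: algebra_simps)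

lemma det3_cramer:
  "det3 x y v *s z = det3 z y v *s x + det3 x z v *s y + det3 x y z *s v"
  unfolding det3_def vec_eq_iff forall_3 by (simp add: algebra_simps)

lemma det3_cramerE:
  assumes "det3 x y v \<noteq> 0"
  obtains a b k where "z = a *s x + b *s y + k *s v"
proof -
  have "z = inverse (det3 x y v) *s (det3 x y v *s z)" using assms by (simp add: vector_smult_assoc)
  also have "\<dots> = (inverse (det3 x y v) * det3 z y v) *s x + (inverse (det3 x y v) * det3 x z v) *s y
      + (inverse (det3 x y v) * det3 x y z) *s v"
    by (subst det3_cramer) (simp add: vector_add_ldistrib vector_smult_assoc)
  finally show ?thesis by (rule that)
qed

lemma det3_planeE:
  assumes "det3 x y v \<noteq> 0" "det3 x y z = 0"
  obtains a b where "z = a *s x + b *s y"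
proof -
  obtain a b k where z: "z = a *s x + b *s y + k *s v" by (rule det3_cramerE[OF assms(1), of z])
  then have "k * det3 x y v = 0" using assms(2) by (simp add: det3_add det3_scale)
  then show ?thesis using z assms(1) that by simp
qed

lemma det3_indep:
  assumes "det3 x y v \<noteq> 0" "a *s x + b *s y + k *s v = 0"
  shows "a = 0 \<and> b = 0 \<and> k = 0"
proof -
  have "det3 (a *s x + b *s y + k *s v) y v = a * det3 x y v"
    "det3 x (a *s x + b *s y + k *s v) v = b * det3 x y v"
    "det3 x y (a *s x + b *s y + k *s v) = k * det3 x y v"
    by (simp_all add: det3_add det3_scale)
  then have "a * det3 x y v = 0" "b * det3 x y v = 0" "k * det3 x y v = 0"
    unfolding assms(2) by simp_all
  then show ?thesis using assms(1) by simp
qed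

lemma det3_indep2: "det3 x y v \<noteq> 0 \<Longrightarrow> a *s x + b *s y = 0 \<Longrightarrow> a = 0 \<and> b = 0"
  using det3_indep[of x y v a b 0] by simp

lemma det3_parallel:
  assumes "\<And>v. det3 x y v = 0" "x \<noteq> 0"
  obtains k where "y = k *s x"
proof -
  \<comment> \<open>Testing against the standard basis reads off the cross product of
    \<open>x\<close> and \<open>y\<close>.\<close>
  have cr: "x$2 * y$3 = x$3 * y$2" "x$1 * y$3 = x$3 * y$1" "x$1 * y$2 = x$2 * y$1"
    using assms(1)[of "axis 1 1"] assms(1)[of "axis 2 1"] assms(1)[of "axis 3 1"]
    unfolding det3_def by (simp_all add: axis_def algebra_simps)
  obtain i where i: "x $ i \<noteq> 0" using assms(2) by (auto simp: vec_eq_iff)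
  have "y = (y $ i / x $ i) *s x"
    unfolding vec_eq_iff forall_3 using i cr exhaust_3[of i] by (auto simp: field_simps)
  then show ?thesis by (rule that)
qed

lemma det3_not_equiv:
  assumes "x \<noteq> 0" "y \<noteq> 0" "\<not> hom_equiv x y"
  obtains v where "det3 x y v \<noteq> 0"
proof (rule ccontr)
  assume "\<not> thesis"
  then have "\<And>v. det3 x y v = 0" using that by blast
  then obtain k where k: "y = k *s x" using det3_parallel[of x y] assms(1) by blast
  then have "k \<noteq> 0" using assms(2) by auto
  then show False using assms k by (auto simp: hom_equiv_def)
qed

section \<open>Bases of the plane and affine charts of the projective line\<close>

lemma basis2:
  fixes w0 :: "complex^2"
  assumes "w0 \<noteq> 0"
  obtains w1 where "\<And>w. \<exists>a b. w = a *s w0 + b *s w1" "\<And>a b. a *s w0 + b *s w1 = 0 \<Longrightarrow> a = 0 \<and> b = 0"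
proof -
  have 12: "(w0 $ 1) \<noteq> 0 \<or> w0 $ 2 \<noteq> 0" using assms by (auto simp: vec_eq_iff forall_2)
  show ?thesis
  proof (cases "w0 $ 1 = 0")
    case False
    show ?thesis
    proof (rule that[of "axis 2 1"])
      fix w :: "complex^2"
      have "w = (w$1 / w0$1) *s w0 + (w$2 - w$1 / w0$1 * w0$2) *s axis 2 1"
        using False by (simp add: vec_eq_iff forall_2 axis_def)
      then show "\<exists>a b. w = a *s w0 + b *s axis 2 1" by blast
    next
      fix a b assume "a *s w0 + b *s axis 2 1 = 0"
      then show "a = 0 \<and> b = 0" using False by (auto simp: vec_eq_iff forall_2 axis_def)
    qed
  next
    case True
    with 12 have 2: "w0 $ 2 \<noteq> 0" by simp
    show ?thesis
    proof (rule that[of "axis 1 1"])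
      fix w :: "complex^2"
      have "w = (w$2 / w0$2) *s w0 + (w$1) *s axis 1 1"
        using True 2 by (simp add: vec_eq_iff forall_2 axis_def)
      then show "\<exists>a b. w = a *s w0 + b *s axis 1 1" by blast
    next
      fix a b assume "a *s w0 + b *s axis 1 1 = 0"
      then show "a = 0 \<and> b = 0" using True 2 by (auto simp: vec_eq_iff forall_2 axis_def)
    qed
  qed
qed

text \<open>A basis yields the affine chart \<open>s *s w0 + w1\<close> of the projective line,
  which misses only the class of \<open>w0\<close>.\<close>

definition is_basis2 :: "complex^2 \<Rightarrow> complex^2 \<Rightarrow> bool" where
  "is_basis2 w0 w1 \<longleftrightarrow> (\<forall>w. \<exists>a b. w = a *s w0 + b *s w1) \<and> (\<forall>a b. a *s w0 + b *s w1 = 0 \<longrightarrow> a = 0 \<and> b = 0)"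

lemma ex_basis2: "w0 \<noteq> 0 \<Longrightarrow> \<exists>w1. is_basis2 w0 w1"
  unfolding is_basis2_def by (metis basis2)

lemma basis2_nonzero: "is_basis2 w0 w1 \<Longrightarrow> s *s w0 + w1 \<noteq> 0" "is_basis2 w0 w1 \<Longrightarrow> w0 \<noteq> 0"
proof -
  assume b: "is_basis2 w0 w1"
  show "s *s w0 + w1 \<noteq> 0"
  proof
    assume "s *s w0 + w1 = 0"
    then have "s *s w0 + 1 *s w1 = 0" by simp
    then show False using b unfolding is_basis2_def by (metis zero_neq_one)
  qed
next
  assume b: "is_basis2 w0 w1"
  show "w0 \<noteq> 0"
  proof
    assume "w0 = 0"
    then have "1 *s w0 + 0 *s w1 = 0" by simp
    then show False using b unfolding is_basis2_def by (metis zero_neq_one)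
  qed
qed

lemma basis2_cover:
  assumes "is_basis2 w0 w1" "w \<noteq> 0"
  shows "hom_equiv w0 w \<or> (\<exists>s. hom_equiv (s *s w0 + w1) w)"
proof -
  obtain a b where w: "w = a *s w0 + b *s w1" using assms unfolding is_basis2_def by blast
  show ?thesis
  proof (cases "b = 0")
    case True
    then show ?thesis using w assms by (auto simp: hom_equiv_def)
  next
    case False
    then have "w = b *s ((a / b) *s w0 + w1)" using w by (simp add: vector_add_ldistrib vector_smult_assoc)
    then show ?thesis using False assms(2) basis2_nonzero(1)[OF assms(1), of "a/b"] unfolding hom_equiv_def by blast
  qed
qed

lemma basis2_inj:
  assumes "is_basis2 w0 w1" "hom_equiv (s *s w0 + w1) (t *s w0 + w1)"
  shows "s = t"
proof -
  obtain k where k: "t *s w0 + w1 = k *s (s *s w0 + w1)" using assms(2) unfolding hom_equiv_def by auto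
  then have "(t - k * s) *s w0 + (1 - k) *s w1 = 0"
    by (simp add: vec_eq_iff algebra_simps)
  then have "t - k * s = 0 \<and> 1 - k = 0" using assms(1) unfolding is_basis2_def by blast
  then show ?thesis by simp
qed

lemma quadratic_form_ternary:
  "\<exists>g. \<forall>z. ternary_form 2 g z = b11 * (z$1)^2 + b22 * (z$2)^2 + b33 * (z$3)^2
     + b12 * z$1 * z$2 + b13 * z$1 * z$3 + b23 * z$2 * z$3"
proof -
  have *: "{..2::nat} = {0,1,2}" "{..Suc 0} = {0,1}" by auto
  define g where "g = (\<lambda>(i::nat) (j::nat). if i = 2 then b11 else if j = 2 then b22 else
     if i = 1 \<and> j = 1 then b12 else if i = 1 then b13 else if j = 1 then b23 else b33)"
  show ?thesis
    by (rule exI[of _ g]) (simp add: ternary_form_def * g_def algebra_simps)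
qed

lemma vec3_axis: "z = z$1 *s axis 1 1 + z$2 *s axis 2 1 + z$3 *s (axis 3 1 :: 'a::field^3)"
  by (simp add: vec_eq_iff forall_3 axis_def)

text \<open>A point of the moment curve \<open>(1, s, s^2)\<close> works: each nonzero
  \<open>n\<close> turns into a nonzero polynomial in \<open>s\<close>, which has finitely many
  roots.\<close>

lemma finite_avoid:
  assumes "finite (T :: (complex^3) set)" "\<And>n. n \<in> T \<Longrightarrow> n \<noteq> 0"
  obtains b :: "complex^3" where "\<And>n. n \<in> T \<Longrightarrow> n$1 * b$1 + n$2 * b$2 + n$3 * b$3 \<noteq> 0"
proof -
  have "finite {s. poly [:n$1, n$2, n$3:] s = 0}" if "n \<in> T" for n
    using assms(2)[OF that] by (intro poly_roots_finite) (auto simp: vec_eq_iff forall_3)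
  then have "finite (\<Union>n\<in>T. {s. poly [:n$1, n$2, n$3:] s = 0})" using assms(1) by blast
  then obtain s where s: "s \<notin> (\<Union>n\<in>T. {s. poly [:n$1, n$2, n$3:] s = 0})"
    using ex_new_if_finite infinite_UNIV_char_0 by blast
  show ?thesis
    by (rule that[of "\<chi> i. if i = 1 then 1 else if i = 2 then s else s^2"]) (use s in \<open>simp add: algebra_simps power2_eq_square vector_3\<close>)
qed

subsection \<open>Rational quartics\<close>

lemma polar_diag_has_derivative:
  fixes c :: "nat \<Rightarrow> nat \<Rightarrow> complex"
  shows "((\<lambda>x. polar c x x x x) has_derivative (\<lambda>h. 4 * polar c x x x h)) (at x)"
proof -
  have "ternary_form 4 c = (\<lambda>x. polar c x x x x)" by (rule ext) (rule ternary_form_polar)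
  then show ?thesis using ternary_form_4_has_derivative[of c x] by simp
qed

locale rat_quartic =
  fixes p :: "3 \<Rightarrow> nat \<Rightarrow> real" and c :: "nat \<Rightarrow> nat \<Rightarrow> real"
  assumes ncr: "no_common_root 4 p"
    and sqf: "squarefree_form 4 (\<lambda>i j. of_real (c i j))"
    and zeros: "{x. ternary_form 4 (\<lambda>i j. of_real (c i j)) (rep_cproj x) = 0} = range (param_map 4 p)"
begin

abbreviation M :: "complex^3 \<Rightarrow> complex^3 \<Rightarrow> complex^3 \<Rightarrow> complex^3 \<Rightarrow> complex" where
  "M \<equiv> polar (\<lambda>i j. of_real (c i j))"

abbreviation P :: "complex^2 \<Rightarrow> complex^3" where "P \<equiv> hom_param 4 p"
abbreviation dP :: "complex^2 \<Rightarrow> complex^2 \<Rightarrow> complex^3" where "dP \<equiv> dparam p"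

lemma P_nonzero: "w \<noteq> 0 \<Longrightarrow> P w \<noteq> 0"
  using ncr unfolding no_common_root_def by blast

lemma P_equiv: "hom_equiv u w \<Longrightarrow> hom_equiv (P u) (P w)"
proof -
  assume "hom_equiv u w"
  then obtain k where "u \<noteq> 0" "k \<noteq> 0" "w = k *s u" by (auto simp: hom_equiv_def)
  then show ?thesis by (simp add: hom_param_4_scale hom_equiv_scale P_nonzero)
qed

lemma zero_equiv: "hom_equiv x z \<Longrightarrow> M x x x x = 0 \<longleftrightarrow> M z z z z = 0"
  by (auto simp: hom_equiv_def polar_scale)

lemma M_P [simp]: "M (P w) (P w) (P w) (P w) = 0"
proof (cases "w = 0")
  case True
  then have "P w = 0" by (simp add: vec_eq_iff hom_param_4)
  then show ?thesis by simp
next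
  case False
  let ?x = "param_map 4 p (abs_cproj w)"
  have "?x \<in> {x. ternary_form 4 (\<lambda>i j. of_real (c i j)) (rep_cproj x) = 0}"
    unfolding zeros by blast
  then have 0: "M (rep_cproj ?x) (rep_cproj ?x) (rep_cproj ?x) (rep_cproj ?x) = 0"
    by (simp add: ternary_form_polar)
  have "hom_equiv (P (rep_cproj (abs_cproj w))) (P w)" using P_equiv rep_abs_cproj False by blast
  moreover have "hom_equiv (rep_cproj ?x) (P (rep_cproj (abs_cproj w)))"
    unfolding param_map_def by (rule rep_abs_cproj) (simp add: P_nonzero)
  ultimately show ?thesis using 0 zero_equiv hom_equiv_trans by blast
qed

lemma M_zeroD:
  assumes "z \<noteq> 0" "M z z z z = 0"
  obtains w where "w \<noteq> 0" "hom_equiv (P w) z"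
proof -
  have "hom_equiv z (rep_cproj (abs_cproj z))" using rep_abs_cproj assms(1) hom_equiv_sym by blast
  then have "abs_cproj z \<in> {x. ternary_form 4 (\<lambda>i j. of_real (c i j)) (rep_cproj x) = 0}"
    using zero_equiv assms(2) by (auto simp: ternary_form_polar)
  then obtain u where u: "abs_cproj z = param_map 4 p u" unfolding zeros by blast
  have "hom_equiv (P (rep_cproj u)) z"
    using u assms(1) abs_cproj_eq_iff[OF P_nonzero[OF rep_cproj_nonzero[of u]] assms(1)] unfolding param_map_def by simp
  then show ?thesis by (rule that[OF rep_cproj_nonzero])
qed

lemma P_line_has_derivative: "((\<lambda>s. P (s *s a + b)) has_derivative (\<lambda>t. t *s dP (s *s a + b) a)) (at s)"
proof -
  have "((\<lambda>s. s *s a + b) has_derivative (\<lambda>t. t *s a)) (at s)"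
    by (rule has_derivative_vec) (auto intro!: derivative_eq_intros)
  from has_derivative_compose[OF this hom_param_4_has_derivative]
  show ?thesis by (simp add: dparam_scale)
qed

text \<open>The equation vanishes identically along the parametrization; this is the derivative of
  that identity.\<close>

lemma M_dP [simp]: "M (P w) (P w) (P w) (dP w h) = 0"
proof -
  have "((\<lambda>w. M (P w) (P w) (P w) (P w)) has_derivative (\<lambda>h. 4 * M (P w) (P w) (P w) (dP w h))) (at w)"
    by (rule has_derivative_compose[OF hom_param_4_has_derivative polar_diag_has_derivative])
  moreover have "((\<lambda>w. M (P w) (P w) (P w) (P w)) has_derivative (\<lambda>h. 0)) (at w)" by simp
  ultimately have "(\<lambda>h. 4 * M (P w) (P w) (P w) (dP w h)) = (\<lambda>h. 0)" by (rule has_derivative_unique)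
  then show ?thesis by (auto simp: fun_eq_iff)
qed

lemma ex_nonzero: obtains y where "M y y y y \<noteq> 0"
  using sqf unfolding squarefree_form_def ternary_form_polar by blast

lemma M_line_expand: "M (s *s y + z) (s *s y + z) (s *s y + z) (s *s y + z) =
   M y y y y * s^4 + 4 * M y y y z * s^3 + 6 * M y y z z * s^2 + 4 * M y z z z * s + M z z z z"
proof -
  have sw: "M y y z y = M y y y z" "M y z y y = M y y y z" "M z y y y = M y y y z"
    "M y z y z = M y y z z" "M y z z y = M y y z z" "M z y y z = M y y z z" "M z y z y = M y y z z" "M z z y y = M y y z z"
    "M z y z z = M y z z z" "M z z y z = M y z z z" "M z z z y = M y z z z"
    by (metis polar_swap)+
  show ?thesis
    by (simp add: polar_add polar_scale sw algebra_simps power2_eq_square power3_eq_cube power4_eq_xxxx)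
qed

text \<open>If every zero were singular, the quartic restricted to any line through a point
  \<open>y\<close> off the curve would have only multiple roots and so be the square of a quadratic.
  The quartic itself would then be the square of a conic, against squarefreeness.\<close>

lemma ex_nonsingular:
  obtains z v where "z \<noteq> 0" "M z z z z = 0" "M z z z v \<noteq> 0"
proof (rule ccontr)
  assume "\<not> thesis"
  then have sing: "M z z z v = 0" if "M z z z z = 0" for z v
    using that \<open>\<not> thesis\<close> \<open>\<And>z v. z \<noteq> 0 \<Longrightarrow> M z z z z = 0 \<Longrightarrow> M z z z v \<noteq> 0 \<Longrightarrow> thesis\<close>
    by (cases "z = 0") auto
  obtain y where y: "M y y y y \<noteq> 0" by (rule ex_nonzero)
  let ?al = "M y y y y"
  \<comment> \<open>The constant term of the quadratic square root in
    \<open>quartic_double_roots\<close>, for the quartic divided by \<open>M y y y y\<close>; it is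
    a quadratic form in \<open>z\<close>.\<close>
  define gam where "gam z = 3 * M y y z z / ?al - 2 * (M y y y z)^2 / ?al^2" for z
  have sq: "M z z z z = ?al * (gam z)^2" for z
  proof -
    let ?a = "4 * M y y y z / ?al" and ?b = "6 * M y y z z / ?al" and ?c = "4 * M y z z z / ?al" and ?d = "M z z z z / ?al"
    have "?d = ((?b - ?a^2/4)/2)^2"
    proof (rule quartic_double_roots)
      fix s assume "s ^ 4 + ?a * s ^ 3 + ?b * s\<^sup>2 + ?c * s + ?d = 0"
      moreover have "al * (s ^ 4 + 4 * A / al * s ^ 3 + 6 * B / al * s\<^sup>2 + 4 * C / al * s + D / al)
          = al * s^4 + 4 * A * s^3 + 6 * B * s^2 + 4 * C * s + D" if "al \<noteq> 0" for al A B C D :: complex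
        using that by (simp add: distrib_left)
      ultimately have "M (s *s y + z) (s *s y + z) (s *s y + z) (s *s y + z) = 0"
        unfolding M_line_expand using y by (metis mult_zero_right)
      then have "M (s *s y + z) (s *s y + z) (s *s y + z) y = 0" by (rule sing)
      moreover have "M (s *s y + z) (s *s y + z) (s *s y + z) y = M y y y y * s^3 + 3 * M y y y z * s^2 + 3 * M y y z z * s + M y z z z"
      proof -
        have sw: "M y y z y = M y y y z" "M y z y y = M y y y z" "M z y y y = M y y y z"
          "M y z y z = M y y z z" "M y z z y = M y y z z" "M z y y z = M y y z z" "M z y z y = M y y z z" "M z z y y = M y y z z"
          "M z y z z = M y z z z" "M z z y z = M y z z z" "M z z z y = M y z z z"
          by (metis polar_swap)+
        show ?thesis
          by (simp add: polar_add polar_scale sw algebra_simps power2_eq_square power3_eq_cube)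
      qed
      ultimately have *: "M y y y y * s^3 + 3 * M y y y z * s^2 + 3 * M y y z z * s + M y z z z = 0" by simp
      have aux: "4 * s^3 + 3 * (4 * A / al) * s^2 + 2 * (6 * B / al) * s + 4 * C / al = 4 * (al * s^3 + 3 * A * s^2 + 3 * B * s + C) / al"
        if "al \<noteq> 0" for al A B C :: complex
        using that by (simp add: divide_inverse algebra_simps)
      show "4 * s ^ 3 + 3 * ?a * s\<^sup>2 + 2 * ?b * s + ?c = 0"
        unfolding aux[OF y] * by simp
    qed
    moreover have "(6 * B / al - (4 * A / al)^2 / 4) / 2 = 3 * B / al - 2 * A^2 / al^2" for A B al :: complex
      by (simp add: power_divide power_mult_distrib diff_divide_distrib)
    ultimately have "?d = (gam z)^2" unfolding gam_def by simp
    then show ?thesis using y by (simp only: nonzero_divide_eq_eq[OF y] mult.commute)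
  qed
  \<comment> \<open>A square root of the leading value turns \<open>?al * (gam z)^2\<close> into a
    pure square, leaving a cofactor of degree 0.\<close>
  obtain r where r: "r^2 = ?al" using power2_csqrt by blast
  let ?e = "\<lambda>i::3. axis i (1::complex) :: complex^3"
  have "\<exists>g. \<forall>z. ternary_form 2 g z = r * gam z"
  proof -
    let ?m = "\<lambda>i. M y y y (?e i)" and ?n = "\<lambda>i j. M y y (?e i) (?e j)"
    let ?B = "\<lambda>i j. 3 * ?n i j / ?al - 2 * ?m i * ?m j / ?al^2"
    obtain g where g: "\<And>z. ternary_form 2 g z = (r * ?B 1 1) * (z$1)^2 + (r * ?B 2 2) * (z$2)^2 + (r * ?B 3 3) * (z$3)^2
     + (2 * r * ?B 1 2) * z$1 * z$2 + (2 * r * ?B 1 3) * z$1 * z$3 + (2 * r * ?B 2 3) * z$2 * z$3"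
      using quadratic_form_ternary by metis
    have G: "gam z = ?B 1 1 * (z$1)^2 + ?B 2 2 * (z$2)^2 + ?B 3 3 * (z$3)^2
     + 2 * ?B 1 2 * z$1 * z$2 + 2 * ?B 1 3 * z$1 * z$3 + 2 * ?B 2 3 * z$2 * z$3" for z
    proof -
      have 1: "M y y y z = z$1 * ?m 1 + z$2 * ?m 2 + z$3 * ?m 3"
        by (subst vec3_axis[of z]) (simp only: polar_add polar_scale)
      have "?n 2 1 = ?n 1 2" "?n 3 1 = ?n 1 3" "?n 3 2 = ?n 2 3" by (metis polar_swap(3))+
      then have 2: "M y y z z = (z$1)^2 * ?n 1 1 + (z$2)^2 * ?n 2 2 + (z$3)^2 * ?n 3 3
         + 2 * z$1 * z$2 * ?n 1 2 + 2 * z$1 * z$3 * ?n 1 3 + 2 * z$2 * z$3 * ?n 2 3"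
        by (subst (1 2) vec3_axis[of z]) (simp only: polar_add polar_scale, simp add: algebra_simps power2_eq_square)
      show ?thesis unfolding gam_def 1 2 
        by (simp add: divide_inverse algebra_simps power2_eq_square)
    qed
    have "\<forall>z. ternary_form 2 g z = r * gam z" unfolding g G by (simp only: distrib_left mult_ac simp_thms)
    then show ?thesis by blast
  qed
  then obtain g where g: "\<And>z. ternary_form 2 g z = r * gam z" by blast
  have h: "ternary_form 0 (\<lambda>i j. 1) z = 1" for z unfolding ternary_form_def by simp
  have "ternary_form 4 (\<lambda>i j. of_real (c i j)) z = (ternary_form 2 g z)\<^sup>2 * ternary_form (4 - 2 * 2) (\<lambda>i j. 1) z" for z
    unfolding ternary_form_polar g using sq[of z] r by (simp add: h power_mult_distrib)
  then show False using sqf unfolding squarefree_form_def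
    by (metis mult_2 numeral_Bit0 order_refl zero_less_numeral)
qed

text \<open>\<open>y\<close> serves as a centre of projection off the curve whose polar cubic does
  not vanish identically along the parametrization. So lines through \<open>y\<close> are tangent to
  the curve, or meet it in a singular point, at only finitely many parameters.\<close>

lemma ex_centre:
  obtains y w where "M y y y y \<noteq> 0" "w \<noteq> 0" "M y (P w) (P w) (P w) \<noteq> 0"
proof -
  obtain z v where z: "z \<noteq> 0" "M z z z z = 0" "M z z z v \<noteq> 0" by (rule ex_nonsingular)
  obtain w where w: "w \<noteq> 0" "hom_equiv (P w) z" using M_zeroD z by metis
  then obtain k where k: "z = k *s P w" by (auto simp: hom_equiv_def)
  then have v: "M (P w) (P w) (P w) v \<noteq> 0" using z(3) by (auto simp: polar_scale)
  obtain y1 where y1: "M y1 y1 y1 y1 \<noteq> 0" by (rule ex_nonzero)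
  \<comment> \<open>Moving \<open>y1\<close> in the direction \<open>v\<close> spoils each condition
    for only finitely many \<open>s\<close>: the first holds at \<open>s = 0\<close>, the second at
    infinity.\<close>
  let ?f = "\<lambda>s. M (s *s v + y1) (s *s v + y1) (s *s v + y1) (s *s v + y1)"
  let ?g = "\<lambda>s. M (P w) (P w) (P w) (s *s v + y1)"
  have "plc (1+1+1+1) (M v v v v) ?f" by (intro plc_polar plc_vec_linear)
  then have "finite {s. ?f s = 0}" by (rule plc_finite[where ?s0.0 = 0]) (use y1 in simp)
  moreover have "plc (0+0+0+1) (M (P w) (P w) (P w) v) ?g" by (intro plc_polar plc_vec_linear plc_vec_const)
  then have "finite {s. ?g s = 0}" by (rule plc_finite') (use v in simp)
  ultimately have "finite ({s. ?f s = 0} \<union> {s. ?g s = 0})" by blast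
  then obtain s where "s \<notin> {s. ?f s = 0} \<union> {s. ?g s = 0}" using ex_new_if_finite infinite_UNIV_char_0 by blast
  then show ?thesis using that[of "s *s v + y1" w] w(1) by (simp, metis polar_swap)
qed

lemma plc_det3_P: "plc 4 (det3 a b (P w0)) (\<lambda>s. det3 a b (P (s *s w0 + w1)))"
  unfolding det3_def
proof -
  have "plc 4 (\<Sum>i\<in>UNIV. k i * P w0 $ i) (\<lambda>s. \<Sum>i\<in>UNIV. k i * P (s *s w0 + w1) $ i)" for k :: "3 \<Rightarrow> complex"
    by (intro plc_sum plc_cmult plc_hom_param finite)
  from this[of "\<lambda>i. if i = 1 then a$2 * b$3 - a$3 * b$2 else if i = 2 then a$3 * b$1 - a$1 * b$3 else a$1 * b$2 - a$2 * b$1"]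
  show "plc 4 (a $ 1 * (b $ 2 * P w0 $ 3 - b $ 3 * P w0 $ 2) - a $ 2 * (b $ 1 * P w0 $ 3 - b $ 3 * P w0 $ 1) +
         a $ 3 * (b $ 1 * P w0 $ 2 - b $ 2 * P w0 $ 1))
     (\<lambda>s. a $ 1 * (b $ 2 * P (s *s w0 + w1) $ 3 - b $ 3 * P (s *s w0 + w1) $ 2) -
          a $ 2 * (b $ 1 * P (s *s w0 + w1) $ 3 - b $ 3 * P (s *s w0 + w1) $ 1) +
          a $ 3 * (b $ 1 * P (s *s w0 + w1) $ 2 - b $ 2 * P (s *s w0 + w1) $ 1))"
    by (simp add: sum_3 algebra_simps)
qed

end

lemma has_field_derivativeI: "(f has_derivative (\<lambda>t. t * d)) (at s) \<Longrightarrow> (f has_field_derivative d) (at s)"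
  unfolding has_field_derivative_def by (erule has_derivative_eq_rhs) (simp add: fun_eq_iff mult.commute)

context rat_quartic
begin

lemma P_zero [simp]: "P 0 = 0"
  by (simp add: vec_eq_iff hom_param_4)

section \<open>Projection from a point off the curve\<close>

context
  fixes y :: "complex^3" and w0 w1 :: "complex^2"
  assumes y: "M y y y y \<noteq> 0" and w0: "M y (P w0) (P w0) (P w0) \<noteq> 0" and basis: "is_basis2 w0 w1"
begin

text \<open>The points of the curve that are multiple intersections with the line joining them to \<open>y\<close>,
  together with \<open>P w0\<close>, which the affine parameter \<open>s\<close> omits. A line through \<open>y\<close> that avoids
  them meets the curve in four distinct points.\<close>

definition bad_points :: "(complex^3) set" where
  "bad_points = insert (P w0) ((\<lambda>s. P (s *s w0 + w1)) `
     {s. M y (P (s *s w0 + w1)) (P (s *s w0 + w1)) (P (s *s w0 + w1)) = 0})"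

definition gen :: "complex^3 \<Rightarrow> bool" where
  "gen z \<longleftrightarrow> (\<forall>b\<in>bad_points. det3 y b z \<noteq> 0)"

lemma finite_bad: "finite bad_points"
proof -
  have "plc (0+4+4+4) (M y (P w0) (P w0) (P w0))
    (\<lambda>s. M y (P (s *s w0 + w1)) (P (s *s w0 + w1)) (P (s *s w0 + w1)))"
    by (intro plc_polar plc_vec_const plc_hom_param)
  then have "finite {s. M y (P (s *s w0 + w1)) (P (s *s w0 + w1)) (P (s *s w0 + w1)) = 0}"
    by (rule plc_finite') (rule w0)
  then show ?thesis unfolding bad_points_def by blast
qed

lemma y_nonzero: "y \<noteq> 0" using y by auto

lemma gen_direction: "\<exists>b. \<forall>z. finite {e. \<not> gen (e *s b + z)}"
proof -
  \<comment> \<open>\<open>cr b\<close> is the cross product of \<open>y\<close> and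
    \<open>b\<close>, that is, the equation of the line joining them.\<close>
  define cr :: "complex^3 \<Rightarrow> complex^3" where
    "cr b = (\<chi> i. if i = 1 then y$2*b$3 - y$3*b$2 else if i = 2 then y$3*b$1 - y$1*b$3 else y$1*b$2-y$2*b$1)" for b
  have cr: "det3 y b z = (cr b)$1 * z$1 + (cr b)$2 * z$2 + (cr b)$3 * z$3" for b z
    unfolding det3_def cr_def by (simp add: algebra_simps)
  have crnz: "cr b \<noteq> 0" if "b \<in> bad_points" for b
  proof
    assume "cr b = 0"
    then have d0: "det3 y b v = 0" for v unfolding cr by simp
    obtain k where k: "b = k *s y" by (rule det3_parallel[OF d0 y_nonzero])
    have "b \<noteq> 0" "M b b b b = 0" using that P_nonzero basis2_nonzero[OF basis] unfolding bad_points_def by auto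
    then show False using y k by (auto simp: polar_scale)
  qed
  have nz: "n \<noteq> 0" if n: "n \<in> cr ` bad_points" for n
  proof -
    obtain b where "n = cr b" "b \<in> bad_points" using n by (rule imageE)
    then show ?thesis using crnz[of b] by simp
  qed
  obtain b0 :: "complex^3" where b0: "\<And>n. n \<in> cr ` bad_points \<Longrightarrow> n$1 * b0$1 + n$2 * b0$2 + n$3 * b0$3 \<noteq> 0"
    by (rule finite_avoid[OF finite_imageI[OF finite_bad, of cr] nz]) auto
  show ?thesis
  proof (intro exI allI)
    fix z
    have "{e. \<not> gen (e *s b0 + z)} \<subseteq> (\<Union>b\<in>bad_points. {e. e * det3 y b b0 + det3 y b z = 0})"
      unfolding gen_def by (auto simp: det3_add det3_scale)
    moreover have "finite {e. e * det3 y b b0 + det3 y b z = 0}" if "b \<in> bad_points" for b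
      by (rule plc_finite'[OF plc_linear]) (use b0 that cr in auto)
    ultimately show "finite {e. \<not> gen (e *s b0 + z)}"
      using finite_bad by (meson finite_UN_I finite_subset)
  qed
qed

text \<open>General points are dense: a function that is polynomial along lines and vanishes at all
  of them vanishes everywhere.\<close>

lemma gen_all:
  assumes "\<And>z. gen z \<Longrightarrow> f z = 0" "\<And>b z. \<exists>n l. plc n l (\<lambda>e. f (e *s b + z))"
  shows "f z = 0"
proof (rule ccontr)
  assume "f z \<noteq> 0"
  obtain b where b: "\<And>z. finite {e. \<not> gen (e *s b + z)}" using gen_direction by blast
  obtain n l where "plc n l (\<lambda>e. f (e *s b + z))" using assms(2) by blast
  then have "finite {e. f (e *s b + z) = 0}" by (rule plc_finite[where ?s0.0 = 0]) (use \<open>f z \<noteq> 0\<close> in simp)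
  then have "finite ({e. \<not> gen (e *s b + z)} \<union> {e. f (e *s b + z) = 0})" using b by blast
  moreover have "{e. \<not> gen (e *s b + z)} \<union> {e. f (e *s b + z) = 0} = UNIV" using assms(1) by blast
  ultimately show False using infinite_UNIV_char_0 by metis
qed

lemma gen_line_nonzero: assumes "gen z" shows "t *s y + z \<noteq> 0"
proof
  assume "t *s y + z = 0"
  then have "det3 y (P w0) (t *s y + z) = 0" by simp
  then show False using assms unfolding gen_def bad_points_def by (simp add: det3_add det3_scale)
qed

text \<open>A multiple root gives a point of the curve on the polar cubic of \<open>y\<close>, hence
  a bad point on the line, which \<open>gen\<close> forbids.\<close>

lemma gen_simple:
  assumes "gen z" "M (t *s y + z) (t *s y + z) (t *s y + z) (t *s y + z) = 0"
  shows "M (t *s y + z) (t *s y + z) (t *s y + z) y \<noteq> 0"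
proof
  assume *: "M (t *s y + z) (t *s y + z) (t *s y + z) y = 0"
  obtain w where w: "w \<noteq> 0" "hom_equiv (P w) (t *s y + z)"
    using M_zeroD[OF gen_line_nonzero[OF assms(1)] assms(2)] by metis
  have fin: False if hyp: "hom_equiv (P u) (t *s y + z)" and bad: "P u \<in> bad_points" for u
  proof -
    obtain k where k: "t *s y + z = k *s P u" using hyp unfolding hom_equiv_def by blast
    have "det3 y (P u) z = det3 y (P u) (t *s y + z)" by (simp add: det3_add det3_scale)
    also have "\<dots> = 0" unfolding k by (simp add: det3_scale)
    finally show False using assms(1) bad unfolding gen_def by blast
  qed
  have D0: "M y (P u) (P u) (P u) = 0" if u: "hom_equiv (P u) (t *s y + z)" for u
  proof -
    obtain k where k: "k \<noteq> 0" "t *s y + z = k *s P u" using u unfolding hom_equiv_def by blast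
    have "M (P u) (P u) (P u) y = 0" using * k(1) unfolding k(2) by (simp add: polar_scale)
    then show ?thesis by (metis polar_swap)
  qed
  from basis2_cover[OF basis w(1)] show False
  proof
    assume "hom_equiv w0 w"
    then show False using fin w P_equiv hom_equiv_trans unfolding bad_points_def by blast
  next
    assume "\<exists>s. hom_equiv (s *s w0 + w1) w"
    then obtain s where "hom_equiv (P (s *s w0 + w1)) (t *s y + z)" using w P_equiv hom_equiv_trans by blast
    with D0 fin show False unfolding bad_points_def by blast
  qed
qed

lemma plc_line: "plc 4 (M y y y y) (\<lambda>t. M (t *s y + z) (t *s y + z) (t *s y + z) (t *s y + z))"
proof -
  have "plc (1+1+1+1) (M y y y y) (\<lambda>t. M (t *s y + z) (t *s y + z) (t *s y + z) (t *s y + z))"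
    by (intro plc_polar plc_vec_linear)
  then show ?thesis by (simp add: numeral_eq_Suc)
qed

lemma gen_card:
  assumes "gen z"
  shows "card {t. M (t *s y + z) (t *s y + z) (t *s y + z) (t *s y + z) = 0} = 4"
proof (rule plc_card_simple[OF plc_line y])
  fix t assume 0: "M (t *s y + z) (t *s y + z) (t *s y + z) (t *s y + z) = 0"
  have l: "((\<lambda>t. t *s y + z) has_derivative (\<lambda>t. t *s y)) (at t)"
    by (rule has_derivative_vec) (auto intro!: derivative_eq_intros)
  have d: "((\<lambda>t. M (t *s y + z) (t *s y + z) (t *s y + z) (t *s y + z)) has_derivative
     (\<lambda>h. 4 * M (t *s y + z) (t *s y + z) (t *s y + z) (h *s y))) (at t)"
    by (rule has_derivative_compose[OF l polar_diag_has_derivative])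
  show "\<not> ((\<lambda>t. M (t *s y + z) (t *s y + z) (t *s y + z) (t *s y + z)) has_field_derivative 0) (at t)"
  proof
    assume "((\<lambda>t. M (t *s y + z) (t *s y + z) (t *s y + z) (t *s y + z)) has_field_derivative 0) (at t)"
    from has_derivative_unique[OF d this[unfolded has_field_derivative_def]]
    have "4 * M (t *s y + z) (t *s y + z) (t *s y + z) (1 *s y) = 0 * 1" by (rule fun_cong)
    then show False using gen_simple[OF assms 0] by simp
  qed
qed

text \<open>On a general line through \<open>y\<close> both quartics, scaled to the same value at
  \<open>y\<close>, vanish at the four points of the curve and hence agree along the line; by
  density they agree everywhere.\<close>

lemma quartic_unique_aux:
  fixes c1 :: "nat \<Rightarrow> nat \<Rightarrow> complex"
  assumes "\<And>w. polar c1 (P w) (P w) (P w) (P w) = 0"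
  shows "\<exists>k. \<forall>z. polar c1 z z z z = k * M z z z z"
proof -
  let ?k = "polar c1 y y y y / M y y y y"
  have "polar c1 z z z z - ?k * M z z z z = 0" for z
  proof (rule gen_all[of "\<lambda>z. polar c1 z z z z - ?k * M z z z z"])
    fix z assume g: "gen z"
    have 1: "plc 4 (polar c1 y y y y) (\<lambda>t. polar c1 (t *s y + z) (t *s y + z) (t *s y + z) (t *s y + z))"
    proof -
      have "plc (1+1+1+1) (polar c1 y y y y) (\<lambda>t. polar c1 (t *s y + z) (t *s y + z) (t *s y + z) (t *s y + z))"
        by (intro plc_polar plc_vec_linear)
      then show ?thesis by (simp add: numeral_eq_Suc)
    qed
    have 2: "plc 4 (polar c1 y y y y) (\<lambda>t. ?k * M (t *s y + z) (t *s y + z) (t *s y + z) (t *s y + z))"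
      using plc_cmult[OF plc_line, of ?k] y by simp
    have "(\<lambda>t. polar c1 (t *s y + z) (t *s y + z) (t *s y + z) (t *s y + z)) =
      (\<lambda>t. ?k * M (t *s y + z) (t *s y + z) (t *s y + z) (t *s y + z))"
    proof (rule plc_eq[OF 1 2])
      show "4 \<le> card {t. M (t *s y + z) (t *s y + z) (t *s y + z) (t *s y + z) = 0}"
        using gen_card[OF g] by simp
      fix t assume "t \<in> {t. M (t *s y + z) (t *s y + z) (t *s y + z) (t *s y + z) = 0}"
      then have t: "M (t *s y + z) (t *s y + z) (t *s y + z) (t *s y + z) = 0" by simp
      obtain w where "hom_equiv (P w) (t *s y + z)" using M_zeroD[OF gen_line_nonzero[OF g] t] by metis
      then obtain k where k: "t *s y + z = k *s P w" unfolding hom_equiv_def by blast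
      show "polar c1 (t *s y + z) (t *s y + z) (t *s y + z) (t *s y + z) =
         ?k * M (t *s y + z) (t *s y + z) (t *s y + z) (t *s y + z)"
        unfolding k by (simp add: polar_scale assms)
    qed
    from fun_cong[OF this, of 0] show "polar c1 z z z z - ?k * M z z z z = 0" by simp
  next
    fix b z
    have "plc (1+1+1+1) (polar c1 b b b b) (\<lambda>t. polar c1 (t *s b + z) (t *s b + z) (t *s b + z) (t *s b + z))"
      "plc (1+1+1+1) (M b b b b) (\<lambda>t. M (t *s b + z) (t *s b + z) (t *s b + z) (t *s b + z))"
      by (intro plc_polar plc_vec_linear)+
    from plc_add[OF this(1) plc_cmult[OF this(2), of "- ?k"]]
    show "\<exists>n l. plc n l (\<lambda>e. polar c1 (e *s b + z) (e *s b + z) (e *s b + z) (e *s b + z) -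
             ?k * M (e *s b + z) (e *s b + z) (e *s b + z) (e *s b + z))"
      by auto
  qed
  then show ?thesis by (metis eq_iff_diff_eq_0)
qed

text \<open>Otherwise a general line through \<open>y\<close> would have at least two distinct
  points in the plane of \<open>a\<close> and \<open>b\<close>, hence lie in it, and so would every
  \<open>z\<close>.\<close>

lemma not_in_plane_aux:
  assumes "det3 a b v \<noteq> 0"
  shows "\<exists>w. det3 a b (P w) \<noteq> 0"
proof (rule ccontr)
  assume "\<not> ?thesis"
  then have P0: "det3 a b (P w) = 0" for w by blast
  have "det3 a b z = 0" for z
  proof (rule gen_all[of "det3 a b"])
    fix z assume g: "gen z"
    let ?R = "{t. M (t *s y + z) (t *s y + z) (t *s y + z) (t *s y + z) = 0}"
    have R: "t * det3 a b y + det3 a b z = 0" if t: "t \<in> ?R" for t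
    proof -
      obtain w where "hom_equiv (P w) (t *s y + z)" using M_zeroD[OF gen_line_nonzero[OF g]] t by blast
      then obtain k where k: "t *s y + z = k *s P w" unfolding hom_equiv_def by blast
      have "det3 a b (t *s y + z) = 0" unfolding k using P0 by (simp add: det3_scale)
      then show ?thesis by (simp add: det3_add det3_scale)
    qed
    have "\<not> ?R \<subseteq> {t0}" for t0
    proof
      assume "?R \<subseteq> {t0}"
      then have "card ?R \<le> card {t0}" by (intro card_mono) auto
      then show False using gen_card[OF g] by simp
    qed
    moreover from this have "?R \<noteq> {}" by blast
    ultimately obtain t1 t2 where "t1 \<in> ?R" "t2 \<in> ?R" "t1 \<noteq> t2" by blast
    have "(t1 - t2) * det3 a b y = (t1 * det3 a b y + det3 a b z) - (t2 * det3 a b y + det3 a b z)"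
      by (simp add: algebra_simps)
    also have "\<dots> = 0" unfolding R[OF \<open>t1 \<in> ?R\<close>] R[OF \<open>t2 \<in> ?R\<close>] by simp
    finally have "det3 a b y = 0" using \<open>t1 \<noteq> t2\<close> by simp
    then show "det3 a b z = 0" using R[OF \<open>t1 \<in> ?R\<close>] by simp
  next
    fix d z
    show "\<exists>n l. plc n l (\<lambda>e. det3 a b (e *s d + z))"
      using plc_linear[of "det3 a b d" "det3 a b z"] by (auto simp: det3_add det3_scale)
  qed
  then show False using assms by blast
qed

end

lemma centre_basis:
  obtains y w0 w1 where "M y y y y \<noteq> 0" "M y (P w0) (P w0) (P w0) \<noteq> 0" "is_basis2 w0 w1"
  using ex_centre ex_basis2 by metis

lemma quartic_unique:
  fixes c1 :: "nat \<Rightarrow> nat \<Rightarrow> complex"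
  assumes "\<And>w. polar c1 (P w) (P w) (P w) (P w) = 0"
  obtains k where "\<And>z. polar c1 z z z z = k * M z z z z"
  using centre_basis quartic_unique_aux[OF _ _ _ assms] by metis

lemma not_in_plane:
  assumes "det3 a b v \<noteq> 0"
  obtains w where "det3 a b (P w) \<noteq> 0"
  using centre_basis not_in_plane_aux[OF _ _ _ assms] by metis

text \<open>A projective line pulls back to a nonzero binary form of degree 4. In a chart whose
  omitted point is off the line all its roots are finite.\<close>

lemma plane_section_card:
  assumes "det3 a b v \<noteq> 0" "\<And>w. w \<in> W \<Longrightarrow> w \<noteq> 0 \<and> det3 a b (P w) = 0"
    "\<And>w w'. w \<in> W \<Longrightarrow> w' \<in> W \<Longrightarrow> w \<noteq> w' \<Longrightarrow> \<not> hom_equiv w w'"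
  shows "finite W \<and> card W \<le> 4"
proof -
  obtain u where u: "det3 a b (P u) \<noteq> 0" using not_in_plane[OF assms(1)] .
  have "u \<noteq> 0" using u by auto
  then obtain u1 where u1: "is_basis2 u u1" using ex_basis2 by blast
  let ?Z = "{s. det3 a b (P (s *s u + u1)) = 0}"
  have fin: "finite ?Z" "card ?Z \<le> 4" using plc_finite'[OF plc_det3_P u] plc_card[OF plc_det3_P u] by blast+
  have "\<exists>s. hom_equiv (s *s u + u1) w \<and> s \<in> ?Z" if w: "w \<in> W" for w
  proof -
    have w': "w \<noteq> 0" "det3 a b (P w) = 0" using assms(2)[OF w] by auto
    have tr: "det3 a b (P x) = 0" if "hom_equiv x w" for x
      using P_equiv[OF that] w'(2) unfolding hom_equiv_def by (auto simp: det3_scale)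
    then show ?thesis using basis2_cover[OF u1 w'(1)] u by blast
  qed
  then obtain f where f: "\<And>w. w \<in> W \<Longrightarrow> hom_equiv (f w *s u + u1) w \<and> f w \<in> ?Z" by metis
  have "inj_on f W"
  proof (rule inj_onI, rule ccontr)
    fix w w' assume "w \<in> W" "w' \<in> W" "f w = f w'" "w \<noteq> w'"
    have 1: "hom_equiv (f w *s u + u1) w" and 2: "hom_equiv (f w *s u + u1) w'"
      using f[OF \<open>w \<in> W\<close>] f[OF \<open>w' \<in> W\<close>] \<open>f w = f w'\<close> by simp_all
    have "hom_equiv w w'" by (rule hom_equiv_trans[OF hom_equiv_sym[OF 1] 2])
    then show False using assms(3) \<open>w \<in> W\<close> \<open>w' \<in> W\<close> \<open>w \<noteq> w'\<close> by blast
  qed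
  moreover have "f ` W \<subseteq> ?Z" using f by blast
  ultimately show ?thesis using fin by (meson card_inj_on_le inj_on_finite order_trans)
qed

lemma plane_section_finite:
  assumes v: "det3 y b v \<noteq> 0" and basis: "is_basis2 w0 w1"
  shows "finite {s. det3 y b (P (s *s w0 + w1)) = 0}"
proof -
  obtain u where u: "det3 y b (P u) \<noteq> 0" using not_in_plane[OF v] .
  have "u \<noteq> 0" using u by auto
  from basis2_cover[OF basis this] show ?thesis
  proof
    assume "hom_equiv w0 u"
    then have "det3 y b (P w0) \<noteq> 0" using u by (auto simp: hom_equiv_def hom_param_4_scale det3_scale)
    from plc_finite'[OF plc_det3_P this] show ?thesis .
  next
    assume "\<exists>s. hom_equiv (s *s w0 + w1) u"
    then obtain s where "hom_equiv (s *s w0 + w1) u" by blast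
    then obtain k where "u = k *s (s *s w0 + w1)" by (rule equiv_scaleE)
    then have "det3 y b (P (s *s w0 + w1)) \<noteq> 0" using u by (simp add: hom_param_4_scale det3_scale del: vector_add_ldistrib)
    from plc_finite[OF plc_det3_P this] show ?thesis .
  qed
qed

text \<open>The infinitely many points of a line inside the curve would all be hit, although a line
  section has at most four parameters.\<close>

lemma not_contains_line:
  assumes "det3 a b v \<noteq> 0"
  obtains s t where "M (s *s a + t *s b) (s *s a + t *s b) (s *s a + t *s b) (s *s a + t *s b) \<noteq> 0"
proof (rule ccontr)
  assume "\<not> thesis"
  then have z: "M (t *s a + b) (t *s a + b) (t *s a + b) (t *s a + b) = 0" for t
    using that[of t 1] by auto
  have nz: "t *s a + b \<noteq> 0" for t using det3_indep2[OF assms, of t 1] by auto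
  have "\<exists>w. w \<noteq> 0 \<and> hom_equiv (P w) (t *s a + b)" for t using M_zeroD[OF nz z] by metis
  then obtain W where W: "\<And>t. W t \<noteq> 0 \<and> hom_equiv (P (W t)) (t *s a + b)" by metis
  have inj: "t = t'" if "hom_equiv (W t) (W t')" for t t'
  proof -
    have "hom_equiv (t *s a + b) (t' *s a + b)"
      by (rule equiv_chain[OF _ _ P_equiv[OF that]]) (use W in blast)+
    then obtain k where "t' *s a + b = k *s (t *s a + b)" unfolding hom_equiv_def by blast
    then have "(t' - k * t) *s a + (1 - k) *s b = 0" by (simp add: vec_eq_iff algebra_simps)
    from det3_indep2[OF assms this] show ?thesis by simp
  qed
  have "finite (range W) \<and> card (range W) \<le> 4"
  proof (rule plane_section_card[OF assms])
    fix w assume "w \<in> range W"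
    then obtain t where t: "w = W t" by blast
    obtain k where k: "k \<noteq> 0" "t *s a + b = k *s P (W t)" using W[of t] unfolding hom_equiv_def by blast
    have "k * det3 a b (P (W t)) = det3 a b (t *s a + b)" unfolding k by (simp add: det3_scale)
    also have "\<dots> = 0" by (simp add: det3_add det3_scale)
    finally show "w \<noteq> 0 \<and> det3 a b (P w) = 0" using t W k by simp
  next
    fix w w' assume "w \<in> range W" "w' \<in> range W" "w \<noteq> w'"
    then show "\<not> hom_equiv w w'" using inj by blast
  qed
  moreover have "inj W" using inj W by (metis hom_equiv_refl injI)
  ultimately show False using finite_imageD infinite_UNIV_char_0 by blast
qed

text \<open>The line through \<open>y\<close> and \<open>P w\<close> carries four distinct points of
  the curve while its pullback has degree 4. So each point has one preimage, and each root of the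
  pullback is simple, which gives the direction \<open>h\<close>.\<close>

lemma gen_fibre:
  assumes y: "M y y y y \<noteq> 0" and w0: "M y (P w0) (P w0) (P w0) \<noteq> 0" and basis: "is_basis2 w0 w1"
    and g: "gen y w0 w1 (P w)" and w: "w \<noteq> 0"
  shows "(\<forall>w'. hom_equiv (P w') (P w) \<longrightarrow> hom_equiv w' w) \<and> (\<exists>h. det3 y (P w) (dP w h) \<noteq> 0)"
proof -
  let ?z = "P w"
  define R where "R = {t. M (t *s y + ?z) (t *s y + ?z) (t *s y + ?z) (t *s y + ?z) = 0}"
  have card: "card R = 4" unfolding R_def by (rule gen_card[OF y w0 basis g])
  have fin: "finite R" by (rule card_ge_0_finite) (simp only: card)
  have ind: "det3 y ?z (P w0) \<noteq> 0"
    using g unfolding gen_def[OF y w0 basis] bad_points_def[OF y w0 basis] by (simp add: det3_swap(1)[of y "P w0"])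
  have ex: "\<exists>u. u \<noteq> 0 \<and> hom_equiv (P u) (t *s y + ?z)" if t: "t \<in> R" for t
  proof -
    have t0: "M (t *s y + ?z) (t *s y + ?z) (t *s y + ?z) (t *s y + ?z) = 0" using t unfolding R_def by (rule CollectD)
    obtain u where "u \<noteq> 0" "hom_equiv (P u) (t *s y + ?z)"
      by (rule M_zeroD[OF gen_line_nonzero[OF y w0 basis g] t0])
    then show ?thesis by blast
  qed
  obtain W where W: "\<And>t. t \<in> R \<Longrightarrow> W t \<noteq> 0 \<and> hom_equiv (P (W t)) (t *s y + ?z)"
    using ex by metis
  have inj: "t = t'" if hyp: "hom_equiv (t *s y + ?z) (t' *s y + ?z)" for t t'
  proof -
    obtain k where "t' *s y + ?z = k *s (t *s y + ?z)" using hyp unfolding hom_equiv_def by blast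
    then have "(t' - k * t) *s y + (1 - k) *s ?z = 0" by (simp add: vec_eq_iff algebra_simps)
    from det3_indep2[OF ind this] show ?thesis by simp
  qed
  have on: "det3 y ?z (P u) = 0" if hyp: "hom_equiv (P u) (t *s y + ?z)" for u t
  proof -
    obtain k where k: "k \<noteq> 0" "t *s y + ?z = k *s P u" using hyp unfolding hom_equiv_def by blast
    have "k * det3 y ?z (P u) = det3 y ?z (t *s y + ?z)" unfolding k by (simp add: det3_scale)
    then show ?thesis using k(1) by (simp add: det3_add det3_scale)
  qed
  have Winj: "t = t'" if "t \<in> R" "t' \<in> R" "hom_equiv (W t) (W t')" for t t'
    by (rule inj, rule equiv_chain[OF _ _ P_equiv[OF that(3)]]) (use W that in blast)+
  have 0: "0 \<in> R" unfolding R_def by simp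
  have "hom_equiv w' w" if w': "hom_equiv (P w') ?z" for w'
  proof (rule ccontr)
    assume neq: "\<not> hom_equiv w' w"
    have "w' \<noteq> 0" using hom_equiv_nonzero[OF w'] by auto
    \<comment> \<open>A second preimage \<open>w'\<close> would give five inequivalent parameters on
      one line: \<open>w\<close>, \<open>w'\<close> and one over each of the three other
      points.\<close>
    let ?W = "insert w (insert w' (W ` (R - {0})))"
    have dis: "\<not> hom_equiv (W t) x" if t: "t \<in> R - {0}" and x: "hom_equiv (P x) ?z" for t x
    proof
      assume a: "hom_equiv (W t) x"
      have "hom_equiv (P (W t)) (t *s y + ?z)" using W t by blast
      from equiv_chain[OF this x P_equiv[OF a]]
      have "hom_equiv (t *s y + ?z) (0 *s y + ?z)" by simp
      then have "t = 0" by (rule inj)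
      then show False using t by blast
    qed
    have dis2: "\<not> hom_equiv x (W t)" if "t \<in> R - {0}" "hom_equiv (P x) ?z" for t x
      using dis[OF that] hom_equiv_sym by blast
    have Winj2: "\<not> hom_equiv (W t) (W t')" if "t \<in> R" "t' \<in> R" "W t \<noteq> W t'" for t t'
      using Winj that by blast
    have wz: "hom_equiv (P w) ?z" using P_nonzero[OF w] by simp
    have "finite ?W \<and> card ?W \<le> 4"
    proof (rule plane_section_card[OF ind])
      fix x assume x: "x \<in> ?W"
      show "x \<noteq> 0 \<and> det3 y ?z (P x) = 0"
        using x W on[of x] on[of x 0] w w' wz \<open>w' \<noteq> 0\<close> by auto
    next
      fix x x' assume "x \<in> ?W" "x' \<in> ?W" "x \<noteq> x'"
      then show "\<not> hom_equiv x x'"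
        using dis[OF _ wz] dis[OF _ w'] dis2[OF _ wz] dis2[OF _ w'] neq Winj2 by (auto dest: hom_equiv_sym)
    qed
    moreover have "card ?W = 5"
    proof -
      have "inj_on W R" using Winj W by (metis (no_types, lifting) hom_equiv_refl inj_onI)
      then have "card (W ` (R - {0})) = 3" using card fin 0 by (subst card_image) (auto simp: inj_on_diff)
      moreover have "x \<notin> W ` (R - {0})" if x: "hom_equiv (P x) ?z" "x \<noteq> 0" for x
      proof
        assume "x \<in> W ` (R - {0})"
        then obtain t where t: "x = W t" "t \<in> R - {0}" by (rule imageE)
        show False using dis[OF t(2) x(1)] x(2) unfolding t(1) by simp
      qed
      then have "w' \<notin> W ` (R - {0})" "w \<notin> W ` (R - {0})" using w' \<open>w' \<noteq> 0\<close> wz w by blast+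
      moreover have "w \<noteq> w'" using neq w by auto
      ultimately show ?thesis using fin by simp
    qed
    ultimately show False by simp
  qed
  moreover have "\<exists>h. det3 y ?z (dP w h) \<noteq> 0"
  proof -
    \<comment> \<open>\<open>u\<close> is taken off the line, so the chart based at \<open>u\<close>
      contains every parameter on the line.\<close>
    obtain u where u: "det3 y ?z (P u) \<noteq> 0" using not_in_plane[OF ind] .
    have "u \<noteq> 0" using u by auto
    then obtain u1 where u1: "is_basis2 u u1" using ex_basis2 by blast
    let ?f = "\<lambda>s. det3 y ?z (P (s *s u + u1))"
    let ?Z = "{s. ?f s = 0}"
    have ex: "\<exists>s. hom_equiv (s *s u + u1) x" if "hom_equiv (P x) (t *s y + ?z)" "x \<noteq> 0" for x t
    proof -
      have "\<not> hom_equiv u x"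
      proof
        assume "hom_equiv u x"
        then have "hom_equiv (P u) (t *s y + ?z)" using that P_equiv hom_equiv_trans by blast
        then show False using on u by blast
      qed
      then show ?thesis using basis2_cover[OF u1 that(2)] by blast
    qed
    have "\<exists>s. hom_equiv (s *s u + u1) (W t)" if "t \<in> R" for t using ex W[OF that] by blast
    then obtain g where g: "\<And>t. t \<in> R \<Longrightarrow> hom_equiv (g t *s u + u1) (W t)" by metis
    have "inj_on g R" 
    proof (rule inj_onI)
      fix t t' assume "t \<in> R" "t' \<in> R" "g t = g t'"
      have 1: "hom_equiv (g t *s u + u1) (W t)" and 2: "hom_equiv (g t *s u + u1) (W t')"
        using g[OF \<open>t \<in> R\<close>] g[OF \<open>t' \<in> R\<close>] \<open>g t = g t'\<close> by simp_all
      have "hom_equiv (W t) (W t')" by (rule hom_equiv_trans[OF hom_equiv_sym[OF 1] 2])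
      then show "t = t'" using Winj \<open>t \<in> R\<close> \<open>t' \<in> R\<close> by blast
    qed
    moreover have "g ` R \<subseteq> ?Z"
    proof
      fix s assume "s \<in> g ` R"
      then obtain t where "t \<in> R" "s = g t" by blast
      then have "hom_equiv (P (s *s u + u1)) (t *s y + ?z)" using g W P_equiv hom_equiv_trans by blast
      then show "s \<in> ?Z" using on by blast
    qed
    ultimately have "4 \<le> card ?Z"
      using card plc_finite'[OF plc_det3_P u] by (metis card_inj_on_le)
    obtain s where s: "hom_equiv (s *s u + u1) w" using ex[of w 0] w P_nonzero[OF w] by auto
    then have fs: "?f s = 0" using on[of "s *s u + u1" 0] P_equiv by simp
    have "(?f has_derivative (\<lambda>t. det3 y ?z (t *s dP (s *s u + u1) u))) (at s)"
    proof -
      have "(det3 y ?z has_derivative det3 y ?z) (at x)" for x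
        unfolding det3_def by (auto intro!: derivative_eq_intros)
      from has_derivative_compose[OF P_line_has_derivative this] show ?thesis by simp
    qed
    then have "(?f has_field_derivative det3 y ?z (dP (s *s u + u1) u)) (at s)"
      by (intro has_field_derivativeI) (simp add: det3_scale)
    from plc_deriv_nonzero[OF plc_det3_P u \<open>4 \<le> card ?Z\<close> fs this]
    have nz: "det3 y ?z (dP (s *s u + u1) u) \<noteq> 0" .
    obtain k where k: "k \<noteq> 0" "w = k *s (s *s u + u1)" using s by (rule equiv_scaleE)
    have "dP w u = k^3 *s dP (s *s u + u1) u" unfolding k(2) by (rule dparam_scale1)
    then have "det3 y ?z (dP w u) \<noteq> 0" using nz k(1) by (simp only: det3_scale mult_eq_0_iff power_eq_0_iff simp_thms)
    then show ?thesis by blast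
  qed
  ultimately show ?thesis by blast
qed

text \<open>Only finitely many parameters map to one of the finitely many lines joining
  \<open>y\<close> to a bad point; \<open>gen_fibre\<close> applies to all others.\<close>

lemma generic_injective_immersion:
  obtains w0 w1 S where "is_basis2 w0 w1" "finite S"
    "\<And>s. s \<notin> S \<Longrightarrow> (\<forall>w'. hom_equiv (P w') (P (s *s w0 + w1)) \<longrightarrow> hom_equiv w' (s *s w0 + w1))"
    "\<And>s. s \<notin> S \<Longrightarrow> \<exists>h. \<forall>a. dP (s *s w0 + w1) h \<noteq> a *s P (s *s w0 + w1)"
proof -
  obtain y w0 w1 where y: "M y y y y \<noteq> 0" and w0: "M y (P w0) (P w0) (P w0) \<noteq> 0" and basis: "is_basis2 w0 w1"
    by (rule centre_basis)
  let ?S = "{s. \<not> gen y w0 w1 (P (s *s w0 + w1))}"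
  have "finite ?S"
  proof -
    have sub: "?S \<subseteq> (\<Union>b\<in>bad_points y w0 w1. {s. det3 y b (P (s *s w0 + w1)) = 0})"
      unfolding gen_def[OF y w0 basis] by blast
    have "finite {s. det3 y b (P (s *s w0 + w1)) = 0}" if b: "b \<in> bad_points y w0 w1" for b
    proof -
      have bz: "b \<noteq> 0" "M b b b b = 0"
        using b P_nonzero basis2_nonzero[OF basis] unfolding bad_points_def[OF y w0 basis] by auto
      have "\<exists>v. det3 y b v \<noteq> 0"
      proof (rule ccontr)
        assume "\<nexists>v. det3 y b v \<noteq> 0"
        then have d0: "det3 y b v = 0" for v by blast
        obtain k where "b = k *s y" by (rule det3_parallel[OF d0 y_nonzero[OF y w0 basis]])
        then show False using bz y by (auto simp: polar_scale)
      qed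
      then obtain v where v: "det3 y b v \<noteq> 0" by blast
      show ?thesis by (rule plane_section_finite[OF v basis])
    qed
    then show ?thesis using sub finite_bad[OF y w0 basis] by (meson finite_UN_I finite_subset)
  qed
  then show ?thesis
  proof (rule that[OF basis])
    fix s assume "s \<notin> ?S"
    then have "gen y w0 w1 (P (s *s w0 + w1))" by blast
    note * = gen_fibre[OF y w0 basis this basis2_nonzero(1)[OF basis]]
    show "\<forall>w'. hom_equiv (P w') (P (s *s w0 + w1)) \<longrightarrow> hom_equiv w' (s *s w0 + w1)" using * by blast
    obtain h where "det3 y (P (s *s w0 + w1)) (dP (s *s w0 + w1) h) \<noteq> 0" using * by blast
    then show "\<exists>h. \<forall>a. dP (s *s w0 + w1) h \<noteq> a *s P (s *s w0 + w1)"
      by (metis det3_refl(3) det3_scale(3) mult_zero_right)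
  qed
qed

end

subsection \<open>Nodal rational quartics\<close>

lemma plc_dparam: "plc 3 (dparam p a h $ i) (\<lambda>s. dparam p (s *s a + b) h $ i)"
proof -
  note l1 = plc_vec_linear[of a 1 b] and l2 = plc_vec_linear[of a 2 b]
  have m: "plc 3 (k * ((a$1)^2 * a$2)) (\<lambda>s. k * (((s *s a + b)$1)^2 * (s *s a + b)$2))"
    "plc 3 (k * (a$1 * (a$2)^2)) (\<lambda>s. k * ((s *s a + b)$1 * ((s *s a + b)$2)^2))"
    "plc 3 (k * (a$1)^3) (\<lambda>s. k * ((s *s a + b)$1)^3)" "plc 3 (k * (a$2)^3) (\<lambda>s. k * ((s *s a + b)$2)^3)" for k
    using plc_cmult[OF plc_mult[OF plc_power[OF l1, of 2] l2]] plc_cmult[OF plc_mult[OF l1 plc_power[OF l2, of 2]]]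
      plc_cmult[OF plc_power[OF l1, of 3]] plc_cmult[OF plc_power[OF l2, of 3]]
    by (simp_all add: numeral_eq_Suc)
  let ?c = "\<lambda>k. complex_of_real (p i k)"
  have e: "dparam p w h $ i = (?c 1 * h$1 + 4 * ?c 0 * h$2) * (w$2)^3 + (2 * ?c 2 * h$1 + 3 * ?c 1 * h$2) * (w$1 * (w$2)^2)
    + (3 * ?c 3 * h$1 + 2 * ?c 2 * h$2) * ((w$1)^2 * w$2) + (4 * ?c 4 * h$1 + ?c 3 * h$2) * (w$1)^3" for w
    unfolding dparam_def by (simp add: algebra_simps)
  show ?thesis unfolding e by (intro plc_add m)
qed

lemma plc_differentiable: "plc n l f \<Longrightarrow> \<exists>d. (f has_field_derivative d) (at s)"
  unfolding plc_def using poly_DERIV by blast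

locale nodal_quartic = rat_quartic +
  assumes nodal: "\<forall>x\<in>singular_points 4 c. node 4 p x"
begin

lemma param_map_abs: "w \<noteq> 0 \<Longrightarrow> param_map 4 p (abs_cproj w) = abs_cproj (P w)"
  unfolding param_map_def
  by (subst abs_cproj_eq_iff) (auto simp: P_nonzero intro!: P_equiv rep_abs_cproj)

lemma singular_abs:
  assumes "z \<noteq> 0" "\<And>v. M z z z v = 0"
  shows "abs_cproj z \<in> singular_points 4 c"
proof -
  obtain k where k: "rep_cproj (abs_cproj z) = k *s z"
    using hom_equiv_sym[OF rep_abs_cproj[OF assms(1)]] by (rule equiv_scaleE)
  show ?thesis unfolding singular_points_4 k by (simp add: polar_scale assms(2))
qed

text \<open>By Euler's identity \<open>dP u u\<close> is a multiple of the image point, so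
  transversality leaves one further tangent vector on each branch, and together with
  \<open>z\<close> these two span the space.\<close>

lemma node_frame:
  assumes z: "z \<noteq> 0" and sing: "\<And>v. M z z z v = 0"
  obtains u u1 v v1 where "is_basis2 u u1" "is_basis2 v v1" "hom_equiv (P u) z" "hom_equiv (P v) z"
    "\<forall>w. hom_equiv (P w) z \<longrightarrow> hom_equiv w u \<or> hom_equiv w v"
    "det3 z (dP u u1) (dP v v1) \<noteq> 0"
proof -
  have "node 4 p (abs_cproj z)" using nodal singular_abs[OF assms] by blast
  then obtain U V where UV: "param_map 4 p -` {abs_cproj z} = {U, V}" and tr: "transversal_branches 4 p U V"
    unfolding node_def by blast
  let ?u = "rep_cproj U" and ?v = "rep_cproj V"
  obtain u1 v1 where b: "is_basis2 ?u u1" "is_basis2 ?v v1" using ex_basis2 rep_cproj_nonzero by metis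
  have uv: "hom_equiv (P (rep_cproj x)) z" if "x = U \<or> x = V" for x
  proof -
    have "abs_cproj (P (rep_cproj x)) = abs_cproj z" using UV that unfolding param_map_def by blast
    then show ?thesis using abs_cproj_eq_iff[OF P_nonzero[OF rep_cproj_nonzero] z] by blast
  qed
  have fib0: "hom_equiv w ?u \<or> hom_equiv w ?v" if w: "hom_equiv (P w) z" for w
  proof -
    have w0: "w \<noteq> 0" using hom_equiv_nonzero[OF w] by auto
    have "param_map 4 p (abs_cproj w) = abs_cproj z"
      unfolding param_map_abs[OF w0] using w abs_cproj_eq_iff[OF P_nonzero[OF w0] z] by blast
    then have "abs_cproj w = U \<or> abs_cproj w = V" using UV by blast
    then show ?thesis using rep_abs_cproj[OF w0] hom_equiv_sym by blast
  qed
  have span: "\<exists>a b k. t = a *s z + b *s dP ?u u1 + k *s dP ?v v1" for t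
  proof -
    have "t \<in> {dP ?u h + dP ?v k |h k. True}" using tr unfolding transversal_branches_def by simp
    then obtain h k where t: "t = dP ?u h + dP ?v k" by blast
    obtain a1 a2 where h: "h = a1 *s ?u + a2 *s u1" using b(1) unfolding is_basis2_def by blast
    obtain b1 b2 where k: "k = b1 *s ?v + b2 *s v1" using b(2) unfolding is_basis2_def by blast
    obtain m1 where m1: "P ?u = m1 *s z" using uv[of U] hom_equiv_sym equiv_scaleE by metis
    obtain m2 where m2: "P ?v = m2 *s z" using uv[of V] hom_equiv_sym equiv_scaleE by metis
    have "t = (a1 * 4 * m1 + b1 * 4 * m2) *s z + a2 *s dP ?u u1 + b2 *s dP ?v v1"
      unfolding t h k dparam_add dparam_scale dparam_euler m1 m2 by (simp add: vec_eq_iff algebra_simps)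
    then show ?thesis by blast
  qed
  have "det3 z (dP ?u u1) (dP ?v v1) \<noteq> 0"
  proof
    let ?a = "dP ?u u1" and ?b = "dP ?v v1"
    assume d: "det3 z ?a ?b = 0"
    then have d': "det3 z ?b ?a = 0" "det3 ?a z ?b = 0" "det3 ?b z ?a = 0" "det3 ?a ?b z = 0" "det3 ?b ?a z = 0"
      unfolding det3_def by (simp_all add: algebra_simps)
    obtain a1 b1 k1 where 1: "axis 1 1 = a1 *s z + b1 *s ?a + k1 *s ?b" using span by blast
    obtain a2 b2 k2 where 2: "axis 2 1 = a2 *s z + b2 *s ?a + k2 *s ?b" using span by blast
    obtain a3 b3 k3 where 3: "axis 3 1 = a3 *s z + b3 *s ?a + k3 *s ?b" using span by blast
    have "det3 (axis 1 1) (axis 2 1) (axis 3 1) = 0"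
      unfolding 1 2 3 by (simp add: det3_add det3_scale d d')
    then show False by (simp add: det3_def axis_def)
  qed
  note det = this
  have fibA: "\<forall>w. hom_equiv (P w) z \<longrightarrow> hom_equiv w ?u \<or> hom_equiv w ?v" using fib0 by blast
  have uvU: "hom_equiv (P ?u) z" and uvV: "hom_equiv (P ?v) z" by (rule uv, simp)+
  show ?thesis by (rule that[OF b(1,2) uvU uvV fibA det])
qed

text \<open>Differentiating \<open>M_dP\<close> along the branch gives three times the Hessian value
  plus a term that is zero because the point is singular.\<close>

lemma branch_isotropic:
  assumes "hom_equiv (P u) z" "\<And>v. M z z z v = 0"
  shows "M z z (dP u h) (dP u h) = 0"
proof -
  obtain k where k: "z = k *s P u" "k \<noteq> 0" using assms(1) by (auto elim: equiv_scaleE)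
  have s: "M (P u) (P u) (P u) v = 0" for v using assms(2)[of v] k by (simp add: polar_scale)
  have "\<exists>d. ((\<lambda>s. dP (s *s h + u) h $ i) has_field_derivative d) (at 0)" for i
    by (rule plc_differentiable[OF plc_dparam])
  then obtain D where D: "\<And>i. ((\<lambda>s. dP (s *s h + u) h $ i) has_field_derivative D i) (at 0)" by metis
  have D': "((\<lambda>s. dP (s *s h + u) h) has_derivative (\<lambda>t. t *s (\<chi> i. D i))) (at 0)"
    by (rule has_derivative_vec) (use D in \<open>simp add: has_field_derivative_def mult_commute_abs\<close>)
  note L = P_line_has_derivative[of h u 0]
  from polar_has_derivative[OF L L L D', of "\<lambda>i j. of_real (c i j)"]
  have "((\<lambda>s. 0) has_derivative (\<lambda>t. t * (3 * M (P u) (P u) (dP u h) (dP u h)))) (at 0)"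
    using s polar_swap(2)[of "\<lambda>i j. of_real (c i j)" "P u" "dP u h" "P u" "dP u h"] 
      polar_swap(1)[of "\<lambda>i j. of_real (c i j)" "dP u h" "P u" "P u" "dP u h"]
    by (simp add: polar_scale algebra_simps)
  from has_derivative_unique[OF this has_derivative_const]
  have "1 * (3 * M (P u) (P u) (dP u h) (dP u h)) = 0" by (rule fun_cong)
  then show ?thesis by (simp add: k polar_scale)
qed

lemma M_sw: "M a b x y = M b a x y" "M a b x y = M a b y x" "M a b x y = M a x b y"
  by (rule polar_swap)+

lemma generic_fibre:
  "\<exists>w0 w1 S. is_basis2 w0 w1 \<and> finite S \<and>
    (\<forall>s. s \<notin> S \<longrightarrow> (\<forall>w'. hom_equiv (P w') (P (s *s w0 + w1)) \<longrightarrow> hom_equiv w' (s *s w0 + w1))) \<and>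
    (\<forall>s. s \<notin> S \<longrightarrow> (\<exists>h. \<forall>a. dP (s *s w0 + w1) h \<noteq> a *s P (s *s w0 + w1)))"
proof (rule generic_injective_immersion)
  fix w0 w1 S assume "is_basis2 w0 w1" "finite S"
    and "\<And>s. s \<notin> S \<Longrightarrow> \<forall>w'. hom_equiv (P w') (P (s *s w0 + w1)) \<longrightarrow> hom_equiv w' (s *s w0 + w1)"
    and "\<And>s. s \<notin> S \<Longrightarrow> \<exists>h. \<forall>a. dP (s *s w0 + w1) h \<noteq> a *s P (s *s w0 + w1)"
  then show ?thesis by - (rule exI[of _ w0], rule exI[of _ w1], rule exI[of _ S], simp)
qed

text \<open>If the Hessian vanished at \<open>z\<close>, a line from \<open>z\<close> to another
  point \<open>y\<close> of the curve would meet the curve in these two points only. For general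
  \<open>y\<close> this leaves three parameters: two over \<open>z\<close> and one over
  \<open>y\<close>. But such a line avoids both tangents at \<open>z\<close> and the tangent at
  \<open>y\<close>, so its pullback has four simple roots.\<close>

lemma no_triple_point:
  assumes z: "z \<noteq> 0" and tr: "\<And>a b. M z z a b = 0"
  shows False
proof -
  obtain u u1 v v1 where b: "is_basis2 u u1" "is_basis2 v v1" and uv: "hom_equiv (P u) z" "hom_equiv (P v) z"
    and fib: "\<forall>w. hom_equiv (P w) z \<longrightarrow> hom_equiv w u \<or> hom_equiv w v"
    and det: "det3 z (dP u u1) (dP v v1) \<noteq> 0"
    by (rule node_frame[OF z tr])
  have det': "det3 z (dP v v1) (dP u u1) \<noteq> 0" using det det3_swap(1)[of z "dP v v1" "dP u u1"] by simp
  obtain w0 w1 S where basis: "is_basis2 w0 w1" and S: "finite S"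
    and inj: "\<forall>s. s \<notin> S \<longrightarrow> (\<forall>w'. hom_equiv (P w') (P (s *s w0 + w1)) \<longrightarrow> hom_equiv w' (s *s w0 + w1))"
    and imm: "\<forall>s. s \<notin> S \<longrightarrow> (\<exists>h. \<forall>a. dP (s *s w0 + w1) h \<noteq> a *s P (s *s w0 + w1))"
    using generic_fibre by (elim exE conjE) (rule that)
  have "finite (S \<union> {s. det3 z (dP u u1) (P (s *s w0 + w1)) = 0} \<union> {s. det3 z (dP v v1) (P (s *s w0 + w1)) = 0})"
    using S plane_section_finite[OF det basis] plane_section_finite[OF det' basis] by blast
  from ex_new_if_finite[OF infinite_UNIV_char_0 this]
  obtain s where s: "s \<notin> S \<union> {s. det3 z (dP u u1) (P (s *s w0 + w1)) = 0} \<union> {s. det3 z (dP v v1) (P (s *s w0 + w1)) = 0}"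
    by (rule exE)
  define w where "w = s *s w0 + w1"
  define y where "y = P w"
  have winj: "hom_equiv w' w" if "hom_equiv (P w') y" for w' using inj[rule_format, of s] s that unfolding w_def y_def by blast
  obtain h0 where h0: "\<And>a. dP w h0 \<noteq> a *s y" using imm[rule_format, of s] s unfolding w_def y_def by blast
  have du: "det3 z y (dP u u1) \<noteq> 0" and dv: "det3 z y (dP v v1) \<noteq> 0"
    using s det3_swap(1)[of z y] unfolding w_def y_def by simp_all
  \<comment> \<open>Only the term with \<open>z\<close> in one slot survives: those with
    \<open>z\<close> in two or more slots vanish by assumption, the one without \<open>z\<close>
    because \<open>y\<close> lies on the curve.\<close>
  have exp: "M (a *s z + b *s y) (a *s z + b *s y) (a *s z + b *s y) (a *s z + b *s y) = 4 * a * b^3 * M z y y y" for a b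
  proof -
    have "M y y y y = 0" unfolding y_def by simp
    moreover have "M z y z y = 0" "M y z z y = 0" "M z y y z = 0" "M y z y z = 0" "M y y z z = 0"
       "M z y z z = 0" "M y z z z = 0"
      using tr M_sw by metis+
    moreover have "M y z y y = M z y y y" "M y y z y = M z y y y" "M y y y z = M z y y y"
      by (metis M_sw)+
    ultimately show ?thesis using tr by (simp add: polar_add polar_scale power3_eq_cube algebra_simps)
  qed
  have zy: "M z y y y \<noteq> 0"
  proof
    assume "M z y y y = 0"
    then have "M (a *s z + b *s y) (a *s z + b *s y) (a *s z + b *s y) (a *s z + b *s y) = 0" for a b
      using exp by simp
    then show False using not_contains_line[OF du] by blast
  qed
  have roots: "(hom_equiv w' u \<or> hom_equiv w' v \<or> hom_equiv w' w) \<and> (\<exists>h. det3 z y (dP w' h) \<noteq> 0)"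
    if w': "w' \<noteq> 0" "det3 z y (P w') = 0" for w'
  proof -
    obtain a b where ab: "P w' = a *s z + b *s y" by (rule det3_planeE[OF du w'(2)])
    have Pn: "P w' \<noteq> 0" using P_nonzero w'(1) by blast
    have "M (P w') (P w') (P w') (P w') = 0" by simp
    then have "a * b^3 = 0" unfolding ab exp using zy by simp
    then consider "b = 0" | "a = 0" by auto
    then show ?thesis
    proof cases
      case 1
      then have "P w' = a *s z" "a \<noteq> 0" using ab Pn by auto
      then have "hom_equiv (P w') z" using hom_equiv_scale[OF z, of a] hom_equiv_sym by metis
      then have *: "hom_equiv w' u \<or> hom_equiv w' v" by (rule fib[rule_format])
      moreover have "\<exists>h. det3 z y (dP w' h) \<noteq> 0"
      proof -
        have "det3 z y (dP w' h) \<noteq> 0" if e: "hom_equiv w' x" and d: "det3 z y (dP x h) \<noteq> 0" for x h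
        proof -
          obtain k where "x = k *s w'" using e by (rule equiv_scaleE)
          then show ?thesis using d by (auto simp: dparam_scale1 det3_scale)
        qed
        then show ?thesis using * du dv by blast
      qed
      ultimately show ?thesis by blast
    next
      case 2
      then have "P w' = b *s y" "b \<noteq> 0" using ab Pn by auto
      moreover have "y \<noteq> 0" using du by auto
      ultimately have "hom_equiv (P w') y" using hom_equiv_scale[of y b] hom_equiv_sym by metis
      then have *: "hom_equiv w' w" by (rule winj)
      \<comment> \<open>The gradient at \<open>y\<close> kills the tangent vector and
        \<open>y\<close> but not \<open>z\<close>, so a tangent vector in the plane of
        \<open>z\<close> and \<open>y\<close> would be a multiple of \<open>y\<close>.\<close>
      have "det3 z y (dP w h0) \<noteq> 0"
      proof
        assume "det3 z y (dP w h0) = 0"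
        then obtain a b where ab: "dP w h0 = a *s z + b *s y" using det3_planeE[OF du] by metis
        have "M y y y (dP w h0) = 0" unfolding y_def by simp
        then have "a * M y y y z = 0" unfolding ab y_def by (simp add: polar_add polar_scale)
        moreover have "M y y y z = M z y y y" by (metis M_sw)
        ultimately have "a = 0" using zy by simp
        then show False using ab h0 by simp
      qed
      moreover obtain k where "w = k *s w'" using * by (rule equiv_scaleE)
      ultimately have "det3 z y (dP w' h0) \<noteq> 0" by (auto simp: dparam_scale1 det3_scale)
      then show ?thesis using * by blast
    qed
  qed
  obtain x where x: "det3 z y (P x) \<noteq> 0" using not_in_plane[OF du] .
  have "x \<noteq> 0" using x by auto
  then obtain x1 where x1: "is_basis2 x x1" using ex_basis2 by blast
  let ?f = "\<lambda>s. det3 z y (P (s *s x + x1))"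
  have "card {s. ?f s = 0} = 4"
  proof (rule plc_card_simple[OF plc_det3_P x])
    fix s assume fs: "?f s = 0"
    let ?w = "s *s x + x1"
    have w: "?w \<noteq> 0" using basis2_nonzero(1)[OF x1] .
    obtain h where h: "det3 z y (dP ?w h) \<noteq> 0" using roots[OF w fs] by blast
    have "det3 z y (dP ?w x) \<noteq> 0"
    proof
      assume 0: "det3 z y (dP ?w x) = 0"
      obtain a b where "h = a *s x + b *s x1" using x1 unfolding is_basis2_def by blast
      then have "h = (a - b * s) *s x + b *s ?w" by (simp add: vec_eq_iff algebra_simps)
      then have "det3 z y (dP ?w h) = 0"
        by (simp only: dparam_add dparam_scale dparam_euler det3_add det3_scale 0 fs mult_zero_right add_0)
      then show False using h by simp
    qed
    moreover have "(det3 z y has_derivative det3 z y) (at a)" for a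
      unfolding det3_def by (auto intro!: derivative_eq_intros)
    from has_derivative_compose[OF P_line_has_derivative this]
    have "(?f has_derivative (\<lambda>t. det3 z y (t *s dP ?w x))) (at s)" .
    then have "(?f has_field_derivative det3 z y (dP ?w x)) (at s)"
      by (intro has_field_derivativeI) (simp add: det3_scale)
    ultimately show "\<not> (?f has_field_derivative 0) (at s)" using DERIV_unique by blast
  qed
  moreover have "card {s. ?f s = 0} \<le> 3"
  proof -
    have "{s. ?f s = 0} \<subseteq> {s. hom_equiv (s *s x + x1) u} \<union> {s. hom_equiv (s *s x + x1) v} \<union> {s. hom_equiv (s *s x + x1) w}"
      using roots[OF basis2_nonzero(1)[OF x1]] by blast
    moreover have one: "finite {s. hom_equiv (s *s x + x1) a} \<and> card {s. hom_equiv (s *s x + x1) a} \<le> 1" for a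
    proof -
      have "s = t" if "hom_equiv (s *s x + x1) a" "hom_equiv (t *s x + x1) a" for s t
        using basis2_inj[OF x1 hom_equiv_trans[OF that(1) hom_equiv_sym[OF that(2)]]] .
      then show ?thesis by (metis (mono_tags, lifting) mem_Collect_eq card_le_Suc0_iff_eq One_nat_def finite_subset finite.emptyI finite.insertI subsetI insertI1)
    qed
    ultimately have "card {s. ?f s = 0} \<le> card ({s. hom_equiv (s *s x + x1) u} \<union> {s. hom_equiv (s *s x + x1) v} \<union> {s. hom_equiv (s *s x + x1) w})"
      by (intro card_mono) auto
    also have "\<dots> \<le> 1 + 1 + 1" 
      by (intro order_trans[OF card_Un_le] add_mono) (use one in blast)+
    finally show ?thesis by simp
  qed
  ultimately show False by simp
qed

text \<open>In the basis of \<open>z\<close> and the two tangent vectors the Hessian has a single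
  entry and its mirror image: \<open>z\<close> is in the kernel, the tangents are isotropic, and
  their mutual value is nonzero because there is no triple point.\<close>

lemma hessian_kernel:
  assumes z: "z \<noteq> 0" and sing: "\<And>v. M z z z v = 0" and ker: "\<And>v. M z z a v = 0"
  obtains k where "a = k *s z"
proof -
  obtain u u1 v v1 where b: "is_basis2 u u1" "is_basis2 v v1" and uv: "hom_equiv (P u) z" "hom_equiv (P v) z"
    and fib: "\<forall>w. hom_equiv (P w) z \<longrightarrow> hom_equiv w u \<or> hom_equiv w v"
    and det: "det3 z (dP u u1) (dP v v1) \<noteq> 0"
    by (rule node_frame[OF z sing])
  let ?d = "dP u u1" and ?e = "dP v v1"
  have dd: "M z z ?d ?d = 0" "M z z ?e ?e = 0" using branch_isotropic uv sing by blast+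
  have zz: "M z z v z = 0" for v using sing M_sw by metis
  have "M z z ?d ?e \<noteq> 0"
  proof
    assume 0: "M z z ?d ?e = 0"
    have "M z z x y = 0" for x y
    proof -
      obtain a1 b1 k1 where 1: "x = a1 *s z + b1 *s ?d + k1 *s ?e" by (rule det3_cramerE[OF det])
      obtain a2 b2 k2 where 2: "y = a2 *s z + b2 *s ?d + k2 *s ?e" by (rule det3_cramerE[OF det])
      have "M z z ?e ?d = 0" using 0 M_sw by metis
      then show ?thesis unfolding 1 2 by (simp add: polar_add polar_scale dd 0 sing zz)
    qed
    then show False using no_triple_point[OF z] by blast
  qed
  moreover obtain a1 b1 k1 where 1: "a = a1 *s z + b1 *s ?d + k1 *s ?e" by (rule det3_cramerE[OF det])
  moreover have "b1 * M z z ?d ?e = 0" using ker[of ?e] unfolding 1 by (simp add: polar_add polar_scale dd sing)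
  moreover have "k1 * M z z ?e ?d = 0" using ker[of ?d] unfolding 1 by (simp add: polar_add polar_scale dd sing)
  moreover have "M z z ?e ?d = M z z ?d ?e" by (rule M_sw)
  ultimately have "a = a1 *s z" by simp
  then show ?thesis by (rule that)
qed


lemma ex_poly3:
  assumes "\<And>i::3. plc n (l i) (f i)"
  shows "\<exists>q. (\<forall>i. degree (q i) \<le> n) \<and> (\<forall>i. coeff (q i) n = l i) \<and> (\<forall>i s. f i s = poly (q i) s)"
proof -
  have "\<forall>i. \<exists>q. degree q \<le> n \<and> coeff q n = l i \<and> f i = poly q" using assms unfolding plc_def by blast
  then obtain q where "\<forall>i. degree (q i) \<le> n \<and> coeff (q i) n = l i \<and> f i = poly (q i)" by (rule choice[THEN exE])
  then show ?thesis by (intro exI[of _ q]) simp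
qed

lemma M_axis: "M x y z v = (\<Sum>i\<in>UNIV. v $ i * M x y z (axis i 1))"
  by (subst vec3_axis[of v]) (simp add: sum_3 polar_add polar_scale)

text \<open>Both branches at a node are immersed, since a tangent vector along \<open>z\<close>
  would annul the determinant of \<open>node_frame\<close>.\<close>

lemma dP_not_degenerate:
  assumes z: "z \<noteq> 0" "\<And>v. M z z z v = 0" and w: "hom_equiv (P w) z" and h: "is_basis2 h w"
  shows "\<not> (\<exists>k. dP w h = k *s P w)"
proof
  assume "\<exists>k. dP w h = k *s P w"
  then obtain k where k: "dP w h = k *s P w" by blast
  obtain u u1 v v1 where b: "is_basis2 u u1" "is_basis2 v v1" and uv: "hom_equiv (P u) z" "hom_equiv (P v) z"
    and fib: "\<forall>w. hom_equiv (P w) z \<longrightarrow> hom_equiv w u \<or> hom_equiv w v"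
    and det: "det3 z (dP u u1) (dP v v1) \<noteq> 0"
    by (rule node_frame[OF z])
  obtain m where m: "P w = m *s z" using hom_equiv_sym[OF w] by (rule equiv_scaleE)
  have par: "\<exists>r. dP x t = r *s z" if x: "hom_equiv w x" for x t
  proof -
    obtain n where n: "x = n *s w" using x by (rule equiv_scaleE)
    obtain a b where t: "t = a *s h + b *s w" using h unfolding is_basis2_def by blast
    have "dP x t = (n^3 * (a * k + b * 4) * m) *s z"
      unfolding n t dparam_scale1 dparam_add dparam_scale k dparam_euler m
      by (simp add: vec_eq_iff algebra_simps)
    then show ?thesis by blast
  qed
  from fib[rule_format, OF w] show False
  proof
    assume "hom_equiv w u"
    then obtain r where "dP u u1 = r *s z" using par by blast
    then show False using det by (simp add: det3_scale)
  next
    assume "hom_equiv w v"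
    then obtain r where "dP v v1 = r *s z" using par by blast
    then show False using det by (simp add: det3_scale)
  qed
qed

text \<open>The gradient of the quartic along the parametrization has degree 12 and is a multiple of the
  tangent line, which has degree 6. The factor of proportionality \<open>g\<close> has degree 6, its roots are
  the preimages of singular points, and they are simple because the Hessian is nondegenerate at a
  node. As at most two roots share a node, there are at least three nodes.\<close>

lemma three_singular:
  obtains z1 z2 z3 where "z1 \<noteq> 0" "z2 \<noteq> 0" "z3 \<noteq> 0" "\<And>v. M z1 z1 z1 v = 0" "\<And>v. M z2 z2 z2 v = 0" "\<And>v. M z3 z3 z3 v = 0"
    "\<not> hom_equiv z1 z2" "\<not> hom_equiv z1 z3" "\<not> hom_equiv z2 z3"
proof -
  obtain z v where z: "z \<noteq> 0" "M z z z z = 0" "M z z z v \<noteq> 0" by (rule ex_nonsingular)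
  obtain a where a: "a \<noteq> 0" "hom_equiv (P a) z" by (rule M_zeroD[OF z(1,2)])
  obtain k where k: "z = k *s P a" using a(2) by (rule equiv_scaleE)
  have "M (P a) (P a) (P a) v \<noteq> 0" using z(3) unfolding k by (auto simp: polar_scale)
  have "\<exists>i0. M (P a) (P a) (P a) (axis i0 1) \<noteq> 0"
  proof (rule ccontr)
    assume "\<not> ?thesis"
    then have "M (P a) (P a) (P a) v = 0" by (subst M_axis) simp
    then show False using \<open>M (P a) (P a) (P a) v \<noteq> 0\<close> by blast
  qed
  then obtain i0 where i0: "M (P a) (P a) (P a) (axis i0 1) \<noteq> 0" by blast
  obtain b where ab: "is_basis2 a b" using ex_basis2[OF a(1)] by blast
  define W where "W s = s *s a + b" for s
  define X where "X s = P (W s)" for s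
  define A where "A s = dP (W s) a" for s
  define B where "B s = dP (W s) b" for s
  \<comment> \<open>The cross product of the two partial derivatives: the tangent line, with
    components of degree 3 + 3.\<close>
  define N where "N s = (\<chi> i::3. if i = 1 then A s $ 2 * B s $ 3 - A s $ 3 * B s $ 2
     else if i = 2 then A s $ 3 * B s $ 1 - A s $ 1 * B s $ 3 else A s $ 1 * B s $ 2 - A s $ 2 * B s $ 1)" for s
  have W0: "W s \<noteq> 0" for s unfolding W_def by (rule basis2_nonzero(1)[OF ab])
  have "plc (4+4+4+0) (M (P a) (P a) (P a) (axis i 1)) (\<lambda>s. M (X s) (X s) (X s) (axis i 1))" for i
    unfolding X_def W_def by (intro plc_polar plc_hom_param plc_vec_const)
  then have "plc 12 (M (P a) (P a) (P a) (axis i 1)) (\<lambda>s. M (X s) (X s) (X s) (axis i 1))" for i by simp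
  then have "\<exists>q. (\<forall>i. degree (q i) \<le> 12) \<and> (\<forall>i. coeff (q i) 12 = M (P a) (P a) (P a) (axis i 1)) \<and>
      (\<forall>i s. M (X s) (X s) (X s) (axis i 1) = poly (q i) s)"
    by (rule ex_poly3)
  then obtain q where q': "\<forall>i. degree (q i) \<le> 12" "\<forall>i. coeff (q i) 12 = M (P a) (P a) (P a) (axis i 1)"
      "\<forall>i s. M (X s) (X s) (X s) (axis i 1) = poly (q i) s"
    by (elim exE conjE) (rule that)
  note q = q'[rule_format]
  have "\<exists>l. plc 6 l (\<lambda>s. N s $ i)" for i
  proof -
    have pA: "plc 3 (dP a a $ j) (\<lambda>s. A s $ j)" and pB: "plc 3 (dP a b $ j) (\<lambda>s. B s $ j)" for j
      unfolding A_def B_def W_def by (rule plc_dparam)+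
    have "\<exists>l. plc 6 l (\<lambda>s. A s $ j * B s $ k - A s $ k * B s $ j)" for j k
      using plc_add[OF plc_mult[OF pA pB] plc_cmult[OF plc_mult[OF pA pB], of "-1"], of j k k j] by auto
    then show ?thesis unfolding N_def using exhaust_3[of i] by auto
  qed
  then have "\<forall>i. \<exists>l. plc 6 l (\<lambda>s. N s $ i)" by blast
  then obtain l where l: "\<forall>i. plc 6 (l i) (\<lambda>s. N s $ i)" by (rule choice[THEN exE])
  have "\<exists>n. (\<forall>i. degree (n i) \<le> 6) \<and> (\<forall>i. coeff (n i) 6 = l i) \<and> (\<forall>i s. N s $ i = poly (n i) s)"
    by (rule ex_poly3) (rule l[rule_format])
  then obtain n where n': "\<forall>i. degree (n i) \<le> 6" "\<forall>i s. N s $ i = poly (n i) s"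
    by (elim exE conjE) (rule that)
  note n = n'[rule_format]
  have orth: "(\<Sum>i\<in>UNIV. dP (W s) h $ i * poly (q i) s) = 0" for s h
  proof -
    have "M (X s) (X s) (X s) (dP (W s) h) = 0" unfolding X_def by (rule M_dP)
    then show ?thesis by (subst (asm) M_axis) (simp add: q(3))
  qed
  \<comment> \<open>The gradient and \<open>N\<close> are both orthogonal to the two partial
    derivatives, hence proportional.\<close>
  have qn: "q i * n j = q j * n i" for i j
  proof -
    have "poly (q i) s * N s $ j = poly (q j) s * N s $ i" for s
    proof -
      have e1: "A s $ 1 * poly (q 1) s + A s $ 2 * poly (q 2) s + A s $ 3 * poly (q 3) s = 0"
        using orth[of s a] unfolding A_def sum_3 .
      have e2: "B s $ 1 * poly (q 1) s + B s $ 2 * poly (q 2) s + B s $ 3 * poly (q 3) s = 0"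
        using orth[of s b] unfolding B_def sum_3 .
      have "poly (q 1) s * N s $ 2 = poly (q 2) s * N s $ 1" "poly (q 1) s * N s $ 3 = poly (q 3) s * N s $ 1"
        "poly (q 2) s * N s $ 3 = poly (q 3) s * N s $ 2"
        using e1 e2 unfolding N_def by (simp; algebra)+
      then show ?thesis using exhaust_3[of i] exhaust_3[of j] by auto
    qed
    then have "poly (q i * n j) s = poly (q j * n i) s" for s by (simp add: n(2))
    then show ?thesis by (simp add: poly_eq_poly_eq_iff[symmetric] fun_eq_iff)
  qed
  \<comment> \<open>At a parameter where the partial derivatives are dependent the parametrization
    is not immersed, so a generic parameter will do.\<close>
  have "\<exists>s. N s \<noteq> 0"
  proof -
    obtain w0 w1 S where basis: "is_basis2 w0 w1" and S: "finite S"
      and inj: "\<forall>s. s \<notin> S \<longrightarrow> (\<forall>w'. hom_equiv (P w') (P (s *s w0 + w1)) \<longrightarrow> hom_equiv w' (s *s w0 + w1))"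
      and imm: "\<forall>s. s \<notin> S \<longrightarrow> (\<exists>h. \<forall>a. dP (s *s w0 + w1) h \<noteq> a *s P (s *s w0 + w1))"
      using generic_fibre by (elim exE conjE) (rule that)
    obtain s1 where s1: "s1 \<notin> S" using ex_new_if_finite[OF infinite_UNIV_char_0 S] by blast
    obtain s2 where s2: "s2 \<notin> insert s1 S" using ex_new_if_finite[OF infinite_UNIV_char_0] S by blast
    \<comment> \<open>Of two generic parameters at least one lies in the chart, which omits only
      \<open>a\<close>.\<close>
    have "\<not> hom_equiv a (s1 *s w0 + w1) \<or> \<not> hom_equiv a (s2 *s w0 + w1)"
      using basis2_inj[OF basis, of s1 s2] s2 hom_equiv_sym hom_equiv_trans by blast
    then obtain s where s: "s \<notin> S" "\<not> hom_equiv a (s *s w0 + w1)" using s1 s2 by blast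
    let ?w = "s *s w0 + w1"
    obtain h where h: "\<And>a. dP ?w h \<noteq> a *s P ?w" using imm[rule_format, OF s(1)] by blast
    obtain t where "hom_equiv (W t) ?w" using basis2_cover[OF ab basis2_nonzero(1)[OF basis, of s]] s(2) unfolding W_def by blast
    then obtain k where k: "k \<noteq> 0" "?w = k *s W t" by (rule equiv_scaleE)
    have "N t \<noteq> 0"
    proof
      assume "N t = 0"
      then have "det3 (A t) (B t) v = 0" for v
        unfolding N_def det3_def vec_eq_iff forall_3 by simp algebra
      then have "A t = 0 \<or> (\<exists>r. B t = r *s A t)" by (metis det3_parallel)
      then obtain D where D: "\<And>h. \<exists>r. dP (W t) h = r *s D"
      proof
        assume A0: "A t = 0"
        show thesis
        proof (rule that)
          fix h
          obtain x y where "h = x *s a + y *s b" using ab unfolding is_basis2_def by blast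
          then have "dP (W t) h = y *s B t" using A0 unfolding A_def B_def by (simp add: dparam_add dparam_scale)
          then show "\<exists>r. dP (W t) h = r *s B t" by blast
        qed
      next
        assume "\<exists>r. B t = r *s A t"
        then obtain r where r: "B t = r *s A t" by blast
        show thesis
        proof (rule that)
          fix h
          obtain x y where "h = x *s a + y *s b" using ab unfolding is_basis2_def by blast
          then have "dP (W t) h = x *s A t + y *s B t" unfolding A_def B_def by (simp add: dparam_add dparam_scale)
          then have "dP (W t) h = (x + y * r) *s A t" unfolding r by (simp add: vec_eq_iff algebra_simps)
          then show "\<exists>r. dP (W t) h = r *s A t" by blast
        qed
      qed
      obtain r1 where r1: "dP (W t) (W t) = r1 *s D" using D by blast
      obtain r2 where r2: "dP (W t) h = r2 *s D" using D by blast
      have 4: "4 *s P (W t) = r1 *s D" using r1 dparam_euler by metis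
      have "r1 \<noteq> 0"
      proof
        assume "r1 = 0"
        then have "P (W t) = 0" using 4 by (simp add: vec_eq_iff)
        then show False using P_nonzero W0 by blast
      qed
      have "D = (4 / r1) *s P (W t)"
      proof -
        have "r1 *s D = r1 *s ((4 / r1) *s P (W t))" using 4 \<open>r1 \<noteq> 0\<close> by (simp add: vector_smult_assoc)
        then show ?thesis using \<open>r1 \<noteq> 0\<close> by (simp add: vec_eq_iff field_simps)
      qed
      moreover have "dP ?w h = k^3 *s dP (W t) h" unfolding k(2) by (rule dparam_scale1)
      moreover have "P ?w = k^4 *s P (W t)" unfolding k(2) by (rule hom_param_4_scale)
      ultimately have "dP ?w h = (r2 * (4 / r1) / k) *s P ?w"
        using r2 k(1) by (simp add: vec_eq_iff power3_eq_cube power4_eq_xxxx)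
      then show False using h by blast
    qed
    then show ?thesis by blast
  qed
  then obtain s0 j0 where "poly (n j0) s0 \<noteq> 0" using n(2) by (auto simp: vec_eq_iff)
  then have nj0: "n j0 \<noteq> 0" by auto
  have "coeff (q i0) 12 \<noteq> 0" using i0 q(2) by simp
  then have qi0: "q i0 \<noteq> 0" "degree (q i0) = 12" using le_degree[of "q i0" 12] q(1)[of i0] by auto
  have ni0: "n i0 \<noteq> 0" using qn[of i0 j0] qi0 nj0 by auto
  define g where "g = gcd (q 1) (gcd (q 2) (q 3))"
  have gdvd: "g dvd q i" for i unfolding g_def using exhaust_3[of i] by (auto intro: dvd_trans[OF gcd_dvd2])
  \<comment> \<open>By proportionality \<open>q i0\<close> divides every \<open>q i * n i0\<close>,
    hence also \<open>g * n i0\<close>; comparing degrees, 12 is at most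
    \<open>degree g + 6\<close>.\<close>
  have "q i0 dvd gcd (q 1 * n i0) (gcd (q 2 * n i0) (q 3 * n i0))"
    using qn[of i0] by (intro gcd_greatest) (metis dvd_triv_left)+
  also have "gcd (q 1 * n i0) (gcd (q 2 * n i0) (q 3 * n i0)) dvd g * n i0"
    unfolding g_def by (simp add: gcd_mult_right gcd.commute gcd.left_commute)
  finally have "q i0 dvd g * n i0" .
  moreover have "g \<noteq> 0" using gdvd[of i0] qi0 by auto
  ultimately have "degree (q i0) \<le> degree g + degree (n i0)"
    using ni0 dvd_imp_degree_le by (metis degree_mult_eq mult_eq_0_iff)
  then have dg: "6 \<le> degree g" using qi0 n(1)[of i0] by simp
  have sing: "M (X s) (X s) (X s) v = 0" if "poly g s = 0" for s v
  proof -
    have "poly (q i) s = 0" for i using gdvd[of i] that by (auto elim!: dvdE)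
    then show ?thesis by (subst M_axis) (simp add: q(3))
  qed
  \<comment> \<open>At a double root of \<open>g\<close> the derivative of the gradient vanishes
    too, so the tangent vector lies in the kernel of the Hessian and is a multiple of the point,
    against the immersion at a node.\<close>
  have "rsquarefree g" unfolding rsquarefree_roots
  proof (intro allI notI)
    fix s assume *: "poly g s = 0 \<and> poly (pderiv g) s = 0"
    have q0: "poly (pderiv (q i)) s = 0" for i
    proof -
      obtain r where "q i = g * r" using gdvd by (rule dvdE)
      then show ?thesis using * by (simp add: pderiv_mult)
    qed
    have "M (X s) (X s) (A s) (axis i 1) = 0" for i
    proof -
      have L: "(X has_derivative (\<lambda>t. t *s A s)) (at s)" unfolding X_def A_def W_def by (rule P_line_has_derivative)
      have d: "((\<lambda>s. M (X s) (X s) (X s) (axis i 1)) has_derivative (\<lambda>t. t * (3 * M (X s) (X s) (A s) (axis i 1)))) (at s)"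
        using polar_has_derivative[OF L L L has_derivative_const, of "\<lambda>i j. of_real (c i j)" "axis i 1"]
          polar_swap(2)[of "\<lambda>i j. of_real (c i j)" "X s" "A s" "X s" "axis i 1"] 
          polar_swap(1)[of "\<lambda>i j. of_real (c i j)" "A s" "X s" "X s" "axis i 1"]
        by (simp add: polar_scale algebra_simps)
      have "(poly (q i) has_field_derivative 3 * M (X s) (X s) (A s) (axis i 1)) (at s)"
        using has_field_derivativeI[OF d] unfolding q(3) .
      from DERIV_unique[OF this poly_DERIV] show ?thesis using q0 by simp
    qed
    then have "M (X s) (X s) (A s) v = 0" for v by (subst M_axis) simp
    then obtain k where k: "A s = k *s X s"
      using hessian_kernel[of "X s" "A s"] sing * P_nonzero[OF W0] unfolding X_def by metis
    have "is_basis2 a (W s)"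
    proof -
      have "\<exists>x y. w = x *s a + y *s W s" for w
      proof -
        obtain x y where "w = x *s a + y *s b" using ab unfolding is_basis2_def by blast
        then have "w = (x - y * s) *s a + y *s W s" unfolding W_def by (simp add: vec_eq_iff algebra_simps)
        then show ?thesis by blast
      qed
      moreover have "x = 0 \<and> y = 0" if "x *s a + y *s W s = 0" for x y
      proof -
        have "(x + y * s) *s a + y *s b = 0" using that unfolding W_def by (simp add: vec_eq_iff algebra_simps)
        then have "x + y * s = 0 \<and> y = 0" using ab unfolding is_basis2_def by blast
        then show ?thesis by auto
      qed
      ultimately show ?thesis unfolding is_basis2_def by blast
    qed
    from dP_not_degenerate[OF P_nonzero[OF W0] _ _ this, of s] show False
      using k sing * P_nonzero[OF W0] unfolding X_def A_def by auto
  qed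
  then have "degree g = degree (smult (lead_coeff g) (\<Prod>z|poly g z = 0. [:- z, 1:]))"
    by (simp add: complex_poly_decompose_rsquarefree)
  also have "\<dots> = card {s. poly g s = 0}"
    using \<open>g \<noteq> 0\<close> by (subst degree_smult_eq) (auto simp: degree_prod_sum_eq)
  finally have cg: "6 \<le> card {s. poly g s = 0}" using dg by simp
  have X0: "X s \<noteq> 0" for s unfolding X_def by (rule P_nonzero[OF W0])
  have cls: "finite {t. hom_equiv (X t) (X s)} \<and> card {t. hom_equiv (X t) (X s)} \<le> 2" if s: "poly g s = 0" for s
  proof -
    obtain u u1 v v1 where "is_basis2 u u1" "is_basis2 v v1" "hom_equiv (P u) (X s)" "hom_equiv (P v) (X s)"
      and fib: "\<forall>w. hom_equiv (P w) (X s) \<longrightarrow> hom_equiv w u \<or> hom_equiv w v"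
      and "det3 (X s) (dP u u1) (dP v v1) \<noteq> 0"
      by (rule node_frame[OF X0 sing[OF s]])
    have "{t. hom_equiv (X t) (X s)} \<subseteq> {t. hom_equiv (W t) u} \<union> {t. hom_equiv (W t) v}"
      using fib unfolding X_def by blast
    moreover have one: "finite {t. hom_equiv (W t) x} \<and> card {t. hom_equiv (W t) x} \<le> 1" for x
    proof -
      have "s = t" if "hom_equiv (W s) x" "hom_equiv (W t) x" for s t
        using basis2_inj[OF ab hom_equiv_trans[OF that(1)[unfolded W_def] hom_equiv_sym[OF that(2)[unfolded W_def]]]] .
      then have "\<exists>t. {t. hom_equiv (W t) x} \<subseteq> {t}" by blast
      then obtain t where t: "{t. hom_equiv (W t) x} \<subseteq> {t}" by blast
      from card_mono[OF _ t] finite_subset[OF t] show ?thesis by simp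
    qed
    ultimately have "finite {t. hom_equiv (X t) (X s)}" "card {t. hom_equiv (X t) (X s)} \<le> card ({t. hom_equiv (W t) u} \<union> {t. hom_equiv (W t) v})"
      by (auto intro: finite_subset card_mono)
    moreover have "card ({t. hom_equiv (W t) u} \<union> {t. hom_equiv (W t) v}) \<le> 1 + 1"
      by (intro order_trans[OF card_Un_le] add_mono) (use one in blast)+
    ultimately show ?thesis by simp
  qed
  define R where "R = {s. poly g s = 0}"
  have cR: "6 \<le> card R" "finite R" unfolding R_def using cg \<open>g \<noteq> 0\<close> poly_roots_finite by auto
  obtain s1 where s1: "s1 \<in> R" using cR by fastforce
  have "\<not> R \<subseteq> {t. hom_equiv (X t) (X s1)}"
    using card_mono[of "{t. hom_equiv (X t) (X s1)}" R] cls[of s1] s1 cR unfolding R_def by fastforce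
  then obtain s2 where s2: "s2 \<in> R" "\<not> hom_equiv (X s2) (X s1)" by blast
  have "\<not> R \<subseteq> {t. hom_equiv (X t) (X s1)} \<union> {t. hom_equiv (X t) (X s2)}"
  proof
    assume "R \<subseteq> {t. hom_equiv (X t) (X s1)} \<union> {t. hom_equiv (X t) (X s2)}"
    then have "card R \<le> card ({t. hom_equiv (X t) (X s1)} \<union> {t. hom_equiv (X t) (X s2)})"
      using cls[of s1] cls[of s2] s1 s2 unfolding R_def by (intro card_mono) auto
    also have "\<dots> \<le> 2 + 2"
      by (intro order_trans[OF card_Un_le] add_mono) (use cls[of s1] cls[of s2] s1 s2 in \<open>auto simp: R_def\<close>)
    finally show False using cR by simp
  qed
  then obtain s3 where s3: "s3 \<in> R" "\<not> hom_equiv (X s3) (X s1)" "\<not> hom_equiv (X s3) (X s2)" by blast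
  show ?thesis
    by (rule that[of "X s1" "X s2" "X s3"])
      (use X0 sing s1 s2 s3 in \<open>auto simp: R_def dest: hom_equiv_sym\<close>)
qed

end

subsection \<open>The conic of a quartic with three real nodes\<close>

text \<open>The equation of the transform of the conic
  \<open>a*X\<^sup>2 + b*Y\<^sup>2 + c*Z\<^sup>2 + 2*f*Y*Z + 2*g*X*Z + 2*h*X*Y = 0\<close> under
  \<open>(x, y, z) \<mapsto> (y*z, x*z, x*y)\<close>.\<close>

definition crem :: "'a::comm_ring_1 \<Rightarrow> 'a \<Rightarrow> 'a \<Rightarrow> 'a \<Rightarrow> 'a \<Rightarrow> 'a \<Rightarrow> 'a \<Rightarrow> 'a \<Rightarrow> 'a \<Rightarrow> 'a" where
  "crem a b c f g h x y z = a * (y*z)^2 + b * (x*z)^2 + c * (x*y)^2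
     + 2 * f * (x*z) * (x*y) + 2 * g * (y*z) * (x*y) + 2 * h * (y*z) * (x*z)"

definition qdet :: "'a::comm_ring_1 \<Rightarrow> 'a \<Rightarrow> 'a \<Rightarrow> 'a \<Rightarrow> 'a \<Rightarrow> 'a \<Rightarrow> 'a" where
  "qdet a b c f g h = a*b*c + 2*f*g*h - a*f^2 - b*g^2 - c*h^2"

text \<open>The conic is smooth, meets no vertex of the coordinate triangle and touches none of its
  sides; the last clause excludes definite forms, whose conics have no real points.\<close>

definition good :: "real \<Rightarrow> real \<Rightarrow> real \<Rightarrow> real \<Rightarrow> real \<Rightarrow> real \<Rightarrow> bool" where
  "good a b c f g h \<longleftrightarrow> a \<noteq> 0 \<and> b \<noteq> 0 \<and> c \<noteq> 0 \<and> b*c - f^2 \<noteq> 0 \<and> a*c - g^2 \<noteq> 0 \<and> a*b - h^2 \<noteq> 0 \<and>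
     qdet a b c f g h \<noteq> 0 \<and> \<not> (0 < a * qdet a b c f g h \<and> 0 < a*b - h^2)"

text \<open>Collects the entries of a tensor, symmetric or not, by monomial. This supplies
  coefficient arrays for products of linear forms, as \<open>ternary_form\<close> demands
  them.\<close>

definition tensor_coeff :: "(3 \<Rightarrow> 3 \<Rightarrow> 3 \<Rightarrow> 3 \<Rightarrow> 'a::comm_monoid_add) \<Rightarrow> nat \<Rightarrow> nat \<Rightarrow> 'a" where
  "tensor_coeff T m n = (\<Sum>i\<in>UNIV. \<Sum>j\<in>UNIV. \<Sum>k\<in>UNIV. \<Sum>l\<in>UNIV.
     if of_bool (i = 1) + of_bool (j = 1) + of_bool (k = 1) + of_bool (l = 1) = m \<and>
        of_bool (i = 2) + of_bool (j = 2) + of_bool (k = 2) + of_bool (l = 2) = n then T i j k l else 0)"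

lemma ternary_form_monomial:
  assumes "m + n \<le> 4"
  shows "ternary_form 4 (\<lambda>i j. if m = i \<and> n = j then t else 0) x = t * x$1 ^ m * x$2 ^ n * x$3 ^ (4 - m - n)"
proof -
  have "ternary_form 4 (\<lambda>i j. if m = i \<and> n = j then t else 0) x =
    (\<Sum>i\<le>4. \<Sum>j\<le>4 - i. if j = n then (if i = m then t * x$1 ^ m * x$2 ^ n * x$3 ^ (4 - m - n) else 0) else 0)"
    unfolding ternary_form_def by (intro sum.cong refl) auto
  also have "\<dots> = (\<Sum>i\<le>4. if i = m then t * x$1 ^ m * x$2 ^ n * x$3 ^ (4 - m - n) else 0)"
    by (intro sum.cong refl) (use assms in \<open>auto simp: sum.delta\<close>)
  also have "\<dots> = t * x$1 ^ m * x$2 ^ n * x$3 ^ (4 - m - n)" using assms by (simp add: sum.delta)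
  finally show ?thesis .
qed

lemma ternary_form_sum: "ternary_form d (\<lambda>m n. \<Sum>k\<in>A. f k m n) x = (\<Sum>k\<in>A. ternary_form d (f k) x)"
proof -
  have "ternary_form d (\<lambda>m n. \<Sum>k\<in>A. f k m n) x =
    (\<Sum>i\<le>d. \<Sum>j\<le>d - i. \<Sum>k\<in>A. f k i j * x$1 ^ i * x$2 ^ j * x$3 ^ (d - i - j))"
    unfolding ternary_form_def by (simp add: sum_distrib_right)
  also have "\<dots> = (\<Sum>i\<le>d. \<Sum>k\<in>A. \<Sum>j\<le>d - i. f k i j * x$1 ^ i * x$2 ^ j * x$3 ^ (d - i - j))"
    by (intro sum.cong refl sum.swap)
  also have "\<dots> = (\<Sum>k\<in>A. ternary_form d (f k) x)"
    unfolding ternary_form_def by (rule sum.swap)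
  finally show ?thesis .
qed

lemma ternary_form_tensor:
  "ternary_form 4 (tensor_coeff T) x = (\<Sum>i\<in>UNIV. \<Sum>j\<in>UNIV. \<Sum>k\<in>UNIV. \<Sum>l\<in>UNIV. T i j k l * x$i * x$j * x$k * x$l)"
proof -
  have "ternary_form 4 (tensor_coeff T) x = (\<Sum>i\<in>UNIV. \<Sum>j\<in>UNIV. \<Sum>k\<in>UNIV. \<Sum>l\<in>UNIV. 
     ternary_form 4 (\<lambda>m n. if of_bool (i = 1) + of_bool (j = 1) + of_bool (k = 1) + of_bool (l = 1) = m \<and>
        of_bool (i = 2) + of_bool (j = 2) + of_bool (k = 2) + of_bool (l = 2) = n then T i j k l else 0) x)"
    unfolding tensor_coeff_def[abs_def] ternary_form_sum ..
  also have "\<dots> = (\<Sum>i\<in>UNIV. \<Sum>j\<in>UNIV. \<Sum>k\<in>UNIV. \<Sum>l\<in>UNIV. T i j k l * x$i * x$j * x$k * x$l)"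
  proof (intro sum.cong refl)
    fix i j k l :: 3
    define m n :: nat where "m = of_bool (i = 1) + of_bool (j = 1) + of_bool (k = 1) + of_bool (l = 1)"
      and "n = of_bool (i = 2) + of_bool (j = 2) + of_bool (k = 2) + of_bool (l = 2)"
    have u: "x $ i = x$1 ^ of_bool (i = 1) * x$2 ^ of_bool (i = 2) * x$3 ^ (1 - of_bool (i = 1) - of_bool (i = 2))" for i
      using exhaust_3[of i] by auto
    have le: "of_bool (i = 1) + of_bool (i = 2) \<le> (1::nat)" for i :: 3 by (cases "i = 1") auto
    have mn: "m + n \<le> 4" using le[of i] le[of j] le[of k] le[of l] unfolding m_def n_def by linarith
    have "T i j k l * x$1 ^ m * x$2 ^ n * x$3 ^ (4 - m - n) = T i j k l * x$i * x$j * x$k * x$l"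
    proof -
      define t :: "3 \<Rightarrow> nat" where "t i = 1 - of_bool (i = 1) - of_bool (i = 2)" for i
      have t: "of_bool (i = 1) + of_bool (i = 2) + t i = 1" for i :: 3
        unfolding t_def by (cases "i = 1") auto
      have "m + n + (t i + t j + t k + t l) = 4"
        using t[of i] t[of j] t[of k] t[of l] unfolding m_def n_def by linarith
      then have e: "4 - m - n = t i + t j + t k + t l" by linarith
      show ?thesis unfolding e
        unfolding m_def n_def power_add by (simp only: u[of i, folded t_def] u[of j, folded t_def] u[of k, folded t_def] u[of l, folded t_def] mult_ac)
    qed
    then show "ternary_form 4 (\<lambda>m n. if of_bool (i = 1) + of_bool (j = 1) + of_bool (k = 1) + of_bool (l = 1) = m \<and>
        of_bool (i = 2) + of_bool (j = 2) + of_bool (k = 2) + of_bool (l = 2) = n then T i j k l else 0) x = T i j k l * x$i * x$j * x$k * x$l"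
      using ternary_form_monomial[OF mn, of "T i j k l" x] unfolding m_def n_def by simp
  qed
  finally show ?thesis .
qed

definition lin :: "'a::comm_ring_1^3 \<Rightarrow> 'a^3 \<Rightarrow> 'a" where
  "lin r x = (\<Sum>i\<in>UNIV. r $ i * x $ i)"

lemma lin_scale: "lin r (k *s x) = k * lin r x"
  unfolding lin_def by (simp add: sum_distrib_left mult_ac)

lemma plc_lin: "(\<And>i. plc n (L $ i) (\<lambda>s. X s $ i)) \<Longrightarrow> plc n (lin r L) (\<lambda>s. lin r (X s))"
  unfolding lin_def by (intro plc_sum plc_cmult) auto

lemma lin_product_tensor:
  "lin p x * lin q x * (lin r x * lin t x) =
    (\<Sum>i\<in>UNIV. \<Sum>j\<in>UNIV. \<Sum>m\<in>UNIV. \<Sum>l\<in>UNIV. (p$i * q$j * r$m * t$l) * x$i * x$j * x$m * x$l)"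
proof -
  have "lin p x * lin q x * (lin r x * lin t x) =
     (\<Sum>i\<in>UNIV. \<Sum>j\<in>UNIV. p$i * x$i * (q$j * x$j)) * (\<Sum>m\<in>UNIV. \<Sum>l\<in>UNIV. r$m * x$m * (t$l * x$l))"
    unfolding lin_def sum_product ..
  also have "\<dots> = (\<Sum>i\<in>UNIV. \<Sum>j\<in>UNIV. p$i * x$i * (q$j * x$j) * (\<Sum>m\<in>UNIV. \<Sum>l\<in>UNIV. r$m * x$m * (t$l * x$l)))"
    by (simp only: sum_distrib_right)
  also have "\<dots> = (\<Sum>i\<in>UNIV. \<Sum>j\<in>UNIV. \<Sum>m\<in>UNIV. \<Sum>l\<in>UNIV. p$i * x$i * (q$j * x$j) * (r$m * x$m * (t$l * x$l)))"
    by (simp only: sum_distrib_left)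
  finally show ?thesis by (simp only: mult_ac)
qed

definition cx :: "real^'n \<Rightarrow> complex^'n" where
  "cx y = (\<chi> i. of_real (y $ i))"

lemma cx_nonzero [simp]: "cx y = 0 \<longleftrightarrow> y = 0"
  unfolding cx_def by (auto simp: vec_eq_iff)

lemma cx_nth [simp]: "cx y $ i = of_real (y $ i)"
  unfolding cx_def by simp

lemma polar_cx: "polar (\<lambda>i j. of_real (c i j)) (cx x) (cx y) (cx z) (cx w) = of_real (polar c x y z w)"
  unfolding cx_def by (rule polar_of_real)

lemma real_point_cx: "real_point x \<longleftrightarrow> (\<exists>y. y \<noteq> 0 \<and> x = abs_cproj (cx y))"
  unfolding real_point_def cx_def ..


lemma lin_product_coeff:
  "\<exists>e. \<forall>x. ternary_form 4 e x = lin p x * lin q x * (lin r x * lin t x)"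
  unfolding lin_product_tensor by (metis ternary_form_tensor)

lemma ternary_form_add: "ternary_form d (\<lambda>i j. e i j + e' i j) x = ternary_form d e x + ternary_form d e' x"
  unfolding ternary_form_def by (simp add: sum.distrib algebra_simps)

lemma ternary_form_cmult: "ternary_form d (\<lambda>i j. k * e i j) x = k * ternary_form d e x"
  unfolding ternary_form_def by (simp add: sum_distrib_left algebra_simps)

section \<open>Quartics in the frame of three real nodes\<close>

locale quartic_frame = nodal_quartic +
  fixes y1 y2 y3 :: "real^3"
  assumes y_nonzero3: "y1 \<noteq> 0" "y2 \<noteq> 0" "y3 \<noteq> 0"
    and y_sing: "\<And>v. M (cx y1) (cx y1) (cx y1) v = 0" "\<And>v. M (cx y2) (cx y2) (cx y2) v = 0" "\<And>v. M (cx y3) (cx y3) (cx y3) v = 0"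
    and y_distinct: "\<not> hom_equiv (cx y1) (cx y2)" "\<not> hom_equiv (cx y1) (cx y3)" "\<not> hom_equiv (cx y2) (cx y3)"
begin

abbreviation "v1 \<equiv> cx y1"
abbreviation "v2 \<equiv> cx y2"
abbreviation "v3 \<equiv> cx y3"
abbreviation "m \<equiv> polar c"

lemma vertex_vanish:
  "M v1 v1 v1 b = 0" "M v1 v1 b v1 = 0" "M v1 b v1 v1 = 0" "M b v1 v1 v1 = 0"
     "M v2 v2 v2 b = 0" "M v2 v2 b v2 = 0" "M v2 b v2 v2 = 0" "M b v2 v2 v2 = 0"
     "M v3 v3 v3 b = 0" "M v3 v3 b v3 = 0" "M v3 b v3 v3 = 0" "M b v3 v3 v3 = 0"
proof -
  have s: "M a a a b = 0" "M a a b a = 0" "M a b a a = 0" "M b a a a = 0" if "a = v1 \<or> a = v2 \<or> a = v3" for a b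
  proof -
    show "M a a a b = 0" using that y_sing by blast
    then show "M a a b a = 0" using polar_swap(3) by metis
    then show "M a b a a = 0" using polar_swap(2) by metis
    then show "M b a a a = 0" using polar_swap(1) by metis
  qed
  show "M v1 v1 v1 b = 0" "M v1 v1 b v1 = 0" "M v1 b v1 v1 = 0" "M b v1 v1 v1 = 0"
     "M v2 v2 v2 b = 0" "M v2 v2 b v2 = 0" "M v2 b v2 v2 = 0" "M b v2 v2 v2 = 0"
     "M v3 v3 v3 b = 0" "M v3 v3 b v3 = 0" "M v3 b v3 v3 = 0" "M b v3 v3 v3 = 0"
    using s[of v1 b] s[of v2 b] s[of v3 b] by simp_all
qed

lemma vertex_swap:
  "M v2 v1 b e = M v1 v2 b e" "M v3 v1 b e = M v1 v3 b e" "M v3 v2 b e = M v2 v3 b e"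
    "M b v2 v1 e = M b v1 v2 e" "M b v3 v1 e = M b v1 v3 e" "M b v3 v2 e = M b v2 v3 e"
    "M b e v2 v1 = M b e v1 v2" "M b e v3 v1 = M b e v1 v3" "M b e v3 v2 = M b e v2 v3"
  using polar_swap by blast+

text \<open>Terms with one node in three slots vanish. The square monomials arise from 6
  arrangements and the mixed ones from 12, which explains the factor 6 here and the factor 2 inside
  \<open>crem\<close>.\<close>

lemma frame_expand:
  "M (x *s v1 + y *s v2 + z *s v3) (x *s v1 + y *s v2 + z *s v3) (x *s v1 + y *s v2 + z *s v3) (x *s v1 + y *s v2 + z *s v3)
   = crem (6 * M v2 v2 v3 v3) (6 * M v1 v1 v3 v3) (6 * M v1 v1 v2 v2) (6 * M v1 v1 v2 v3) (6 * M v1 v2 v2 v3) (6 * M v1 v2 v3 v3) x y z"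
  by (simp add: polar_add polar_scale vertex_vanish vertex_swap) (simp add: crem_def power2_eq_square algebra_simps)

text \<open>On the line of \<open>v1\<close> and \<open>v2\<close> the quartic is a multiple of
  \<open>s^2 * t^2\<close>. A third node on that line has both coordinates nonzero, so the curve
  would contain the line.\<close>

lemma frame_det: "det3 v1 v2 v3 \<noteq> 0"
proof
  assume d: "det3 v1 v2 v3 = 0"
  have n: "v1 \<noteq> 0" "v2 \<noteq> 0" "v3 \<noteq> 0" using y_nonzero3 by simp_all
  obtain v where v: "det3 v1 v2 v \<noteq> 0" using det3_not_equiv[OF n(1,2) y_distinct(1)] .
  obtain a b where ab: "v3 = a *s v1 + b *s v2" using det3_planeE[OF v d] .
  have "a \<noteq> 0" using ab n(2,3) y_distinct(3) by (auto simp: hom_equiv_def)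
  moreover have "b \<noteq> 0" using ab n(1,3) y_distinct(2) by (auto simp: hom_equiv_def)
  moreover have pl: "M (s *s v1 + t *s v2) (s *s v1 + t *s v2) (s *s v1 + t *s v2) (s *s v1 + t *s v2) = 6 * s^2 * t^2 * M v1 v1 v2 v2" for s t
    using frame_expand[of s t 0] by (simp add: crem_def power_mult_distrib)
  moreover have "M v3 v3 v3 v3 = 0" by (rule y_sing)
  ultimately have "M v1 v1 v2 v2 = 0" unfolding ab by simp
  then show False using not_contains_line[OF v] pl by auto
qed

end

lemma (in nodal_quartic) quartic_frame_permI:
  "quartic_frame p c y1 y2 y3 \<Longrightarrow> quartic_frame p c y2 y3 y1"
  "quartic_frame p c y1 y2 y3 \<Longrightarrow> quartic_frame p c y2 y1 y3"
  unfolding quartic_frame_def quartic_frame_axioms_def using hom_equiv_sym by blast+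

context quartic_frame
begin

lemma M_real: "M (cx x) (cx y) (cx z) (cx w) = of_real (m x y z w)"
  by (rule polar_cx)

lemma coeff_c_nonzero: "m y1 y1 y2 y2 \<noteq> 0"
proof
  assume "m y1 y1 y2 y2 = 0"
  then have "M v1 v1 v2 v2 = 0" by (simp add: M_real)
  then have "M (s *s v1 + t *s v2) (s *s v1 + t *s v2) (s *s v1 + t *s v2) (s *s v1 + t *s v2) = 0" for s t
    using frame_expand[of s t 0] by (simp add: crem_def)
  then show False using not_contains_line[OF frame_det] by blast
qed

text \<open>Up to a factor the minor is the determinant of the Hessian at \<open>v1\<close> on
  \<open>v2\<close> and \<open>v3\<close>. If it vanished, \<open>?d\<close> would be a kernel
  vector that is not a multiple of \<open>v1\<close>, against \<open>hessian_kernel\<close>.\<close>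

lemma minor_nonzero: "(6 * m y1 y1 y3 y3) * (6 * m y1 y1 y2 y2) - (6 * m y1 y1 y2 y3)^2 \<noteq> 0"
proof
  assume 0: "(6 * m y1 y1 y3 y3) * (6 * m y1 y1 y2 y2) - (6 * m y1 y1 y2 y3)^2 = 0"
  let ?f = "m y1 y1 y2 y3" and ?b = "m y1 y1 y3 y3" and ?c = "m y1 y1 y2 y2"
  have fb: "?f^2 = ?b * ?c" using 0 by (simp add: power2_eq_square)
  let ?d = "of_real ?f *s v2 + of_real (- ?c) *s v3"
  have sw: "M v1 v1 v3 v2 = M v1 v1 v2 v3" "M v1 v1 v2 v1 = 0" "M v1 v1 v3 v1 = 0" "M v1 v1 v v1 = 0" for v
    using polar_swap(3) y_sing(1) by metis+
  have "M v1 v1 ?d v = 0" for v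
  proof -
    obtain a b k where v: "v = a *s v1 + b *s v2 + k *s v3" by (rule det3_cramerE[OF frame_det])
    have 1: "M v1 v1 ?d v2 = 0" unfolding polar_add polar_scale sw M_real using polar_swap(3)[of c y1 y1 y3 y2] by simp
    have 2: "M v1 v1 ?d v3 = 0" unfolding polar_add polar_scale sw M_real
      using fb polar_swap(3)[of c y1 y1 y3 y2] by (simp add: power2_eq_square mult.commute flip: of_real_mult)
    show ?thesis unfolding v polar_add(4) polar_scale(4) 1 2 sw by simp
  qed
  then obtain k where "?d = k *s v1" using hessian_kernel[of v1 ?d] y_sing(1) y_nonzero3(1) by auto
  then have "(- k) *s v1 + of_real ?f *s v2 + of_real (- ?c) *s v3 = 0" by (simp add: vec_eq_iff algebra_simps)
  from det3_indep[OF frame_det this] show False using coeff_c_nonzero by simp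
qed

definition "dual1 = (\<chi> i. det3 (axis i 1) v2 v3 / det3 v1 v2 v3)"
definition "dual2 = (\<chi> i. det3 v1 (axis i 1) v3 / det3 v1 v2 v3)"
definition "dual3 = (\<chi> i. det3 v1 v2 (axis i 1) / det3 v1 v2 v3)"

lemma dual_eq: "lin dual1 x = det3 x v2 v3 / det3 v1 v2 v3"
  "lin dual2 x = det3 v1 x v3 / det3 v1 v2 v3" "lin dual3 x = det3 v1 v2 x / det3 v1 v2 v3"
proof -
  have "det3 x v2 v3 = x$1 * det3 (axis 1 1) v2 v3 + x$2 * det3 (axis 2 1) v2 v3 + x$3 * det3 (axis 3 1) v2 v3"
    "det3 v1 x v3 = x$1 * det3 v1 (axis 1 1) v3 + x$2 * det3 v1 (axis 2 1) v3 + x$3 * det3 v1 (axis 3 1) v3"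
    "det3 v1 v2 x = x$1 * det3 v1 v2 (axis 1 1) + x$2 * det3 v1 v2 (axis 2 1) + x$3 * det3 v1 v2 (axis 3 1)"
    using arg_cong[OF vec3_axis[of x], of "\<lambda>x. det3 x v2 v3"] arg_cong[OF vec3_axis[of x], of "\<lambda>x. det3 v1 x v3"]
      arg_cong[OF vec3_axis[of x], of "\<lambda>x. det3 v1 v2 x"]
    by (simp_all only: det3_add det3_scale)
  then show "lin dual1 x = det3 x v2 v3 / det3 v1 v2 v3"
    "lin dual2 x = det3 v1 x v3 / det3 v1 v2 v3" "lin dual3 x = det3 v1 v2 x / det3 v1 v2 v3"
    unfolding lin_def sum_3 dual1_def dual2_def dual3_def by (simp_all add: add_divide_distrib mult.commute)
qed

lemma dual_frame: "x = lin dual1 x *s v1 + lin dual2 x *s v2 + lin dual3 x *s v3"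
proof -
  have "det3 v1 v2 v3 *s x = det3 x v2 v3 *s v1 + det3 v1 x v3 *s v2 + det3 v1 v2 x *s v3"
    by (rule det3_cramer)
  then have "inverse (det3 v1 v2 v3) *s (det3 v1 v2 v3 *s x) = inverse (det3 v1 v2 v3) *s (det3 x v2 v3 *s v1 + det3 v1 x v3 *s v2 + det3 v1 v2 x *s v3)"
    by simp
  then show ?thesis using frame_det unfolding dual_eq
    by (simp add: vector_smult_assoc vector_add_ldistrib divide_inverse mult.commute)
qed

lemma dual_coords:
  "lin dual1 (x *s v1 + y *s v2 + z *s v3) = x" "lin dual2 (x *s v1 + y *s v2 + z *s v3) = y" "lin dual3 (x *s v1 + y *s v2 + z *s v3) = z"
  using frame_det unfolding dual_eq by (simp_all add: det3_add det3_scale)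

end

lemma plc_zero: assumes "plc n l f" "\<And>s. f s = 0" shows "l = 0"
proof -
  obtain q where q: "coeff q n = l" "f = poly q" using assms(1) unfolding plc_def by blast
  have "q = 0" using assms(2) q(2) poly_all_0_iff_0[of q] by simp
  then show ?thesis using q by simp
qed

text \<open>Lagrange's completion of squares for the conic, evaluated at
  \<open>(y*z, x*z, x*y)\<close>. The last square carries the determinant, so a degenerate conic
  leaves only two squares.\<close>

lemma crem_square_sum:
  fixes a b c f g h :: "'a::comm_ring_1"
  shows "(a*b - h^2) * a * crem a b c f g h x y z =
    (a*b - h^2) * (a*(y*z) + h*(x*z) + g*(x*y))^2 + ((a*b - h^2)*(x*z) + (a*f - g*h)*(x*y))^2
      + a * qdet a b c f g h * (x*y)^2"
  unfolding crem_def qdet_def by (simp add: algebra_simps power2_eq_square)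

lemma is_basis2_axis: "is_basis2 (axis 1 1) (axis 2 1)"
  unfolding is_basis2_def
proof (intro conjI allI impI)
  fix w :: "complex^2"
  have "w = w$1 *s axis 1 1 + w$2 *s axis 2 1" by (simp add: vec_eq_iff forall_2 axis_def)
  then show "\<exists>a b. w = a *s axis 1 1 + b *s axis 2 1" by blast
next
  fix a b :: complex assume "a *s axis 1 1 + b *s axis 2 1 = (0::complex^2)"
  then show "a = 0" "b = 0" by (auto simp: vec_eq_iff forall_2 axis_def)
qed

context quartic_frame
begin

abbreviation "qa \<equiv> 6 * m y2 y2 y3 y3"
abbreviation "qb \<equiv> 6 * m y1 y1 y3 y3"
abbreviation "qc \<equiv> 6 * m y1 y1 y2 y2"
abbreviation "qf \<equiv> 6 * m y1 y1 y2 y3"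
abbreviation "qg \<equiv> 6 * m y1 y2 y2 y3"
abbreviation "qh \<equiv> 6 * m y1 y2 y3 y3"

lemma quartic_frame_self: "quartic_frame p c y1 y2 y3"
  by (rule quartic_frame_axioms)

lemma coeffs_nonzero: "qa \<noteq> 0" "qb \<noteq> 0" "qc \<noteq> 0" "qb * qc - qf^2 \<noteq> 0" "qa * qc - qg^2 \<noteq> 0" "qa * qb - qh^2 \<noteq> 0"
proof -
  \<comment> \<open>The remaining coefficients and minors are those already treated, in the
    cyclically rotated frames.\<close>
  note F2 = quartic_frame_permI(1)[OF quartic_frame_self]
  note F3 = quartic_frame_permI(1)[OF F2]
  show "qa \<noteq> 0" using quartic_frame.coeff_c_nonzero[OF F2] by simp
  show "qb \<noteq> 0" using quartic_frame.coeff_c_nonzero[OF F3] polar_swap[of c] by (metis mult_eq_0_iff zero_neq_numeral)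
  show "qc \<noteq> 0" using coeff_c_nonzero by simp
  show "qb * qc - qf^2 \<noteq> 0" by (rule minor_nonzero)
  have s: "m y2 y2 y1 y1 = m y1 y1 y2 y2" "m y2 y2 y3 y1 = m y1 y2 y2 y3" "m y3 y3 y2 y2 = m y2 y2 y3 y3"
     "m y3 y3 y1 y1 = m y1 y1 y3 y3" "m y3 y3 y1 y2 = m y1 y2 y3 y3"
    by (metis polar_swap)+
  show "qa * qc - qg^2 \<noteq> 0" using quartic_frame.minor_nonzero[OF F2] unfolding s by (simp add: mult.commute)
  show "qa * qb - qh^2 \<noteq> 0" using quartic_frame.minor_nonzero[OF F3] unfolding s by (simp add: mult.commute)
qed

lemma M_crem: "M z z z z = crem (of_real qa) (of_real qb) (of_real qc) (of_real qf) (of_real qg) (of_real qh)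
    (lin dual1 z) (lin dual2 z) (lin dual3 z)"
proof -
  let ?z = "lin dual1 z *s v1 + lin dual2 z *s v2 + lin dual3 z *s v3"
  have "M ?z ?z ?z ?z = crem (of_real qa) (of_real qb) (of_real qc) (of_real qf) (of_real qg) (of_real qh)
    (lin dual1 z) (lin dual2 z) (lin dual3 z)"
    unfolding frame_expand M_real by simp
  then show ?thesis using dual_frame[of z] by simp
qed

text \<open>A conic through the nodes that contains the curve becomes, after multiplication by the
  square of \<open>lin dual1\<close>, a quartic vanishing on the curve and so a multiple of its
  equation. The multiple is zero because the line \<open>lin dual1 = 0\<close> is not part of the
  curve; hence the conic is zero.\<close>

lemma no_conic:
  assumes K: "\<And>w. A * (lin dual2 (P w) * lin dual3 (P w)) + B * (lin dual1 (P w) * lin dual3 (P w)) + C * (lin dual1 (P w) * lin dual2 (P w)) = 0"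
  shows "A = 0"
proof -
  obtain e1 where e1: "\<And>x. ternary_form 4 e1 x = lin dual2 x * lin dual3 x * (lin dual1 x * lin dual1 x)"
    using lin_product_coeff by metis
  obtain e2 where e2: "\<And>x. ternary_form 4 e2 x = lin dual1 x * lin dual3 x * (lin dual1 x * lin dual1 x)"
    using lin_product_coeff by metis
  obtain e3 where e3: "\<And>x. ternary_form 4 e3 x = lin dual1 x * lin dual2 x * (lin dual1 x * lin dual1 x)"
    using lin_product_coeff by metis
  let ?e = "\<lambda>i j. (A * e1 i j + B * e2 i j) + C * e3 i j"
  have e: "polar ?e z z z z = (A * (lin dual2 z * lin dual3 z) + B * (lin dual1 z * lin dual3 z) + C * (lin dual1 z * lin dual2 z)) * (lin dual1 z)^2" for z
    unfolding ternary_form_polar[symmetric] ternary_form_add ternary_form_cmult e1 e2 e3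
    by (simp add: algebra_simps power2_eq_square)
  have e0: "polar ?e (P w) (P w) (P w) (P w) = 0" for w by (simp only: e K mult_zero_left)
  obtain k where k: "\<And>z. polar ?e z z z z = k * M z z z z" by (rule quartic_unique[OF e0]) metis
  have "k = 0"
  proof (rule ccontr)
    assume "k \<noteq> 0"
    have d: "det3 v2 v3 v1 \<noteq> 0" using frame_det det3_swap by metis
    have "M (s *s v2 + t *s v3) (s *s v2 + t *s v3) (s *s v2 + t *s v3) (s *s v2 + t *s v3) = 0" for s t
    proof -
      have "lin dual1 (s *s v2 + t *s v3) = 0" using dual_coords(1)[of 0 s t] by simp
      then show ?thesis using k[of "s *s v2 + t *s v3"] e[of "s *s v2 + t *s v3"] \<open>k \<noteq> 0\<close> by simp
    qed
    then show False using not_contains_line[OF d] by blast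
  qed
  have "A * (y * z) + B * z + C * y = 0" for y z
  proof -
    let ?z = "1 *s v1 + y *s v2 + z *s v3"
    have "polar ?e ?z ?z ?z ?z = 0" using k[of ?z] \<open>k = 0\<close> by simp
    then show ?thesis unfolding e dual_coords by simp
  qed
  from this[of 1 0] this[of 0 1] this[of 1 1] show "A = 0" by simp
qed

text \<open>A degenerate conic would split into the two lines whose transforms are \<open>K 1\<close> and
  \<open>K (-1)\<close>, so the irreducible curve would lie on a conic.\<close>

lemma det_nonzero: "qdet qa qb qc qf qg qh \<noteq> 0"
proof
  assume d: "qdet qa qb qc qf qg qh = 0"
  let ?a = "complex_of_real qa" and ?b = "complex_of_real qb" and ?c = "complex_of_real qc"
    and ?f = "complex_of_real qf" and ?g = "complex_of_real qg" and ?h = "complex_of_real qh"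
  let ?mm = "?a * ?b - ?h^2"
  have "?mm = of_real (qa * qb - qh^2)" by simp
  moreover have "complex_of_real (qa * qb - qh^2) \<noteq> 0"
    unfolding of_real_eq_0_iff by (rule coeffs_nonzero(6))
  ultimately have mm: "?mm \<noteq> 0" by metis
  have d': "qdet ?a ?b ?c ?f ?g ?h = 0"
  proof -
    have "qdet ?a ?b ?c ?f ?g ?h = of_real (qdet qa qb qc qf qg qh)" unfolding qdet_def by simp
    then show ?thesis using d by simp
  qed
  obtain r where r: "r^2 = - ?mm" using power2_csqrt by blast
  have "r \<noteq> 0" using r mm by auto
  define K where "K q z = (q * r * ?a) * (lin dual2 z * lin dual3 z) + (?mm + q * r * ?h) * (lin dual1 z * lin dual3 z)
     + ((?a * ?f - ?g * ?h) + q * r * ?g) * (lin dual1 z * lin dual2 z)" for q z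
  have Kscale: "K q (k *s z) = k^2 * K q z" for q k z
    unfolding K_def lin_scale by (simp only: power2_eq_square distrib_left mult_ac)
  have KK: "K 1 z * K (-1) z = ?mm * ?a * M z z z z" for z
  proof -
    have *: "(r * A + B) * (B - r * A) = B^2 - r^2 * A^2" for A B by (simp add: power2_eq_square algebra_simps)
    have "K 1 z * K (-1) z = (?mm*(lin dual1 z*lin dual3 z) + (?a*?f - ?g*?h)*(lin dual1 z*lin dual2 z))^2
       - r^2 * (?a*(lin dual2 z*lin dual3 z) + ?h*(lin dual1 z*lin dual3 z) + ?g*(lin dual1 z*lin dual2 z))^2"
      unfolding K_def *[symmetric] by (simp add: algebra_simps)
    also have "\<dots> = ?mm * ?a * M z z z z" unfolding M_crem crem_square_sum r d' by (simp only: mult_zero_right mult_zero_left add_0_right add_0_left mult_minus_left diff_minus_eq_add add.commute)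
    finally show ?thesis .
  qed
  let ?w = "\<lambda>s. s *s axis 1 1 + axis 2 1 :: complex^2"
  have pK: "plc 8 (K q (P (axis 1 1))) (\<lambda>s. K q (P (?w s)))" for q
  proof -
    have "plc (4+4) (K q (P (axis 1 1))) (\<lambda>s. K q (P (?w s)))"
      unfolding K_def by (intro plc_add plc_cmult plc_mult plc_lin plc_hom_param)
    then show ?thesis by simp
  qed
  have Kzero: False if q: "q \<noteq> 0" and inf: "infinite {s. K q (P (?w s)) = 0}" for q
  proof -
    have all: "K q (P (?w s)) = 0" for s using plc_finite[OF pK[of q], of s] inf by blast
    then have 0: "K q (P (axis 1 1)) = 0" using plc_zero[OF pK[of q]] by blast
    have hom: "K q (P w) = 0" if "hom_equiv u w" "K q (P u) = 0" for u w
    proof -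
      obtain k where "w = k *s u" using \<open>hom_equiv u w\<close> by (rule equiv_scaleE)
      then have "K q (P w) = (k^4)^2 * K q (P u)"
        by (simp only: hom_param_4_scale Kscale)
      then show ?thesis using that(2) by simp
    qed
    have "K q (P w) = 0" for w
    proof (cases "w = 0")
      case True
      then show ?thesis by (simp add: K_def lin_def)
    next
      case False
      from basis2_cover[OF is_basis2_axis this] show ?thesis using hom all 0 by blast
    qed
    then have "q * r * ?a = 0" unfolding K_def by (rule no_conic)
    then show False using q \<open>r \<noteq> 0\<close> coeffs_nonzero(1) by simp
  qed
  have "{s. K 1 (P (?w s)) = 0} \<union> {s. K (-1) (P (?w s)) = 0} = UNIV"
  proof -
    have "K 1 (P (?w s)) * K (-1) (P (?w s)) = 0" for s unfolding KK by simp
    then show ?thesis by auto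
  qed
  then have "infinite {s. K 1 (P (?w s)) = 0} \<or> infinite {s. K (-1) (P (?w s)) = 0}"
    using infinite_UNIV_char_0[where 'a = complex] by (metis finite_UnI)
  then show False using Kzero[of 1] Kzero[of "-1"] by auto
qed

lemma dual_real: "lin dual1 (cx x) \<in> \<real>" "lin dual2 (cx x) \<in> \<real>" "lin dual3 (cx x) \<in> \<real>"
  unfolding dual_eq det3_def by (auto intro!: Reals_divide Reals_add Reals_diff Reals_mult)

lemma P_real: "P (cx w) = cx (\<chi> i. p i 0 * (w$2)^4 + p i 1 * w$1 * (w$2)^3
   + p i 2 * (w$1)^2 * (w$2)^2 + p i 3 * (w$1)^3 * w$2 + p i 4 * (w$1)^4)"
  by (simp add: vec_eq_iff hom_param_4)

text \<open>For a definite form the quartic is a sum of squares and its only real points are the vertices,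
  but the parametrization maps the infinitely many real parameters to real points.\<close>

lemma indefinite: "\<not> (0 < qa * qdet qa qb qc qf qg qh \<and> 0 < qa * qb - qh^2)"
proof
  assume pos: "0 < qa * qdet qa qb qc qf qg qh \<and> 0 < qa * qb - qh^2"
  let ?w = "\<lambda>s::real. cx (s *s axis 1 1 + axis 2 1 :: real^2)"
  have w: "?w s = of_real s *s axis 1 1 + axis 2 1" for s by (simp add: vec_eq_iff axis_def forall_2)
  have w0: "?w s \<noteq> 0" for s unfolding w using basis2_nonzero(1)[OF is_basis2_axis] .
  have inj: "s = t" if "hom_equiv (?w s) (?w t)" for s t
    using basis2_inj[OF is_basis2_axis, of "of_real s" "of_real t"] that unfolding w by simp
  have cover: "hom_equiv (P (?w s)) v1 \<or> hom_equiv (P (?w s)) v2 \<or> hom_equiv (P (?w s)) v3" for s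
  proof -
    let ?z = "P (?w s)"
    obtain \<rho> where "?z = cx \<rho>" using P_real by blast
    then obtain x y z where xyz: "lin dual1 ?z = of_real x" "lin dual2 ?z = of_real y" "lin dual3 ?z = of_real z"
      using dual_real by (metis Reals_cases)
    have "complex_of_real (crem qa qb qc qf qg qh x y z) = M ?z ?z ?z ?z"
      unfolding M_crem xyz crem_def by simp
    then have "crem qa qb qc qf qg qh x y z = 0" by simp
    then have sum0: "(qa*qb - qh^2) * (qa*(y*z) + qh*(x*z) + qg*(x*y))^2 + ((qa*qb - qh^2)*(x*z) + (qa*qf - qg*qh)*(x*y))^2
      + qa * qdet qa qb qc qf qg qh * (x*y)^2 = 0"
      using crem_square_sum[of qa qb qh qc qf qg x y z] by simp
    have nn: "0 \<le> (qa*qb - qh^2) * (qa*(y*z) + qh*(x*z) + qg*(x*y))^2" "0 \<le> ((qa*qb - qh^2)*(x*z) + (qa*qf - qg*qh)*(x*y))^2"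
      "0 \<le> qa * qdet qa qb qc qf qg qh * (x*y)^2"
      using pos by (auto intro!: mult_nonneg_nonneg simp del: mult_eq_0_iff)
    have "qa * qdet qa qb qc qf qg qh * (x*y)^2 = 0" using sum0 nn by linarith
    then have xy: "x * y = 0" using pos by (metis less_irrefl mult_eq_0_iff power_eq_0_iff)
    have "((qa*qb - qh^2)*(x*z) + (qa*qf - qg*qh)*(x*y))^2 = 0" using sum0 nn by linarith
    then have xz: "x * z = 0" using pos unfolding xy by auto
    have "(qa*qb - qh^2) * (qa*(y*z) + qh*(x*z) + qg*(x*y))^2 = 0" using sum0 nn by linarith
    then have yz: "y * z = 0" using pos coeffs_nonzero(1) unfolding xy xz by auto
    have z: "?z = of_real x *s v1 + of_real y *s v2 + of_real z *s v3"
      using dual_frame[of ?z] unfolding xyz .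
    have n0: "?z \<noteq> 0" using P_nonzero w0 by blast
    have "(x = 0 \<and> y = 0) \<or> (x = 0 \<and> z = 0) \<or> (y = 0 \<and> z = 0)" using xy xz yz by auto
    then obtain k v where "?z = k *s v" "v \<in> {v1, v2, v3}" using z by auto
    moreover have "v \<noteq> 0" "k \<noteq> 0" using calculation n0 by auto
    ultimately show ?thesis using hom_equiv_scale[of v k] hom_equiv_sym by (metis insertE singletonD)
  qed
  \<comment> \<open>A node has only two preimages, and distinct real \<open>s\<close> give
    inequivalent parameters.\<close>
  have fin: "finite {s. hom_equiv (P (?w s)) z}" if z: "z \<noteq> 0" and sing: "\<And>v. M z z z v = 0" for z
  proof -
    obtain u u1 v v1 where "is_basis2 u u1" "is_basis2 v v1" "hom_equiv (P u) z" "hom_equiv (P v) z"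
      and fib: "\<forall>w. hom_equiv (P w) z \<longrightarrow> hom_equiv w u \<or> hom_equiv w v"
      and "det3 z (dP u u1) (dP v v1) \<noteq> 0"
      by (rule node_frame[OF z sing])
    have "finite {s. hom_equiv (?w s) a}" for a
    proof -
      have "s = t" if "hom_equiv (?w s) a" "hom_equiv (?w t) a" for s t
        using inj[OF hom_equiv_trans[OF that(1) hom_equiv_sym[OF that(2)]]] .
      then have "\<exists>t. {t. hom_equiv (?w t) a} \<subseteq> {t}" by blast
      then show ?thesis using finite_subset by blast
    qed
    moreover have "{s. hom_equiv (P (?w s)) z} \<subseteq> {s. hom_equiv (?w s) u} \<union> {s. hom_equiv (?w s) v}" using fib by blast
    ultimately show ?thesis by (meson finite_UnI finite_subset)
  qed
  have "UNIV = {s. hom_equiv (P (?w s)) v1} \<union> {s. hom_equiv (P (?w s)) v2} \<union> {s. hom_equiv (P (?w s)) v3}"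
    using cover by blast
  moreover have "finite ({s. hom_equiv (P (?w s)) v1} \<union> {s. hom_equiv (P (?w s)) v2} \<union> {s. hom_equiv (P (?w s)) v3})"
    using fin[OF _ y_sing(1)] fin[OF _ y_sing(2)] fin[OF _ y_sing(3)] y_nonzero3 by simp
  ultimately show False using infinite_UNIV_char_0[where 'a = real] by metis
qed

lemma good_conic: "good qa qb qc qf qg qh"
  unfolding good_def using coeffs_nonzero det_nonzero indefinite by blast

end

text \<open>Off the coordinate triangle the chain rule expresses the partial derivatives through
  half the gradient of the conic, \<open>(?A, ?B, ?C)\<close>, which must then vanish; the
  determinant forbids that. On a side of the triangle the equation reduces to a single term, which
  forces a second coordinate to vanish.\<close>

lemma crem_singular:
  fixes a b c f g h x y z :: "'a::field_char_0"
  assumes nz: "a \<noteq> 0" "b \<noteq> 0" "c \<noteq> 0" "qdet a b c f g h \<noteq> 0"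
    and F: "crem a b c f g h x y z = 0"
    and dx: "b*x*z^2 + c*x*y^2 + 2*f*x*y*z + g*y^2*z + h*y*z^2 = 0"
    and dy: "a*y*z^2 + c*x^2*y + f*x^2*z + 2*g*x*y*z + h*x*z^2 = 0"
    and dz: "a*y^2*z + b*x^2*z + f*x^2*y + g*x*y^2 + 2*h*x*y*z = 0"
  shows "x = 0 \<and> y = 0 \<or> x = 0 \<and> z = 0 \<or> y = 0 \<and> z = 0"
proof (cases "x * y * z = 0")
  case True
  then consider "x = 0" | "y = 0" | "z = 0" by auto
  then show ?thesis
    by cases (use F nz in \<open>auto simp: crem_def\<close>)
next
  case False
  let ?A = "a*(y*z) + h*(x*z) + g*(x*y)" and ?B = "h*(y*z) + b*(x*z) + f*(x*y)" and ?C = "g*(y*z) + f*(x*z) + c*(x*y)"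
  have e1: "z * ?B + y * ?C = 0" using dx by (simp add: algebra_simps power2_eq_square)
  have e2: "z * ?A + x * ?C = 0" using dy by (simp add: algebra_simps power2_eq_square)
  have e3: "y * ?A + x * ?B = 0" using dz by (simp add: algebra_simps power2_eq_square)
  have "2 * x * y * ?C = x * (z * ?B + y * ?C) + y * (z * ?A + x * ?C) - z * (y * ?A + x * ?B)" by (simp add: algebra_simps)
  then have C0: "?C = 0" unfolding e1 e2 e3 using False by auto
  have "z * ?B = 0" using e1 unfolding C0 by simp
  then have B0: "?B = 0" using False by auto
  have "z * ?A = 0" using e2 unfolding C0 by simp
  then have A0: "?A = 0" using False by auto
  \<comment> \<open>A row of the adjugate matrix applied to the gradient.\<close>
  have "qdet a b c f g h * (y * z) = (b*c - f^2) * ?A + (f*g - h*c) * ?B + (h*f - b*g) * ?C"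
    unfolding qdet_def by (simp add: algebra_simps power2_eq_square)
  then have "qdet a b c f g h * (y * z) = 0" unfolding A0 B0 C0 by simp
  then show ?thesis using nz(4) False by auto
qed

subsection \<open>The quartic of a conic\<close>

definition qform :: "'a::comm_ring_1 \<Rightarrow> 'a \<Rightarrow> 'a \<Rightarrow> 'a \<Rightarrow> 'a \<Rightarrow> 'a \<Rightarrow> 'a \<Rightarrow> 'a \<Rightarrow> 'a \<Rightarrow> 'a" where
  "qform a b c f g h x y z = a*x^2 + b*y^2 + c*z^2 + 2*f*y*z + 2*g*x*z + 2*h*x*y"

lemma crem_qform: "crem a b c f g h x y z = qform a b c f g h (y*z) (x*z) (x*y)"
  unfolding crem_def qform_def by (simp add: algebra_simps)

definition bq :: "real^3 \<Rightarrow> complex^2 \<Rightarrow> complex" where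
  "bq s w = of_real (s$1) * (w$1)^2 + of_real (s$2) * w$1 * w$2 + of_real (s$3) * (w$2)^2"

definition dbq :: "real^3 \<Rightarrow> complex^2 \<Rightarrow> complex^2 \<Rightarrow> complex" where
  "dbq s w h = 2 * of_real (s$1) * w$1 * h$1 + of_real (s$2) * (w$1 * h$2 + w$2 * h$1) + 2 * of_real (s$3) * w$2 * h$2"

text \<open>Coefficients of the product of the binary quadratic forms \<open>bq s\<close> and
  \<open>bq t\<close>, by powers of the first variable.\<close>

definition pc :: "real^3 \<Rightarrow> real^3 \<Rightarrow> nat \<Rightarrow> real" where
  "pc s t k = (if k = 4 then s$1 * t$1 else if k = 3 then s$1 * t$2 + s$2 * t$1
     else if k = 2 then s$1 * t$3 + s$2 * t$2 + s$3 * t$1 else if k = 1 then s$2 * t$3 + s$3 * t$2 else s$3 * t$3)"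

text \<open>The Cremona map applied to the parametrization \<open>(bq s1, bq s2, bq s3)\<close> of
  the conic, in the frame \<open>y1\<close>, \<open>y2\<close>, \<open>y3\<close>.\<close>

definition cparam :: "real^3 \<Rightarrow> real^3 \<Rightarrow> real^3 \<Rightarrow> real^3 \<Rightarrow> real^3 \<Rightarrow> real^3 \<Rightarrow> 3 \<Rightarrow> nat \<Rightarrow> real" where
  "cparam y1 y2 y3 s1 s2 s3 j k = pc s2 s3 k * y1$j + pc s1 s3 k * y2$j + pc s1 s2 k * y3$j"

lemma pc_commute: "pc s t k = pc t s k"
  unfolding pc_def by auto

lemma cparam_rotate: "cparam y2 y3 y1 s2 s3 s1 = cparam y1 y2 y3 s1 s2 s3"
  unfolding cparam_def by (intro ext) (simp add: pc_commute[of s3 s1] pc_commute[of s2 s1] add_ac)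

lemma hom_param_cparam: "hom_param 4 (cparam y1 y2 y3 s1 s2 s3) w =
   (bq s2 w * bq s3 w) *s cx y1 + (bq s1 w * bq s3 w) *s cx y2 + (bq s1 w * bq s2 w) *s cx y3"
  by (simp add: vec_eq_iff hom_param_4 cparam_def pc_def bq_def algebra_simps power2_eq_square power3_eq_cube power4_eq_xxxx)

lemma dparam_cparam: "dparam (cparam y1 y2 y3 s1 s2 s3) w h =
   (dbq s2 w h * bq s3 w + bq s2 w * dbq s3 w h) *s cx y1 + (dbq s1 w h * bq s3 w + bq s1 w * dbq s3 w h) *s cx y2
   + (dbq s1 w h * bq s2 w + bq s1 w * dbq s2 w h) *s cx y3"
  by (simp add: vec_eq_iff dparam_def cparam_def pc_def bq_def dbq_def algebra_simps power2_eq_square power3_eq_cube)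

lemma bq_add: "bq s (x *s w + y *s h) = x^2 * bq s w + x * y * dbq s w h + y^2 * bq s h"
  unfolding bq_def dbq_def by (simp add: algebra_simps power2_eq_square)

lemma bq_scale: "bq s (x *s w) = x^2 * bq s w"
  unfolding bq_def by (simp add: algebra_simps power2_eq_square)

locale cremona_param =
  fixes y1 y2 y3 s1 s2 s3 :: "real^3" and a b c f g h :: real
  assumes indep: "det3 (cx y1) (cx y2) (cx y3) \<noteq> 0"
    and conic: "\<And>w. qform (of_real a) (of_real b) (of_real c) (of_real f) (of_real g) (of_real h) (bq s1 w) (bq s2 w) (bq s3 w) = 0"
    and onto: "\<And>x y z. qform (of_real a) (of_real b) (of_real c) (of_real f) (of_real g) (of_real h) x y z = 0 \<Longrightarrow>
       \<not> (x = 0 \<and> y = 0 \<and> z = 0) \<Longrightarrow> \<exists>w k. w \<noteq> 0 \<and> k \<noteq> 0 \<and> x = k * bq s1 w \<and> y = k * bq s2 w \<and> z = k * bq s3 w"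
    and inj: "\<And>w w' k. w \<noteq> 0 \<Longrightarrow> w' \<noteq> 0 \<Longrightarrow> bq s1 w' = k * bq s1 w \<Longrightarrow> bq s2 w' = k * bq s2 w \<Longrightarrow> bq s3 w' = k * bq s3 w \<Longrightarrow> hom_equiv w w'"
    and nonzero: "\<And>w. w \<noteq> 0 \<Longrightarrow> \<not> (bq s1 w = 0 \<and> bq s2 w = 0 \<and> bq s3 w = 0)"
    and nz: "a \<noteq> 0" "b \<noteq> 0" "c \<noteq> 0" "b*c - f^2 \<noteq> 0" "a*c - g^2 \<noteq> 0" "a*b - h^2 \<noteq> 0" "qdet a b c f g h \<noteq> 0"
begin

abbreviation "pp \<equiv> cparam y1 y2 y3 s1 s2 s3"
abbreviation "PP \<equiv> hom_param 4 pp"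

text \<open>Cyclic symmetry, by which statements about the vertex \<open>y1\<close> yield those
  about \<open>y2\<close> and \<open>y3\<close>.\<close>

lemma rotate: "cremona_param y2 y3 y1 s2 s3 s1 b c a g h f"
proof
  show "det3 (cx y2) (cx y3) (cx y1) \<noteq> 0" using indep det3_swap by metis
  show "qform (of_real b) (of_real c) (of_real a) (of_real g) (of_real h) (of_real f) (bq s2 w) (bq s3 w) (bq s1 w) = 0" for w
    using conic[of w] unfolding qform_def by (simp add: algebra_simps)
  show "\<exists>w k. w \<noteq> 0 \<and> k \<noteq> 0 \<and> x = k * bq s2 w \<and> y = k * bq s3 w \<and> z = k * bq s1 w"
    if "qform (of_real b) (of_real c) (of_real a) (of_real g) (of_real h) (of_real f) x y z = 0" "\<not> (x = 0 \<and> y = 0 \<and> z = 0)" for x y z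
  proof -
    have "qform (of_real a) (of_real b) (of_real c) (of_real f) (of_real g) (of_real h) z x y = 0"
      using that(1) unfolding qform_def by (simp add: algebra_simps)
    from onto[OF this] that(2) show ?thesis by blast
  qed
  show "hom_equiv w w'" if "w \<noteq> 0" "w' \<noteq> 0" "bq s2 w' = k * bq s2 w" "bq s3 w' = k * bq s3 w" "bq s1 w' = k * bq s1 w" for w w' k
    using inj that by blast
  show "\<not> (bq s2 w = 0 \<and> bq s3 w = 0 \<and> bq s1 w = 0)" if "w \<noteq> 0" for w using nonzero[OF that] by blast
  show "b \<noteq> 0" "c \<noteq> 0" "a \<noteq> 0" using nz by blast+
  show "c * a - g\<^sup>2 \<noteq> 0" "b * a - h\<^sup>2 \<noteq> 0" "b * c - f\<^sup>2 \<noteq> 0" using nz by (simp_all add: mult.commute)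
  have "qdet b c a g h f = qdet a b c f g h" unfolding qdet_def by (simp add: algebra_simps)
  then show "qdet b c a g h f \<noteq> 0" using nz by simp
qed

lemma two_vanish:
  assumes "w \<noteq> 0" "bq s1 w = 0"
  shows "bq s2 w \<noteq> 0 \<and> bq s3 w \<noteq> 0"
  using conic[of w] nonzero[OF assms(1)] assms(2) nz unfolding qform_def by auto

lemma PP_nonzero: "w \<noteq> 0 \<Longrightarrow> PP w \<noteq> 0"
proof
  assume w: "w \<noteq> 0" and 0: "PP w = 0"
  from 0 have "bq s2 w * bq s3 w = 0 \<and> bq s1 w * bq s3 w = 0 \<and> bq s1 w * bq s2 w = 0"
    unfolding hom_param_cparam by (rule det3_indep[OF indep])
  then show False using two_vanish[OF w] cremona_param.two_vanish[OF rotate w] nonzero[OF w] by auto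
qed

text \<open>The conic meets the first side of the triangle in the points
  \<open>(0, - f + t, b)\<close> with \<open>t = r\<close> or \<open>t = - r\<close>, where
  \<open>r^2 = f^2 - b*c\<close>. They are distinct because the side is not tangent.\<close>

lemma vertex_preimage:
  obtains u v where "u \<noteq> 0" "v \<noteq> 0" "\<not> hom_equiv u v" "bq s1 u = 0" "bq s1 v = 0"
    "bq s2 u * bq s3 v - bq s3 u * bq s2 v \<noteq> 0" "\<And>w. w \<noteq> 0 \<Longrightarrow> bq s1 w = 0 \<Longrightarrow> hom_equiv w u \<or> hom_equiv w v"
proof -
  let ?b = "complex_of_real b" and ?c = "complex_of_real c" and ?f = "complex_of_real f"
  obtain r where r: "r^2 = ?f^2 - ?b * ?c" using power2_csqrt by blast
  have "?f^2 - ?b * ?c = - of_real (b*c - f^2)" by simp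
  then have "r \<noteq> 0" using r nz(4) by (metis neg_equal_0_iff_equal of_real_eq_0_iff power_zero_numeral)
  have b0: "?b \<noteq> 0" using nz by simp
  have on: "qform (of_real a) ?b ?c ?f (of_real g) (of_real h) 0 (- ?f + t) ?b = 0" if "t = r \<or> t = - r" for t
  proof -
    have "qform (of_real a) ?b ?c ?f (of_real g) (of_real h) 0 (- ?f + t) ?b = ?b * (t^2 - (?f^2 - ?b * ?c))"
      unfolding qform_def by (simp add: algebra_simps power2_eq_square)
    also have "t^2 = r^2" using that by auto
    finally show ?thesis using r by simp
  qed
  obtain u k where u: "u \<noteq> 0" "k \<noteq> 0" "0 = k * bq s1 u" "- ?f + r = k * bq s2 u" "?b = k * bq s3 u"
    using onto[OF on[of r]] b0 by auto
  obtain v l where v: "v \<noteq> 0" "l \<noteq> 0" "0 = l * bq s1 v" "- ?f + - r = l * bq s2 v" "?b = l * bq s3 v"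
    using onto[OF on[of "- r"]] b0 by auto
  have d: "k * l * (bq s2 u * bq s3 v - bq s3 u * bq s2 v) = 2 * r * ?b"
  proof -
    have "k * l * (bq s2 u * bq s3 v - bq s3 u * bq s2 v) = (k * bq s2 u) * (l * bq s3 v) - (k * bq s3 u) * (l * bq s2 v)"
      by (simp add: algebra_simps)
    also have "\<dots> = (- ?f + r) * ?b - ?b * (- ?f + - r)" using u v by metis
    finally show ?thesis by (simp add: algebra_simps)
  qed
  show ?thesis
  proof (rule that[OF u(1) v(1)])
    show "bq s1 u = 0" "bq s1 v = 0" using u v by auto
    show d0: "bq s2 u * bq s3 v - bq s3 u * bq s2 v \<noteq> 0" using d \<open>r \<noteq> 0\<close> b0 by auto
    show "\<not> hom_equiv u v"
    proof
      assume "hom_equiv u v"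
      then obtain k where "v = k *s u" by (rule equiv_scaleE)
      then show False using d0 by (simp add: bq_scale)
    qed
    fix w assume w: "w \<noteq> 0" "bq s1 w = 0"
    have "qform (of_real a) ?b ?c ?f (of_real g) (of_real h) 0 (bq s2 w) (bq s3 w) = 0"
      using conic[of w] w(2) by simp
    then have "(?b * bq s2 w + ?f * bq s3 w)^2 = (r * bq s3 w)^2"
      using r unfolding qform_def power_mult_distrib by (simp add: algebra_simps power2_eq_square) algebra
    then have "?b * bq s2 w + ?f * bq s3 w = r * bq s3 w \<or> ?b * bq s2 w + ?f * bq s3 w = - (r * bq s3 w)"
      by (simp add: power2_eq_iff)
    then consider "?b * bq s2 w = (- ?f + r) * bq s3 w" | "?b * bq s2 w = (- ?f + - r) * bq s3 w"
      by (auto simp: algebra_simps eq_neg_iff_add_eq_0)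
    then show "hom_equiv w u \<or> hom_equiv w v"
    proof cases
      case 1
      have "hom_equiv u w"
      proof (rule inj[OF u(1) w(1), of "bq s3 w * k / ?b"])
        show "bq s1 w = bq s3 w * k / ?b * bq s1 u" using w u by auto
        show "bq s3 w = bq s3 w * k / ?b * bq s3 u" using u(5) b0 by (simp add: field_simps)
        have "bq s2 w = (- ?f + r) * bq s3 w / ?b" using 1 b0 by (simp add: field_simps)
        then show "bq s2 w = bq s3 w * k / ?b * bq s2 u" unfolding u(4) by (simp add: field_simps)
      qed
      then show ?thesis using hom_equiv_sym by blast
    next
      case 2
      have "hom_equiv v w"
      proof (rule inj[OF v(1) w(1), of "bq s3 w * l / ?b"])
        show "bq s1 w = bq s3 w * l / ?b * bq s1 v" using w v by auto
        show "bq s3 w = bq s3 w * l / ?b * bq s3 v" using v(5) b0 by (simp add: field_simps)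
        have "bq s2 w = (- ?f + - r) * bq s3 w / ?b" using 2 b0 by (simp add: field_simps)
        then show "bq s2 w = bq s3 w * l / ?b * bq s2 v" unfolding v(4) by (simp add: field_simps)
      qed
      then show ?thesis using hom_equiv_sym by blast
    qed
  qed
qed

lemma PP_vertex: "w \<noteq> 0 \<Longrightarrow> hom_equiv (PP w) (cx y1) \<longleftrightarrow> bq s1 w = 0"
proof
  assume w: "w \<noteq> 0" and "hom_equiv (PP w) (cx y1)"
  then obtain k where k: "k \<noteq> 0" "cx y1 = k *s PP w" by (auto elim: equiv_scaleE)
  have "(k * (bq s2 w * bq s3 w) - 1) *s cx y1 + (k * (bq s1 w * bq s3 w)) *s cx y2 + (k * (bq s1 w * bq s2 w)) *s cx y3 = 0"
    using k(2) unfolding hom_param_cparam by (simp add: vec_eq_iff algebra_simps)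
  from det3_indep[OF indep this] show "bq s1 w = 0" using k(1) by auto
next
  assume w: "w \<noteq> 0" and 0: "bq s1 w = 0"
  have "PP w = (bq s2 w * bq s3 w) *s cx y1" unfolding hom_param_cparam using 0 by simp
  moreover have "cx y1 \<noteq> 0" using indep det3_refl(4) by metis
  ultimately show "hom_equiv (PP w) (cx y1)" using two_vanish[OF w 0] hom_equiv_scale hom_equiv_sym
    by (metis mult_eq_0_iff)
qed

lemma no_common_root: "no_common_root 4 pp"
  unfolding no_common_root_def using PP_nonzero by blast

lemma PP_equiv: "hom_equiv u w \<Longrightarrow> hom_equiv (PP u) (PP w)"
proof -
  assume e: "hom_equiv u w"
  then obtain k where "k \<noteq> 0" "w = k *s u" by (rule equiv_scaleE)
  then show ?thesis using hom_equiv_nonzero[OF e] by (simp add: hom_param_4_scale hom_equiv_scale PP_nonzero)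
qed

lemma param_map_eq_iff: "z \<noteq> 0 \<Longrightarrow> param_map 4 pp x = abs_cproj z \<longleftrightarrow> hom_equiv (PP (rep_cproj x)) z"
  unfolding param_map_def by (rule abs_cproj_eq_iff) (auto simp: PP_nonzero)

text \<open>Modulo \<open>cx y1\<close> the branch at \<open>u\<close> has a tangent with
  coordinates proportional to \<open>(bq s3 u, bq s2 u)\<close> with respect to \<open>cx y2\<close>
  and \<open>cx y3\<close>. The two tangents are independent by the determinant in
  \<open>vertex_preimage\<close>.\<close>

lemma node_vertex: "node 4 pp (abs_cproj (cx y1))"
proof -
  obtain u v where u: "u \<noteq> 0" and v: "v \<noteq> 0" and ne: "\<not> hom_equiv u v" and u0: "bq s1 u = 0" and v0: "bq s1 v = 0"
    and d: "bq s2 u * bq s3 v - bq s3 u * bq s2 v \<noteq> 0" and fib: "\<And>w. w \<noteq> 0 \<Longrightarrow> bq s1 w = 0 \<Longrightarrow> hom_equiv w u \<or> hom_equiv w v"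
    by (rule vertex_preimage) blast
  let ?U = "abs_cproj u" and ?V = "abs_cproj v"
  have y1: "cx y1 \<noteq> 0" using indep det3_refl(4) by metis
  have ne': "?U \<noteq> ?V" using ne abs_cproj_eq_iff u v by blast
  define u' where "u' = rep_cproj ?U"
  define v' where "v' = rep_cproj ?V"
  have u': "u' \<noteq> 0" "hom_equiv u' u" and v': "v' \<noteq> 0" "hom_equiv v' v" unfolding u'_def v'_def using rep_abs_cproj u v by auto
  have pre: "param_map 4 pp x = abs_cproj (cx y1) \<longleftrightarrow> x = ?U \<or> x = ?V" for x
  proof -
    have "param_map 4 pp x = abs_cproj (cx y1) \<longleftrightarrow> bq s1 (rep_cproj x) = 0"
      unfolding param_map_eq_iff[OF y1] by (rule PP_vertex) simp
    also have "\<dots> \<longleftrightarrow> hom_equiv (rep_cproj x) u \<or> hom_equiv (rep_cproj x) v"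
    proof
      assume "bq s1 (rep_cproj x) = 0" then show "hom_equiv (rep_cproj x) u \<or> hom_equiv (rep_cproj x) v" using fib by simp
    next
      have "bq s1 w = 0" if "hom_equiv w t" "bq s1 t = 0" for w t
        using that by (auto simp: hom_equiv_def bq_scale)
      then show "hom_equiv (rep_cproj x) u \<or> hom_equiv (rep_cproj x) v \<Longrightarrow> bq s1 (rep_cproj x) = 0" using u0 v0 by blast
    qed
    also have "\<dots> \<longleftrightarrow> x = ?U \<or> x = ?V"
      using abs_cproj_eq_iff[of "rep_cproj x"] u v by simp
    finally show ?thesis .
  qed
  obtain ku where ku: "ku \<noteq> 0" "u = ku *s u'" using u'(2) by (rule equiv_scaleE)
  obtain kv where kv: "kv \<noteq> 0" "v = kv *s v'" using v'(2) by (rule equiv_scaleE)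
  have u0': "bq s1 u' = 0" using u0 ku by (simp add: bq_scale)
  have v0': "bq s1 v' = 0" using v0 kv by (simp add: bq_scale)
  have d': "bq s2 u' * bq s3 v' - bq s3 u' * bq s2 v' \<noteq> 0"
  proof
    assume "bq s2 u' * bq s3 v' - bq s3 u' * bq s2 v' = 0"
    moreover have "bq s2 u * bq s3 v - bq s3 u * bq s2 v = ku^2 * kv^2 * (bq s2 u' * bq s3 v' - bq s3 u' * bq s2 v')"
      unfolding ku(2) kv(2) bq_scale by (simp add: algebra_simps)
    ultimately show False using d by simp
  qed
  \<comment> \<open>If this vanished, \<open>bq s1\<close> would be zero on all combinations of
    \<open>u'\<close> and \<open>v'\<close>, so \<open>u' + v'\<close> would be a third point over
    the vertex.\<close>
  have dB: "dbq s1 u' v' \<noteq> 0" 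
  proof
    assume 0: "dbq s1 u' v' = 0"
    have z: "bq s1 (x *s u' + y *s v') = 0" for x y unfolding bq_add 0 u0' v0' by simp
    have "hom_equiv (1 *s u' + k *s v') u \<or> hom_equiv (1 *s u' + k *s v') v" if "k \<noteq> 0" for k
    proof (rule fib[OF _ z])
      show "1 *s u' + k *s v' \<noteq> 0"
      proof
        assume "1 *s u' + k *s v' = 0"
        then have "u' = (- k) *s v'" by (simp add: vec_eq_iff add_eq_0_iff2)
        then have "hom_equiv v' u'" using hom_equiv_scale[OF v'(1), of "- k"] that by (metis neg_equal_0_iff_equal)
        then show False using ne u' v' hom_equiv_sym hom_equiv_trans by blast
      qed
    qed
    from this[of 1] have "hom_equiv (u' + v') u \<or> hom_equiv (u' + v') v" by simp
    then have "hom_equiv (u' + v') u' \<or> hom_equiv (u' + v') v'"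
      using hom_equiv_trans[OF _ hom_equiv_sym[OF u'(2)]] hom_equiv_trans[OF _ hom_equiv_sym[OF v'(2)]] by blast
    then show False
    proof
      assume "hom_equiv (u' + v') u'"
      then have "hom_equiv u' (u' + v')" by (rule hom_equiv_sym)
      then obtain k where "u' + v' = k *s u'" by (rule equiv_scaleE)
      then have "v' = (k - 1) *s u'" by (simp add: vec_eq_iff algebra_simps)
      then have "hom_equiv u' v'" using v'(1) u'(1) by (metis hom_equiv_scale vector_smult_lzero)
      then show False using ne u' v' hom_equiv_sym hom_equiv_trans by blast
    next
      assume "hom_equiv (u' + v') v'"
      then have "hom_equiv v' (u' + v')" by (rule hom_equiv_sym)
      then obtain k where "u' + v' = k *s v'" by (rule equiv_scaleE)
      then have "u' = (k - 1) *s v'" by (simp add: vec_eq_iff algebra_simps)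
      then have "hom_equiv v' u'" using v'(1) u'(1) by (metis hom_equiv_scale vector_smult_lzero)
      then show False using ne u' v' hom_equiv_sym hom_equiv_trans by blast
    qed
  qed
  have dB': "dbq s1 v' u' = dbq s1 u' v'" unfolding dbq_def by (simp add: algebra_simps)
  have "t \<in> {dparam pp u' h + dparam pp v' k |h k. True}" for t
  proof -
    obtain \<alpha> \<beta> \<gamma> where t: "t = \<alpha> *s cx y1 + \<beta> *s cx y2 + \<gamma> *s cx y3" by (rule det3_cramerE[OF indep])
    let ?D = "bq s2 u' * bq s3 v' - bq s3 u' * bq s2 v'"
    let ?d = "dbq s1 u' v'"
    \<comment> \<open>\<open>\<xi>\<close> and \<open>\<eta>\<close> solve the 2 by 2 system for the
      coefficients of \<open>cx y2\<close> and \<open>cx y3\<close> by Cramer's rule. The Euler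
      direction \<open>u'\<close>, weighted by \<open>\<zeta>\<close>, then adjusts the coefficient
      of \<open>cx y1\<close>.\<close>
    define \<xi> where "\<xi> = (\<gamma> * bq s3 v' - \<beta> * bq s2 v') / (?D * ?d)"
    define \<eta> where "\<eta> = (\<beta> * bq s2 u' - \<gamma> * bq s3 u') / (?D * ?d)"
    have e2: "\<xi> * (?d * bq s3 u') + \<eta> * (?d * bq s3 v') = \<beta>"
    proof -
      have "\<xi> * (?d * bq s3 u') + \<eta> * (?d * bq s3 v') = ((\<gamma> * bq s3 v' - \<beta> * bq s2 v') * bq s3 u' + (\<beta> * bq s2 u' - \<gamma> * bq s3 u') * bq s3 v') / ?D"
        unfolding \<xi>_def \<eta>_def using dB by (simp add: add_divide_distrib mult.commute)
      also have "(\<gamma> * bq s3 v' - \<beta> * bq s2 v') * bq s3 u' + (\<beta> * bq s2 u' - \<gamma> * bq s3 u') * bq s3 v' = \<beta> * ?D" by (simp add: algebra_simps)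
      finally show ?thesis using d' by simp
    qed
    have e3: "\<xi> * (?d * bq s2 u') + \<eta> * (?d * bq s2 v') = \<gamma>"
    proof -
      have "\<xi> * (?d * bq s2 u') + \<eta> * (?d * bq s2 v') = ((\<gamma> * bq s3 v' - \<beta> * bq s2 v') * bq s2 u' + (\<beta> * bq s2 u' - \<gamma> * bq s3 u') * bq s2 v') / ?D"
        unfolding \<xi>_def \<eta>_def using dB by (simp add: add_divide_distrib mult.commute)
      also have "(\<gamma> * bq s3 v' - \<beta> * bq s2 v') * bq s2 u' + (\<beta> * bq s2 u' - \<gamma> * bq s3 u') * bq s2 v' = \<gamma> * ?D" by (simp add: algebra_simps)
      finally show ?thesis using d' by simp
    qed
    define \<tau> where "\<tau> = \<xi> * (dbq s2 u' v' * bq s3 u' + bq s2 u' * dbq s3 u' v') + \<eta> * (dbq s2 v' u' * bq s3 v' + bq s2 v' * dbq s3 v' u')"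
    have nzu: "4 * (bq s2 u' * bq s3 u') \<noteq> 0" using two_vanish[OF u'(1) u0'] by simp
    define \<zeta> where "\<zeta> = (\<alpha> - \<tau>) / (4 * (bq s2 u' * bq s3 u'))"
    have "dparam pp u' (\<xi> *s v' + \<zeta> *s u') + dparam pp v' (\<eta> *s u') = t"
    proof -
      have eu: "dparam pp u' u' = (4 * (bq s2 u' * bq s3 u')) *s cx y1"
        unfolding dparam_euler hom_param_cparam u0' by (simp add: vector_smult_assoc)
      have "dparam pp u' (\<xi> *s v' + \<zeta> *s u') + dparam pp v' (\<eta> *s u') =
         (\<tau> + \<zeta> * (4 * (bq s2 u' * bq s3 u'))) *s cx y1 + (\<xi> * (?d * bq s3 u') + \<eta> * (?d * bq s3 v')) *s cx y2
         + (\<xi> * (?d * bq s2 u') + \<eta> * (?d * bq s2 v')) *s cx y3"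
        unfolding dparam_add dparam_scale eu unfolding dparam_cparam u0' v0' dB' \<tau>_def
        by (simp add: vec_eq_iff algebra_simps)
      also have "\<tau> + \<zeta> * (4 * (bq s2 u' * bq s3 u')) = \<alpha>" unfolding \<zeta>_def using nzu by simp
      finally show ?thesis unfolding e2 e3 t .
    qed
    then show ?thesis by blast
  qed
  then have tr: "transversal_branches 4 pp ?U ?V"
    unfolding transversal_branches_def frechet_hom_param_4 u'_def[symmetric] v'_def[symmetric] by blast
  show ?thesis unfolding node_def
    by (rule exI[of _ ?U], rule exI[of _ ?V]) (use ne' tr pre in auto)
qed

end

section \<open>The equation of the Cremona image of a conic\<close>

definition crem_coeff :: "real^3 \<Rightarrow> real^3 \<Rightarrow> real^3 \<Rightarrow> real \<Rightarrow> real \<Rightarrow> real \<Rightarrow> real \<Rightarrow> real \<Rightarrow> real \<Rightarrow> nat \<Rightarrow> nat \<Rightarrow> real" where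
  "crem_coeff r1 r2 r3 a b c f g h = tensor_coeff (\<lambda>i j k l.
     a * (r2$i * r2$j * r3$k * r3$l) + b * (r1$i * r1$j * r3$k * r3$l) + c * (r1$i * r1$j * r2$k * r2$l)
     + 2 * f * (r1$i * r1$j * r2$k * r3$l) + 2 * g * (r2$i * r2$j * r1$k * r3$l) + 2 * h * (r3$i * r3$j * r1$k * r2$l))"

lemma ternary_form_crem_coeff:
  "ternary_form 4 (\<lambda>i j. of_real (crem_coeff r1 r2 r3 a b c f g h i j)) x =
     crem (of_real a) (of_real b) (of_real c) (of_real f) (of_real g) (of_real h) (lin (cx r1) x) (lin (cx r2) x) (lin (cx r3) x)"
proof -
  let ?T = "\<lambda>i j k l. a * (r2$i * r2$j * r3$k * r3$l) + b * (r1$i * r1$j * r3$k * r3$l) + c * (r1$i * r1$j * r2$k * r2$l)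
     + 2 * f * (r1$i * r1$j * r2$k * r3$l) + 2 * g * (r2$i * r2$j * r1$k * r3$l) + 2 * h * (r3$i * r3$j * r1$k * r2$l)"
  have 1: "(\<lambda>i j. complex_of_real (crem_coeff r1 r2 r3 a b c f g h i j)) = tensor_coeff (\<lambda>i j k l. complex_of_real (?T i j k l))"
    unfolding crem_coeff_def tensor_coeff_def[abs_def] of_real_sum
    by (intro ext sum.cong refl) simp
  have 2: "crem A B C F G H p q r = A * (q * q * (r * r)) + B * (p * p * (r * r)) + C * (p * p * (q * q))
      + (2 * F) * (p * p * (q * r)) + (2 * G) * (q * q * (p * r)) + (2 * H) * (r * r * (p * q))" for A B C F G H p q r :: complex
    unfolding crem_def by (simp add: algebra_simps power2_eq_square)
  show ?thesis
    unfolding 1 2 ternary_form_tensor lin_product_tensor sum_distrib_left sum.distrib[symmetric]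
    by (intro sum.cong refl) (simp add: algebra_simps)
qed

lemma plc_ternary_form: "plc d (ternary_form d e a) (\<lambda>s. ternary_form d e (s *s a + b))"
proof -
  have "plc d (e i j * (a$1)^i * (a$2)^j * (a$3)^(d - i - j)) (\<lambda>s. e i j * ((s *s a + b)$1)^i * ((s *s a + b)$2)^j * ((s *s a + b)$3)^(d - i - j))"
    if "i \<le> d" "j \<le> d - i" for i j
  proof -
    have "plc (((0 + 1 * i) + 1 * j) + 1 * (d - i - j)) (e i j * (a$1)^i * (a$2)^j * (a$3)^(d - i - j))
      (\<lambda>s. e i j * ((s *s a + b)$1)^i * ((s *s a + b)$2)^j * ((s *s a + b)$3)^(d - i - j))"
      by (intro plc_mult plc_power plc_const plc_vec_linear)
    moreover have "((0 + 1 * i) + 1 * j) + 1 * (d - i - j) = d" using that by simp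
    ultimately show ?thesis by simp
  qed
  then show ?thesis unfolding ternary_form_def by (intro plc_sum) auto
qed

lemma ternary_form_differentiable: "\<exists>D. (ternary_form d e has_derivative D) (at x)"
proof -
  have nd: "(\<lambda>x. x $ i) differentiable at x" for i and x :: "complex^3"
    unfolding differentiable_def using vec_nth_has_derivative[OF has_derivative_ident] by blast
  have "(\<lambda>x. \<Sum>i\<le>d. \<Sum>j\<le>d - i. e i j * (x $ 1) ^ i * (x $ 2) ^ j * (x $ 3) ^ (d - i - j)) differentiable (at x)"
    by (intro differentiable_sum ballI finite_atMost differentiable_mult differentiable_power differentiable_const nd)
  then show ?thesis unfolding differentiable_def ternary_form_def[abs_def] .
qed

lemma (in cremona_param) vertex_preimage_nonempty: "\<exists>w. w \<noteq> 0 \<and> hom_equiv (PP w) (cx y1)"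
proof -
  obtain u v where u: "u \<noteq> 0" and v: "v \<noteq> 0" and ne: "\<not> hom_equiv u v" and u0: "bq s1 u = 0" and v0: "bq s1 v = 0"
    and d: "bq s2 u * bq s3 v - bq s3 u * bq s2 v \<noteq> 0" and fib: "\<And>w. w \<noteq> 0 \<Longrightarrow> bq s1 w = 0 \<Longrightarrow> hom_equiv w u \<or> hom_equiv w v"
    by (rule vertex_preimage) blast
  show ?thesis using PP_vertex[OF u] u u0 by blast
qed

lemma (in cremona_param) pp_rotate: "cparam y2 y3 y1 s2 s3 s1 = pp" "cparam y3 y1 y2 s3 s1 s2 = pp"
  by (rule cparam_rotate, rule trans[OF cparam_rotate cparam_rotate])

lemma complex_double_zero: "2 * x = 0 \<Longrightarrow> x = (0::complex)"
  by simp

locale cremona_curve = cremona_param +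
  fixes r1 r2 r3 :: "real^3"
  assumes dual: "\<And>x. x = lin (cx r1) x *s cx y1 + lin (cx r2) x *s cx y2 + lin (cx r3) x *s cx y3"
begin

abbreviation "cc \<equiv> crem_coeff r1 r2 r3 a b c f g h"
abbreviation "MM \<equiv> polar (\<lambda>i j. complex_of_real (cc i j))"
abbreviation "CR \<equiv> crem (complex_of_real a) (of_real b) (of_real c) (of_real f) (of_real g) (of_real h)"

lemma MM_eq: "MM x x x x = CR (lin (cx r1) x) (lin (cx r2) x) (lin (cx r3) x)"
  unfolding ternary_form_polar[symmetric] by (rule ternary_form_crem_coeff)

lemma coords:
  "lin (cx r1) (x *s cx y1 + y *s cx y2 + z *s cx y3) = x"
  "lin (cx r2) (x *s cx y1 + y *s cx y2 + z *s cx y3) = y"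
  "lin (cx r3) (x *s cx y1 + y *s cx y2 + z *s cx y3) = z"
proof -
  let ?v = "x *s cx y1 + y *s cx y2 + z *s cx y3"
  have "(lin (cx r1) ?v - x) *s cx y1 + (lin (cx r2) ?v - y) *s cx y2 + (lin (cx r3) ?v - z) *s cx y3
     = (lin (cx r1) ?v *s cx y1 + lin (cx r2) ?v *s cx y2 + lin (cx r3) ?v *s cx y3) - ?v"
    by (simp add: vec_eq_iff algebra_simps)
  also have "\<dots> = 0" using dual[of ?v] by simp
  finally have "lin (cx r1) ?v - x = 0 \<and> lin (cx r2) ?v - y = 0 \<and> lin (cx r3) ?v - z = 0" by (rule det3_indep[OF indep])
  then show "lin (cx r1) ?v = x" "lin (cx r2) ?v = y" "lin (cx r3) ?v = z" by simp_all
qed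

lemma MM_frame: "MM (x *s cx y1 + y *s cx y2 + z *s cx y3) (x *s cx y1 + y *s cx y2 + z *s cx y3)
   (x *s cx y1 + y *s cx y2 + z *s cx y3) (x *s cx y1 + y *s cx y2 + z *s cx y3) = CR x y z"
  unfolding MM_eq coords ..

lemma nzc: "complex_of_real a \<noteq> 0" "complex_of_real b \<noteq> 0" "complex_of_real c \<noteq> 0"
  "qdet (complex_of_real a) (of_real b) (of_real c) (of_real f) (of_real g) (of_real h) \<noteq> 0"
proof -
  have "qdet (complex_of_real a) (of_real b) (of_real c) (of_real f) (of_real g) (of_real h) = of_real (qdet a b c f g h)"
    unfolding qdet_def by simp
  then show "qdet (complex_of_real a) (of_real b) (of_real c) (of_real f) (of_real g) (of_real h) \<noteq> 0" 
    using nz by (simp only: of_real_eq_0_iff not_False_eq_True)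
qed (use nz in simp_all)

text \<open>Restriction to the lines through \<open>x\<close> in the three frame directions yields
  the partial derivatives that \<open>crem_singular\<close> asks for, each up to a factor 2.\<close>

lemma singular_vertex:
  assumes "\<And>v. MM x x x v = 0"
  shows "lin (cx r1) x = 0 \<and> lin (cx r2) x = 0 \<or> lin (cx r1) x = 0 \<and> lin (cx r3) x = 0 \<or> lin (cx r2) x = 0 \<and> lin (cx r3) x = 0"
proof -
  define \<alpha> \<beta> \<gamma> where "\<alpha> = lin (cx r1) x" and "\<beta> = lin (cx r2) x" and "\<gamma> = lin (cx r3) x"
  have x: "x = \<alpha> *s cx y1 + \<beta> *s cx y2 + \<gamma> *s cx y3" unfolding \<alpha>_def \<beta>_def \<gamma>_def by (rule dual)
  let ?a = "complex_of_real a" and ?b = "complex_of_real b" and ?c = "complex_of_real c"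
    and ?f = "complex_of_real f" and ?g = "complex_of_real g" and ?h = "complex_of_real h"
  have z: "d = 0" if d: "((\<lambda>s. MM (s *s v + x) (s *s v + x) (s *s v + x) (s *s v + x)) has_field_derivative d) (at 0)" for v d
  proof -
    have l: "((\<lambda>s. s *s v + x) has_derivative (\<lambda>t. t *s v)) (at 0)"
      by (rule has_derivative_vec) (auto intro!: derivative_eq_intros)
    have "((\<lambda>s. MM (s *s v + x) (s *s v + x) (s *s v + x) (s *s v + x)) has_derivative (\<lambda>t. 4 * MM (0 *s v + x) (0 *s v + x) (0 *s v + x) (t *s v))) (at 0)"
      by (rule has_derivative_compose[OF l polar_diag_has_derivative])
    then have "((\<lambda>s. MM (s *s v + x) (s *s v + x) (s *s v + x) (s *s v + x)) has_derivative (\<lambda>t. t * 0)) (at 0)"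
      using assms by simp
    from DERIV_unique[OF d has_field_derivativeI[OF this]] show ?thesis .
  qed
  have "(\<lambda>s. MM (s *s cx y1 + x) (s *s cx y1 + x) (s *s cx y1 + x) (s *s cx y1 + x)) = (\<lambda>s. CR (s + \<alpha>) \<beta> \<gamma>)"
    "(\<lambda>s. MM (s *s cx y2 + x) (s *s cx y2 + x) (s *s cx y2 + x) (s *s cx y2 + x)) = (\<lambda>s. CR \<alpha> (s + \<beta>) \<gamma>)"
    "(\<lambda>s. MM (s *s cx y3 + x) (s *s cx y3 + x) (s *s cx y3 + x) (s *s cx y3 + x)) = (\<lambda>s. CR \<alpha> \<beta> (s + \<gamma>))"
  proof -
    have e: "s *s cx y1 + x = (s + \<alpha>) *s cx y1 + \<beta> *s cx y2 + \<gamma> *s cx y3"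
      "s *s cx y2 + x = \<alpha> *s cx y1 + (s + \<beta>) *s cx y2 + \<gamma> *s cx y3"
      "s *s cx y3 + x = \<alpha> *s cx y1 + \<beta> *s cx y2 + (s + \<gamma>) *s cx y3" for s
      by (subst x, simp add: vec_eq_iff algebra_simps)+
    show "(\<lambda>s. MM (s *s cx y1 + x) (s *s cx y1 + x) (s *s cx y1 + x) (s *s cx y1 + x)) = (\<lambda>s. CR (s + \<alpha>) \<beta> \<gamma>)"
      "(\<lambda>s. MM (s *s cx y2 + x) (s *s cx y2 + x) (s *s cx y2 + x) (s *s cx y2 + x)) = (\<lambda>s. CR \<alpha> (s + \<beta>) \<gamma>)"
      "(\<lambda>s. MM (s *s cx y3 + x) (s *s cx y3 + x) (s *s cx y3 + x) (s *s cx y3 + x)) = (\<lambda>s. CR \<alpha> \<beta> (s + \<gamma>))"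
      unfolding e MM_frame by (rule refl)+
  qed
  note e = this
  have "((\<lambda>s. CR (s + \<alpha>) \<beta> \<gamma>) has_field_derivative 2 * (?b*\<alpha>*\<gamma>^2 + ?c*\<alpha>*\<beta>^2 + 2*?f*\<alpha>*\<beta>*\<gamma> + ?g*\<beta>^2*\<gamma> + ?h*\<beta>*\<gamma>^2)) (at 0)"
    unfolding crem_def by (auto intro!: derivative_eq_intros simp: algebra_simps power2_eq_square)
  then have d1: "?b*\<alpha>*\<gamma>^2 + ?c*\<alpha>*\<beta>^2 + 2*?f*\<alpha>*\<beta>*\<gamma> + ?g*\<beta>^2*\<gamma> + ?h*\<beta>*\<gamma>^2 = 0" by - (rule complex_double_zero, rule z[of "cx y1", unfolded e])
  have "((\<lambda>s. CR \<alpha> (s + \<beta>) \<gamma>) has_field_derivative 2 * (?a*\<beta>*\<gamma>^2 + ?c*\<alpha>^2*\<beta> + ?f*\<alpha>^2*\<gamma> + 2*?g*\<alpha>*\<beta>*\<gamma> + ?h*\<alpha>*\<gamma>^2)) (at 0)"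
    unfolding crem_def by (auto intro!: derivative_eq_intros simp: algebra_simps power2_eq_square)
  then have d2: "?a*\<beta>*\<gamma>^2 + ?c*\<alpha>^2*\<beta> + ?f*\<alpha>^2*\<gamma> + 2*?g*\<alpha>*\<beta>*\<gamma> + ?h*\<alpha>*\<gamma>^2 = 0" by - (rule complex_double_zero, rule z[of "cx y2", unfolded e])
  have "((\<lambda>s. CR \<alpha> \<beta> (s + \<gamma>)) has_field_derivative 2 * (?a*\<beta>^2*\<gamma> + ?b*\<alpha>^2*\<gamma> + ?f*\<alpha>^2*\<beta> + ?g*\<alpha>*\<beta>^2 + 2*?h*\<alpha>*\<beta>*\<gamma>)) (at 0)"
    unfolding crem_def by (auto intro!: derivative_eq_intros simp: algebra_simps power2_eq_square)
  then have d3: "?a*\<beta>^2*\<gamma> + ?b*\<alpha>^2*\<gamma> + ?f*\<alpha>^2*\<beta> + ?g*\<alpha>*\<beta>^2 + 2*?h*\<alpha>*\<beta>*\<gamma> = 0" by - (rule complex_double_zero, rule z[of "cx y3", unfolded e])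
  have "CR \<alpha> \<beta> \<gamma> = 0" using assms[of x] MM_eq[of x] unfolding \<alpha>_def \<beta>_def \<gamma>_def by simp
  from crem_singular[OF nzc this d1 d2 d3] show ?thesis unfolding \<alpha>_def \<beta>_def \<gamma>_def .
qed

lemma vertex_on_curve: "\<exists>w. w \<noteq> 0 \<and> hom_equiv (PP w) (cx y1)" "\<exists>w. w \<noteq> 0 \<and> hom_equiv (PP w) (cx y2)" "\<exists>w. w \<noteq> 0 \<and> hom_equiv (PP w) (cx y3)"
  by (rule vertex_preimage_nonempty)
     (rule cremona_param.vertex_preimage_nonempty[OF rotate, unfolded pp_rotate]
       cremona_param.vertex_preimage_nonempty[OF cremona_param.rotate[OF rotate], unfolded pp_rotate])+

lemma node_vertices: "node 4 pp (abs_cproj (cx y1))" "node 4 pp (abs_cproj (cx y2))" "node 4 pp (abs_cproj (cx y3))"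
  by (rule node_vertex)
     (rule cremona_param.node_vertex[OF rotate, unfolded pp_rotate]
       cremona_param.node_vertex[OF cremona_param.rotate[OF rotate], unfolded pp_rotate])+

lemma y_nonzero: "y1 \<noteq> 0" "y2 \<noteq> 0" "y3 \<noteq> 0"
  using indep det3_refl(4) det3_refl(5) det3_refl(6) cx_nonzero by metis+

lemma vertex_cases:
  assumes "x \<noteq> 0" "lin (cx r1) x = 0 \<and> lin (cx r2) x = 0 \<or> lin (cx r1) x = 0 \<and> lin (cx r3) x = 0 \<or> lin (cx r2) x = 0 \<and> lin (cx r3) x = 0"
  shows "hom_equiv (cx y1) x \<or> hom_equiv (cx y2) x \<or> hom_equiv (cx y3) x"
proof -
  have "\<exists>k v. x = k *s v \<and> v \<in> {cx y1, cx y2, cx y3}"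
    using assms(2)
  proof (elim disjE)
    assume "lin (cx r1) x = 0 \<and> lin (cx r2) x = 0"
    then have "x = lin (cx r3) x *s cx y3" using dual[of x] by simp
    then show ?thesis by blast
  next
    assume "lin (cx r1) x = 0 \<and> lin (cx r3) x = 0"
    then have "x = lin (cx r2) x *s cx y2" using dual[of x] by simp
    then show ?thesis by blast
  next
    assume "lin (cx r2) x = 0 \<and> lin (cx r3) x = 0"
    then have "x = lin (cx r1) x *s cx y1" using dual[of x] by simp
    then show ?thesis by blast
  qed
  then obtain k v where "x = k *s v" "v \<in> {cx y1, cx y2, cx y3}" by blast
  moreover have "k \<noteq> 0" "v \<noteq> 0" using calculation assms(1) by auto
  ultimately show ?thesis using hom_equiv_scale[of v k] by auto
qed

text \<open>On the triangle the curve has only the vertices. Off it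
  \<open>(\<beta>*\<gamma>, \<alpha>*\<gamma>, \<alpha>*\<beta>)\<close> is a point of the conic,
  and a second application of the Cremona map returns \<open>x\<close> up to the factor
  \<open>\<alpha>*\<beta>*\<gamma>\<close>.\<close>

lemma on_curve_iff:
  assumes "x \<noteq> 0"
  shows "MM x x x x = 0 \<longleftrightarrow> (\<exists>w. w \<noteq> 0 \<and> hom_equiv (PP w) x)"
proof
  assume 0: "MM x x x x = 0"
  define \<alpha> \<beta> \<gamma> where "\<alpha> = lin (cx r1) x" and "\<beta> = lin (cx r2) x" and "\<gamma> = lin (cx r3) x"
  have x: "x = \<alpha> *s cx y1 + \<beta> *s cx y2 + \<gamma> *s cx y3" unfolding \<alpha>_def \<beta>_def \<gamma>_def by (rule dual)
  have cr: "CR \<alpha> \<beta> \<gamma> = 0" using 0 MM_eq[of x] unfolding \<alpha>_def \<beta>_def \<gamma>_def by simp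
  show "\<exists>w. w \<noteq> 0 \<and> hom_equiv (PP w) x"
  proof (cases "\<alpha> * \<beta> * \<gamma> = 0")
    case True
    then consider "\<alpha> = 0" | "\<beta> = 0" | "\<gamma> = 0" by auto
    then have "\<alpha> = 0 \<and> \<beta> = 0 \<or> \<alpha> = 0 \<and> \<gamma> = 0 \<or> \<beta> = 0 \<and> \<gamma> = 0"
      by cases (use cr nz in \<open>auto simp: crem_def\<close>)
    from vertex_cases[OF assms this[unfolded \<alpha>_def \<beta>_def \<gamma>_def]] vertex_on_curve hom_equiv_trans show ?thesis by blast
  next
    case False
    from onto[OF cr[unfolded crem_qform]] False
    obtain w k where w: "w \<noteq> 0" "k \<noteq> 0" "\<beta> * \<gamma> = k * bq s1 w" "\<alpha> * \<gamma> = k * bq s2 w" "\<alpha> * \<beta> = k * bq s3 w" by auto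
    have "(k^2) *s PP w = (\<alpha> * \<beta> * \<gamma>) *s x"
    proof -
      have "k^2 * (bq s2 w * bq s3 w) = (\<alpha> * \<gamma>) * (\<alpha> * \<beta>)" "k^2 * (bq s1 w * bq s3 w) = (\<beta> * \<gamma>) * (\<alpha> * \<beta>)"
        "k^2 * (bq s1 w * bq s2 w) = (\<beta> * \<gamma>) * (\<alpha> * \<gamma>)"
        unfolding w(3-5) by (simp_all add: power2_eq_square algebra_simps)
      then have "(k^2) *s PP w = ((\<alpha> * \<gamma>) * (\<alpha> * \<beta>)) *s cx y1 + ((\<beta> * \<gamma>) * (\<alpha> * \<beta>)) *s cx y2 + ((\<beta> * \<gamma>) * (\<alpha> * \<gamma>)) *s cx y3"
        unfolding hom_param_cparam vector_add_ldistrib vector_smult_assoc by simp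
      also have "\<dots> = (\<alpha> * \<beta> * \<gamma>) *s x" by (subst x) (simp add: vec_eq_iff algebra_simps)
      finally show ?thesis .
    qed
    moreover have "hom_equiv (PP w) ((k^2) *s PP w)" using PP_nonzero[OF w(1)] w(2) by (simp add: hom_equiv_scale)
    moreover have "hom_equiv x ((\<alpha> * \<beta> * \<gamma>) *s x)" using assms False by (rule hom_equiv_scale)
    ultimately show ?thesis using w(1) hom_equiv_sym hom_equiv_trans by metis
  qed
next
  assume "\<exists>w. w \<noteq> 0 \<and> hom_equiv (PP w) x"
  then obtain w where w: "w \<noteq> 0" "hom_equiv (PP w) x" by blast
  obtain k where k: "x = k *s PP w" using w(2) by (rule equiv_scaleE)
  have "MM (PP w) (PP w) (PP w) (PP w) = (bq s1 w * bq s2 w * bq s3 w)^2 *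
      qform (of_real a) (of_real b) (of_real c) (of_real f) (of_real g) (of_real h) (bq s1 w) (bq s2 w) (bq s3 w)"
    unfolding hom_param_cparam MM_frame crem_qform qform_def by (simp add: algebra_simps power2_eq_square)
  then show "MM x x x x = 0" unfolding k polar_scale conic by simp
qed

lemma param_range: "{x. ternary_form 4 (\<lambda>i j. of_real (cc i j)) (rep_cproj x) = 0} = range (param_map 4 pp)"
proof (intro set_eqI iffI)
  fix x assume "x \<in> {x. ternary_form 4 (\<lambda>i j. of_real (cc i j)) (rep_cproj x) = 0}"
  then obtain w where w: "w \<noteq> 0" "hom_equiv (PP w) (rep_cproj x)"
    using on_curve_iff[OF rep_cproj_nonzero[of x]] by (auto simp: ternary_form_polar)
  have "param_map 4 pp (abs_cproj w) = abs_cproj (rep_cproj x)"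
    unfolding param_map_eq_iff[OF rep_cproj_nonzero] using PP_equiv[OF rep_abs_cproj[OF w(1)]] w(2) hom_equiv_trans by blast
  then show "x \<in> range (param_map 4 pp)" by (metis abs_rep_cproj rangeI)
next
  fix x assume "x \<in> range (param_map 4 pp)"
  then obtain u where "x = param_map 4 pp u" by blast
  then have "\<exists>w. w \<noteq> 0 \<and> hom_equiv (PP w) (rep_cproj x)"
    using param_map_eq_iff[OF rep_cproj_nonzero[of x], of u] rep_cproj_nonzero by (metis abs_rep_cproj)
  then show "x \<in> {x. ternary_form 4 (\<lambda>i j. of_real (cc i j)) (rep_cproj x) = 0}"
    using on_curve_iff[OF rep_cproj_nonzero[of x]] by (auto simp: ternary_form_polar)
qed

text \<open>A repeated factor has a zero on the line \<open>x + y + z = 0\<close>, where the curve would be singular,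
  although that line contains no vertex.\<close>

lemma squarefree: "squarefree_form 4 (\<lambda>i j. of_real (cc i j))"
  unfolding squarefree_form_def
proof (intro conjI notI)
  have "ternary_form 4 (\<lambda>i j. of_real (cc i j)) (0 *s cx y1 + 1 *s cx y2 + 1 *s cx y3) = of_real a"
    unfolding ternary_form_polar MM_frame by (simp add: crem_def)
  then show "\<exists>x. ternary_form 4 (\<lambda>i j. of_real (cc i j)) x \<noteq> 0" using nz by (metis of_real_eq_0_iff)
next
  assume "\<exists>e g h. 0 < e \<and> 2 * e \<le> 4 \<and>
     (\<forall>x. ternary_form 4 (\<lambda>i j. of_real (cc i j)) x = (ternary_form e g x)\<^sup>2 * ternary_form (4 - 2 * e) h x)"
  then obtain e G H where e: "0 < e" and F: "\<And>x. MM x x x x = (ternary_form e G x)\<^sup>2 * ternary_form (4 - 2 * e) H x"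
    unfolding ternary_form_polar[where c = "\<lambda>i j. of_real (cc i j)"] by blast
  have sing: "MM x x x v = 0" if x: "ternary_form e G x = 0" for x v
  proof -
    obtain D where D: "(ternary_form e G has_derivative D) (at x)" using ternary_form_differentiable by blast
    obtain D' where D': "(ternary_form (4 - 2 * e) H has_derivative D') (at x)" using ternary_form_differentiable by blast
    have "((\<lambda>x. (ternary_form e G x)\<^sup>2 * ternary_form (4 - 2 * e) H x) has_derivative (\<lambda>h. 0)) (at x)"
      by (rule has_derivative_eq_rhs, (rule derivative_intros D D')+) (simp add: x)
    then have "((\<lambda>x. MM x x x x) has_derivative (\<lambda>h. 0)) (at x)" unfolding F .
    from has_derivative_unique[OF polar_diag_has_derivative this] have "4 * MM x x x v = 0" by (rule fun_cong)
    then show ?thesis by simp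
  qed
  let ?d = "0 *s cx y1 + 1 *s cx y2 + (-1) *s cx y3" and ?o = "1 *s cx y1 + 0 *s cx y2 + (-1) *s cx y3"
  have "\<exists>x. ternary_form e G x = 0 \<and> (x = ?d \<or> (\<exists>t. x = t *s ?d + ?o))"
  proof (cases "ternary_form e G ?d = 0")
    case True then show ?thesis by blast
  next
    case False
    from plc_root[OF plc_ternary_form this e] show ?thesis by blast
  qed
  then obtain x where x: "ternary_form e G x = 0" and xd: "x = ?d \<or> (\<exists>t. x = t *s ?d + ?o)" by blast
  have "\<exists>p q r. x = p *s cx y1 + q *s cx y2 + r *s cx y3 \<and> \<not> (p = 0 \<and> q = 0 \<or> p = 0 \<and> r = 0 \<or> q = 0 \<and> r = 0)"
    using xd
  proof
    assume "x = ?d"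
    then show ?thesis by (intro exI[of _ 0] exI[of _ 1] exI[of _ "-1"]) simp
  next
    assume "\<exists>t. x = t *s ?d + ?o"
    then obtain t where "x = t *s ?d + ?o" by blast
    then have "x = 1 *s cx y1 + t *s cx y2 + (- t - 1) *s cx y3" by (simp add: vec_eq_iff algebra_simps)
    moreover have "\<not> ((1::complex) = 0 \<and> t = 0 \<or> (1::complex) = 0 \<and> - t - 1 = 0 \<or> t = 0 \<and> - t - 1 = 0)" by auto
    ultimately show ?thesis by blast
  qed
  then show False using singular_vertex[OF sing[OF x]] coords by metis
qed

lemma singular_real_nodes:
  assumes "x \<in> singular_points 4 cc"
  shows "node 4 pp x \<and> real_point x"
proof -
  have "\<And>v. MM (rep_cproj x) (rep_cproj x) (rep_cproj x) v = 0" using assms unfolding singular_points_4 by blast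
  from vertex_cases[OF rep_cproj_nonzero singular_vertex[OF this]]
  have "x = abs_cproj (cx y1) \<or> x = abs_cproj (cx y2) \<or> x = abs_cproj (cx y3)"
    using abs_cproj_eq_iff[of _ "rep_cproj x"] y_nonzero by (metis abs_rep_cproj cx_nonzero rep_cproj_nonzero)
  then show ?thesis using node_vertices y_nonzero unfolding real_point_cx by blast
qed

lemma real_rational: "real_rational_curve 4 pp cc {x. ternary_form 4 (\<lambda>i j. of_real (cc i j)) (rep_cproj x) = 0}"
  unfolding real_rational_curve_def real_plane_curve_def
  using no_common_root squarefree param_range by blast

end

section \<open>Dual frames and real parametrizations of indefinite conics\<close>

definition rdet :: "real^3 \<Rightarrow> real^3 \<Rightarrow> real^3 \<Rightarrow> real" where
  "rdet x y z = x$1 * (y$2 * z$3 - y$3 * z$2) - x$2 * (y$1 * z$3 - y$3 * z$1) + x$3 * (y$1 * z$2 - y$2 * z$1)"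

lemma det3_cx: "det3 (cx x) (cx y) (cx z) = of_real (rdet x y z)"
  unfolding det3_def rdet_def by simp

definition cof :: "real^3 \<Rightarrow> real^3 \<Rightarrow> real^3" where
  "cof y z = (\<chi> i. if i = 1 then y$2 * z$3 - y$3 * z$2 else if i = 2 then y$3 * z$1 - y$1 * z$3 else y$1 * z$2 - y$2 * z$1)"

lemma cof_nth [simp]: "cof y z $ 1 = y$2 * z$3 - y$3 * z$2" "cof y z $ 2 = y$3 * z$1 - y$1 * z$3" "cof y z $ 3 = y$1 * z$2 - y$2 * z$1"
  unfolding cof_def by simp_all

lemma dual_rows:
  assumes D: "rdet r1 r2 r3 \<noteq> 0"
  defines "k \<equiv> 1 / rdet r1 r2 r3"
  shows "x = lin (cx r1) x *s cx (k *s cof r2 r3) + lin (cx r2) x *s cx (k *s cof r3 r1) + lin (cx r3) x *s cx (k *s cof r1 r2)"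
proof -
  let ?c = "\<lambda>y. cx y"
  have "complex_of_real (rdet r1 r2 r3) * x $ j = lin (cx r1) x * of_real (cof r2 r3 $ j) + lin (cx r2) x * of_real (cof r3 r1 $ j) + lin (cx r3) x * of_real (cof r1 r2 $ j)" for j
    using exhaust_3[of j] unfolding rdet_def lin_def sum_3 by (auto simp: algebra_simps)
  then have "x $ j = of_real k * (lin (cx r1) x * of_real (cof r2 r3 $ j) + lin (cx r2) x * of_real (cof r3 r1 $ j) + lin (cx r3) x * of_real (cof r1 r2 $ j))" for j
    using D unfolding k_def by (simp add: field_simps)
  then show ?thesis by (simp add: vec_eq_iff algebra_simps)
qed

lemma frame_of_dual:
  assumes "\<And>x. x = lin q1 x *s v1 + lin q2 x *s v2 + lin q3 x *s v3"
  shows "det3 v1 v2 v3 \<noteq> 0"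
proof
  assume d: "det3 v1 v2 v3 = 0"
  then have d': "det3 v1 v3 v2 = 0" "det3 v2 v1 v3 = 0" "det3 v3 v1 v2 = 0" "det3 v2 v3 v1 = 0" "det3 v3 v2 v1 = 0"
    unfolding det3_def by (simp_all add: algebra_simps)
  have ex: "\<exists>a b k. t = a *s v1 + b *s v2 + k *s v3" for t using assms by blast
  obtain a1 b1 k1 where 1: "axis 1 1 = a1 *s v1 + b1 *s v2 + k1 *s v3" using ex by blast
  obtain a2 b2 k2 where 2: "axis 2 1 = a2 *s v1 + b2 *s v2 + k2 *s v3" using ex by blast
  obtain a3 b3 k3 where 3: "axis 3 1 = a3 *s v1 + b3 *s v2 + k3 *s v3" using ex by blast
  have "det3 (axis 1 1) (axis 2 1) (axis 3 1) = 0"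
    unfolding 1 2 3 by (simp add: det3_add det3_scale d d')
  then show False by (simp add: det3_def axis_def)
qed

lemma qform_square_sum:
  fixes a b c f g h :: "'a::comm_ring_1"
  shows "(a*b - h^2) * a * qform a b c f g h x y z =
    (a*b - h^2) * (a*x + h*y + g*z)^2 + ((a*b - h^2)*y + (a*f - g*h)*z)^2 + a * qdet a b c f g h * z^2"
  unfolding qform_def qdet_def by (simp add: algebra_simps power2_eq_square)

lemma rdet_add_scale:
  "rdet (x + x') y z = rdet x y z + rdet x' y z" "rdet x y (z + z') = rdet x y z + rdet x y z'"
  "rdet (k *s x) y z = k * rdet x y z" "rdet x y (k *s z) = k * rdet x y z"
  "rdet x y x = 0" "rdet z y x = - rdet x y z"
  unfolding rdet_def by (simp_all add: algebra_simps)

lemma cx_linear: "cx (x + y) = cx x + cx y" "cx (k *s x) = of_real k *s cx x"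
  by (simp_all add: vec_eq_iff)

lemma lin_row_linear: "lin (p + q) x = lin p x + lin q x" "lin (k *s p) x = k * lin p x"
  unfolding lin_def by (simp add: distrib_right sum.distrib, simp add: sum_distrib_left mult_ac)

text \<open>With \<open>e2 = u^2 * e1\<close> and \<open>e3 = - (v^2 * e1)\<close> the last two
  squares form a difference of squares and split into real linear factors. The resulting form
  \<open>t2^2 - t1 * t3\<close> is the one whose zeros are parametrized by two squares and a
  product.\<close>

lemma isotropic_rows:
  assumes D: "rdet l1 l2 l3 \<noteq> 0" and e: "0 < e1 * e2" "e1 * e3 < 0"
  shows "\<exists>t1 t2 t3 k. rdet t1 t2 t3 \<noteq> 0 \<and> k \<noteq> 0 \<and>
    (\<forall>x. of_real e1 * (lin (cx l1) x)^2 + of_real e2 * (lin (cx l2) x)^2 + of_real e3 * (lin (cx l3) x)^2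
      = of_real k * ((lin (cx t2) x)^2 - lin (cx t1) x * lin (cx t3) x))"
proof -
  have e1: "e1 \<noteq> 0" using e by auto
  define u v where "u = sqrt (e2 / e1)" and "v = sqrt (- e3 / e1)"
  have r: "0 < e2 / e1" "0 < - e3 / e1"
    using e by (auto simp: zero_less_mult_iff mult_less_0_iff zero_less_divide_iff divide_less_0_iff)
  have u: "u^2 * e1 = e2" "u \<noteq> 0" unfolding u_def using r e1 by auto
  have v: "v^2 * e1 = - e3" "v \<noteq> 0" unfolding v_def using r e1 by auto
  let ?t1 = "v *s l3 + (- u) *s l2" and ?t3 = "v *s l3 + u *s l2"
  have "rdet ?t1 l1 ?t3 = 2 * u * v * rdet l3 l1 l2"
    by (simp only: rdet_add_scale(1-5)) (simp add: rdet_add_scale(6)[of l3 l1 l2])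
  moreover have "rdet l3 l1 l2 = rdet l1 l2 l3" unfolding rdet_def by (simp add: algebra_simps)
  ultimately have "rdet ?t1 l1 ?t3 \<noteq> 0" using D u v by simp
  moreover have "of_real e1 * (lin (cx l1) x)^2 + of_real e2 * (lin (cx l2) x)^2 + of_real e3 * (lin (cx l3) x)^2
      = of_real e1 * ((lin (cx l1) x)^2 - lin (cx ?t1) x * lin (cx ?t3) x)" for x
  proof -
    have 1: "complex_of_real e2 = (of_real u)^2 * of_real e1" using u(1) by (metis of_real_mult of_real_power)
    have "complex_of_real (- e3) = (of_real v)^2 * of_real e1" using v(1) by (metis of_real_mult of_real_power)
    then have 2: "complex_of_real e3 = - ((of_real v)^2 * of_real e1)" by (metis minus_minus of_real_minus)
    show ?thesis unfolding cx_linear lin_row_linear 1 2 by (simp add: algebra_simps power2_eq_square)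
  qed
  ultimately show ?thesis using e1 by blast
qed

text \<open>Completing squares diagonalizes the form over the reals. Since it is indefinite, in a
  suitable order the first two signs agree and the third differs.\<close>

lemma good_isotropic:
  assumes "good a b c f g h"
  shows "\<exists>t1 t2 t3 k. rdet t1 t2 t3 \<noteq> 0 \<and> k \<noteq> 0 \<and>
    (\<forall>x. qform (of_real a) (of_real b) (of_real c) (of_real f) (of_real g) (of_real h) (x$1) (x$2) (x$3)
      = of_real k * ((lin (cx t2) x)^2 - lin (cx t1) x * lin (cx t3) x))"
proof -
  define mm where "mm = a*b - h^2"
  define d where "d = qdet a b c f g h"
  have nz: "a \<noteq> 0" "mm \<noteq> 0" "d \<noteq> 0" and ind: "\<not> (0 < a * d \<and> 0 < mm)"
    using assms unfolding good_def mm_def d_def by auto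
  define l1 l2 l3 :: "real^3" where "l1 = vector [a, h, g]" and "l2 = vector [0, mm, a*f - g*h]" and "l3 = vector [0, 0, 1]"
  define e1 e2 e3 where "e1 = 1 / a" and "e2 = 1 / (mm * a)" and "e3 = d / mm"
  have D: "rdet l1 l2 l3 = a * mm" unfolding rdet_def l1_def l2_def l3_def by simp
  have eq: "qform (of_real a) (of_real b) (of_real c) (of_real f) (of_real g) (of_real h) (x$1) (x$2) (x$3)
     = of_real e1 * (lin (cx l1) x)^2 + of_real e2 * (lin (cx l2) x)^2 + of_real e3 * (lin (cx l3) x)^2" for x
  proof -
    let ?m = "complex_of_real mm" and ?a = "complex_of_real a" and ?d = "complex_of_real d"
    let ?q = "qform ?a (of_real b) (of_real c) (of_real f) (of_real g) (of_real h) (x$1) (x$2) (x$3)"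
    have m: "?a * of_real b - (of_real h)^2 = ?m" unfolding mm_def by simp
    have d: "qdet ?a (of_real b) (of_real c) (of_real f) (of_real g) (of_real h) = ?d" unfolding d_def qdet_def by simp
    have L: "lin (cx l1) x = ?a * x$1 + of_real h * x$2 + of_real g * x$3"
      "lin (cx l2) x = ?m * x$2 + (?a * of_real f - of_real g * of_real h) * x$3" "lin (cx l3) x = x$3"
      unfolding lin_def sum_3 l1_def l2_def l3_def by simp_all
    have "?m * ?a * ?q = ?m * (lin (cx l1) x)^2 + (lin (cx l2) x)^2 + ?a * ?d * (lin (cx l3) x)^2"
      using qform_square_sum[of ?a "of_real b" "of_real h" "of_real c" "of_real f" "of_real g" "x$1" "x$2" "x$3"]
      unfolding m d L .
    moreover have "?m * ?a \<noteq> 0" using nz by simp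
    ultimately have "?q = (?m * (lin (cx l1) x)^2 + (lin (cx l2) x)^2 + ?a * ?d * (lin (cx l3) x)^2) / (?m * ?a)"
      by (simp add: field_simps)
    then show ?thesis unfolding e1_def e2_def e3_def using nz by (simp add: add_divide_distrib)
  qed
  have nze: "e1 \<noteq> 0" "e2 \<noteq> 0" "e3 \<noteq> 0" using nz unfolding e1_def e2_def e3_def by auto
  have p: "e1 * e2 = 1 / (a^2 * mm)" "e1 * e3 = d / (a * mm)" unfolding e1_def e2_def e3_def by (simp_all add: power2_eq_square)
  have D1: "rdet l1 l2 l3 \<noteq> 0" using D nz by simp
  then have D2: "rdet l1 l3 l2 \<noteq> 0" "rdet l2 l3 l1 \<noteq> 0" unfolding rdet_def by (simp_all add: algebra_simps)
  \<comment> \<open>Three equal signs would mean a definite form, which \<open>good\<close>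
    excludes.\<close>
  have "\<not> (0 < e1 * e2 \<and> 0 < e1 * e3)"
  proof
    assume *: "0 < e1 * e2 \<and> 0 < e1 * e3"
    then have "0 < mm" using nz unfolding p by (simp add: zero_less_divide_iff zero_less_mult_iff)
    have "a * d = (d / (a * mm)) * (a^2 * mm)" using nz by (simp add: field_simps power2_eq_square)
    moreover have "0 < d / (a * mm)" "0 < a^2 * mm" using * nz \<open>0 < mm\<close> unfolding p by simp_all
    ultimately have "0 < a * d" by (metis mult_pos_pos)
    then show False using ind \<open>0 < mm\<close> by blast
  qed
  then consider "0 < e1 * e2" "e1 * e3 < 0" | "0 < e1 * e3" "e1 * e2 < 0" | "0 < e2 * e3" "e2 * e1 < 0"
    using nze by (auto simp: zero_less_mult_iff mult_less_0_iff linorder_neq_iff)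
  then show ?thesis
  proof cases
    case 1 from isotropic_rows[OF D1 1] show ?thesis unfolding eq .
  next
    case 2 
    from isotropic_rows[OF D2(1) 2] show ?thesis unfolding eq
      by (simp only: add.commute add.left_commute)
  next
    case 3
    from isotropic_rows[OF D2(2) 3] show ?thesis unfolding eq
      by (simp only: add.commute add.left_commute)
  qed
qed

lemma cremona_curve_exists:
  assumes r: "rdet r1 r2 r3 \<noteq> 0" and gd: "good a b c f g h"
  shows "\<exists>y1 y2 y3 s1 s2 s3. cremona_curve y1 y2 y3 s1 s2 s3 a b c f g h r1 r2 r3"
proof -
  obtain y1 y2 y3 where y: "\<And>x. x = lin (cx r1) x *s cx y1 + lin (cx r2) x *s cx y2 + lin (cx r3) x *s cx y3"
    using dual_rows[OF r] by blast
  obtain t1 t2 t3 k where t: "rdet t1 t2 t3 \<noteq> 0" and k: "k \<noteq> 0" and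
    Q: "\<And>x. qform (of_real a) (of_real b) (of_real c) (of_real f) (of_real g) (of_real h) (x$1) (x$2) (x$3)
      = of_real k * ((lin (cx t2) x)^2 - lin (cx t1) x * lin (cx t3) x)"
    using good_isotropic[OF gd] by blast
  obtain u1 u2 u3 where u: "\<And>x. x = lin (cx t1) x *s cx u1 + lin (cx t2) x *s cx u2 + lin (cx t3) x *s cx u3"
    using dual_rows[OF t] by blast
  \<comment> \<open>In the coordinates \<open>t1\<close>, \<open>t2\<close>, \<open>t3\<close> the
    map \<open>N\<close> below sends \<open>w\<close> to \<open>(w1^2, w1*w2, w2^2)\<close>, which
    solves \<open>t2^2 = t1 * t3\<close>; \<open>s i\<close> collects the coefficients of component
    \<open>i\<close> of \<open>N\<close>.\<close>
  define s :: "3 \<Rightarrow> real^3" where "s i = (\<chi> j. if j = 1 then u1 $ i else if j = 2 then u2 $ i else u3 $ i)" for i :: 3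
  define N where "N w = (w$1)^2 *s cx u1 + (w$1 * w$2) *s cx u2 + (w$2)^2 *s cx u3" for w :: "complex^2"
  have s: "bq (s i) w = N w $ i" for i w unfolding bq_def s_def N_def by (simp add: algebra_simps)
  have ui: "det3 (cx u1) (cx u2) (cx u3) \<noteq> 0" by (rule frame_of_dual[OF u])
  have co: "lin (cx t1) (x *s cx u1 + y *s cx u2 + z *s cx u3) = x \<and> lin (cx t2) (x *s cx u1 + y *s cx u2 + z *s cx u3) = y \<and>
     lin (cx t3) (x *s cx u1 + y *s cx u2 + z *s cx u3) = z" for x y z
  proof -
    let ?v = "x *s cx u1 + y *s cx u2 + z *s cx u3"
    have "(lin (cx t1) ?v - x) *s cx u1 + (lin (cx t2) ?v - y) *s cx u2 + (lin (cx t3) ?v - z) *s cx u3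
       = (lin (cx t1) ?v *s cx u1 + lin (cx t2) ?v *s cx u2 + lin (cx t3) ?v *s cx u3) - ?v"
      by (simp add: vec_eq_iff algebra_simps)
    also have "\<dots> = 0" using u[of ?v] by simp
    finally have "lin (cx t1) ?v - x = 0 \<and> lin (cx t2) ?v - y = 0 \<and> lin (cx t3) ?v - z = 0" by (rule det3_indep[OF ui])
    then show ?thesis by simp
  qed
  have N: "lin (cx t1) (N w) = (w$1)^2" "lin (cx t2) (N w) = w$1 * w$2" "lin (cx t3) (N w) = (w$2)^2" for w
    unfolding N_def using co by blast+
  have Nscale: "\<exists>i. N w' $ i \<noteq> k * N w $ i" if "N w' \<noteq> k *s N w" for w w' k using that by (auto simp: vec_eq_iff)
  have "cremona_param y1 y2 y3 (s 1) (s 2) (s 3) a b c f g h"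
  proof
    show "det3 (cx y1) (cx y2) (cx y3) \<noteq> 0" by (rule frame_of_dual[OF y])
    show "qform (of_real a) (of_real b) (of_real c) (of_real f) (of_real g) (of_real h) (bq (s 1) w) (bq (s 2) w) (bq (s 3) w) = 0" for w
      unfolding s Q N by (simp add: power_mult_distrib)
    show "\<exists>w k. w \<noteq> 0 \<and> k \<noteq> 0 \<and> x = k * bq (s 1) w \<and> y = k * bq (s 2) w \<and> z = k * bq (s 3) w"
      if q0: "qform (of_real a) (of_real b) (of_real c) (of_real f) (of_real g) (of_real h) x y z = 0" and n0: "\<not> (x = 0 \<and> y = 0 \<and> z = 0)" for x y z
    proof -
      define X :: "complex^3" where "X = vector [x, y, z]"
      have X: "X$1 = x" "X$2 = y" "X$3 = z" unfolding X_def by simp_all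
      define p q r where "p = lin (cx t1) X" and "q = lin (cx t2) X" and "r = lin (cx t3) X"
      have Xe: "X = p *s cx u1 + q *s cx u2 + r *s cx u3" unfolding p_def q_def r_def by (rule u)
      have "X \<noteq> 0" using n0 X by auto
      have qpr: "q^2 = p * r" using Q[of X] q0 k unfolding X p_def q_def r_def by simp
      have "\<exists>w l. w \<noteq> 0 \<and> l \<noteq> 0 \<and> X = l *s N w"
      \<comment> \<open>A solution of \<open>q^2 = p * r\<close> comes from the parameter
        \<open>(p, q)\<close>, or from \<open>(0, 1)\<close> when \<open>p = 0\<close>.\<close>
      proof (cases "p = 0")
        case False
        have "N (vector [p, q]) = p *s X"
          unfolding N_def Xe using qpr by (simp add: vec_eq_iff algebra_simps power2_eq_square)
        then have "X = (1 / p) *s N (vector [p, q])" using False by (simp add: vector_smult_assoc)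
        moreover have "vector [p, q] \<noteq> (0 :: complex^2)" using False by (metis vector_2(1) zero_index)
        ultimately show ?thesis using False by (intro exI[of _ "vector [p, q]"] exI[of _ "1/p"]) simp
      next
        case True
        then have q: "q = 0" using qpr by simp
        then have r: "r \<noteq> 0" using Xe True \<open>X \<noteq> 0\<close> by auto
        have "X = r *s N (vector [0, 1])" unfolding N_def Xe True q by (simp add: vec_eq_iff)
        moreover have "vector [0, 1] \<noteq> (0 :: complex^2)" by (metis vector_2(2) zero_index zero_neq_one)
        ultimately show ?thesis using r by blast
      qed
      then show ?thesis unfolding s using X by (metis vector_smult_component)
    qed
    show "hom_equiv w w'" if w: "w \<noteq> 0" "w' \<noteq> 0" and e: "bq (s 1) w' = l * bq (s 1) w" "bq (s 2) w' = l * bq (s 2) w" "bq (s 3) w' = l * bq (s 3) w" for w w' l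
    proof -
      have "N w' = l *s N w" using e unfolding s by (simp add: vec_eq_iff forall_3)
      then have e': "(w'$1)^2 = l * (w$1)^2" "w'$1 * w'$2 = l * (w$1 * w$2)" "(w'$2)^2 = l * (w$2)^2"
        using N[of w'] N[of w] by (simp_all add: lin_scale)
      show ?thesis
      proof (cases "w$1 = 0")
        case True
        then have w1': "w'$1 = 0" using e' by simp
        have "w$2 \<noteq> 0" "w'$2 \<noteq> 0" using w True w1' by (auto simp: vec_eq_iff forall_2)
        moreover then have "w' = (w'$2 / w$2) *s w" using True w1' by (simp add: vec_eq_iff forall_2)
        ultimately show ?thesis using hom_equiv_scale[OF w(1)] by (metis divide_eq_0_iff)
      next
        case False
        have "l \<noteq> 0"
        proof
          assume "l = 0"
          then have "w' = 0" using e' by (simp add: vec_eq_iff forall_2)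
          then show False using w by blast
        qed
        then have w1': "w'$1 \<noteq> 0" using e' False by auto
        have "w'$1 * (w'$2 * w$1) = w'$1 * (w'$1 * w$2)"
        proof -
          have "w'$1 * (w'$2 * w$1) = (w'$1 * w'$2) * w$1" by simp
          also have "\<dots> = (l * (w$1)^2) * w$2" unfolding e'(2) by (simp add: power2_eq_square)
          also have "\<dots> = w'$1 * (w'$1 * w$2)" unfolding e'(1)[symmetric] by (simp add: power2_eq_square)
          finally show ?thesis .
        qed
        then have "w'$2 * w$1 = w'$1 * w$2" using w1' by simp
        then have "w' = (w'$1 / w$1) *s w" using False by (simp add: vec_eq_iff forall_2 field_simps)
        then show ?thesis using hom_equiv_scale[OF w(1)] w1' False by (metis divide_eq_0_iff)
      qed
    qed
    show "\<not> (bq (s 1) w = 0 \<and> bq (s 2) w = 0 \<and> bq (s 3) w = 0)" if w: "w \<noteq> 0" for w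
    proof
      assume "bq (s 1) w = 0 \<and> bq (s 2) w = 0 \<and> bq (s 3) w = 0"
      then have "N w = 0" unfolding s by (simp add: vec_eq_iff forall_3)
      then have "(w$1)^2 = 0" "(w$2)^2 = 0" using N[of w] by (simp_all add: lin_def)
      then show False using w by (simp add: vec_eq_iff forall_2)
    qed
  qed (use gd in \<open>auto simp: good_def\<close>)
  then have "cremona_curve y1 y2 y3 (s 1) (s 2) (s 3) a b c f g h r1 r2 r3"
    unfolding cremona_curve_def cremona_curve_axioms_def using y by blast
  then show ?thesis by blast
qed

subsection \<open>Classification of conics relative to a triangle\<close>

type_synonym conic = "real \<times> real \<times> real \<times> real \<times> real \<times> real"

fun cdet :: "conic \<Rightarrow> real" where "cdet (a,b,c,f,g,h) = qdet a b c f g h"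
fun cgood :: "conic \<Rightarrow> bool" where "cgood (a,b,c,f,g,h) = good a b c f g h"
fun cneg :: "conic \<Rightarrow> conic" where "cneg (a,b,c,f,g,h) = (-a,-b,-c,-f,-g,-h)"

text \<open>The counts make the label invariant under permutations of the coordinates. They agree on the
  two types of conics for which all diagonal coefficients and all principal minors are negative;
  these differ in the sign of \<open>f*g*h\<close>.\<close>

fun plabel :: "conic \<Rightarrow> nat \<times> nat \<times> bool" where
  "plabel (a,b,c,f,g,h) = (of_bool (a > 0) + of_bool (b > 0) + of_bool (c > 0),
     of_bool (b*c - f^2 > 0) + of_bool (a*c - g^2 > 0) + of_bool (a*b - h^2 > 0),
     a < 0 \<and> b < 0 \<and> c < 0 \<and> b*c - f^2 < 0 \<and> a*c - g^2 < 0 \<and> a*b - h^2 < 0 \<and> f*g*h > 0)"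

text \<open>Equations are determined up to a nonzero real factor. The determinant has odd degree in
  the coefficients, so requiring it to be positive fixes the sign.\<close>

definition clabel :: "conic \<Rightarrow> nat \<times> nat \<times> bool" where
  "clabel q = (if cdet q > 0 then plabel q else plabel (cneg q))"

text \<open>Each step passes to a permuted or rescaled frame or negates the equation. Steps are put
  in front of a derivation for the changed conic, so that inductions peel off the first
  change.\<close>

inductive conic_equiv :: "conic \<Rightarrow> conic \<Rightarrow> bool" where
  refl: "conic_equiv q q"
| swap12: "conic_equiv (a,b,c,f,g,h) q \<Longrightarrow> conic_equiv (b,a,c,g,f,h) q"
| swap23: "conic_equiv (a,b,c,f,g,h) q \<Longrightarrow> conic_equiv (a,c,b,f,h,g) q"
| scale: "conic_equiv (a*k^2, b*l^2, c*m^2, f*l*m, g*k*m, h*k*l) q \<Longrightarrow> k \<noteq> 0 \<Longrightarrow> l \<noteq> 0 \<Longrightarrow> m \<noteq> 0 \<Longrightarrow> conic_equiv (a,b,c,f,g,h) q"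
| neg: "conic_equiv (-a,-b,-c,-f,-g,-h) q \<Longrightarrow> conic_equiv (a,b,c,f,g,h) q"

section \<open>Invariance of the label under changes of frame\<close>

lemma minor_identity: "a * qdet a b c f g h = (a*b - h^2) * (a*c - g^2) - (a*f - g*h)^2" for a :: "'a::comm_ring_1"
  unfolding qdet_def by (simp add: algebra_simps power2_eq_square)

text \<open>A positive minor \<open>a*b - h^2\<close> forces \<open>a\<close> and \<open>b\<close>
  to have the same sign, so definiteness may be tested with either.\<close>

lemma good_swap12: "good b a c g f h = good a b c f g h"
proof -
  have d: "qdet b a c g f h = qdet a b c f g h" unfolding qdet_def by (simp add: algebra_simps)
  have "0 < b * qdet a b c f g h \<and> 0 < b * a - h^2 \<longleftrightarrow> 0 < a * qdet a b c f g h \<and> 0 < a * b - h^2"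
  proof (cases "0 < a * b - h^2")
    case True
    then have "0 < a * b" using zero_le_power2[of h] by linarith
    then show ?thesis using True by (auto simp: zero_less_mult_iff mult.commute)
  qed (simp add: mult.commute)
  then show ?thesis unfolding good_def d by (auto simp: mult.commute)
qed

text \<open>When \<open>a\<close> and the determinant have the same sign,
  \<open>minor_identity\<close> (an instance of Jacobi's identity for minors) makes the product of
  the two minors positive.\<close>

lemma good_swap23: "good a c b f h g = good a b c f g h"
proof -
  have d: "qdet a c b f h g = qdet a b c f g h" unfolding qdet_def by (simp add: algebra_simps)
  have "0 < a * c - g^2 \<longleftrightarrow> 0 < a * b - h^2" if "0 < a * qdet a b c f g h"
  proof -
    have "0 < (a*b - h^2) * (a*c - g^2)"
      using that zero_le_power2[of "a*f - g*h"] unfolding minor_identity by linarith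
    then show ?thesis by (auto simp: zero_less_mult_iff)
  qed
  then show ?thesis unfolding good_def d by (auto simp: mult.commute)
qed

lemma good_neg: "good (-a) (-b) (-c) (-f) (-g) (-h) = good a b c f g h"
proof -
  have d: "qdet (-a) (-b) (-c) (-f) (-g) (-h) = - qdet a b c f g h" unfolding qdet_def by (simp add: algebra_simps)
  show ?thesis unfolding good_def d by simp
qed

lemma qdet_scale: "qdet (a*k^2) (b*l^2) (c*m^2) (f*l*m) (g*k*m) (h*k*l) = (k*l*m)^2 * qdet a b c f g h" for a :: "'a::comm_ring_1"
  unfolding qdet_def by (simp add: algebra_simps power2_eq_square)

lemma minor_scale: "(b*l^2) * (c*m^2) - (f*l*m)^2 = (l*m)^2 * (b*c - f^2)" for b :: "'a::comm_ring_1"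
  by (simp add: algebra_simps power2_eq_square)

lemma pos_scale_iff: "0 < t \<Longrightarrow> 0 < x * t \<longleftrightarrow> 0 < x" "0 < t \<Longrightarrow> x * t < 0 \<longleftrightarrow> x < 0"
   "0 < t \<Longrightarrow> 0 < t * x \<longleftrightarrow> 0 < x" "0 < t \<Longrightarrow> t * x < 0 \<longleftrightarrow> x < 0" for x t :: real
  by (auto simp: zero_less_mult_iff mult_less_0_iff)

lemma good_scale:
  assumes "k \<noteq> 0" "l \<noteq> 0" "m \<noteq> 0"
  shows "good (a*k^2) (b*l^2) (c*m^2) (f*l*m) (g*k*m) (h*k*l) = good a b c f g h"
proof -
  have p: "0 < k^2" "0 < (k*l)^2" "0 < (k*l*m)^2" using assms by simp_all
  have "0 < a*k^2 * ((k*l*m)^2 * qdet a b c f g h) \<longleftrightarrow> 0 < a * qdet a b c f g h"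
  proof -
    have "a*k^2 * ((k*l*m)^2 * qdet a b c f g h) = (k^2 * (k*l*m)^2) * (a * qdet a b c f g h)" by simp
    moreover have "0 < k^2 * (k*l*m)^2" using p by simp
    ultimately show ?thesis by (simp only: pos_scale_iff(3))
  qed
  note e = this
  show ?thesis unfolding good_def qdet_scale minor_scale e pos_scale_iff(3)[OF p(2)] using assms by simp
qed

lemma clabel_neg: "cdet q \<noteq> 0 \<Longrightarrow> clabel (cneg q) = clabel q"
proof -
  assume "cdet q \<noteq> 0"
  moreover have "cdet (cneg q) = - cdet q" by (cases q) (simp add: qdet_def algebra_simps)
  moreover have "cneg (cneg q) = q" by (cases q) simp
  ultimately show ?thesis unfolding clabel_def by auto
qed

lemma plabel_scale:
  assumes "k \<noteq> 0" "l \<noteq> 0" "m \<noteq> 0"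
  shows "plabel (a*k^2, b*l^2, c*m^2, f*l*m, g*k*m, h*k*l) = plabel (a,b,c,f,g,h)"
proof -
  have p: "0 < k^2" "0 < l^2" "0 < m^2" "0 < (k*l)^2" "0 < (k*m)^2" "0 < (l*m)^2" using assms by simp_all
  have fgh: "(f*l*m) * (g*k*m) * (h*k*l) = (k*l*m)^2 * (f*g*h)" by (simp add: power2_eq_square)
  have "0 < (k*l*m)^2" using assms by simp
  note pos_scale_iff(3)[OF this]
  then show ?thesis
    unfolding plabel.simps minor_scale fgh pos_scale_iff(1)[OF p(1)] pos_scale_iff(1)[OF p(2)] pos_scale_iff(1)[OF p(3)]
     pos_scale_iff(2)[OF p(1)] pos_scale_iff(2)[OF p(2)] pos_scale_iff(2)[OF p(3)]
     pos_scale_iff(3)[OF p(4)] pos_scale_iff(3)[OF p(5)] pos_scale_iff(3)[OF p(6)]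
     pos_scale_iff(4)[OF p(4)] pos_scale_iff(4)[OF p(5)] pos_scale_iff(4)[OF p(6)]
    by simp
qed

lemma clabel_swap12: "clabel (b,a,c,g,f,h) = clabel (a,b,c,f,g,h)"
proof -
  have "qdet b a c g f h = qdet a b c f g h" unfolding qdet_def by (simp add: algebra_simps)
  then show ?thesis unfolding clabel_def by (auto simp: ac_simps)
qed

lemma clabel_swap23: "clabel (a,c,b,f,h,g) = clabel (a,b,c,f,g,h)"
proof -
  have "qdet a c b f h g = qdet a b c f g h" unfolding qdet_def by (simp add: algebra_simps)
  then show ?thesis unfolding clabel_def by (auto simp: ac_simps)
qed

lemma clabel_scale:
  assumes "k \<noteq> 0" "l \<noteq> 0" "m \<noteq> 0"
  shows "clabel (a*k^2, b*l^2, c*m^2, f*l*m, g*k*m, h*k*l) = clabel (a,b,c,f,g,h)"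
proof -
  have "0 < (k*l*m)^2" using assms by simp
  from pos_scale_iff(3)[OF this] have d: "0 < cdet (a*k^2, b*l^2, c*m^2, f*l*m, g*k*m, h*k*l) \<longleftrightarrow> 0 < cdet (a,b,c,f,g,h)"
    by (simp only: cdet.simps qdet_scale)
  have "plabel (cneg (a*k^2, b*l^2, c*m^2, f*l*m, g*k*m, h*k*l)) = plabel (cneg (a,b,c,f,g,h))"
    using plabel_scale[OF assms, of "-a" "-b" "-c" "-f" "-g" "-h"] by simp
  then show ?thesis unfolding clabel_def d using plabel_scale[OF assms] by simp
qed

lemma conic_equiv_label: "conic_equiv q q' \<Longrightarrow> cgood q \<Longrightarrow> clabel q = clabel q'"
proof (induction rule: conic_equiv.induct)
  case (neg a b c f g h q)
  have "cdet (a,b,c,f,g,h) \<noteq> 0" using neg.prems by (simp add: good_def)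
  from clabel_neg[OF this] neg show ?case by (simp add: good_neg)
qed (simp_all add: clabel_swap12 clabel_swap23 clabel_scale good_swap12 good_swap23 good_scale)

text \<open>Conics with positive determinant and diagonal coefficients \<open>1\<close> or \<open>-1\<close>, in coordinates that
  turn each type into the image of a convex set.\<close>

definition region_map :: "nat \<Rightarrow> real \<times> real \<times> real \<Rightarrow> conic" where
  "region_map k = (\<lambda>(x,y,z).
     if k = 0 then (1,1,1,x,y,x*y + z * sqrt ((x^2-1)*(y^2-1)))
     else if k = 1 then (1,1,-1,y*x + z * sqrt ((y^2-1)*(1+x^2)),x,y)
     else if k = 2 then (1,-1,-1,x,y,z)
     else if k = 3 then (1,-1,-1,x,y,-x*y + sqrt ((x^2-1)*(y^2+1)) + z)
     else if k = 4 then (-1,-1,-1,x,y,(1-z) * (-x*y + sqrt ((1-x^2)*(1-y^2))) + z)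
     else if k \<le> 7 then (-1,-1,-1,x,y,z)
     else (-1,-1,-1,x,y,-(x*y + sqrt ((x^2-1)*(y^2-1)) + z)))"

definition region_dom :: "nat \<Rightarrow> (real \<times> real \<times> real) set" where
  "region_dom k =
    (if k = 0 then {1<..} \<times> {1<..} \<times> {-1<..<1}
     else if k = 1 then UNIV \<times> {1<..} \<times> {-1<..<1}
     else if k = 2 then {-1<..<1} \<times> UNIV \<times> UNIV
     else if k = 3 then {1<..} \<times> UNIV \<times> {0<..}
     else if k = 4 then ({-1<..<1} \<times> {-1<..<1} \<times> {0<..<1}) \<inter> {x. inner (1,1,0) x > 0}
     else if k = 5 then {1<..} \<times> {-1<..<1} \<times> {-1<..<1}
     else if k = 6 then {1<..} \<times> {1<..} \<times> {-1<..<1}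
     else if k = 7 then {1<..} \<times> {1<..} \<times> {1<..}
     else {1<..} \<times> {1<..} \<times> {0<..})"

definition region :: "nat \<Rightarrow> conic set" where
  "region k = region_map k ` region_dom k"

definition region_label :: "nat \<Rightarrow> nat \<times> nat \<times> bool" where
  "region_label k = [(3,0,False), (2,0,False), (1,1,False), (1,0,False), (0,3,False), (0,2,False), (0,1,False), (0,0,True), (0,0,False)] ! k"

lemma region_path_connected: "path_connected (region k)"
  unfolding region_def
proof (rule path_connected_continuous_image[OF _ convex_imp_path_connected])
  show "convex (region_dom k)"
    unfolding region_dom_def by (auto intro!: convex_Int convex_Times convex_halfspace_gt simp del: inner_Pair)
  have e: "region_map k = (\<lambda>p. let x = fst p; y = fst (snd p); z = snd (snd p) in
     if k = 0 then (1,1,1,x,y,x*y + z * sqrt ((x^2-1)*(y^2-1)))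
     else if k = 1 then (1,1,-1,y*x + z * sqrt ((y^2-1)*(1+x^2)),x,y)
     else if k = 2 then (1,-1,-1,x,y,z)
     else if k = 3 then (1,-1,-1,x,y,-x*y + sqrt ((x^2-1)*(y^2+1)) + z)
     else if k = 4 then (-1,-1,-1,x,y,(1-z) * (-x*y + sqrt ((1-x^2)*(1-y^2))) + z)
     else if k \<le> 7 then (-1,-1,-1,x,y,z)
     else (-1,-1,-1,x,y,-(x*y + sqrt ((x^2-1)*(y^2-1)) + z)))"
    unfolding region_map_def by (simp add: fun_eq_iff)
  consider "k = 0" | "k = 1" | "k = 2" | "k = 3" | "k = 4" | "4 < k" "k \<le> 7" | "7 < k" by linarith
  then show "continuous_on (region_dom k) (region_map k)"
    unfolding e Let_def by cases (simp_all, (intro continuous_intros)+)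
qed

lemma region_nonempty: "region k \<noteq> {}"
proof -
  have "(2, 2, 1/2) \<in> region_dom k \<or> (1/2, 1/2, 1/2) \<in> region_dom k \<or> (2, 1/2, 1/2) \<in> region_dom k \<or> (2, 2, 2) \<in> region_dom k"
    unfolding region_dom_def by auto
  then show ?thesis unfolding region_def by blast
qed

lemma sq_gt1: "1 < (x::real) \<Longrightarrow> 1 < x^2" "x < -1 \<Longrightarrow> 1 < x^2" "-1 < x \<Longrightarrow> x < 1 \<Longrightarrow> x^2 < 1"
proof -
  show "1 < x \<Longrightarrow> 1 < x^2" by simp
  show "x < -1 \<Longrightarrow> 1 < x^2" using one_less_power[of "- x" 2] by simp
  show "-1 < x \<Longrightarrow> x < 1 \<Longrightarrow> x^2 < 1" using abs_square_less_1[of x] by (simp add: abs_if)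
qed

lemma region_spec:
  assumes q: "q \<in> region k" and k: "k < 9"
  shows "cgood q \<and> clabel q = region_label k"
proof -
  \<comment> \<open>With positive determinant, the excluded definite case would require both
    \<open>a > 0\<close> and \<open>a*b - h^2 > 0\<close>.\<close>
  have fin: "cgood (a,b,c,f,g,h) \<and> clabel (a,b,c,f,g,h) = l"
    if "0 < qdet a b c f g h" "plabel (a,b,c,f,g,h) = l" "a \<noteq> 0" "b \<noteq> 0" "c \<noteq> 0" "b*c - f^2 \<noteq> 0" "a*c - g^2 \<noteq> 0" "a*b - h^2 \<noteq> 0"
      "a < 0 \<or> a*b - h^2 < 0" for a b c f g h l
    using that unfolding clabel_def by (auto simp: good_def zero_less_mult_iff)
  obtain x1 x2 x3 where xyz: "(x1, x2, x3) \<in> region_dom k" "q = region_map k (x1, x2, x3)"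
    using q unfolding region_def by auto
  consider "k = 0" | "k = 1" | "k = 2" | "k = 3" | "k = 4" | "k = 5" | "k = 6" | "k = 7" | "k = 8" using k by linarith
  then show ?thesis
  proof cases
    case 1
    obtain f g t where e: "x1 = f" "x2 = g" "x3 = t" by blast
    have q: "q = (1,1,1,f,g,f*g + t * sqrt ((f^2-1)*(g^2-1)))" using xyz(2) 1 unfolding e by (simp add: region_map_def)
    have r: "1 < f" "1 < g" "-1 < t" "t < 1" using xyz(1) 1 unfolding e region_dom_def by auto
    let ?s = "(f^2-1)*(g^2-1)" let ?h = "f*g + t * sqrt ?s"
    have s: "0 < ?s" using sq_gt1(1)[OF r(1)] sq_gt1(1)[OF r(2)] by simp
    have "qdet 1 1 1 f g ?h = ?s * (1 - t^2)"
    proof -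
      have "qdet 1 1 1 f g (f*g + t * u) = ?s - t^2 * u^2" for u unfolding qdet_def by (simp add: algebra_simps power2_eq_square)
      from this[of "sqrt ?s"] have "qdet 1 1 1 f g ?h = ?s - t^2 * (sqrt ?s)^2" .
      also have "(sqrt ?s)^2 = ?s" using s by (intro real_sqrt_pow2) simp
      also have "?s - t^2 * ?s = ?s * (1 - t^2)" by (simp add: algebra_simps)
      finally show ?thesis .
    qed
    then have d: "0 < qdet 1 1 1 f g ?h" using s sq_gt1(3)[OF r(3,4)] by simp
    \<comment> \<open>This is \<open>minor_identity\<close> for the present conic: as
      \<open>1 - g^2\<close> is negative, so is \<open>1 - ?h^2\<close>.\<close>
    have e: "1 * qdet 1 1 1 f g u + (1*f - g*u)^2 = (1*1 - u^2) * (1*1 - g^2)" for u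
      unfolding qdet_def by (simp add: algebra_simps power2_eq_square)
    have "0 < 1 * qdet 1 1 1 f g ?h + (1*f - g*?h)^2" using d by (simp add: add_pos_nonneg)
    then have "0 < (1*1 - ?h^2) * (1*1 - g^2)" unfolding e .
    then have h: "1 - ?h^2 < 0" using sq_gt1(1)[OF r(2)] by (auto simp: zero_less_mult_iff)
    show ?thesis unfolding q by (rule fin[OF d]) (use h sq_gt1(1)[OF r(1)] sq_gt1(1)[OF r(2)] 1 in \<open>auto simp: region_label_def\<close>)
  next
    case 2
    obtain g h t where e: "x1 = g" "x2 = h" "x3 = t" by blast
    have q: "q = (1,1,-1,h*g + t * sqrt ((h^2-1)*(1+g^2)),g,h)" using xyz(2) 2 unfolding e by (simp add: region_map_def)
    have r: "1 < h" "-1 < t" "t < 1" using xyz(1) 2 unfolding e region_dom_def by auto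
    let ?s = "(h^2-1)*(1+g^2)" let ?f = "h*g + t * sqrt ?s"
    have p: "0 < 1 + g^2" "0 < 1 + ?f^2" using zero_le_power2[of g] zero_le_power2[of ?f] by linarith+
    have s: "0 < ?s" using sq_gt1(1)[OF r(1)] p by simp
    have "qdet 1 1 (-1) ?f g h = ?s * (1 - t^2)"
    proof -
      have "qdet 1 1 (-1) (h*g + t * u) g h = ?s - t^2 * u^2" for u unfolding qdet_def by (simp add: algebra_simps power2_eq_square)
      from this[of "sqrt ?s"] have "qdet 1 1 (-1) ?f g h = ?s - t^2 * (sqrt ?s)^2" .
      also have "(sqrt ?s)^2 = ?s" using s by (intro real_sqrt_pow2) simp
      also have "?s - t^2 * ?s = ?s * (1 - t^2)" by (simp add: algebra_simps)
      finally show ?thesis .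
    qed
    then have d: "0 < qdet 1 1 (-1) ?f g h" using s sq_gt1(3)[OF r(2,3)] by simp
    have n: "- 1 - ?f^2 < 0" "-1 - g^2 < 0" using p by linarith+
    show ?thesis unfolding q by (rule fin[OF d]) (use n sq_gt1(1)[OF r(1)] 2 in \<open>auto simp: region_label_def\<close>)
  next
    case 3
    obtain f g h where e: "x1 = f" "x2 = g" "x3 = h" by blast
    have q: "q = (1,-1,-1,f,g,h)" using xyz(2) 3 unfolding e by (simp add: region_map_def)
    have r: "-1 < f" "f < 1" using xyz(1) 3 unfolding e region_dom_def by auto
    have "qdet 1 (-1) (-1) f g h = (1 - f^2) + (h + f*g)^2 + g^2 * (1 - f^2)"
      unfolding qdet_def by (simp add: algebra_simps power2_eq_square)
    moreover have "0 < 1 - f^2" using sq_gt1(3)[OF r] by simp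
    moreover have "0 \<le> g^2 * (1 - f^2)" using sq_gt1(3)[OF r] by simp
    ultimately have d: "0 < qdet 1 (-1) (-1) f g h" using zero_le_power2[of "h + f*g"] by linarith
    have n: "- 1 - h^2 < 0" "-1 - g^2 < 0" using zero_le_power2[of h] zero_le_power2[of g] by linarith+
    show ?thesis unfolding q by (rule fin[OF d]) (use n sq_gt1(3)[OF r] 3 in \<open>auto simp: region_label_def\<close>)
  next
    case 4
    obtain f g t where e: "x1 = f" "x2 = g" "x3 = t" by blast
    have q: "q = (1,-1,-1,f,g,-f*g + sqrt ((f^2-1)*(g^2+1)) + t)" using xyz(2) 4 unfolding e by (simp add: region_map_def)
    have r: "1 < f" "0 < t" using xyz(1) 4 unfolding e region_dom_def by auto
    let ?s = "(f^2-1)*(g^2+1)" let ?h = "-f*g + sqrt ?s + t"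
    have "0 < g^2 + 1" using zero_le_power2[of g] by linarith
    then have s: "0 < ?s" using sq_gt1(1)[OF r(1)] by simp
    have "qdet 1 (-1) (-1) f g ?h = (sqrt ?s + t)^2 - ?s"
      unfolding qdet_def by (simp add: algebra_simps power2_eq_square)
    moreover have "(sqrt ?s)^2 < (sqrt ?s + t)^2" using r s by (intro power_strict_mono) auto
    ultimately have d: "0 < qdet 1 (-1) (-1) f g ?h" using s by simp
    have n: "- 1 - ?h^2 < 0" "-1 - g^2 < 0" using zero_le_power2[of ?h] zero_le_power2[of g] by linarith+
    show ?thesis unfolding q by (rule fin[OF d]) (use n sq_gt1(1)[OF r(1)] 4 in \<open>auto simp: region_label_def\<close>)
  next
    case 5
    obtain f g t where e: "x1 = f" "x2 = g" "x3 = t" by blast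
    have q: "q = (-1,-1,-1,f,g,(1-t) * (-f*g + sqrt ((1-f^2)*(1-g^2))) + t)" using xyz(2) 5 unfolding e by (simp add: region_map_def)
    have r: "-1 < f" "f < 1" "-1 < g" "g < 1" "0 < f + g" "0 < t" "t < 1" using xyz(1) 5 unfolding e region_dom_def by auto
    let ?s = "(1-f^2)*(1-g^2)" let ?l = "-f*g + sqrt ?s" let ?h = "(1-t) * ?l + t"
    have s: "0 < ?s" using sq_gt1(3)[OF r(1,2)] sq_gt1(3)[OF r(3,4)] by simp
    have fg: "\<bar>f * g\<bar> < 1" unfolding abs_mult using abs_mult_less[of f 1 g 1] r by (simp add: abs_less_iff)
    \<comment> \<open>So the larger root \<open>?l\<close> of the determinant, as a function of the
      third mixed coefficient, lies below 1.\<close>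
    have "?s = (1 + f*g)^2 - (f+g)^2" by (simp add: algebra_simps power2_eq_square)
    moreover have "0 < (f+g)^2" using r by simp
    ultimately have "sqrt ?s < 1 + f*g" using fg by (intro real_less_lsqrt) auto
    then have l1: "?l < 1" by simp
    have "f * g < 1" "0 < sqrt ?s" using fg real_sqrt_gt_zero[OF s] by linarith+
    then have l2: "-1 < ?l" by (simp only: mult_minus_left)
    have hl: "?h - ?l = t * (1 - ?l)" by (simp add: algebra_simps)
    have hl2: "1 - ?h = (1 - t) * (1 - ?l)" by (simp add: algebra_simps)
    have "0 < ?h - ?l" "0 < 1 - ?h" unfolding hl hl2 using r l1 by simp_all
    then have h: "?l < ?h" "?h < 1" "-1 < ?h" using l2 by linarith+
    have "qdet (-1) (-1) (-1) f g ?h = (?h + f*g)^2 - ?s"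
    proof -
      have "qdet (-1) (-1) (-1) f g u = (u + f*g)^2 - ?s" for u unfolding qdet_def by (simp add: algebra_simps power2_eq_square)
      then show ?thesis .
    qed
    moreover have "(sqrt ?s)^2 < (?h + f*g)^2" using h(1) s by (intro power_strict_mono) auto
    ultimately have d: "0 < qdet (-1) (-1) (-1) f g ?h" using s by simp
    show ?thesis unfolding q
      by (rule fin[OF d]) (use sq_gt1(3)[OF r(1,2)] sq_gt1(3)[OF r(3,4)] sq_gt1(3)[OF h(3,2)] 5 in \<open>auto simp: region_label_def\<close>)
  next
    case 6
    obtain f g h where e: "x1 = f" "x2 = g" "x3 = h" by blast
    have q: "q = (-1,-1,-1,f,g,h)" using xyz(2) 6 unfolding e by (simp add: region_map_def)
    have r: "1 < f" "-1 < g" "g < 1" "-1 < h" "h < 1" using xyz(1) 6 unfolding e region_dom_def by auto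
    have "qdet (-1) (-1) (-1) f g h = (f + g*h)^2 - (1 + g*h)^2 + (g + h)^2"
      unfolding qdet_def by (simp add: algebra_simps power2_eq_square)
    moreover have "\<bar>g * h\<bar> < 1" unfolding abs_mult using abs_mult_less[of g 1 h 1] r by (simp add: abs_less_iff)
    then have "(1 + g*h)^2 < (f + g*h)^2" using r by (intro power_strict_mono) auto
    ultimately have d: "0 < qdet (-1) (-1) (-1) f g h" using zero_le_power2[of "g + h"] by linarith
    show ?thesis unfolding q
      by (rule fin[OF d]) (use sq_gt1(1)[OF r(1)] sq_gt1(3)[OF r(2,3)] sq_gt1(3)[OF r(4,5)] 6 in \<open>auto simp: region_label_def\<close>)
  next
    case 7
    obtain f g h where e: "x1 = f" "x2 = g" "x3 = h" by blast
    have q: "q = (-1,-1,-1,f,g,h)" using xyz(2) 7 unfolding e by (simp add: region_map_def)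
    have r: "1 < f" "1 < g" "-1 < h" "h < 1" using xyz(1) 7 unfolding e region_dom_def by auto
    have "qdet (-1) (-1) (-1) f g h = (f + g*h)^2 + (g^2 - 1) * (1 - h^2)"
      unfolding qdet_def by (simp add: algebra_simps power2_eq_square)
    moreover have "0 < (g^2 - 1) * (1 - h^2)" using sq_gt1(1)[OF r(2)] sq_gt1(3)[OF r(3,4)] by simp
    ultimately have d: "0 < qdet (-1) (-1) (-1) f g h" using zero_le_power2[of "f + g*h"] by linarith
    show ?thesis unfolding q
      by (rule fin[OF d]) (use sq_gt1(1)[OF r(1)] sq_gt1(1)[OF r(2)] sq_gt1(3)[OF r(3,4)] 7 in \<open>auto simp: region_label_def\<close>)
  next
    case 8
    obtain f g h where e: "x1 = f" "x2 = g" "x3 = h" by blast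
    have q: "q = (-1,-1,-1,f,g,h)" using xyz(2) 8 unfolding e by (simp add: region_map_def)
    have r: "1 < f" "1 < g" "1 < h" using xyz(1) 8 unfolding e region_dom_def by auto
    have "qdet (-1) (-1) (-1) f g h = (f^2 - 1) + g^2 + h^2 + 2 * (f * g * h)"
      unfolding qdet_def by (simp add: algebra_simps power2_eq_square)
    moreover have fgh: "0 < f * g * h" using r by simp
    ultimately have d: "0 < qdet (-1) (-1) (-1) f g h" using sq_gt1(1)[OF r(1)] zero_le_power2[of g] zero_le_power2[of h] by linarith
    show ?thesis unfolding q
      by (rule fin[OF d]) (use sq_gt1(1)[OF r(1)] sq_gt1(1)[OF r(2)] sq_gt1(1)[OF r(3)] fgh 8 in \<open>auto simp: region_label_def\<close>)
  next
    case 9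
    obtain f g t where e: "x1 = f" "x2 = g" "x3 = t" by blast
    have q: "q = (-1,-1,-1,f,g,-(f*g + sqrt ((f^2-1)*(g^2-1)) + t))" using xyz(2) 9 unfolding e by (simp add: region_map_def)
    have r: "1 < f" "1 < g" "0 < t" using xyz(1) 9 unfolding e region_dom_def by auto
    let ?s = "(f^2-1)*(g^2-1)" let ?h = "-(f*g + sqrt ?s + t)"
    have s: "0 < ?s" using sq_gt1(1)[OF r(1)] sq_gt1(1)[OF r(2)] by simp
    have "qdet (-1) (-1) (-1) f g ?h = (sqrt ?s + t)^2 - ?s"
      unfolding qdet_def by (simp add: algebra_simps power2_eq_square)
    moreover have "(sqrt ?s)^2 < (sqrt ?s + t)^2" using r s by (intro power_strict_mono) auto
    ultimately have d: "0 < qdet (-1) (-1) (-1) f g ?h" using s by simp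
    have "1 < f * g" using r by (metis less_1_mult)
    then have h: "?h < -1" using s r by (smt (verit) real_sqrt_ge_zero)
    have "f * g * ?h < 0" using h \<open>1 < f * g\<close> by (intro mult_pos_neg) auto
    then show ?thesis unfolding q
      by (intro fin[OF d]) (use sq_gt1(1)[OF r(1)] sq_gt1(1)[OF r(2)] sq_gt1(2)[OF h] 9 in \<open>auto simp: region_label_def\<close>)
  qed
qed


section \<open>Reduction of admissible conics to normal form\<close>

definition has_normal :: "conic \<Rightarrow> bool" where
  "has_normal q \<longleftrightarrow> (\<exists>k<9. \<exists>q'\<in>region k. conic_equiv q q')"

lemma has_normal_region: "k < 9 \<Longrightarrow> (x,y,z) \<in> region_dom k \<Longrightarrow> q = region_map k (x,y,z) \<Longrightarrow> has_normal q"
  unfolding has_normal_def region_def using conic_equiv.refl by blast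

lemma has_normal_lift: "(\<And>q'. conic_equiv q q' \<Longrightarrow> conic_equiv r q') \<Longrightarrow> has_normal q \<Longrightarrow> has_normal r"
  unfolding has_normal_def by blast

lemma has_normal_steps:
  "has_normal (a,b,c,f,g,h) \<Longrightarrow> has_normal (b,a,c,g,f,h)"
  "has_normal (a,b,c,f,g,h) \<Longrightarrow> has_normal (a,c,b,f,h,g)"
  "has_normal (-a,-b,-c,-f,-g,-h) \<Longrightarrow> has_normal (a,b,c,f,g,h)"
  "has_normal (a*k^2, b*l^2, c*m^2, f*l*m, g*k*m, h*k*l) \<Longrightarrow> k \<noteq> 0 \<Longrightarrow> l \<noteq> 0 \<Longrightarrow> m \<noteq> 0 \<Longrightarrow> has_normal (a,b,c,f,g,h)"
  by (erule has_normal_lift[rotated], erule conic_equiv.swap12)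
     (erule has_normal_lift[rotated], erule conic_equiv.swap23,
      erule has_normal_lift[rotated], erule conic_equiv.neg,
      erule has_normal_lift[rotated], erule conic_equiv.scale, assumption+)

text \<open>Reversing one coordinate changes the sign of two mixed coefficients, so the sign of
  \<open>f*g*h\<close> is all that persists.\<close>

lemma has_normal_flip:
  "has_normal (a,b,c,f,-g,-h) \<Longrightarrow> has_normal (a,b,c,f,g,h)"
  "has_normal (a,b,c,-f,g,-h) \<Longrightarrow> has_normal (a,b,c,f,g,h)"
  "has_normal (a,b,c,-f,-g,h) \<Longrightarrow> has_normal (a,b,c,f,g,h)"
  using has_normal_steps(4)[of a "-1" b 1 c 1 f g h] has_normal_steps(4)[of a 1 b "-1" c 1 f g h] has_normal_steps(4)[of a 1 b 1 c "-1" f g h]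
  by simp_all

lemma sq_gt1_cases: "1 < (x::real)^2 \<Longrightarrow> 1 < x \<or> 1 < - x"
  using abs_square_le_1[of x] by (auto simp: abs_if split: if_splits)

lemma sq_lt1D: "(x::real)^2 < 1 \<Longrightarrow> -1 < x \<and> x < 1"
  using abs_square_less_1[of x] by (auto simp: abs_if split: if_splits)

lemma ratio_sqrt:
  assumes "(x::real)^2 < s"
  shows "\<exists>t. -1 < t \<and> t < 1 \<and> x = t * sqrt s"
proof -
  have s: "0 < s" using assms zero_le_power2[of x] by linarith
  have "\<bar>x\<bar> < sqrt s" using real_sqrt_less_mono[OF assms] by simp
  then have "-1 < x / sqrt s" "x / sqrt s < 1" using s by (simp_all add: field_simps abs_if split: if_splits)
  then show ?thesis using s by (intro exI[of _ "x / sqrt s"]) simp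
qed

lemma sqrt_less_or: "(s::real) < x^2 \<Longrightarrow> 0 \<le> s \<Longrightarrow> sqrt s < x \<or> sqrt s < - x"
  using real_sqrt_less_mono[of s "x^2"] by (auto simp: abs_if split: if_splits)

text \<open>The determinant is \<open>(f^2-1)*(g^2-1) - (h - f*g)^2\<close>, so its positivity
  confines \<open>h\<close> to the interval between two roots, where \<open>t\<close> is the
  relative position. Sign changes make \<open>f\<close> and \<open>g\<close> positive.\<close>

lemma has_normal_ppp:
  assumes "1 < f^2" "1 < g^2" "0 < qdet 1 1 1 f g h"
  shows "has_normal (1,1,1,f,g,h)"
proof -
  have base: "has_normal (1,1,1,f,g,h)" if "1 < f" "1 < g" "0 < qdet 1 1 1 f g h" for f g h
  proof -
    have "qdet 1 1 1 f g h = (f^2-1)*(g^2-1) - (h - f*g)^2" unfolding qdet_def by (simp add: algebra_simps power2_eq_square)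
    then have "(h - f*g)^2 < (f^2-1)*(g^2-1)" using that(3) by simp
    from ratio_sqrt[OF this] obtain t where t: "-1 < t" "t < 1" "h - f*g = t * sqrt ((f^2-1)*(g^2-1))" by blast
    then have "h = f*g + t * sqrt ((f^2-1)*(g^2-1))" by linarith
    then show ?thesis using t that by (intro has_normal_region[of 0 f g t]) (simp_all add: region_dom_def region_map_def)
  qed
  have d: "qdet 1 1 1 (-f) g (-h) = qdet 1 1 1 f g h" "qdet 1 1 1 f (-g) (-h) = qdet 1 1 1 f g h" "qdet 1 1 1 (-f) (-g) h = qdet 1 1 1 f g h"
    unfolding qdet_def by (simp_all add: algebra_simps)
  have *: "1 < f \<or> 1 < - f" "1 < g \<or> 1 < - g" using sq_gt1_cases assms by blast+
  then show ?thesis using base[of f g h] base[of "-f" g "-h"] base[of f "-g" "-h"] base[of "-f" "-g" h] assms(3) d has_normal_flip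
    by metis
qed

lemma has_normal_ppm:
  assumes "0 < qdet 1 1 (-1) f g h"
  shows "has_normal (1,1,-1,f,g,h)"
proof -
  have e: "qdet 1 1 (-1) f g h = (h^2-1)*(1+g^2) - (f - h*g)^2" for f g h :: real unfolding qdet_def by (simp add: algebra_simps power2_eq_square)
  have base: "has_normal (1,1,-1,f,g,h)" if "1 < h" "0 < qdet 1 1 (-1) f g h" for f g h
  proof -
    have "(f - h*g)^2 < (h^2-1)*(1+g^2)" using that(2) e by simp
    from ratio_sqrt[OF this] obtain t where t: "-1 < t" "t < 1" "f - h*g = t * sqrt ((h^2-1)*(1+g^2))" by blast
    then have "f = h*g + t * sqrt ((h^2-1)*(1+g^2))" by linarith
    then show ?thesis using t that by (intro has_normal_region[of 1 g h t]) (simp_all add: region_dom_def region_map_def)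
  qed
  have "0 < (h^2-1)*(1+g^2)" using assms e[of f g h] zero_le_power2[of "f - h*g"] by linarith
  moreover have "0 < 1 + g^2" using zero_le_power2[of g] by linarith
  ultimately have "1 < h^2" by (simp add: zero_less_mult_iff)
  then have "1 < h \<or> 1 < - h" by (rule sq_gt1_cases)
  moreover have "qdet 1 1 (-1) f (-g) (-h) = qdet 1 1 (-1) f g h" unfolding qdet_def by (simp add: algebra_simps)
  ultimately show ?thesis using base[of h f g] base[of "-h" f "-g"] has_normal_flip(1) assms by metis
qed

text \<open>For \<open>f^2 < 1\<close> there is no constraint on \<open>g\<close> and
  \<open>h\<close>. For \<open>f^2 > 1\<close> the determinant is positive on two half lines in
  \<open>h\<close>, which are exchanged by changing the signs of \<open>g\<close> and
  \<open>h\<close>.\<close>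

lemma has_normal_pmm:
  assumes "0 < qdet 1 (-1) (-1) f g h" "1 - f^2 \<noteq> 0"
  shows "has_normal (1,-1,-1,f,g,h)"
proof (cases "f^2 < 1")
  case True
  then show ?thesis using sq_lt1D[OF True] by (intro has_normal_region[of 2 f g h]) (simp_all add: region_dom_def region_map_def)
next
  case False
  then have f: "1 < f^2" using assms(2) by simp
  have e: "qdet 1 (-1) (-1) f g h = (h + f*g)^2 - (f^2-1)*(g^2+1)" for f g h :: real unfolding qdet_def by (simp add: algebra_simps power2_eq_square)
  have base: "has_normal (1,-1,-1,f,g,h)" if "1 < f" "sqrt ((f^2-1)*(g^2+1)) < h + f*g" for f g h
    using that by (intro has_normal_region[of 3 f g "h + f*g - sqrt ((f^2-1)*(g^2+1))"]) (simp_all add: region_dom_def region_map_def)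
  have base2: "has_normal (1,-1,-1,f,g,h)" if "1 < f" "0 < qdet 1 (-1) (-1) f g h" for f g h
  proof -
    have "(f^2-1)*(g^2+1) < (h + f*g)^2" using that(2) e by simp
    moreover have "0 \<le> (f^2-1)*(g^2+1)" using sq_gt1(1)[OF that(1)] zero_le_power2[of g] by (intro mult_nonneg_nonneg) linarith+
    ultimately have "sqrt ((f^2-1)*(g^2+1)) < h + f*g \<or> sqrt ((f^2-1)*(g^2+1)) < - (h + f*g)" by (rule sqrt_less_or)
    then show ?thesis
    proof
      assume "sqrt ((f^2-1)*(g^2+1)) < - (h + f*g)"
      then have "has_normal (1,-1,-1,f,-g,-h)" by (intro base[OF that(1)]) simp
      then show ?thesis by (rule has_normal_flip)
    qed (rule base[OF that(1)])
  qed
  have "qdet 1 (-1) (-1) (-f) g (-h) = qdet 1 (-1) (-1) f g h" unfolding qdet_def by (simp add: algebra_simps)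
  then show ?thesis using base2[of f g h] base2[of "-f" g "-h"] sq_gt1_cases[OF f] has_normal_flip(2) assms by metis
qed

lemma qdet_mmm: "qdet (-1) (-1) (-1) f g h = (h + f*g)^2 - (1 - f^2)*(1 - g^2)" for f :: real
  unfolding qdet_def by (simp add: algebra_simps power2_eq_square)

lemma has_normal_mmm_small:
  assumes "0 < qdet (-1) (-1) (-1) f g h" "f^2 < 1" "g^2 < 1" "h^2 < 1"
  shows "has_normal (-1,-1,-1,f,g,h)"
proof -
  have base: "has_normal (-1,-1,-1,f,g,h)" if fg: "-1 < f" "f < 1" "-1 < g" "g < 1" "0 < f + g" and h: "h < 1" "sqrt ((1-f^2)*(1-g^2)) < h + f*g" for f g h
  proof -
    let ?l = "-f*g + sqrt ((1-f^2)*(1-g^2))"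
    have l: "?l < h" "?l < 1" using h by linarith+
    \<comment> \<open>The relative position of \<open>h\<close> between the larger root
      \<open>?l\<close> of the determinant and 1.\<close>
    let ?t = "(h - ?l) / (1 - ?l)"
    have t: "0 < ?t" "?t < 1" using l h by (simp_all add: field_simps)
    have "h = ?l + ?t * (1 - ?l)" using l by simp
    also have "\<dots> = (1 - ?t) * ?l + ?t" by (simp only: left_diff_distrib right_diff_distrib mult_1_left mult_1_right)
    finally have "h = (1 - ?t) * ?l + ?t" .
    then show ?thesis using t fg by (intro has_normal_region[of 4 f g ?t]) (simp_all add: region_dom_def region_map_def)
  qed
  have base2: "has_normal (-1,-1,-1,f,g,h)" if fg: "f^2 < 1" "g^2 < 1" "h^2 < 1" and h: "sqrt ((1-f^2)*(1-g^2)) < h + f*g" for f g h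
  proof -
    note b = sq_lt1D[OF fg(1)] sq_lt1D[OF fg(2)] sq_lt1D[OF fg(3)]
    \<comment> \<open>On \<open>f + g = 0\<close> the larger root equals 1, which leaves no room for
      \<open>h\<close>.\<close>
    have "f + g \<noteq> 0"
    proof
      assume "f + g = 0"
      then have g: "g = - f" by linarith
      have "sqrt ((1-f^2)*(1-g^2)) = 1 - f^2" unfolding g using fg(1) by (simp flip: power2_eq_square)
      then show False using h b unfolding g by (simp add: power2_eq_square)
    qed
    then consider "0 < f + g" | "0 < - f + - g" by linarith
    then show ?thesis
    proof cases
      case 1 then show ?thesis using base b h by blast
    next
      case 2
      have "has_normal (-1,-1,-1,-f,-g,h)" using base[of "-f" "-g" h] 2 b h by simp
      then show ?thesis by (rule has_normal_flip)
    qed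
  qed
  have "(1-f^2)*(1-g^2) < (h + f*g)^2" using assms(1) unfolding qdet_mmm by simp
  moreover have "0 \<le> (1-f^2)*(1-g^2)" using assms by (intro mult_nonneg_nonneg) linarith+
  ultimately have "sqrt ((1-f^2)*(1-g^2)) < h + f*g \<or> sqrt ((1-f^2)*(1-g^2)) < - (h + f*g)" by (rule sqrt_less_or)
  then show ?thesis
  proof
    assume "sqrt ((1-f^2)*(1-g^2)) < - (h + f*g)"
    then have "has_normal (-1,-1,-1,f,-g,-h)" using assms by (intro base2) simp_all
    then show ?thesis by (rule has_normal_flip)
  qed (intro base2 assms)
qed

lemma has_normal_mmm_1:
  assumes "1 < f^2" "g^2 < 1" "h^2 < 1"
  shows "has_normal (-1,-1,-1,f,g,h)"
proof -
  have base: "has_normal (-1,-1,-1,f,g,h)" if "1 < f" "g^2 < 1" "h^2 < 1" for f g h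
    using that sq_lt1D[OF that(2)] sq_lt1D[OF that(3)] by (intro has_normal_region[of 5 f g h]) (simp_all add: region_dom_def region_map_def)
  show ?thesis using sq_gt1_cases[OF assms(1)]
  proof
    assume "1 < - f"
    then have "has_normal (-1,-1,-1,-f,g,-h)" using assms by (intro base) simp_all
    then show ?thesis by (rule has_normal_flip)
  qed (intro base assms)
qed

text \<open>For \<open>f\<close> and \<open>g\<close> above 1 and \<open>h\<close> below -1 the
  determinant is positive below its smaller and above its larger root in \<open>h\<close>. Requiring
  \<open>h\<close> to have the largest absolute value excludes the second range, where another
  coefficient dominates.\<close>

lemma has_normal_mmm_23:
  assumes "0 < qdet (-1) (-1) (-1) f g h" "1 < f^2" "1 < g^2" "h^2 \<noteq> 1" "h^2 < 1 \<or> f^2 \<le> h^2 \<and> g^2 \<le> h^2"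
  shows "has_normal (-1,-1,-1,f,g,h)"
proof -
  have base: "has_normal (-1,-1,-1,f,g,h)" if d: "0 < qdet (-1) (-1) (-1) f g h" and fg: "1 < f" "1 < g" and h1: "h^2 \<noteq> 1"
     and h: "h^2 < 1 \<or> f^2 \<le> h^2 \<and> g^2 \<le> h^2" for f g h
  proof (cases "h^2 < 1")
    case True
    then show ?thesis using sq_lt1D[OF True] fg by (intro has_normal_region[of 6 f g h]) (simp_all add: region_dom_def region_map_def)
  next
    case False
    then have "1 < h^2" using h1 by simp
    then consider "1 < h" | "1 < - h" using sq_gt1_cases by blast
    then show ?thesis
    proof cases
      case 1
      then show ?thesis using fg by (intro has_normal_region[of 7 f g h]) (simp_all add: region_dom_def region_map_def)
    next
      case 2
      let ?s = "(f^2-1)*(g^2-1)"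
      have s: "0 \<le> ?s" using sq_gt1(1)[OF fg(1)] sq_gt1(1)[OF fg(2)] by simp
      have "?s < (h + f*g)^2" using d unfolding qdet_mmm by (simp add: algebra_simps)
      then have "sqrt ?s < h + f*g \<or> sqrt ?s < - (h + f*g)" using s by (rule sqrt_less_or)
      moreover have "\<not> sqrt ?s < h + f*g"
      proof
        assume a: "sqrt ?s < h + f*g"
        have le: "f \<le> - h" "g \<le> - h" using h False fg 2 power2_le_imp_le[of f "- h"] power2_le_imp_le[of g "- h"] by auto
        define M where "M = max f g"
        \<comment> \<open>Together with \<open>M \<le> - h\<close> this gives
          \<open>h + f * g \<le> sqrt ?s\<close>, contrary to the assumption.\<close>
        have "f * g - M \<le> sqrt ?s"
        proof -
          have ord: "f * g - f \<le> sqrt ((f^2-1)*(g^2-1))" if "1 < g" "g \<le> f" for f g :: real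
          proof (rule real_le_rsqrt)
            have "g^2 \<le> f^2" using that by (intro power_mono) auto
            have "(f^2-1)*(g^2-1) - (f * g - f)^2 = (g - 1) * (2 * f^2 - g - 1)" by (simp add: algebra_simps power2_eq_square)
            have "g \<le> g^2" using that by (intro self_le_power) auto
            then have "g \<le> f^2" using \<open>g^2 \<le> f^2\<close> by linarith
            have "1 \<le> f^2" using that sq_gt1(1)[of f] by auto
            show "(f * g - f)^2 \<le> (f^2-1)*(g^2-1)" 
            proof -
              have "0 \<le> (g - 1) * (2 * f^2 - g - 1)"
                using that \<open>g \<le> f^2\<close> \<open>1 \<le> f^2\<close> by (intro mult_nonneg_nonneg) linarith+
              then show ?thesis
                using \<open>(f^2-1)*(g^2-1) - (f * g - f)^2 = (g - 1) * (2 * f^2 - g - 1)\<close> by linarith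
            qed
          qed
          show ?thesis unfolding M_def using ord[of g f] ord[of f g] fg by (cases "g \<le> f") (auto simp: mult.commute)
        qed
        moreover have "M \<le> - h" unfolding M_def using le by simp
        ultimately show False using a by linarith
      qed
      ultimately have "sqrt ?s < - (h + f*g)" by blast
      then show ?thesis using fg by (intro has_normal_region[of 8 f g "- (h + f*g) - sqrt ?s"]) (simp_all add: region_dom_def region_map_def)
    qed
  qed
  have d: "qdet (-1) (-1) (-1) (-f) g (-h) = qdet (-1) (-1) (-1) f g h" "qdet (-1) (-1) (-1) f (-g) (-h) = qdet (-1) (-1) (-1) f g h"
    "qdet (-1) (-1) (-1) (-f) (-g) h = qdet (-1) (-1) (-1) f g h"
    unfolding qdet_def by (simp_all add: algebra_simps)
  consider "1 < f" "1 < g" | "1 < - f" "1 < g" | "1 < f" "1 < - g" | "1 < - f" "1 < - g"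
    using sq_gt1_cases assms by blast
  then show ?thesis
  proof cases
    case 1 then show ?thesis using assms by (intro base)
  next
    case 2
    then have "has_normal (-1,-1,-1,-f,g,-h)" using assms by (intro base) (simp_all add: d)
    then show ?thesis by (rule has_normal_flip)
  next
    case 3
    then have "has_normal (-1,-1,-1,f,-g,-h)" using assms by (intro base) (simp_all add: d)
    then show ?thesis by (rule has_normal_flip)
  next
    case 4
    then have "has_normal (-1,-1,-1,-f,-g,h)" using assms by (intro base) (simp_all add: d)
    then show ?thesis by (rule has_normal_flip)
  qed
qed

text \<open>By permutations only the number of mixed coefficients outside \<open>[-1, 1]\<close>
  matters, and if all three are outside, the last may be taken to be the largest in absolute
  value.\<close>

lemma has_normal_mmm:
  assumes "0 < qdet (-1) (-1) (-1) f g h" "f^2 \<noteq> 1" "g^2 \<noteq> 1" "h^2 \<noteq> 1"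
  shows "has_normal (-1,-1,-1,f,g,h)"
proof -
  let ?H = "\<lambda>f g h. has_normal (-1,-1,-1,f,g,h)"
  have sw: "?H g f h \<Longrightarrow> ?H f g h" "?H f h g \<Longrightarrow> ?H f g h" for f g h
    using has_normal_steps(1)[of "-1" "-1" "-1" g f h] has_normal_steps(2)[of "-1" "-1" "-1" f h g] by blast+
  have rot: "?H g h f \<Longrightarrow> ?H f g h" "?H h f g \<Longrightarrow> ?H f g h" "?H h g f \<Longrightarrow> ?H f g h" for f g h
    using sw by blast+
  have d: "0 < qdet (-1) (-1) (-1) g f h" "0 < qdet (-1) (-1) (-1) f h g" "0 < qdet (-1) (-1) (-1) g h f"
     "0 < qdet (-1) (-1) (-1) h f g" "0 < qdet (-1) (-1) (-1) h g f"
    using assms(1) unfolding qdet_def by (simp_all add: algebra_simps)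
  have c: "f^2 < 1 \<or> 1 < f^2" "g^2 < 1 \<or> 1 < g^2" "h^2 < 1 \<or> 1 < h^2" using assms by linarith+
  consider "f^2 < 1" "g^2 < 1" "h^2 < 1" | "1 < f^2" "g^2 < 1" "h^2 < 1" | "f^2 < 1" "1 < g^2" "h^2 < 1" | "f^2 < 1" "g^2 < 1" "1 < h^2"
    | "1 < f^2" "1 < g^2" "h^2 < 1 \<or> f^2 \<le> h^2 \<and> g^2 \<le> h^2" | "1 < f^2" "1 < h^2" "g^2 < 1 \<or> f^2 \<le> g^2 \<and> h^2 \<le> g^2"
    | "1 < g^2" "1 < h^2" "f^2 < 1 \<or> g^2 \<le> f^2 \<and> h^2 \<le> f^2"
    using c by linarith
  then show ?thesis
  proof cases
    case 1 then show ?thesis using has_normal_mmm_small assms by blast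
  next
    case 2 then show ?thesis using has_normal_mmm_1 by blast
  next
    case 3 then show ?thesis using has_normal_mmm_1 sw(1) by blast
  next
    case 4 then show ?thesis using has_normal_mmm_1[of h f g] rot(2) by blast
  next
    case 5 then show ?thesis using has_normal_mmm_23 assms by blast
  next
    case 6 then show ?thesis using has_normal_mmm_23[of f h g] assms d sw(2) by blast
  next
    case 7 then show ?thesis using has_normal_mmm_23[of g h f] assms d rot(1) by blast
  qed
qed

lemma qdet_swap: "qdet b a c g f h = qdet a b c f g h" "qdet a c b f h g = qdet a b c f g h" for a :: real
  unfolding qdet_def by (simp_all add: algebra_simps)

lemma good_has_normal:
  assumes "good a b c f g h"
  shows "has_normal (a,b,c,f,g,h)"
proof -
  have unit: "has_normal (a,b,c,f,g,h)" if gd: "good a b c f g h" and d: "0 < qdet a b c f g h"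
     and u: "a = 1 \<or> a = -1" "b = 1 \<or> b = -1" "c = 1 \<or> c = -1" for a b c f g h
  proof -
    have pmm: "has_normal (1,-1,-1,f,g,h)" if "good 1 (-1) (-1) f g h" "0 < qdet 1 (-1) (-1) f g h" for f g h
      using that has_normal_pmm[of f g h] unfolding good_def by simp
    have ppm: "has_normal (1,1,-1,f,g,h)" if "0 < qdet 1 1 (-1) f g h" for f g h by (rule has_normal_ppm[OF that])
    consider "a = 1" "b = 1" "c = 1" | "a = 1" "b = 1" "c = -1" | "a = 1" "b = -1" "c = 1" | "a = -1" "b = 1" "c = 1"
      | "a = 1" "b = -1" "c = -1" | "a = -1" "b = 1" "c = -1" | "a = -1" "b = -1" "c = 1" | "a = -1" "b = -1" "c = -1"
      using u by blast
    then show ?thesis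
    proof cases
      case 1
      have g1: "1 - h^2 < 0" using gd d unfolding good_def 1 by auto
      have e: "1 * qdet 1 1 1 f g h + (1*f - g*h)^2 = (1*1 - h^2) * (1*1 - g^2)"
        "1 * qdet 1 1 1 f g h + (1*g - f*h)^2 = (1*1 - h^2) * (1*1 - f^2)"
        unfolding qdet_def by (simp_all add: algebra_simps power2_eq_square)
      have "0 < 1 * qdet 1 1 1 f g h + (1*f - g*h)^2" "0 < 1 * qdet 1 1 1 f g h + (1*g - f*h)^2"
        using d unfolding 1 by (simp_all add: add_pos_nonneg)
      then have "1 < g^2" "1 < f^2" using g1 unfolding e by (auto simp: zero_less_mult_iff)
      then show ?thesis using has_normal_ppp d unfolding 1 by blast
    next
      case 2 then show ?thesis using ppm d by blast
    next
      case 3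
      have "has_normal (1,1,-1,f,h,g)" using d qdet_swap(2)[of 1 1 "-1" f h g] unfolding 3 by (intro ppm) simp
      then show ?thesis unfolding 3 by (rule has_normal_steps(2))
    next
      case 4
      have "qdet 1 1 (-1) g h f = qdet (-1) 1 1 f g h" unfolding qdet_def by (simp add: algebra_simps)
      then have "has_normal (1,1,-1,g,h,f)" using d unfolding 4 by (intro ppm) simp
      then show ?thesis unfolding 4 by (intro has_normal_steps(1)[of 1 "-1" 1 g f h] has_normal_steps(2)[of 1 1 "-1" g h f])
    next
      case 5 then show ?thesis using pmm gd d by blast
    next
      case 6
      have "has_normal (1,-1,-1,g,f,h)" using d gd qdet_swap(1)[of 1 "-1" "-1" g f h] good_swap12[of 1 "-1" "-1" g f h] unfolding 6 by (intro pmm) simp_all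
      then show ?thesis unfolding 6 by (rule has_normal_steps(1))
    next
      case 7
      have "qdet 1 (-1) (-1) h f g = qdet (-1) (-1) 1 f g h" unfolding qdet_def by (simp add: algebra_simps)
      moreover have "good 1 (-1) (-1) h f g" using gd good_swap12[of 1 "-1" "-1" h f g] good_swap23[of "-1" 1 "-1" f h g] unfolding 7 by simp
      ultimately have "has_normal (1,-1,-1,h,f,g)" using d unfolding 7 by (intro pmm) simp_all
      then show ?thesis unfolding 7 by (intro has_normal_steps(2)[of "-1" 1 "-1" f h g] has_normal_steps(1)[of 1 "-1" "-1" h f g])
    next
      case 8
      then show ?thesis using has_normal_mmm[of f g h] gd d unfolding good_def by auto
    qed
  qed
  have pos: "has_normal (a,b,c,f,g,h)" if gd: "good a b c f g h" and d: "0 < qdet a b c f g h" for a b c f g h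
  proof -
    have nz: "a \<noteq> 0" "b \<noteq> 0" "c \<noteq> 0" using gd unfolding good_def by auto
    define k l m where "k = 1 / sqrt \<bar>a\<bar>" and "l = 1 / sqrt \<bar>b\<bar>" and "m = 1 / sqrt \<bar>c\<bar>"
    have klm: "k \<noteq> 0" "l \<noteq> 0" "m \<noteq> 0" unfolding k_def l_def m_def using nz by simp_all
    have sq: "x * (1 / sqrt \<bar>x\<bar>)^2 = 1 \<or> x * (1 / sqrt \<bar>x\<bar>)^2 = -1" if "x \<noteq> 0" for x :: real
      using that by (cases "0 < x") (simp_all add: power_divide)
    have "has_normal (a*k^2, b*l^2, c*m^2, f*l*m, g*k*m, h*k*l)"
    proof (rule unit)
      show "good (a*k^2) (b*l^2) (c*m^2) (f*l*m) (g*k*m) (h*k*l)" using good_scale[OF klm] gd by simp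
      show "0 < qdet (a*k^2) (b*l^2) (c*m^2) (f*l*m) (g*k*m) (h*k*l)" unfolding qdet_scale using d klm by simp
    qed (use sq nz in \<open>auto simp: k_def l_def m_def\<close>)
    then show ?thesis using klm by (rule has_normal_steps(4))
  qed
  show ?thesis
  proof (cases "0 < qdet a b c f g h")
    case True then show ?thesis using pos assms by blast
  next
    case False
    then have "qdet a b c f g h < 0" using assms unfolding good_def by auto
    moreover have "qdet (-a) (-b) (-c) (-f) (-g) (-h) = - qdet a b c f g h" unfolding qdet_def by (simp add: algebra_simps)
    ultimately have "has_normal (-a,-b,-c,-f,-g,-h)" using assms by (intro pos) (simp_all add: good_neg)
    then show ?thesis by (rule has_normal_steps(3))
  qed
qed

lemma region_label_inj: "k < 9 \<Longrightarrow> k' < 9 \<Longrightarrow> region_label k = region_label k' \<Longrightarrow> k = k'"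
  unfolding region_label_def by (auto simp: less_Suc_eq numeral_eq_Suc nth_Cons split: nat.splits)

lemma cgood_normal_form:
  assumes "cgood q"
  obtains k q' where "k < 9" "q' \<in> region k" "conic_equiv q q'" "clabel q = region_label k"
proof -
  have "has_normal q" using assms good_has_normal by (cases q) auto
  then obtain k q' where "k < 9" "q' \<in> region k" "conic_equiv q q'" unfolding has_normal_def by blast
  moreover have "clabel q = region_label k" using calculation region_spec conic_equiv_label[OF _ assms] by metis
  ultimately show ?thesis by (rule that)
qed

subsection \<open>The label of a quartic\<close>

text \<open>The form is recovered from its diagonal: one derivative frees the last slot, a second
  one the third slot, and expansion at \<open>x + y\<close> separates the first two.\<close>

lemma polar_eq_of_diag:
  fixes c c' :: "nat \<Rightarrow> nat \<Rightarrow> complex"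
  assumes "\<And>z. polar c z z z z = k * polar c' z z z z"
  shows "polar c x y z w = k * polar c' x y z w"
proof -
  have 1: "polar c z z z v = k * polar c' z z z v" for z v
  proof -
    have "((\<lambda>z. k * polar c' z z z z) has_derivative (\<lambda>h. k * (4 * polar c' z z z h))) (at z)"
      by (rule has_derivative_mult_right[OF polar_diag_has_derivative])
    moreover have "((\<lambda>z. k * polar c' z z z z) has_derivative (\<lambda>h. 4 * polar c z z z h)) (at z)"
      unfolding assms[symmetric] by (rule polar_diag_has_derivative)
    ultimately have "(\<lambda>h. k * (4 * polar c' z z z h)) = (\<lambda>h. 4 * polar c z z z h)" by (rule has_derivative_unique)
    from fun_cong[OF this, of v] show ?thesis by simp
  qed
  have d3: "((\<lambda>z. polar e z z z v) has_derivative (\<lambda>h. 3 * polar e z z h v)) (at z)" for e :: "nat \<Rightarrow> nat \<Rightarrow> complex" and z v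
    using polar_has_derivative[OF has_derivative_ident has_derivative_ident has_derivative_ident has_derivative_const, of e v z]
      polar_swap(1)[of e _ z z v] polar_swap(2)[of e z _ z v] by simp
  have 2: "polar c z z u v = k * polar c' z z u v" for z u v
  proof -
    have "((\<lambda>z. k * polar c' z z z v) has_derivative (\<lambda>h. k * (3 * polar c' z z h v))) (at z)"
      by (rule has_derivative_mult_right[OF d3])
    moreover have "((\<lambda>z. k * polar c' z z z v) has_derivative (\<lambda>h. 3 * polar c z z h v)) (at z)"
      unfolding 1[symmetric] by (rule d3)
    ultimately have "(\<lambda>h. k * (3 * polar c' z z h v)) = (\<lambda>h. 3 * polar c z z h v)" by (rule has_derivative_unique)
    from fun_cong[OF this, of u] show ?thesis by simp
  qed
  have "polar c (x + y) (x + y) z w = k * polar c' (x + y) (x + y) z w" by (rule 2)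
  then show ?thesis
    using 2[of x z w] 2[of y z w] polar_swap(1)[of c y x z w] polar_swap(1)[of c' y x z w]
    by (simp add: polar_add algebra_simps)
qed

text \<open>The coefficients that \<open>frame_expand\<close> finds for a quartic in the frame of
  its nodes.\<close>

definition conic_of :: "(nat \<Rightarrow> nat \<Rightarrow> real) \<Rightarrow> real^3 \<Rightarrow> real^3 \<Rightarrow> real^3 \<Rightarrow> conic" where
  "conic_of c y1 y2 y3 = (6 * polar c y2 y2 y3 y3, 6 * polar c y1 y1 y3 y3, 6 * polar c y1 y1 y2 y2,
     6 * polar c y1 y1 y2 y3, 6 * polar c y1 y2 y2 y3, 6 * polar c y1 y2 y3 y3)"

lemma conic_of_label_swap:
  "clabel (conic_of c y2 y1 y3) = clabel (conic_of c y1 y2 y3)"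
  "clabel (conic_of c y1 y3 y2) = clabel (conic_of c y1 y2 y3)"
proof -
  have 1: "polar c y2 y2 y1 y1 = polar c y1 y1 y2 y2" "polar c y2 y2 y1 y3 = polar c y1 y2 y2 y3" "polar c y2 y1 y1 y3 = polar c y1 y1 y2 y3"
    "polar c y2 y1 y3 y3 = polar c y1 y2 y3 y3"
    by (metis polar_swap)+
  have 2: "polar c y3 y3 y2 y2 = polar c y2 y2 y3 y3" "polar c y1 y1 y3 y2 = polar c y1 y1 y2 y3" "polar c y1 y3 y3 y2 = polar c y1 y2 y3 y3"
    "polar c y1 y3 y2 y2 = polar c y1 y2 y2 y3"
    by (metis polar_swap)+
  show "clabel (conic_of c y2 y1 y3) = clabel (conic_of c y1 y2 y3)"
    unfolding conic_of_def 1 by (rule clabel_swap12)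
  show "clabel (conic_of c y1 y3 y2) = clabel (conic_of c y1 y2 y3)"
    unfolding conic_of_def 2 by (rule clabel_swap23)
qed

lemma conic_of_label_scale:
  assumes "k \<noteq> 0" "l \<noteq> 0" "m \<noteq> 0"
  shows "clabel (conic_of c (k *s y1) (l *s y2) (m *s y3)) = clabel (conic_of c y1 y2 y3)"
proof -
  let ?a = "6 * polar c y2 y2 y3 y3" and ?b = "6 * polar c y1 y1 y3 y3" and ?c = "6 * polar c y1 y1 y2 y2"
    and ?f = "6 * polar c y1 y1 y2 y3" and ?g = "6 * polar c y1 y2 y2 y3" and ?h = "6 * polar c y1 y2 y3 y3"
  have "conic_of c (k *s y1) (l *s y2) (m *s y3) = (?a*(l*m)^2, ?b*(k*m)^2, ?c*(k*l)^2, ?f*(k*m)*(k*l), ?g*(l*m)*(k*l), ?h*(l*m)*(k*m))"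
    unfolding conic_of_def by (simp add: polar_scale power2_eq_square algebra_simps)
  then show ?thesis using assms unfolding conic_of_def[of c y1 y2 y3] by (simp only: clabel_scale mult_eq_0_iff simp_thms)
qed

lemma clabel_cmult:
  assumes "k \<noteq> 0" "qdet a b c f g h \<noteq> 0"
  shows "clabel (k*a,k*b,k*c,k*f,k*g,k*h) = clabel (a,b,c,f,g,h)"
proof -
  have pos: "clabel (k*a,k*b,k*c,k*f,k*g,k*h) = clabel (a,b,c,f,g,h)" if "0 < k" for k a b c f g h
  proof -
    have k: "x * sqrt k * sqrt k = k * x" "x * (sqrt k)^2 = k * x" for x using that by (simp_all add: mult.assoc)
    have "clabel (a*(sqrt k)^2,b*(sqrt k)^2,c*(sqrt k)^2,f * sqrt k * sqrt k,g * sqrt k * sqrt k,h * sqrt k * sqrt k) = clabel (a,b,c,f,g,h)"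
      by (rule clabel_scale) (use that in simp_all)
    then show ?thesis unfolding k .
  qed
  show ?thesis
  proof (cases "0 < k")
    case True then show ?thesis by (rule pos)
  next
    case False
    then have "0 < - k" using assms(1) by simp
    from pos[OF this, of "-a" "-b" "-c" "-f" "-g" "-h"]
    have "clabel (k*a,k*b,k*c,k*f,k*g,k*h) = clabel (cneg (a,b,c,f,g,h))" by simp
    also have "\<dots> = clabel (a,b,c,f,g,h)" by (rule clabel_neg) (simp add: assms(2))
    finally show ?thesis .
  qed
qed

lemma real_plane_curve_zeros:
  "real_plane_curve 4 c C \<Longrightarrow> C = {x. ternary_form 4 (\<lambda>i j. of_real (c i j)) (rep_cproj x) = 0}"
  unfolding real_plane_curve_def by blast

lemma real_rational_rat_quartic:
  assumes "real_rational_curve 4 p c' C" "real_plane_curve 4 c C"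
  shows "rat_quartic p c"
  using assms unfolding real_rational_curve_def real_plane_curve_def rat_quartic_def by blast

lemma equation_unique:
  assumes "rat_quartic p c" "rat_quartic p c'"
  obtains k where "k \<noteq> 0" "\<And>x y z w. polar (\<lambda>i j. complex_of_real (c' i j)) x y z w = k * polar (\<lambda>i j. of_real (c i j)) x y z w"
proof -
  interpret R: rat_quartic p c by fact
  interpret R': rat_quartic p c' by fact
  obtain k where k: "\<And>z. R'.M z z z z = k * R.M z z z z" using R.quartic_unique[OF R'.M_P] by metis
  have e: "R'.M x y z w = k * R.M x y z w" for x y z w by (rule polar_eq_of_diag) (rule k)
  obtain y where "R'.M y y y y \<noteq> 0" by (rule R'.ex_nonzero)
  then have "k \<noteq> 0" using k by auto
  then show ?thesis using e by (rule that)
qed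

lemma nodal_transfer:
  assumes "rat_quartic p c" "rat_quartic p c'" "\<forall>x\<in>singular_points 4 c. Q x"
  shows "\<forall>x\<in>singular_points 4 c'. Q x"
proof -
  obtain k where "k \<noteq> 0" "\<And>x y z w. polar (\<lambda>i j. complex_of_real (c' i j)) x y z w = k * polar (\<lambda>i j. of_real (c i j)) x y z w"
    using equation_unique[OF assms(1,2)] by metis
  then have "singular_points 4 c' = singular_points 4 c" by (auto simp: singular_points_4)
  then show ?thesis using assms(3) by simp
qed

text \<open>\<open>nodal_curve\<close> speaks of some equation of \<open>C\<close>, while an isotopy
  prescribes the equation \<open>c\<close>. Uniqueness of the equation carries nodality over to
  \<open>c\<close>.\<close>

lemma nodal_curve_quartic:
  assumes "nodal_curve 4 C" "real_plane_curve 4 c C"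
  obtains p where "nodal_quartic p c"
proof -
  obtain p c' where p: "real_rational_curve 4 p c' C" and n: "\<forall>x\<in>singular_points 4 c'. node 4 p x"
    using assms(1) unfolding nodal_curve_def by blast
  have c': "rat_quartic p c'" using p real_rational_rat_quartic unfolding real_rational_curve_def by blast
  have c: "rat_quartic p c" using p assms(2) by (rule real_rational_rat_quartic)
  show ?thesis
    by (rule that) (use c nodal_transfer[OF c' c n] in \<open>auto simp: nodal_quartic_def nodal_quartic_axioms_def\<close>)
qed

text \<open>A nonzero coordinate of \<open>y\<close> exhibits the complex factor between the two
  real vectors as a quotient of real numbers.\<close>

lemma equiv_cx:
  assumes "hom_equiv (cx y) (cx y')"
  obtains k where "k \<noteq> 0" "y' = k *s y"
proof -
  obtain l where l: "l \<noteq> 0" "cx y' = l *s cx y" using assms by (rule equiv_scaleE)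
  have "cx y \<noteq> 0" using hom_equiv_nonzero[OF assms] by blast
  then have "y \<noteq> 0" by simp
  then obtain i where i: "y $ i \<noteq> 0" by (auto simp: vec_eq_iff)
  have "of_real (y' $ i) = l * of_real (y $ i)" using arg_cong[OF l(2), of "\<lambda>v. v $ i"] by simp
  then have le: "l = of_real (y' $ i / y $ i)" using i by (simp add: field_simps)
  have "y' $ j = (y' $ i / y $ i) * y $ j" for j
  proof -
    have "complex_of_real (y' $ j) = l * of_real (y $ j)" using arg_cong[OF l(2), of "\<lambda>v. v $ j"] by simp
    then have "complex_of_real (y' $ j) = of_real ((y' $ i / y $ i) * y $ j)" unfolding le by simp
    then show ?thesis by (simp only: of_real_eq_iff)
  qed
  then have "\<forall>j. y' $ j = ((y' $ i / y $ i) *s y) $ j" unfolding vector_smult_component by (intro allI)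
  then have "y' = (y' $ i / y $ i) *s y" unfolding vec_eq_iff .
  moreover have "y' $ i / y $ i \<noteq> 0" using le l(1) by auto
  ultimately show ?thesis using that by blast
qed

context quartic_frame
begin

lemma frame_gradient:
  assumes "z0 = x *s v1 + y *s v2 + z *s v3"
  shows "2 * M z0 z0 z0 v1 = (6 * M v1 v1 v3 v3)*x*z^2 + (6 * M v1 v1 v2 v2)*x*y^2 + 2*(6 * M v1 v1 v2 v3)*x*y*z + (6 * M v1 v2 v2 v3)*y^2*z + (6 * M v1 v2 v3 v3)*y*z^2"
    "2 * M z0 z0 z0 v2 = (6 * M v2 v2 v3 v3)*y*z^2 + (6 * M v1 v1 v2 v2)*x^2*y + (6 * M v1 v1 v2 v3)*x^2*z + 2*(6 * M v1 v2 v2 v3)*x*y*z + (6 * M v1 v2 v3 v3)*x*z^2"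
    "2 * M z0 z0 z0 v3 = (6 * M v2 v2 v3 v3)*y^2*z + (6 * M v1 v1 v3 v3)*x^2*z + (6 * M v1 v1 v2 v3)*x^2*y + (6 * M v1 v2 v2 v3)*x*y^2 + 2*(6 * M v1 v2 v3 v3)*x*y*z"
  unfolding assms by (simp add: polar_add polar_scale vertex_vanish vertex_swap, simp add: power2_eq_square algebra_simps)+

lemma cgood_conic: "cgood (conic_of c y1 y2 y3)"
  unfolding conic_of_def using good_conic by simp

text \<open>\<open>crem_singular\<close> applies to the quartic in its frame, the partial
  derivatives being those of \<open>frame_gradient\<close>; so three is the exact number of
  nodes.\<close>

lemma singular_is_vertex:
  assumes z: "z \<noteq> 0" and sing: "\<And>v. M z z z v = 0"
  shows "hom_equiv v1 z \<or> hom_equiv v2 z \<or> hom_equiv v3 z"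
proof -
  obtain \<alpha> \<beta> \<gamma> where e: "z = \<alpha> *s v1 + \<beta> *s v2 + \<gamma> *s v3" using dual_frame by blast
  have nz: "6 * M v2 v2 v3 v3 \<noteq> 0" "6 * M v1 v1 v3 v3 \<noteq> 0" "6 * M v1 v1 v2 v2 \<noteq> 0"
    using coeffs_nonzero unfolding M_real by simp_all
  have q: "qdet (6 * M v2 v2 v3 v3) (6 * M v1 v1 v3 v3) (6 * M v1 v1 v2 v2) (6 * M v1 v1 v2 v3) (6 * M v1 v2 v2 v3) (6 * M v1 v2 v3 v3) \<noteq> 0"
  proof -
    have "qdet (6 * M v2 v2 v3 v3) (6 * M v1 v1 v3 v3) (6 * M v1 v1 v2 v2) (6 * M v1 v1 v2 v3) (6 * M v1 v2 v2 v3) (6 * M v1 v2 v3 v3)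
      = of_real (qdet qa qb qc qf qg qh)" unfolding M_real qdet_def by simp
    then show ?thesis using det_nonzero by (simp only: of_real_eq_0_iff not_False_eq_True)
  qed
  have "\<alpha> = 0 \<and> \<beta> = 0 \<or> \<alpha> = 0 \<and> \<gamma> = 0 \<or> \<beta> = 0 \<and> \<gamma> = 0"
  proof (rule crem_singular[OF nz q])
    show "crem (6 * M v2 v2 v3 v3) (6 * M v1 v1 v3 v3) (6 * M v1 v1 v2 v2) (6 * M v1 v1 v2 v3) (6 * M v1 v2 v2 v3) (6 * M v1 v2 v3 v3) \<alpha> \<beta> \<gamma> = 0"
      unfolding frame_expand[symmetric] e[symmetric] by (rule sing)
  qed (simp_all only: frame_gradient[OF e, symmetric] sing mult_zero_right)
  then obtain k v where "z = k *s v" "v \<in> {v1, v2, v3}" using e by auto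
  moreover then have "k \<noteq> 0" "v \<noteq> 0" using z by auto
  ultimately show ?thesis using hom_equiv_scale[of v k] by auto
qed

lemma all_singular_real: "x \<in> singular_points 4 c \<Longrightarrow> real_point x"
proof -
  assume "x \<in> singular_points 4 c"
  then have "\<And>v. M (rep_cproj x) (rep_cproj x) (rep_cproj x) v = 0" unfolding singular_points_4 by blast
  from singular_is_vertex[OF rep_cproj_nonzero this] obtain y where "y \<noteq> 0" "hom_equiv (cx y) (rep_cproj x)"
    using y_nonzero3 by blast
  then have "abs_cproj (cx y) = x" using abs_cproj_eq_iff[of "cx y" "rep_cproj x"] by (simp add: rep_cproj_nonzero abs_rep_cproj)
  then show ?thesis unfolding real_point_cx using \<open>y \<noteq> 0\<close> by auto
qed

text \<open>Both frames consist of the same three singular points, so they differ by order and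
  scaling, under which the label is invariant.\<close>

lemma frame_label_unique:
  assumes "quartic_frame p c z1 z2 z3"
  shows "clabel (conic_of c z1 z2 z3) = clabel (conic_of c y1 y2 y3)"
proof -
  interpret F: quartic_frame p c z1 z2 z3 by fact
  have e: "\<exists>k y. k \<noteq> 0 \<and> z = k *s y \<and> y \<in> {y1, y2, y3}" if z: "z \<noteq> 0" "\<And>v. M (cx z) (cx z) (cx z) v = 0" for z
  proof -
    have "cx z \<noteq> 0" using z by simp
    from singular_is_vertex[OF this z(2)] obtain y where y: "y \<in> {y1,y2,y3}" "hom_equiv (cx y) (cx z)" by auto
    obtain k where "k \<noteq> 0" "z = k *s y" using y(2) by (rule equiv_cx)
    then show ?thesis using y(1) by blast
  qed
  obtain k1 u1 where 1: "k1 \<noteq> 0" "z1 = k1 *s u1" "u1 \<in> {y1, y2, y3}" using e[OF F.y_nonzero3(1) F.y_sing(1)] by blast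
  obtain k2 u2 where 2: "k2 \<noteq> 0" "z2 = k2 *s u2" "u2 \<in> {y1, y2, y3}" using e[OF F.y_nonzero3(2) F.y_sing(2)] by blast
  obtain k3 u3 where 3: "k3 \<noteq> 0" "z3 = k3 *s u3" "u3 \<in> {y1, y2, y3}" using e[OF F.y_nonzero3(3) F.y_sing(3)] by blast
  have ne: "u \<noteq> u'" if "\<not> hom_equiv (cx (k *s u)) (cx (k' *s u'))" "k \<noteq> 0" "k' \<noteq> 0" "k *s u \<noteq> 0" for k k' u u'
  proof
    assume "u = u'"
    then have "cx (k' *s u') = of_real (k' / k) *s cx (k *s u)" using that(2) by (simp add: vec_eq_iff)
    moreover have "cx (k *s u) \<noteq> 0" using that(4) by (simp only: cx_nonzero not_False_eq_True)
    ultimately show False using that(1-3) hom_equiv_scale[of "cx (k *s u)" "of_real (k' / k)"] by simp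
  qed
  have d: "u1 \<noteq> u2" "u1 \<noteq> u3" "u2 \<noteq> u3"
    using ne[of k1 u1 k2 u2] ne[of k1 u1 k3 u3] ne[of k2 u2 k3 u3] F.y_distinct F.y_nonzero3 1 2 3 by auto
  let ?L = "\<lambda>a b e. clabel (conic_of c a b e)"
  have "?L y2 y1 y3 = ?L y1 y2 y3" "?L y1 y3 y2 = ?L y1 y2 y3" "?L y2 y3 y1 = ?L y2 y1 y3" "?L y3 y1 y2 = ?L y1 y3 y2" "?L y3 y2 y1 = ?L y2 y3 y1"
    by (rule conic_of_label_swap)+
  then have "?L u1 u2 u3 = ?L y1 y2 y3"
    using 1(3) 2(3) 3(3) d by (elim insertE emptyE) simp_all
  then show ?thesis unfolding 1(2) 2(2) 3(2) using conic_of_label_scale[OF 1(1) 2(1) 3(1)] by simp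
qed

end

lemma (in nodal_quartic) real_frame_exists:
  assumes "\<forall>x\<in>singular_points 4 c. real_point x"
  obtains y1 y2 y3 where "quartic_frame p c y1 y2 y3"
proof -
  have r: "\<exists>y. y \<noteq> 0 \<and> hom_equiv (cx y) z" if z: "z \<noteq> 0" "\<And>v. M z z z v = 0" for z
  proof -
    have "real_point (abs_cproj z)" using singular_abs[OF z] assms by blast
    then obtain y where y: "y \<noteq> 0" "abs_cproj z = abs_cproj (cx y)" unfolding real_point_cx by blast
    then have "hom_equiv z (cx y)" using abs_cproj_eq_iff[OF z(1), of "cx y"] by simp
    then show ?thesis using y(1) hom_equiv_sym by blast
  qed
  obtain z1 z2 z3 where z: "z1 \<noteq> 0" "z2 \<noteq> 0" "z3 \<noteq> 0" and s: "\<And>v. M z1 z1 z1 v = 0" "\<And>v. M z2 z2 z2 v = 0" "\<And>v. M z3 z3 z3 v = 0"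
    and d: "\<not> hom_equiv z1 z2" "\<not> hom_equiv z1 z3" "\<not> hom_equiv z2 z3" using three_singular by metis
  obtain y1 where y1: "y1 \<noteq> 0" "hom_equiv (cx y1) z1" using r[OF z(1) s(1)] by blast
  obtain y2 where y2: "y2 \<noteq> 0" "hom_equiv (cx y2) z2" using r[OF z(2) s(2)] by blast
  obtain y3 where y3: "y3 \<noteq> 0" "hom_equiv (cx y3) z3" using r[OF z(3) s(3)] by blast
  have si: "M (cx y) (cx y) (cx y) v = 0" if h: "hom_equiv (cx y) z" "\<And>v. M z z z v = 0" for y z v
  proof -
    obtain k where "k \<noteq> 0" "cx y = k *s z" using hom_equiv_sym[OF h(1)] by (rule equiv_scaleE)
    then show ?thesis using h(2) by (simp add: polar_scale)
  qed
  have "quartic_frame p c y1 y2 y3"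
  proof unfold_locales
    show "\<not> hom_equiv (cx y1) (cx y2)" using equiv_chain[OF y1(2) y2(2)] d by blast
    show "\<not> hom_equiv (cx y1) (cx y3)" using equiv_chain[OF y1(2) y3(2)] d by blast
    show "\<not> hom_equiv (cx y2) (cx y3)" using equiv_chain[OF y2(2) y3(2)] d by blast
  qed (use y1 y2 y3 si s in blast)+
  then show ?thesis by (rule that)
qed

definition labelled :: "(nat \<Rightarrow> nat \<Rightarrow> real) \<Rightarrow> nat \<times> nat \<times> bool \<Rightarrow> bool" where
  "labelled c l \<longleftrightarrow> (\<exists>p y1 y2 y3. quartic_frame p c y1 y2 y3 \<and> clabel (conic_of c y1 y2 y3) = l)"

text \<open>Two equations of one curve are proportional, and the factor is real, being a quotient of
  real values. The label ignores both this factor and the choice of frame.\<close>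

lemma labelled_unique:
  assumes "real_plane_curve 4 c C" "real_plane_curve 4 c' C" "labelled c l" "labelled c' l'"
  shows "l = l'"
proof -
  obtain p y1 y2 y3 where y: "quartic_frame p c y1 y2 y3" and l: "clabel (conic_of c y1 y2 y3) = l" using assms(3) unfolding labelled_def by blast
  obtain p' z1 z2 z3 where z: "quartic_frame p' c' z1 z2 z3" and l': "clabel (conic_of c' z1 z2 z3) = l'" using assms(4) unfolding labelled_def by blast
  interpret Y: quartic_frame p c y1 y2 y3 by fact
  interpret Z: quartic_frame p' c' z1 z2 z3 by fact
  have rc': "rat_quartic p c'"
  proof
    show "no_common_root 4 p" by (rule Y.ncr)
    show "squarefree_form 4 (\<lambda>i j. of_real (c' i j))" by (rule Z.sqf)
    show "{x. ternary_form 4 (\<lambda>i j. of_real (c' i j)) (rep_cproj x) = 0} = range (param_map 4 p)"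
      using real_plane_curve_zeros[OF assms(1)] real_plane_curve_zeros[OF assms(2)] Y.zeros by simp
  qed
  obtain k where k: "k \<noteq> 0" "\<And>x y z w. polar (\<lambda>i j. complex_of_real (c' i j)) x y z w = k * polar (\<lambda>i j. of_real (c i j)) x y z w"
    by (rule equation_unique[OF Y.rat_quartic_axioms rc']) metis
  have "quartic_frame p c z1 z2 z3"
    by unfold_locales (use Z.y_nonzero3 Z.y_sing Z.y_distinct k in auto)
  from Y.frame_label_unique[OF this] have L: "clabel (conic_of c z1 z2 z3) = l" using l by simp
  interpret W: quartic_frame p c z1 z2 z3 by fact
  have kr: "complex_of_real (polar c' x y z w) = k * of_real (polar c x y z w)" for x y z w
    using k(2)[of "cx x" "cx y" "cx z" "cx w"] unfolding polar_cx .
  have nz: "polar c z1 z1 z2 z2 \<noteq> 0" using W.coeff_c_nonzero .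
  define r where "r = polar c' z1 z1 z2 z2 / polar c z1 z1 z2 z2"
  have kr2: "k = of_real r" using kr[of z1 z1 z2 z2] nz unfolding r_def by (simp add: field_simps)
  have e: "polar c' x y z w = r * polar c x y z w" for x y z w
  proof -
    have "complex_of_real (polar c' x y z w) = of_real (r * polar c x y z w)" using kr kr2 by simp
    then show ?thesis by (simp only: of_real_eq_iff)
  qed
  have "r \<noteq> 0" using kr2 k(1) by auto
  have "clabel (conic_of c' z1 z2 z3) = clabel (conic_of c z1 z2 z3)"
    unfolding conic_of_def e using clabel_cmult[OF \<open>r \<noteq> 0\<close> W.det_nonzero] by (simp only: mult.left_commute[of 6])
  then show ?thesis using L l' by simp
qed

section \<open>Curves given by a conic and a dual frame\<close>

fun ccoeff :: "real^3 \<Rightarrow> real^3 \<Rightarrow> real^3 \<Rightarrow> conic \<Rightarrow> nat \<Rightarrow> nat \<Rightarrow> real" where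
  "ccoeff r1 r2 r3 (a,b,c,f,g,h) = crem_coeff r1 r2 r3 a b c f g h"

definition ccurve :: "real^3 \<Rightarrow> real^3 \<Rightarrow> real^3 \<Rightarrow> conic \<Rightarrow> 3 cproj set" where
  "ccurve r1 r2 r3 q = {x. ternary_form 4 (\<lambda>i j. of_real (ccoeff r1 r2 r3 q i j)) (rep_cproj x) = 0}"

lemma ccurve_eq: "ccurve r1 r2 r3 (a,b,c,f,g,h) = {x. crem (of_real a) (of_real b) (of_real c) (of_real f) (of_real g) (of_real h)
    (lin (cx r1) (rep_cproj x)) (lin (cx r2) (rep_cproj x)) (lin (cx r3) (rep_cproj x)) = 0}"
  unfolding ccurve_def by (simp add: ternary_form_crem_coeff)

text \<open>Comparison of coefficients on a line by evaluation at five points; it shows that the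
  vertices of a Cremona image are singular.\<close>

lemma polar_biquadratic:
  fixes c :: "nat \<Rightarrow> nat \<Rightarrow> complex"
  assumes "\<And>x y. polar c (x *s u + y *s v) (x *s u + y *s v) (x *s u + y *s v) (x *s u + y *s v) = k * x^2 * y^2"
  shows "polar c u u u u = 0" "polar c u u u v = 0" "polar c v v v u = 0" "polar c v v v v = 0"
proof -
  let ?A = "polar c u u u u" and ?B = "polar c u u u v" and ?C = "polar c u u v v" and ?D = "polar c v v v u" and ?E = "polar c v v v v"
  have s: "polar c u u v u = ?B" "polar c u v u u = ?B" "polar c v u u u = ?B"
    "polar c u v u v = ?C" "polar c u v v u = ?C" "polar c v v u u = ?C" "polar c v u u v = ?C" "polar c v u v u = ?C"
    "polar c v v u v = ?D" "polar c v u v v = ?D" "polar c u v v v = ?D"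
    by (metis polar_swap)+
  have e: "x^4 * ?A + 4 * x^3 * y * ?B + 6 * x^2 * y^2 * ?C + 4 * x * y^3 * ?D + y^4 * ?E = k * x^2 * y^2" for x y
    unfolding assms[symmetric] by (simp add: polar_add polar_scale s) (simp add: eval_nat_numeral algebra_simps)
  show A: "?A = 0" and E: "?E = 0" using e[of 1 0] e[of 0 1] by simp_all
  have "4 * ?B + 6 * ?C + 4 * ?D = k" "- (4 * ?B) + 6 * ?C - 4 * ?D = k" "8 * ?B + 24 * ?C + 32 * ?D = 4 * k"
    using e[of 1 1] e[of 1 "-1"] e[of 1 2] A E by (simp_all add: algebra_simps)
  then show "?B = 0" "?D = 0" unfolding complex_eq_iff by simp_all
qed

lemma crem_inject:
  fixes a :: complex
  assumes "\<And>x y z. crem a b c f g h x y z = crem a' b' c' f' g' h' x y z"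
  shows "a = a'" "b = b'" "c = c'" "f = f'" "g = g'" "h = h'"
proof -
  show "a = a'" "b = b'" "c = c'"
    using assms[of 0 1 1] assms[of 1 0 1] assms[of 1 1 0] by (simp_all add: crem_def)
  moreover have "f + g + h = f' + g' + h'" "f - g - h = f' - g' - h'" "g - f - h = g' - f' - h'"
    using assms[of 1 1 1] assms[of "-1" 1 1] assms[of 1 "-1" 1] calculation by (simp_all add: crem_def) algebra+
  ultimately show "f = f'" "g = g'" "h = h'" unfolding complex_eq_iff by simp_all
qed

context cremona_curve
begin

lemma vertices_singular:
  "MM (cx y1) (cx y1) (cx y1) v = 0" "MM (cx y2) (cx y2) (cx y2) v = 0" "MM (cx y3) (cx y3) (cx y3) v = 0"
proof -
  note e = MM_frame[of _ _ 0] MM_frame[of _ 0] MM_frame[of 0]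
  have 12: "MM (x *s cx y1 + y *s cx y2) (x *s cx y1 + y *s cx y2) (x *s cx y1 + y *s cx y2) (x *s cx y1 + y *s cx y2) = of_real c * x^2 * y^2" for x y
    using e(1)[of x y] by (simp add: crem_def power_mult_distrib)
  have 13: "MM (x *s cx y1 + y *s cx y3) (x *s cx y1 + y *s cx y3) (x *s cx y1 + y *s cx y3) (x *s cx y1 + y *s cx y3) = of_real b * x^2 * y^2" for x y
    using e(2)[of x y] by (simp add: crem_def power_mult_distrib)
  have 23: "MM (x *s cx y2 + y *s cx y3) (x *s cx y2 + y *s cx y3) (x *s cx y2 + y *s cx y3) (x *s cx y2 + y *s cx y3) = of_real a * x^2 * y^2" for x y
    using e(3)[of x y] by (simp add: crem_def power_mult_distrib)
  note z = polar_biquadratic[OF 12] polar_biquadratic[OF 13] polar_biquadratic[OF 23]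
  obtain \<alpha> \<beta> \<gamma> where v: "v = \<alpha> *s cx y1 + \<beta> *s cx y2 + \<gamma> *s cx y3" using dual by blast
  show "MM (cx y1) (cx y1) (cx y1) v = 0" "MM (cx y2) (cx y2) (cx y2) v = 0" "MM (cx y3) (cx y3) (cx y3) v = 0"
    unfolding v by (simp_all add: polar_add polar_scale z)
qed

lemma quartic_frame_vertices: "quartic_frame pp cc y1 y2 y3"
proof
  show "no_common_root 4 pp" "squarefree_form 4 (\<lambda>i j. of_real (cc i j))" 
    "{x. ternary_form 4 (\<lambda>i j. of_real (cc i j)) (rep_cproj x) = 0} = range (param_map 4 pp)"
    using real_rational squarefree param_range unfolding real_rational_curve_def by blast+
  show "\<forall>x\<in>singular_points 4 cc. node 4 pp x" using singular_real_nodes by blast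
  show "\<not> hom_equiv (cx y1) (cx y2)" "\<not> hom_equiv (cx y1) (cx y3)" "\<not> hom_equiv (cx y2) (cx y3)"
    using indep by (auto simp: hom_equiv_def det3_def algebra_simps simp del: cx_nth)
qed (use y_nonzero vertices_singular in blast)+

lemma conic_of_vertices: "conic_of cc y1 y2 y3 = (a,b,c,f,g,h)"
proof -
  interpret F: quartic_frame pp cc y1 y2 y3 by (rule quartic_frame_vertices)
  have "crem (of_real F.qa) (of_real F.qb) (of_real F.qc) (of_real F.qf) (of_real F.qg) (of_real F.qh) x y z = CR x y z" for x y z
    unfolding MM_frame[symmetric] F.frame_expand F.M_real by simp
  from crem_inject[OF this] show ?thesis unfolding conic_of_def of_real_eq_iff by simp
qed

end

lemma ccurve_model:
  assumes r: "rdet r1 r2 r3 \<noteq> 0" and q: "cgood q"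
  shows "real_nodal_curve 4 (ccurve r1 r2 r3 q)" "nodal_curve 4 (ccurve r1 r2 r3 q)"
    "real_plane_curve 4 (ccoeff r1 r2 r3 q) (ccurve r1 r2 r3 q)" "labelled (ccoeff r1 r2 r3 q) (clabel q)"
proof -
  obtain a b c f g h where qe: "q = (a,b,c,f,g,h)" by (cases q)
  have "good a b c f g h" using q unfolding qe by simp
  then obtain y1 y2 y3 s1 s2 s3 where "cremona_curve y1 y2 y3 s1 s2 s3 a b c f g h r1 r2 r3" using cremona_curve_exists[OF r] by blast
  then interpret cremona_curve y1 y2 y3 s1 s2 s3 a b c f g h r1 r2 r3 .
  have cu: "ccurve r1 r2 r3 q = {x. ternary_form 4 (\<lambda>i j. of_real (cc i j)) (rep_cproj x) = 0}" unfolding ccurve_def qe by simp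
  show "real_nodal_curve 4 (ccurve r1 r2 r3 q)" "nodal_curve 4 (ccurve r1 r2 r3 q)"
    unfolding cu real_nodal_curve_def nodal_curve_def using real_rational singular_real_nodes by blast+
  show "real_plane_curve 4 (ccoeff r1 r2 r3 q) (ccurve r1 r2 r3 q)"
    using real_rational unfolding real_rational_curve_def cu unfolding qe ccoeff.simps by blast
  show "labelled (ccoeff r1 r2 r3 q) (clabel q)"
    unfolding labelled_def qe ccoeff.simps using quartic_frame_vertices conic_of_vertices by metis
qed

text \<open>The rows of the inverse of the matrix of nodes form the dual frame, in which the
  equation is the one of \<open>frame_expand\<close>.\<close>

lemma (in quartic_frame) is_ccurve:
  assumes "real_plane_curve 4 c C"
  shows "\<exists>r1 r2 r3. rdet r1 r2 r3 \<noteq> 0 \<and> C = ccurve r1 r2 r3 (conic_of c y1 y2 y3)"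
proof -
  define D where "D = rdet y1 y2 y3"
  have D: "D \<noteq> 0" using frame_det unfolding det3_cx D_def by simp
  define r1 r2 r3 where "r1 = (1/D) *s cof y2 y3" and "r2 = (1/D) *s cof y3 y1" and "r3 = (1/D) *s cof y1 y2"
  have "rdet (cof y2 y3) (cof y3 y1) (cof y1 y2) = D^2"
    unfolding D_def rdet_def cof_nth by algebra
  then have "rdet r1 r2 r3 = (1/D)^3 * D^2"
    unfolding r1_def r2_def r3_def rdet_def vector_smult_component by (simp only: mult.assoc) algebra
  then have nz: "rdet r1 r2 r3 \<noteq> 0" using D by simp
  have "of_real D * x $ j = of_real D * (lin (cx r1) x *s v1 + lin (cx r2) x *s v2 + lin (cx r3) x *s v3) $ j" for x j
  proof -
    have l: "of_real D * lin (cx r1) x = lin (cx (cof y2 y3)) x" "of_real D * lin (cx r2) x = lin (cx (cof y3 y1)) x" "of_real D * lin (cx r3) x = lin (cx (cof y1 y2)) x"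
      unfolding lin_def sum_3 r1_def r2_def r3_def using D by (simp_all add: field_simps)
    have "of_real D * x $ j = lin (cx (cof y2 y3)) x * of_real (y1 $ j) + lin (cx (cof y3 y1)) x * of_real (y2 $ j) + lin (cx (cof y1 y2)) x * of_real (y3 $ j)"
      using exhaust_3[of j] unfolding D_def rdet_def lin_def sum_3 by (auto simp: algebra_simps)
    then show ?thesis unfolding l[symmetric] by (simp add: algebra_simps)
  qed
  then have e: "x = lin (cx r1) x *s v1 + lin (cx r2) x *s v2 + lin (cx r3) x *s v3" for x
    unfolding vec_eq_iff using D by (simp only: mult_cancel_left of_real_eq_0_iff simp_thms)
  have "M x x x x = crem (of_real qa) (of_real qb) (of_real qc) (of_real qf) (of_real qg) (of_real qh) (lin (cx r1) x) (lin (cx r2) x) (lin (cx r3) x)" for x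
    using frame_expand[of "lin (cx r1) x" "lin (cx r2) x" "lin (cx r3) x"] unfolding e[of x, symmetric] M_real by simp
  then have "C = ccurve r1 r2 r3 (conic_of c y1 y2 y3)"
    unfolding real_plane_curve_zeros[OF assms] conic_of_def ccurve_eq ternary_form_polar by (simp only:)
  then show ?thesis using nz by blast
qed

lemma lin_cx_scale: "lin (cx (k *s r)) x = of_real k * lin (cx r) x"
  unfolding lin_def sum_3 by (simp add: algebra_simps)

lemma rdet_scale: "rdet (k *s x) (l *s y) (m *s z) = k * l * m * rdet x y z"
  unfolding rdet_def by (simp add: algebra_simps)

lemma rdet_swap: "rdet y x z = - rdet x y z" "rdet x z y = - rdet x y z"
  unfolding rdet_def by (simp_all add: algebra_simps)

lemma ccurve_scale:
  assumes "k \<noteq> 0" "l \<noteq> 0" "m \<noteq> 0"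
  shows "ccurve (k *s r1) (l *s r2) (m *s r3) (a*k^2, b*l^2, c*m^2, f*l*m, g*k*m, h*k*l) = ccurve r1 r2 r3 (a,b,c,f,g,h)"
proof -
  have "crem (A*K^2) (B*L^2) (E*N^2) (F*L*N) (G*K*N) (H*K*L) (K*x) (L*y) (N*z) = (K*L*N)^2 * crem A B E F G H x y z" for A B E F G H K L N x y z :: complex
    unfolding crem_def by (simp add: algebra_simps power2_eq_square)
  then show ?thesis unfolding ccurve_eq lin_cx_scale using assms by simp
qed

text \<open>The curve stays fixed: each change of the conic is absorbed by permuting or rescaling
  the dual forms, or by the sign of the equation.\<close>

lemma ccurve_conic_equiv:
  assumes "conic_equiv q q'" "rdet r1 r2 r3 \<noteq> 0"
  shows "\<exists>r1' r2' r3'. rdet r1' r2' r3' \<noteq> 0 \<and> ccurve r1 r2 r3 q = ccurve r1' r2' r3' q'"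
  using assms
proof (induction arbitrary: r1 r2 r3 rule: conic_equiv.induct)
  case (refl q)
  then show ?case by blast
next
  case (swap12 a b c f g h q)
  have "ccurve r1 r2 r3 (b,a,c,g,f,h) = ccurve r2 r1 r3 (a,b,c,f,g,h)"
    unfolding ccurve_eq crem_def by (simp add: algebra_simps)
  then show ?case using swap12.IH[of r2 r1 r3] swap12.prems by (simp add: rdet_swap(1)[of r2 r1 r3])
next
  case (swap23 a b c f g h q)
  have "ccurve r1 r2 r3 (a,c,b,f,h,g) = ccurve r1 r3 r2 (a,b,c,f,g,h)"
    unfolding ccurve_eq crem_def by (simp add: algebra_simps)
  then show ?case using swap23.IH[of r1 r3 r2] swap23.prems by (simp add: rdet_swap(2)[of r1 r3 r2])
next
  case (scale a k b l c m f g h q)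
  then show ?case using scale.IH[of "k *s r1" "l *s r2" "m *s r3"] ccurve_scale[OF scale.hyps(2-4), of r1 r2 r3 a b c f g h]
    by (simp add: rdet_scale)
next
  case (neg a b c f g h q)
  have "crem (-A) (-B) (-E) (-F) (-G) (-H) x y z = - crem A B E F G H x y z" for A B E F G H x y z :: complex
    unfolding crem_def by simp
  then have "ccurve r1 r2 r3 (a,b,c,f,g,h) = ccurve r1 r2 r3 (-a,-b,-c,-f,-g,-h)"
    unfolding ccurve_eq by simp
  then show ?case using neg.IH[OF neg.prems] by simp
qed

lemma ccurve_orient:
  assumes "rdet r1 r2 r3 \<noteq> 0"
  shows "\<exists>r1' r2' r3'. rdet r1' r2' r3' > 0 \<and> ccurve r1 r2 r3 q = ccurve r1' r2' r3' q"
proof (cases "rdet r1 r2 r3 > 0")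
  case False
  obtain a b c f g h where "q = (a,b,c,f,g,h)" by (cases q)
  then have "ccurve ((-1) *s r1) ((-1) *s r2) ((-1) *s r3) q = ccurve r1 r2 r3 q"
    using ccurve_scale[of "-1" "-1" "-1" r1 r2 r3 a b c f g h] by simp
  moreover have "rdet ((-1) *s r1) ((-1) *s r2) ((-1) *s r3) > 0" unfolding rdet_scale using assms False by simp
  ultimately show ?thesis by metis
qed blast

lemma labelled_normal_form:
  assumes "real_plane_curve 4 c C" "labelled c l"
  shows "\<exists>k<9. l = region_label k \<and> (\<exists>q\<in>region k. \<exists>r1 r2 r3. rdet r1 r2 r3 > 0 \<and> C = ccurve r1 r2 r3 q)"
proof -
  obtain p y1 y2 y3 where y: "quartic_frame p c y1 y2 y3" and l: "clabel (conic_of c y1 y2 y3) = l" using assms(2) unfolding labelled_def by blast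
  interpret quartic_frame p c y1 y2 y3 by fact
  obtain r1 r2 r3 where r: "rdet r1 r2 r3 \<noteq> 0" "C = ccurve r1 r2 r3 (conic_of c y1 y2 y3)" using is_ccurve[OF assms(1)] by blast
  obtain k q where k: "k < 9" "q \<in> region k" "conic_equiv (conic_of c y1 y2 y3) q" "clabel (conic_of c y1 y2 y3) = region_label k"
    using cgood_conic by (rule cgood_normal_form)
  obtain t1 t2 t3 where t: "rdet t1 t2 t3 \<noteq> 0" "C = ccurve t1 t2 t3 q" using ccurve_conic_equiv[OF k(3) r(1)] r(2) by blast
  obtain u1 u2 u3 where "rdet u1 u2 u3 > 0" "C = ccurve u1 u2 u3 q" using ccurve_orient[OF t(1), of q] t(2) by blast
  then show ?thesis using k l by blast
qed

lemma real_nodal_labelled: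
  assumes "real_nodal_curve 4 C"
  shows "\<exists>c l. real_plane_curve 4 c C \<and> labelled c l"
proof -
  obtain p c where p: "real_rational_curve 4 p c C" and n: "\<forall>x\<in>singular_points 4 c. node 4 p x \<and> real_point x"
    using assms unfolding real_nodal_curve_def by blast
  have c: "real_plane_curve 4 c C" using p unfolding real_rational_curve_def by blast
  interpret nodal_quartic p c
    using real_rational_rat_quartic[OF p c] n by (simp add: nodal_quartic_def nodal_quartic_axioms_def)
  obtain y1 y2 y3 where "quartic_frame p c y1 y2 y3" by (rule real_frame_exists) (use n in blast)+
  then show ?thesis unfolding labelled_def using c by blast
qed

subsection \<open>Isotopies between curves of equal label\<close>

abbreviation "oriented_frames \<equiv> {(x,y,z). 0 < rdet x y z}"

text \<open>Used with \<open>f\<close> moving a single row: the admissible positions of that row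
  form a half space, which is convex.\<close>

lemma path_component_segment:
  assumes "\<And>x. f x \<in> S \<longleftrightarrow> 0 < inner w x" "continuous_on UNIV f" "f x \<in> S" "f y \<in> S"
  shows "path_component S (f x) (f y)"
proof -
  have "path_connected (f ` {x. inner w x > 0})"
    by (intro path_connected_continuous_image convex_imp_path_connected convex_halfspace_gt continuous_on_subset[OF assms(2)] subset_UNIV)
  then have "path_component (f ` {x. inner w x > 0}) (f x) (f y)"
    using assms(1,3,4) unfolding path_connected_component by blast
  then show ?thesis by (rule path_component_of_subset[rotated]) (use assms(1) in blast)
qed

lemma rdet_inner: "rdet x y z = inner (cof y z) x" "rdet x y z = inner (cof z x) y" "rdet x y z = inner (cof x y) z"
  unfolding rdet_def inner_vec_def sum_3 cof_nth by (simp_all add: algebra_simps)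

lemma row_moves:
  "0 < rdet x y z \<Longrightarrow> 0 < rdet x' y z \<Longrightarrow> path_component oriented_frames (x,y,z) (x',y,z)"
  "0 < rdet x y z \<Longrightarrow> 0 < rdet x y' z \<Longrightarrow> path_component oriented_frames (x,y,z) (x,y',z)"
  "0 < rdet x y z \<Longrightarrow> 0 < rdet x y z' \<Longrightarrow> path_component oriented_frames (x,y,z) (x,y,z')"
proof -
  show "0 < rdet x y z \<Longrightarrow> 0 < rdet x' y z \<Longrightarrow> path_component oriented_frames (x,y,z) (x',y,z)"
    by (rule path_component_segment[of "\<lambda>x. (x,y,z)" _ "cof y z"]) (simp_all only: mem_Collect_eq case_prod_conv rdet_inner(1), intro continuous_intros)
  show "0 < rdet x y z \<Longrightarrow> 0 < rdet x y' z \<Longrightarrow> path_component oriented_frames (x,y,z) (x,y',z)"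
    by (rule path_component_segment[of "\<lambda>y. (x,y,z)" _ "cof z x"]) (simp_all only: mem_Collect_eq case_prod_conv rdet_inner(2), intro continuous_intros)
  show "0 < rdet x y z \<Longrightarrow> 0 < rdet x y z' \<Longrightarrow> path_component oriented_frames (x,y,z) (x,y,z')"
    by (rule path_component_segment[of "\<lambda>z. (x,y,z)" _ "cof x y"]) (simp_all only: mem_Collect_eq case_prod_conv rdet_inner(3), intro continuous_intros)
qed

text \<open>A quarter turn of two rows is a product of three shears, \<open>(x,y)\<close> to
  \<open>(x+y,y)\<close> to \<open>(x+y,-x)\<close> to \<open>(y,-x)\<close>, each moving one row at
  constant determinant.\<close>

lemma row_rotate:
  assumes "0 < rdet x y z"
  shows "path_component oriented_frames (x,y,z) (y,-x,z)" "path_component oriented_frames (x,y,z) (x,z,-y)"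
proof -
  have d: "rdet (x+y) y z = rdet x y z" "rdet (x+y) (-x) z = rdet x y z" "rdet y (-x) z = rdet x y z"
    "rdet x (y+z) z = rdet x y z" "rdet x (y+z) (-y) = rdet x y z" "rdet x z (-y) = rdet x y z"
    unfolding rdet_def by (simp_all add: algebra_simps)
  show "path_component oriented_frames (x,y,z) (y,-x,z)"
    by (rule path_component_trans[OF row_moves(1)[of x y z "x+y"] path_component_trans[OF row_moves(2)[of "x+y" y z "-x"] row_moves(1)[of "x+y" "-x" z y]]])
      (simp_all add: d assms)
  show "path_component oriented_frames (x,y,z) (x,z,-y)"
    by (rule path_component_trans[OF row_moves(2)[of x y z "y+z"] path_component_trans[OF row_moves(3)[of x "y+z" z "-y"] row_moves(2)[of x "y+z" "-y" z]]])
      (simp_all add: d assms)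
qed

text \<open>Connectedness by Gaussian elimination: the elementary row operations of determinant 1 and the
  positive rescalings move a single row within a half space.\<close>

definition joinable :: "real^3 \<Rightarrow> real^3 \<Rightarrow> real^3 \<Rightarrow> bool" where
  "joinable x y z \<longleftrightarrow> (0 < rdet x y z \<longrightarrow> path_component oriented_frames (x,y,z) (axis 1 1, axis 2 1, axis 3 1))"

lemma joinable_moves:
  "joinable x' y z \<Longrightarrow> 0 < rdet x' y z \<Longrightarrow> joinable x y z"
  "joinable x y' z \<Longrightarrow> 0 < rdet x y' z \<Longrightarrow> joinable x y z"
  "joinable x y z' \<Longrightarrow> 0 < rdet x y z' \<Longrightarrow> joinable x y z"
  "joinable y (-x) z \<Longrightarrow> joinable x y z"
  "joinable x z (-y) \<Longrightarrow> joinable x y z"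
proof -
  have d: "rdet y (-x) z = rdet x y z" "rdet x z (-y) = rdet x y z"
    unfolding rdet_def by (simp_all add: algebra_simps)
  show "joinable x' y z \<Longrightarrow> 0 < rdet x' y z \<Longrightarrow> joinable x y z" "joinable x y' z \<Longrightarrow> 0 < rdet x y' z \<Longrightarrow> joinable x y z"
    "joinable x y z' \<Longrightarrow> 0 < rdet x y z' \<Longrightarrow> joinable x y z"
    "joinable y (-x) z \<Longrightarrow> joinable x y z" "joinable x z (-y) \<Longrightarrow> joinable x y z"
    unfolding joinable_def d by (blast intro: row_moves row_rotate path_component_trans)+
qed

lemma joinable_step3:
  assumes "y$1 = 0" "z$1 = 0" "z$2 = 0" "0 < y$2"
  shows "joinable (axis 1 1) y z"
proof (cases "0 < z$3")
  case True
  have a: "(axis 1 1 :: real^3) $ 1 = 1" "(axis 1 1 :: real^3) $ 2 = 0" "(axis 1 1 :: real^3) $ 3 = 0"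
    "(axis 2 1 :: real^3) $ 1 = 0" "(axis 2 1 :: real^3) $ 2 = 1" "(axis 2 1 :: real^3) $ 3 = 0"
    "(axis 3 1 :: real^3) $ 1 = 0" "(axis 3 1 :: real^3) $ 2 = 0" "(axis 3 1 :: real^3) $ 3 = 1"
    by (simp_all add: axis_def)
  have d: "0 < rdet (axis 1 1) (axis 2 1) z" "0 < rdet (axis 1 1) (axis 2 1) (axis 3 1)"
    unfolding rdet_def a using True by simp_all
  have "joinable (axis 1 1) (axis 2 1) (axis 3 1)"
    unfolding joinable_def by (simp add: path_component_refl_eq)
  then have "joinable (axis 1 1) (axis 2 1) z" by (rule joinable_moves(3)) (rule d)
  then show ?thesis by (rule joinable_moves(2)) (rule d)
next
  case False
  have "\<not> 0 < rdet (axis 1 1) y z" unfolding rdet_def using assms False by (simp add: axis_def mult_nonneg_nonpos not_less)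
  then show ?thesis unfolding joinable_def by blast
qed

lemma joinable_step2:
  assumes "y$1 = 0" "z$1 = 0" "y$2 \<noteq> 0"
  shows "joinable (axis 1 1) y z"
proof -
  have pos: "joinable (axis 1 1) y z" if "y$1 = 0" "z$1 = 0" "0 < y$2" for y z
  proof -
    have "joinable (axis 1 1) y (z - (z$2 / y$2) *s y)" by (rule joinable_step3) (use that in simp_all)
    moreover have "rdet (axis 1 1) y (z - (z$2 / y$2) *s y) = rdet (axis 1 1) y z"
      unfolding rdet_def by (simp add: algebra_simps)
    ultimately show ?thesis using joinable_moves(3) unfolding joinable_def by metis
  qed
  show ?thesis
  proof (cases "0 < y$2")
    case True then show ?thesis using pos assms by blast
  next
    case False
    have "joinable (axis 1 1) (-y) (-z)" by (rule pos) (use assms False in simp_all)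
    \<comment> \<open>Two quarter turns negate both rows.\<close>
    then show ?thesis by (rule joinable_moves(5)[OF joinable_moves(5)])
  qed
qed

lemma joinable_step1:
  assumes "x$1 \<noteq> 0"
  shows "joinable x y z"
proof -
  have e1: "joinable (axis 1 1) y z" if yz: "y$1 = 0" "z$1 = 0" for y z
  proof (cases "y$2 = 0")
    case False then show ?thesis by (rule joinable_step2[OF yz])
  next
    case y: True
    show ?thesis
    proof (cases "z$2 = 0")
      case True
      then show ?thesis using y yz unfolding joinable_def rdet_def by simp
    next
      case False
      then have "joinable (axis 1 1) z (-y)" by (intro joinable_step2) (use yz in simp_all)
      then show ?thesis by (rule joinable_moves)
    qed
  qed
  have pos: "joinable x y z" if x: "0 < x$1" for x y z
  proof -
    let ?y = "y - (y$1 / x$1) *s x" and ?z = "z - (z$1 / x$1) *s x"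
    have d: "rdet x ?y z = rdet x y z" "rdet x ?y ?z = rdet x y z"
      unfolding rdet_def by (simp_all add: algebra_simps)
    have z: "?y $ 1 = 0" "?z $ 1 = 0" using x by simp_all
    have pr: "rdet x ?y ?z = x$1 * rdet (axis 1 1) ?y ?z"
      unfolding rdet_def z by (simp add: axis_def)
    show ?thesis
    proof (cases "0 < rdet x y z")
      case True
      then have p: "0 < rdet (axis 1 1) ?y ?z" using pr x d by (simp add: zero_less_mult_iff)
      have "joinable x ?y ?z" by (rule joinable_moves(1)[OF e1[OF z] p])
      then have "joinable x ?y z" by (rule joinable_moves(3)) (simp only: d True)
      then show ?thesis by (rule joinable_moves(2)) (simp only: d True)
    qed (simp add: joinable_def)
  qed
  show ?thesis
  proof (cases "0 < x$1")
    case True then show ?thesis by (rule pos)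
  next
    case False
    have "joinable (-x) (-y) z" by (rule pos) (use assms False in simp)
    then show ?thesis by (rule joinable_moves(4)[OF joinable_moves(4)])
  qed
qed

lemma joinable: "joinable x y z"
proof -
  consider "x$1 \<noteq> 0" | "y$1 \<noteq> 0" | "z$1 \<noteq> 0" | "x$1 = 0" "y$1 = 0" "z$1 = 0" by blast
  then show ?thesis
  proof cases
    case 1 then show ?thesis by (rule joinable_step1)
  next
    case 2 then show ?thesis by (rule joinable_moves(4)[OF joinable_step1])
  next
    case 3 then show ?thesis by (rule joinable_moves(5)[OF joinable_moves(4)[OF joinable_step1]])
  next
    case 4 then show ?thesis unfolding joinable_def rdet_def by simp
  qed
qed

lemma oriented_frames_path_connected: "path_connected oriented_frames"
proof -
  have "path_component oriented_frames u (axis 1 1, axis 2 1, axis 3 1)" if "u \<in> oriented_frames" for u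
    using that joinable unfolding joinable_def by auto
  then show ?thesis unfolding path_connected_component using path_component_sym path_component_trans by blast
qed

lemma ccoeff_continuous:
  fixes u :: "real \<Rightarrow> ((real^3) \<times> (real^3) \<times> (real^3)) \<times> conic"
  assumes "continuous_on S u"
  shows "continuous_on S (\<lambda>t. case u t of ((r1,r2,r3),q) \<Rightarrow> ccoeff r1 r2 r3 q i j)"
proof -
  have "(\<lambda>t. case u t of ((r1,r2,r3),q) \<Rightarrow> ccoeff r1 r2 r3 q i j) =
    (\<lambda>t. crem_coeff (fst (fst (u t))) (fst (snd (fst (u t)))) (snd (snd (fst (u t))))
       (fst (snd (u t))) (fst (snd (snd (u t)))) (fst (snd (snd (snd (u t))))) (fst (snd (snd (snd (snd (u t))))))
       (fst (snd (snd (snd (snd (snd (u t))))))) (snd (snd (snd (snd (snd (snd (u t))))))) i j)"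
    by (auto simp: fun_eq_iff split: prod.splits)
  moreover have "(if P then x else 0) = of_bool P * x" for P and x :: real by simp
  ultimately show ?thesis
    unfolding crem_coeff_def tensor_coeff_def by (simp only:) (intro continuous_intros assms)
qed

lemma region_isotopic:
  assumes k: "k < 9" and q: "q \<in> region k" "q' \<in> region k" and r: "0 < rdet r1 r2 r3" "0 < rdet t1 t2 t3"
  shows "rigidly_isotopic 4 (ccurve r1 r2 r3 q) (ccurve t1 t2 t3 q')"
proof -
  have "path_connected (oriented_frames \<times> region k)"
    by (rule path_connected_Times[OF oriented_frames_path_connected region_path_connected])
  moreover have "((r1,r2,r3),q) \<in> oriented_frames \<times> region k" "((t1,t2,t3),q') \<in> oriented_frames \<times> region k" using q r by simp_all
  ultimately have "path_component (oriented_frames \<times> region k) ((r1,r2,r3),q) ((t1,t2,t3),q')"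
    unfolding path_connected_component by blast
  then obtain u where u: "path u" "path_image u \<subseteq> oriented_frames \<times> region k" "pathstart u = ((r1,r2,r3),q)" "pathfinish u = ((t1,t2,t3),q')"
    unfolding path_component_def by blast
  have in_S: "u t \<in> oriented_frames \<times> region k" if "t \<in> {0..1}" for t
    using u(2) that unfolding path_image_def by blast
  let ?G = "\<lambda>t. case u t of ((r1,r2,r3),q) \<Rightarrow> ccurve r1 r2 r3 q" and ?c = "\<lambda>t i j. case u t of ((r1,r2,r3),q) \<Rightarrow> ccoeff r1 r2 r3 q i j"
  have "nodal_curve 4 (?G t) \<and> real_plane_curve 4 (?c t) (?G t)" if t: "t \<in> {0..1}" for t
  proof -
    obtain x y z q where e: "u t = ((x,y,z),q)" by (metis prod.collapse)
    then have "rdet x y z \<noteq> 0" "cgood q" using in_S[OF t] region_spec[OF _ k, of q] by auto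
    from ccurve_model[OF this] show ?thesis unfolding e by simp
  qed
  moreover have "?G 0 = ccurve r1 r2 r3 q" "?G 1 = ccurve t1 t2 t3 q'"
    using u(3,4) unfolding pathstart_def pathfinish_def by simp_all
  moreover have "continuous_on {0..1} (\<lambda>t. ?c t i j)" for i j
    by (rule ccoeff_continuous) (use u(1) in \<open>simp add: path_def\<close>)
  ultimately show ?thesis unfolding rigidly_isotopic_def by (intro exI[of _ ?G] exI[of _ ?c]) blast
qed

subsection \<open>Invariance of the label\<close>

lemma polar_tendsto:
  fixes c :: "nat \<Rightarrow> nat \<Rightarrow> 'a::real_normed_field"
  assumes c: "\<And>i j. i + j \<le> 4 \<Longrightarrow> (\<lambda>n. cs n i j) \<longlonglongrightarrow> c i j"
    and "xs \<longlonglongrightarrow> x" "ys \<longlonglongrightarrow> y" "zs \<longlonglongrightarrow> z" "ws \<longlonglongrightarrow> w"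
  shows "(\<lambda>n. polar (cs n) (xs n) (ys n) (zs n) (ws n)) \<longlonglongrightarrow> polar c x y z w"
proof -
  have "(\<lambda>n. ind_coeff (cs n) i j k l) \<longlonglongrightarrow> ind_coeff c i j k l" for i j k l
    unfolding ind_coeff_def Let_def
    by (intro tendsto_divide tendsto_mult tendsto_const c) (auto simp: of_bool_def)
  then show ?thesis unfolding polar_def using assms(2-5)
    by (intro tendsto_sum tendsto_mult tendsto_vec_nth)
qed

abbreviation "cpolar c \<equiv> polar (\<lambda>i j. complex_of_real (c i j))"

lemma cpolar_tendsto:
  assumes "\<And>i j. i + j \<le> 4 \<Longrightarrow> (\<lambda>n. cs n i j) \<longlonglongrightarrow> c i j"
    and "xs \<longlonglongrightarrow> x" "ys \<longlonglongrightarrow> y" "zs \<longlonglongrightarrow> z" "ws \<longlonglongrightarrow> w"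
  shows "(\<lambda>n. cpolar (cs n) (xs n) (ys n) (zs n) (ws n)) \<longlonglongrightarrow> cpolar c x y z w"
  by (rule polar_tendsto) (use assms in \<open>auto intro: tendsto_of_real\<close>)

lemma cx_tendsto: "ys \<longlonglongrightarrow> y \<Longrightarrow> (\<lambda>n. cx (ys n)) \<longlonglongrightarrow> cx y"
  by (rule vec_tendstoI) (auto intro: tendsto_of_real tendsto_vec_nth)

lemma smult_tendsto: "ks \<longlonglongrightarrow> k \<Longrightarrow> xs \<longlonglongrightarrow> x \<Longrightarrow> (\<lambda>n. ks n *s xs n) \<longlonglongrightarrow> k *s (x :: 'a::real_normed_field^'n)"
  by (rule vec_tendstoI) (auto intro: tendsto_mult tendsto_vec_nth)

lemma sgn_smult: "sgn z = complex_of_real (inverse (norm z)) *s (z :: complex^'n)"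
proof -
  have "inverse (norm z) *\<^sub>R z $ i = complex_of_real (inverse (norm z)) * z $ i" for i by (rule scaleR_conv_of_real)
  then show ?thesis unfolding vec_eq_iff vector_smult_component sgn_vec_def sgn_div_norm vector_scaleR_component by blast
qed

lemma norm_smult_sgn: "of_real (norm d) *s sgn d = (d :: complex^'n)"
  by (cases "d = 0") (simp_all add: sgn_smult)

text \<open>If two singular points of \<open>cs n\<close> converged to the same \<open>x\<close>, then, scaled to agree in a
  coordinate \<open>i\<close> with \<open>x $ i \<noteq> 0\<close>, their normalized differences would accumulate at a unit vector
  with vanishing coordinate \<open>i\<close> in the kernel of the Hessian at \<open>x\<close>, which is spanned by \<open>x\<close>.\<close>

lemma (in nodal_quartic) no_collision:
  assumes lim: "\<And>i j. i + j \<le> 4 \<Longrightarrow> (\<lambda>n. cs n i j) \<longlonglongrightarrow> c i j"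
    and xs: "xs \<longlonglongrightarrow> x" and zs: "zs \<longlonglongrightarrow> x" and x: "x \<noteq> 0"
    and sx: "\<And>n v. cpolar (cs n) (xs n) (xs n) (xs n) v = 0" and sz: "\<And>n v. cpolar (cs n) (zs n) (zs n) (zs n) v = 0"
    and ne: "\<And>n. \<not> hom_equiv (xs n) (zs n)"
  shows False
proof -
  obtain i where i: "x $ i \<noteq> 0" using x by (auto simp: vec_eq_iff)
  define s where "s n = xs n $ i / zs n $ i" for n
  define d where "d n = s n *s zs n - xs n" for n
  define e where "e n = sgn (d n)" for n
  have "s \<longlonglongrightarrow> x $ i / x $ i" unfolding s_def by (intro tendsto_divide tendsto_vec_nth xs zs i)
  then have "d \<longlonglongrightarrow> 1 *s x - x" unfolding d_def using i by (intro tendsto_diff smult_tendsto xs zs) simp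
  then have d0: "d \<longlonglongrightarrow> 0" by simp
  have evx: "\<forall>\<^sub>F n in sequentially. xs n $ i \<noteq> 0" by (rule tendsto_imp_eventually_ne[OF tendsto_vec_nth[OF xs] i])
  have evz: "\<forall>\<^sub>F n in sequentially. zs n $ i \<noteq> 0" by (rule tendsto_imp_eventually_ne[OF tendsto_vec_nth[OF zs] i])
  have di: "\<forall>\<^sub>F n in sequentially. d n $ i = 0" using evz by eventually_elim (simp add: d_def s_def)
  have dn: "\<forall>\<^sub>F n in sequentially. d n \<noteq> 0" using evx evz
  proof eventually_elim
    case (elim n)
    have "xs n \<noteq> 0" "zs n \<noteq> 0" "s n \<noteq> 0" using elim by (auto simp: s_def)
    then have "hom_equiv (zs n) (s n *s zs n)" by (intro hom_equiv_scale)
    then show ?case using ne[of n] hom_equiv_sym[of "zs n" "xs n"] unfolding d_def by auto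
  qed
  have "\<forall>n. e n \<in> cball 0 1" unfolding e_def by (simp add: norm_sgn)
  then obtain e0 r where r: "strict_mono r" and er: "(e \<circ> r) \<longlonglongrightarrow> e0"
    using compact_cball[of "0::complex^3" 1] unfolding compact_def by blast
  have evr: "\<forall>\<^sub>F n in sequentially. Q (r n)" if "\<forall>\<^sub>F n in sequentially. Q n" for Q
    using r that by (rule eventually_subseq)
  have lr: "(\<lambda>n. f (r n)) \<longlonglongrightarrow> l" if "f \<longlonglongrightarrow> l" for f :: "nat \<Rightarrow> 'b::topological_space" and l
    using LIMSEQ_subseq_LIMSEQ[OF that r] by (simp add: o_def)
  have er: "(\<lambda>n. e (r n)) \<longlonglongrightarrow> e0" using er by (simp add: o_def)
  have "(\<lambda>n. norm (e (r n))) \<longlonglongrightarrow> 1"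
    by (rule tendsto_eventually) (use evr[OF dn] in eventually_elim, simp add: e_def norm_sgn)
  then have "norm e0 = 1" using tendsto_norm[OF er] LIMSEQ_unique by blast
  have "(\<lambda>n. e (r n) $ i) \<longlonglongrightarrow> 0"
    by (rule tendsto_eventually) (use evr[OF di] in eventually_elim, simp add: e_def sgn_div_norm)
  then have e0i: "e0 $ i = 0" using tendsto_vec_nth[OF er] LIMSEQ_unique by blast
  have M0: "M x x x v = 0" for v
  proof -
    have "(\<lambda>n. cpolar (cs n) (xs n) (xs n) (xs n) v) \<longlonglongrightarrow> M x x x v" by (intro cpolar_tendsto lim xs tendsto_const)
    then show ?thesis unfolding sx using LIMSEQ_unique tendsto_const by blast
  qed
  have M1: "M x x e0 v = 0" for v
  proof -
    let ?t = "\<lambda>n. complex_of_real (norm (d n))"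
    \<comment> \<open>The expansion at \<open>xs n + ?t n *s e n\<close>, divided by
      \<open>?t n\<close>. The term without \<open>e n\<close> is zero since \<open>xs n\<close> is
      singular, and in the limit only the Hessian term remains.\<close>
    let ?F = "\<lambda>n. 3 * cpolar (cs n) (xs n) (xs n) (e n) v + 3 * ?t n * cpolar (cs n) (xs n) (e n) (e n) v + (?t n)^2 * cpolar (cs n) (e n) (e n) (e n) v"
    have "\<forall>\<^sub>F n in sequentially. ?F n = 0" using dn
    proof eventually_elim
      case (elim n)
      have t: "?t n \<noteq> 0" using elim by simp
      have "s n *s zs n = xs n + ?t n *s e n"
        unfolding e_def norm_smult_sgn by (simp add: d_def)
      moreover have "cpolar (cs n) (s n *s zs n) (s n *s zs n) (s n *s zs n) v = 0" by (simp add: polar_scale sz)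
      ultimately have "cpolar (cs n) (xs n + ?t n *s e n) (xs n + ?t n *s e n) (xs n + ?t n *s e n) v = 0" by simp
      moreover have "cpolar (cs n) (xs n) (e n) (xs n) v = cpolar (cs n) (xs n) (xs n) (e n) v" "cpolar (cs n) (e n) (xs n) (xs n) v = cpolar (cs n) (xs n) (xs n) (e n) v"
        "cpolar (cs n) (e n) (xs n) (e n) v = cpolar (cs n) (xs n) (e n) (e n) v" "cpolar (cs n) (e n) (e n) (xs n) v = cpolar (cs n) (xs n) (e n) (e n) v"
        by (metis polar_swap)+
      then have "cpolar (cs n) (xs n + ?t n *s e n) (xs n + ?t n *s e n) (xs n + ?t n *s e n) v = ?t n * ?F n"
        by (simp add: polar_add polar_scale sx) (simp add: algebra_simps power2_eq_square)
      ultimately have "?t n * ?F n = 0" by simp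
      then show ?case using t by (simp only: mult_eq_0_iff simp_thms)
    qed
    then have "(\<lambda>n. ?F (r n)) \<longlonglongrightarrow> 0" by (intro tendsto_eventually evr)
    moreover have "(\<lambda>n. ?F (r n)) \<longlonglongrightarrow> 3 * M x x e0 v + 3 * of_real (norm (0 :: complex^3)) * M x e0 e0 v + (of_real (norm (0 :: complex^3)))^2 * M e0 e0 e0 v"
      by (intro tendsto_intros cpolar_tendsto lr[OF lim] lr[OF xs] er lr[OF d0])
    ultimately have "3 * M x x e0 v + 3 * of_real (norm (0 :: complex^3)) * M x e0 e0 v + (of_real (norm (0 :: complex^3)))^2 * M e0 e0 e0 v = 0"
      using LIMSEQ_unique by blast
    then show ?thesis by simp
  qed
  obtain k where k: "e0 = k *s x" using x M0 M1 by (rule hessian_kernel)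
  then have "k = 0" using e0i i by simp
  then show False using k \<open>norm e0 = 1\<close> by simp
qed

lemma eventually_same_sign:
  assumes "u \<longlonglongrightarrow> (l::real)" "l \<noteq> 0"
  shows "\<forall>\<^sub>F n in sequentially. (0 < u n \<longleftrightarrow> 0 < l) \<and> (u n < 0 \<longleftrightarrow> l < 0)"
proof (cases "0 < l")
  case True
  from order_tendstoD(1)[OF assms(1) this] show ?thesis by eventually_elim (use True in simp)
next
  case False
  then have "l < 0" using assms(2) by simp
  from order_tendstoD(2)[OF assms(1) this] show ?thesis by eventually_elim (use False \<open>l < 0\<close> in simp)
qed

text \<open>The only sign that can degenerate in the limit is that of \<open>f*g*h\<close>. It
  matters only when all diagonal coefficients and minors are negative, and then
  \<open>f^2 > b*c > 0\<close>, and likewise for \<open>g\<close> and \<open>h\<close>, so the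
  product is nonzero.\<close>

lemma plabel_eventually:
  assumes l: "as \<longlonglongrightarrow> a" "bs \<longlonglongrightarrow> b" "cs \<longlonglongrightarrow> c" "fs \<longlonglongrightarrow> f" "gs \<longlonglongrightarrow> g" "hs \<longlonglongrightarrow> h" and gd: "good a b c f g h"
  shows "\<forall>\<^sub>F n in sequentially. plabel (as n, bs n, cs n, fs n, gs n, hs n) = plabel (a,b,c,f,g,h)"
proof -
  have nz: "a \<noteq> 0" "b \<noteq> 0" "c \<noteq> 0" "b*c - f^2 \<noteq> 0" "a*c - g^2 \<noteq> 0" "a*b - h^2 \<noteq> 0" using gd unfolding good_def by auto
  note ev = eventually_same_sign[OF l(1) nz(1)] eventually_same_sign[OF l(2) nz(2)] eventually_same_sign[OF l(3) nz(3)]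
    eventually_same_sign[OF tendsto_diff[OF tendsto_mult[OF l(2,3)] tendsto_power[OF l(4)]] nz(4)]
    eventually_same_sign[OF tendsto_diff[OF tendsto_mult[OF l(1,3)] tendsto_power[OF l(5)]] nz(5)]
    eventually_same_sign[OF tendsto_diff[OF tendsto_mult[OF l(1,2)] tendsto_power[OF l(6)]] nz(6)]
  show ?thesis
  proof (cases "a < 0 \<and> b < 0 \<and> c < 0 \<and> b*c - f^2 < 0 \<and> a*c - g^2 < 0 \<and> a*b - h^2 < 0")
    case True
    then have "0 < b * c" "0 < a * c" "0 < a * b" by (auto simp: zero_less_mult_iff)
    then have "f * g * h \<noteq> 0" using True by auto
    from eventually_same_sign[OF tendsto_mult[OF tendsto_mult[OF l(4,5)] l(6)] this] ev
    show ?thesis by eventually_elim (simp only: plabel.simps)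
  next
    case False
    from ev show ?thesis by eventually_elim (use False in \<open>simp only: plabel.simps, blast\<close>)
  qed
qed

lemma clabel_eventually:
  assumes l: "as \<longlonglongrightarrow> a" "bs \<longlonglongrightarrow> b" "cs \<longlonglongrightarrow> c" "fs \<longlonglongrightarrow> f" "gs \<longlonglongrightarrow> g" "hs \<longlonglongrightarrow> h" and gd: "good a b c f g h"
  shows "\<forall>\<^sub>F n in sequentially. clabel (as n, bs n, cs n, fs n, gs n, hs n) = clabel (a,b,c,f,g,h)"
proof -
  have "qdet a b c f g h \<noteq> 0" using gd unfolding good_def by blast
  moreover have "(\<lambda>n. qdet (as n) (bs n) (cs n) (fs n) (gs n) (hs n)) \<longlonglongrightarrow> qdet a b c f g h"
    unfolding qdet_def by (intro tendsto_intros l)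
  ultimately have d: "\<forall>\<^sub>F n in sequentially. (0 < qdet (as n) (bs n) (cs n) (fs n) (gs n) (hs n) \<longleftrightarrow> 0 < qdet a b c f g h) \<and>
      (qdet (as n) (bs n) (cs n) (fs n) (gs n) (hs n) < 0 \<longleftrightarrow> qdet a b c f g h < 0)" using eventually_same_sign by blast
  have "good (-a) (-b) (-c) (-f) (-g) (-h)" using gd good_neg by simp
  from plabel_eventually[OF tendsto_minus[OF l(1)] tendsto_minus[OF l(2)] tendsto_minus[OF l(3)] tendsto_minus[OF l(4)] tendsto_minus[OF l(5)] tendsto_minus[OF l(6)] this]
    plabel_eventually[OF l gd] d
  show ?thesis unfolding clabel_def by eventually_elim (simp del: plabel.simps)
qed

lemma (in quartic_frame) rescale_frame:
  assumes k: "k1 \<noteq> 0" "k2 \<noteq> 0" "k3 \<noteq> 0"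
  shows "quartic_frame p c (k1 *s y1) (k2 *s y2) (k3 *s y3)"
proof
  have s: "hom_equiv (cx (k *s y)) (cx y)" if "k \<noteq> 0" "y \<noteq> 0" for k y
    using hom_equiv_scale[of "cx y" "of_real k"] that unfolding cx_linear by (simp add: hom_equiv_sym)
  note s1 = s[OF k(1) y_nonzero3(1)] and s2 = s[OF k(2) y_nonzero3(2)] and s3 = s[OF k(3) y_nonzero3(3)]
  show "\<not> hom_equiv (cx (k1 *s y1)) (cx (k2 *s y2))" using equiv_chain[OF s1 s2] y_distinct by blast
  show "\<not> hom_equiv (cx (k1 *s y1)) (cx (k3 *s y3))" using equiv_chain[OF s1 s3] y_distinct by blast
  show "\<not> hom_equiv (cx (k2 *s y2)) (cx (k3 *s y3))" using equiv_chain[OF s2 s3] y_distinct by blast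
qed (use k y_nonzero3 y_sing in \<open>simp_all add: cx_linear polar_scale\<close>)

lemma labelled_unit_frame:
  assumes "labelled c l"
  shows "\<exists>p y1 y2 y3. quartic_frame p c y1 y2 y3 \<and> clabel (conic_of c y1 y2 y3) = l \<and> norm y1 = 1 \<and> norm y2 = 1 \<and> norm y3 = 1"
proof -
  obtain p y1 y2 y3 where y: "quartic_frame p c y1 y2 y3" and l: "clabel (conic_of c y1 y2 y3) = l" using assms unfolding labelled_def by blast
  interpret quartic_frame p c y1 y2 y3 by fact
  let ?k = "\<lambda>y :: real^3. inverse (norm y)"
  have k: "?k y1 \<noteq> 0" "?k y2 \<noteq> 0" "?k y3 \<noteq> 0" using y_nonzero3 by simp_all
  have "norm (?k y *s y) = 1" if "y \<noteq> 0" for y :: "real^3" using that by (simp add: scalar_mult_eq_scaleR)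
  then show ?thesis using rescale_frame[OF k] conic_of_label_scale[OF k, of c y1 y2 y3] l y_nonzero3 by blast
qed

text \<open>Unit representatives of the nodes subconverge by compactness. Their limits are singular
  by continuity and distinct by \<open>no_collision\<close>, so they form a frame, along which the
  label is eventually constant.\<close>

lemma (in nodal_quartic) labelled_closed:
  assumes lim: "\<And>i j. i + j \<le> 4 \<Longrightarrow> (\<lambda>n. cs n i j) \<longlonglongrightarrow> c i j" and lab: "\<And>n. labelled (cs n) l"
  shows "labelled c l"
proof -
  let ?F = "\<lambda>n (y1,y2,y3). (\<exists>p. quartic_frame p (cs n) y1 y2 y3) \<and> clabel (conic_of (cs n) y1 y2 y3) = l \<and> norm y1 = 1 \<and> norm y2 = 1 \<and> norm y3 = 1"
  have "\<forall>n. \<exists>Y. ?F n Y"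
  proof
    fix n
    obtain p y1 y2 y3 where "quartic_frame p (cs n) y1 y2 y3" "clabel (conic_of (cs n) y1 y2 y3) = l" "norm y1 = 1" "norm y2 = 1" "norm y3 = 1"
      using labelled_unit_frame[OF lab[of n]] by (elim exE conjE) (rule that)
    then have "?F n (y1,y2,y3)" by auto
    then show "\<exists>Y. ?F n Y" by (rule exI)
  qed
  from choice[OF this] obtain Y where Y: "\<forall>n. ?F n (Y n)" ..
  let ?S = "sphere (0::real^3) 1"
  have "\<forall>n. Y n \<in> ?S \<times> ?S \<times> ?S" using Y by (simp add: split_beta mem_Times_iff)
  moreover have "compact (?S \<times> ?S \<times> ?S)" by (intro compact_Times compact_sphere)
  ultimately obtain L r where L: "L \<in> ?S \<times> ?S \<times> ?S" and r: "strict_mono r" and Lr: "(Y \<circ> r) \<longlonglongrightarrow> L"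
    unfolding compact_def by blast
  obtain y1 y2 y3 where Le: "L = (y1,y2,y3)" by (cases L)
  define a b e where "a n = fst (Y (r n))" and "b n = fst (snd (Y (r n)))" and "e n = snd (snd (Y (r n)))" for n
  have lims: "a \<longlonglongrightarrow> y1" "b \<longlonglongrightarrow> y2" "e \<longlonglongrightarrow> y3"
    using tendsto_fst[OF Lr] tendsto_fst[OF tendsto_snd[OF Lr]] tendsto_snd[OF tendsto_snd[OF Lr]]
    unfolding Le a_def b_def e_def by (simp_all add: o_def)
  have F: "\<exists>p. quartic_frame p (cs (r n)) (a n) (b n) (e n)" "clabel (conic_of (cs (r n)) (a n) (b n) (e n)) = l" for n
    using spec[OF Y, of "r n"] unfolding a_def b_def e_def split_beta by blast+
  have limr: "(\<lambda>n. cs (r n) i j) \<longlonglongrightarrow> c i j" if "i + j \<le> 4" for i j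
    using LIMSEQ_subseq_LIMSEQ[OF lim[OF that] r] by (simp add: o_def)
  have sing: "cpolar (cs (r n)) (cx (a n)) (cx (a n)) (cx (a n)) v = 0" "cpolar (cs (r n)) (cx (b n)) (cx (b n)) (cx (b n)) v = 0"
    "cpolar (cs (r n)) (cx (e n)) (cx (e n)) (cx (e n)) v = 0"
    and dist: "\<not> hom_equiv (cx (a n)) (cx (b n))" "\<not> hom_equiv (cx (a n)) (cx (e n))" "\<not> hom_equiv (cx (b n)) (cx (e n))" for n v
  proof -
    obtain p' where f: "quartic_frame p' (cs (r n)) (a n) (b n) (e n)" using F(1)[of n] ..
    show "cpolar (cs (r n)) (cx (a n)) (cx (a n)) (cx (a n)) v = 0" "cpolar (cs (r n)) (cx (b n)) (cx (b n)) (cx (b n)) v = 0"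
      "cpolar (cs (r n)) (cx (e n)) (cx (e n)) (cx (e n)) v = 0"
      by (rule quartic_frame.y_sing[OF f])+
    show "\<not> hom_equiv (cx (a n)) (cx (b n))" "\<not> hom_equiv (cx (a n)) (cx (e n))" "\<not> hom_equiv (cx (b n)) (cx (e n))"
      by (rule quartic_frame.y_distinct[OF f])+
  qed
  have limit: "M (cx y) (cx y) (cx y) v = 0" if y: "s \<longlonglongrightarrow> y" "\<And>n v. cpolar (cs (r n)) (cx (s n)) (cx (s n)) (cx (s n)) v = 0" for s y v
  proof -
    have "(\<lambda>n. cpolar (cs (r n)) (cx (s n)) (cx (s n)) (cx (s n)) v) \<longlonglongrightarrow> M (cx y) (cx y) (cx y) v"
      by (intro cpolar_tendsto limr cx_tendsto y tendsto_const)
    then show ?thesis unfolding y(2) using LIMSEQ_unique tendsto_const by blast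
  qed
  have nz: "y1 \<noteq> 0" "y2 \<noteq> 0" "y3 \<noteq> 0" using L unfolding Le by auto
  have distinct: "\<not> hom_equiv (cx y) (cx y')" if y: "s \<longlonglongrightarrow> y" "s' \<longlonglongrightarrow> y'" "y \<noteq> 0" "\<And>n v. cpolar (cs (r n)) (cx (s n)) (cx (s n)) (cx (s n)) v = 0"
     "\<And>n v. cpolar (cs (r n)) (cx (s' n)) (cx (s' n)) (cx (s' n)) v = 0" "\<And>n. \<not> hom_equiv (cx (s n)) (cx (s' n))" for s s' y y'
  proof
    assume "hom_equiv (cx y) (cx y')"
    then obtain k where k: "k \<noteq> 0" "y' = k *s y" by (rule equiv_cx)
    show False
    \<comment> \<open>The factor \<open>1/k\<close> makes both sequences converge to the same
      vector.\<close>
    proof (rule no_collision[of "\<lambda>n. cs (r n)" "\<lambda>n. cx (s n)" "cx y" "\<lambda>n. of_real (1/k) *s cx (s' n)"])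
      show "(\<lambda>n. cx (s n)) \<longlonglongrightarrow> cx y" by (rule cx_tendsto[OF y(1)])
      have "(\<lambda>n. of_real (1/k) *s cx (s' n)) \<longlonglongrightarrow> of_real (1/k) *s cx y'" by (intro smult_tendsto tendsto_const cx_tendsto y)
      then show "(\<lambda>n. of_real (1/k) *s cx (s' n)) \<longlonglongrightarrow> cx y" unfolding k(2) using k(1) by (simp add: cx_linear)
      show "\<not> hom_equiv (cx (s n)) (of_real (1/k) *s cx (s' n))" for n
      proof
        assume h: "hom_equiv (cx (s n)) (of_real (1/k) *s cx (s' n))"
        then have "cx (s' n) \<noteq> 0" using hom_equiv_nonzero[OF h] by auto
        then have "hom_equiv (of_real (1/k) *s cx (s' n)) (cx (s' n))" by (rule hom_equiv_sym[OF hom_equiv_scale]) (use k(1) in simp_all)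
        from hom_equiv_trans[OF h this] y(6) show False by blast
      qed
    qed (use y limr in \<open>simp_all add: polar_scale\<close>)
  qed
  have Q: "quartic_frame p c y1 y2 y3"
  proof unfold_locales
    show "M (cx y1) (cx y1) (cx y1) v = 0" "M (cx y2) (cx y2) (cx y2) v = 0" "M (cx y3) (cx y3) (cx y3) v = 0" for v
      by (rule limit[OF lims(1) sing(1)] limit[OF lims(2) sing(2)] limit[OF lims(3) sing(3)])+
    show "\<not> hom_equiv (cx y1) (cx y2)" by (rule distinct[OF lims(1,2) nz(1) sing(1,2) dist(1)])
    show "\<not> hom_equiv (cx y1) (cx y3)" by (rule distinct[OF lims(1,3) nz(1) sing(1,3) dist(2)])
    show "\<not> hom_equiv (cx y2) (cx y3)" by (rule distinct[OF lims(2,3) nz(2) sing(2,3) dist(3)])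
  qed (rule nz)+
  have "\<forall>\<^sub>F n in sequentially. clabel (conic_of (cs (r n)) (a n) (b n) (e n)) = clabel (conic_of c y1 y2 y3)"
    unfolding conic_of_def
    by (rule clabel_eventually) (intro tendsto_mult tendsto_const polar_tendsto limr lims, assumption | rule quartic_frame.good_conic[OF Q])+
  then have "clabel (conic_of c y1 y2 y3) = l" unfolding F(2) by simp
  then show ?thesis unfolding labelled_def using Q by blast
qed

section \<open>Complex conjugation and nonreal nodes\<close>

definition cnjv :: "complex^'n \<Rightarrow> complex^'n" where
  "cnjv x = (\<chi> i. cnj (x $ i))"

lemma cnjv_nth [simp]: "cnjv x $ i = cnj (x $ i)"
  unfolding cnjv_def by simp

lemma cnjv_scale: "cnjv (k *s x) = cnj k *s cnjv x"
  by (simp add: vec_eq_iff)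

lemma cnjv_cx [simp]: "cnjv (cx y) = cx y"
  by (simp add: vec_eq_iff)

lemma cnjv_tendsto: "xs \<longlonglongrightarrow> x \<Longrightarrow> (\<lambda>n. cnjv (xs n)) \<longlonglongrightarrow> cnjv x"
  by (rule vec_tendstoI) (auto intro: tendsto_cnj tendsto_vec_nth)

lemma cpolar_cnjv: "cpolar c (cnjv x) (cnjv y) (cnjv z) (cnjv w) = cnj (cpolar c x y z w)"
  unfolding polar_def ind_coeff_of_real by simp

text \<open>After division by a nonzero coordinate all coordinates are invariant under
  conjugation.\<close>

lemma equiv_cnjv_real:
  assumes "hom_equiv x (cnjv x)"
  obtains k y where "k \<noteq> 0" "y \<noteq> 0" "x = k *s cx y"
proof -
  obtain l where l: "l \<noteq> 0" "cnjv x = l *s x" using assms by (rule equiv_scaleE)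
  have x: "x \<noteq> 0" using assms unfolding hom_equiv_def by blast
  then obtain i where i: "x $ i \<noteq> 0" by (auto simp: vec_eq_iff)
  have lj: "cnj (x $ j) = l * x $ j" for j using arg_cong[OF l(2), of "\<lambda>v. v $ j"] by simp
  have "cnj (x $ j / x $ i) = x $ j / x $ i" for j using l(1) by (simp add: lj)
  then have "x $ j / x $ i \<in> \<real>" for j by (simp only: Reals_cnj_iff)
  then have "x $ j / x $ i = of_real (Re (x $ j / x $ i))" for j by (simp add: of_real_Re)
  then have "x = x $ i *s cx (\<chi> j. Re (x $ j / x $ i))" using i by (simp add: vec_eq_iff field_simps)
  moreover from this have "(\<chi> j. Re (x $ j / x $ i)) \<noteq> 0" using x by (metis cx_nonzero vector_smult_rzero)
  ultimately show ?thesis using i that by blast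
qed

definition has_nonreal_node :: "(nat \<Rightarrow> nat \<Rightarrow> real) \<Rightarrow> bool" where
  "has_nonreal_node c \<longleftrightarrow> (\<exists>z. z \<noteq> 0 \<and> (\<forall>v. cpolar c z z z v = 0) \<and> \<not> hom_equiv z (cnjv z))"

lemma nonreal_scale:
  assumes "k \<noteq> 0" "z \<noteq> 0" "\<not> hom_equiv z (cnjv z)"
  shows "\<not> hom_equiv (k *s z) (cnjv (k *s z))"
proof
  have z: "cnjv z \<noteq> 0" using assms(2) by (auto simp: vec_eq_iff)
  assume h: "hom_equiv (k *s z) (cnjv (k *s z))"
  have "hom_equiv (k *s z) z" by (rule hom_equiv_sym[OF hom_equiv_scale]) (rule assms)+
  moreover note h
  moreover have "hom_equiv (cnjv (k *s z)) (cnjv z)" unfolding cnjv_scale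
    by (rule hom_equiv_sym[OF hom_equiv_scale]) (use z assms in simp_all)
  ultimately have "hom_equiv z (cnjv z)" by (rule hom_equiv_trans[OF hom_equiv_sym hom_equiv_trans])
  then show False using assms(3) by blast
qed

text \<open>The equation is real, so the conjugate of a node is a node. If nonreal nodes converged
  to a real one, so would their conjugates, and two nodes would collide.\<close>

lemma (in nodal_quartic) nonreal_node_closed:
  assumes lim: "\<And>i j. i + j \<le> 4 \<Longrightarrow> (\<lambda>n. cs n i j) \<longlonglongrightarrow> c i j" and nr: "\<And>n. has_nonreal_node (cs n)"
  shows "has_nonreal_node c"
proof -
  let ?F = "\<lambda>n z. norm z = 1 \<and> (\<forall>v. cpolar (cs n) z z z v = 0) \<and> \<not> hom_equiv z (cnjv z)"
  have "\<forall>n. \<exists>z. ?F n z"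
  proof
    fix n
    obtain z where z: "z \<noteq> 0" "\<forall>v. cpolar (cs n) z z z v = 0" "\<not> hom_equiv z (cnjv z)"
      using nr[of n] unfolding has_nonreal_node_def by (elim exE conjE) (rule that)
    have "norm (sgn z) = 1" using z(1) by (simp add: norm_sgn)
    moreover have "\<forall>v. cpolar (cs n) (sgn z) (sgn z) (sgn z) v = 0" unfolding sgn_smult by (simp add: polar_scale z(2))
    moreover have "\<not> hom_equiv (sgn z) (cnjv (sgn z))" unfolding sgn_smult by (rule nonreal_scale) (use z in simp_all)
    ultimately show "\<exists>z. ?F n z" by blast
  qed
  from choice[OF this] obtain x where x: "\<forall>n. ?F n (x n)" ..
  have "\<forall>n. x n \<in> sphere 0 1" using x by simp
  then obtain x0 r where x0: "x0 \<in> sphere 0 1" and r: "strict_mono r" and xr: "(x \<circ> r) \<longlonglongrightarrow> x0"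
    using compact_sphere[of "0::complex^3" 1] unfolding compact_def by blast
  have xr: "(\<lambda>n. x (r n)) \<longlonglongrightarrow> x0" using xr by (simp add: o_def)
  have limr: "(\<lambda>n. cs (r n) i j) \<longlonglongrightarrow> c i j" if "i + j \<le> 4" for i j
    using LIMSEQ_subseq_LIMSEQ[OF lim[OF that] r] by (simp add: o_def)
  have sx: "cpolar (cs (r n)) (x (r n)) (x (r n)) (x (r n)) v = 0" for n v using x by blast
  have "M x0 x0 x0 v = 0" for v
  proof -
    have "(\<lambda>n. cpolar (cs (r n)) (x (r n)) (x (r n)) (x (r n)) v) \<longlonglongrightarrow> M x0 x0 x0 v"
      by (intro cpolar_tendsto limr xr tendsto_const)
    then show ?thesis unfolding sx using LIMSEQ_unique tendsto_const by blast
  qed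
  moreover have "\<not> hom_equiv x0 (cnjv x0)"
  proof
    assume "hom_equiv x0 (cnjv x0)"
    then obtain k y where k: "k \<noteq> 0" "y \<noteq> 0" "x0 = k *s cx y" by (rule equiv_cnjv_real)
    \<comment> \<open>Scaled so that the limit is a real vector, which conjugation fixes.\<close>
    define w where "w n = inverse k *s x (r n)" for n
    have w: "w \<longlonglongrightarrow> cx y"
    proof -
      have "(\<lambda>n. inverse k *s x (r n)) \<longlonglongrightarrow> inverse k *s x0" by (intro smult_tendsto tendsto_const xr)
      then show ?thesis unfolding w_def k(3) using k(1) by simp
    qed
    have sw: "cpolar (cs (r n)) (w n) (w n) (w n) v = 0" for n v unfolding w_def by (simp add: polar_scale sx)
    show False
    proof (rule no_collision[of "\<lambda>n. cs (r n)" w "cx y" "\<lambda>n. cnjv (w n)"])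
      show "(\<lambda>n. cnjv (w n)) \<longlonglongrightarrow> cx y" using cnjv_tendsto[OF w] by simp
      show "cpolar (cs (r n)) (cnjv (w n)) (cnjv (w n)) (cnjv (w n)) v = 0" for n v
      proof -
        have "cnjv (cnjv v) = v" by (simp add: vec_eq_iff)
        then show ?thesis using cpolar_cnjv[of "cs (r n)" "w n" "w n" "w n" "cnjv v"] sw[of n "cnjv v"] by simp
      qed
      show "\<not> hom_equiv (w n) (cnjv (w n))" for n
      proof -
        have "x (r n) \<noteq> 0" using x[rule_format, of "r n"] by auto
        then show ?thesis unfolding w_def by (intro nonreal_scale) (use k(1) x in auto)
      qed
    qed (use w sw limr k(2) in simp_all)
  qed
  moreover have "x0 \<noteq> 0" using x0 by auto
  ultimately show ?thesis unfolding has_nonreal_node_def by blast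
qed

lemma labelled_same:
  assumes "labelled c l" "labelled c l'"
  shows "l = l'"
proof -
  obtain p y1 y2 y3 where y: "quartic_frame p c y1 y2 y3" using assms(1) unfolding labelled_def by blast
  interpret quartic_frame p c y1 y2 y3 by fact
  have "real_plane_curve 4 c {x. ternary_form 4 (\<lambda>i j. of_real (c i j)) (rep_cproj x) = 0}" unfolding real_plane_curve_def using sqf by blast
  then show ?thesis using labelled_unique assms by blast
qed

lemma labelled_real:
  assumes "labelled c l"
  shows "\<not> has_nonreal_node c"
proof
  obtain p y1 y2 y3 where y: "quartic_frame p c y1 y2 y3" using assms(1) unfolding labelled_def by blast
  interpret quartic_frame p c y1 y2 y3 by fact
  assume "has_nonreal_node c"
  then obtain z where z: "z \<noteq> 0" "\<forall>v. M z z z v = 0" "\<not> hom_equiv z (cnjv z)" unfolding has_nonreal_node_def by (elim exE conjE) (rule that)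
  obtain y where y: "hom_equiv (cx y) z" using singular_is_vertex[OF z(1)] z(2) by blast
  obtain k where k: "k \<noteq> 0" "z = k *s cx y" using y by (rule equiv_scaleE)
  have "cx y \<noteq> 0" using z(1) k(2) by auto
  have "hom_equiv (cnj k *s cx y) (cx y)" by (rule hom_equiv_sym[OF hom_equiv_scale]) (use k(1) \<open>cx y \<noteq> 0\<close> in simp_all)
  then have "hom_equiv (cnjv z) z" using y unfolding k(2) cnjv_scale cnjv_cx by (rule hom_equiv_trans)
  then show False using z(3) hom_equiv_sym by blast
qed

lemma labelled_region:
  assumes "labelled c l"
  shows "\<exists>k<9. l = region_label k"
proof -
  obtain p y1 y2 y3 where y: "quartic_frame p c y1 y2 y3" and l: "clabel (conic_of c y1 y2 y3) = l" using assms(1) unfolding labelled_def by blast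
  from quartic_frame.cgood_conic[OF y] obtain k q where "k < 9" "clabel (conic_of c y1 y2 y3) = region_label k" by (rule cgood_normal_form)
  then show ?thesis using l by blast
qed

lemma (in nodal_quartic) labelled_or_nonreal: "has_nonreal_node c \<or> (\<exists>l. labelled c l)"
proof (cases "has_nonreal_node c")
  case nr: False
  have "real_point x" if x: "x \<in> singular_points 4 c" for x
  proof -
    have "\<forall>v. M (rep_cproj x) (rep_cproj x) (rep_cproj x) v = 0" using x unfolding singular_points_4 by blast
    then have "hom_equiv (rep_cproj x) (cnjv (rep_cproj x))" using nr rep_cproj_nonzero unfolding has_nonreal_node_def by blast
    then obtain k y where y: "k \<noteq> 0" "y \<noteq> 0" "rep_cproj x = k *s cx y" by (rule equiv_cnjv_real)
    then have "hom_equiv (cx y) (rep_cproj x)" using hom_equiv_scale[of "cx y" k] by simp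
    then have "abs_cproj (cx y) = x" using abs_cproj_eq_iff[of "cx y" "rep_cproj x"] y(2) by (simp add: abs_rep_cproj)
    then show ?thesis unfolding real_point_cx using y(2) by blast
  qed
  then obtain y1 y2 y3 where "quartic_frame p c y1 y2 y3" using real_frame_exists by blast
  then show ?thesis unfolding labelled_def by blast
qed simp

lemma label_constant:
  assumes nod: "\<And>t. t \<in> {0..1::real} \<Longrightarrow> \<exists>p. nodal_quartic p (c t)"
    and cont: "\<And>i j. i + j \<le> 4 \<Longrightarrow> continuous_on {0..1} (\<lambda>t. c t i j)"
    and lab: "labelled (c 0) l"
  shows "labelled (c 1) l"
proof -
  define A where "A l = {t\<in>{0..1}. labelled (c t) l}" for l
  define B where "B = {t\<in>{0..1}. has_nonreal_node (c t)}"
  have seq: "(\<lambda>n. c (t n) i j) \<longlonglongrightarrow> c s i j" if "\<And>n. t n \<in> {0..1}" "t \<longlonglongrightarrow> s" "s \<in> {0..1}" "i + j \<le> 4" for t s i j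
    using cont[OF that(4)] that(1-3) unfolding continuous_on_sequentially comp_def by blast
  have lim01: "s \<in> {0..1}" if "\<And>n. t n \<in> {0..1}" "t \<longlonglongrightarrow> s" for t and s :: real
    using closed_sequentially[OF closed_atLeastAtMost that] .
  have cA: "closed (A l)" for l
    unfolding closed_sequential_limits
  proof (intro allI impI, elim conjE)
    fix t s assume t: "\<forall>n. t n \<in> A l" and ts: "t \<longlonglongrightarrow> s"
    have t01: "\<And>n. t n \<in> {0..1}" using t unfolding A_def by blast
    have s: "s \<in> {0..1}" by (rule lim01[OF t01 ts])
    obtain p where p: "nodal_quartic p (c s)" using nod[OF s] by blast
    have "labelled (c s) l"
    proof (rule nodal_quartic.labelled_closed[OF p, of "\<lambda>n. c (t n)"])
      show "(\<lambda>n. c (t n) i j) \<longlonglongrightarrow> c s i j" if "i + j \<le> 4" for i j by (rule seq[OF t01 ts s that])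
      show "labelled (c (t n)) l" for n using t unfolding A_def by blast
    qed
    then show "s \<in> A l" unfolding A_def using s by blast
  qed
  have cB: "closed B"
    unfolding closed_sequential_limits
  proof (intro allI impI, elim conjE)
    fix t s assume t: "\<forall>n. t n \<in> B" and ts: "t \<longlonglongrightarrow> s"
    have t01: "\<And>n. t n \<in> {0..1}" using t unfolding B_def by blast
    have s: "s \<in> {0..1}" by (rule lim01[OF t01 ts])
    obtain p where p: "nodal_quartic p (c s)" using nod[OF s] by blast
    have "has_nonreal_node (c s)"
    proof (rule nodal_quartic.nonreal_node_closed[OF p, of "\<lambda>n. c (t n)"])
      show "(\<lambda>n. c (t n) i j) \<longlonglongrightarrow> c s i j" if "i + j \<le> 4" for i j by (rule seq[OF t01 ts s that])
      show "has_nonreal_node (c (t n))" for n using t unfolding B_def by blast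
    qed
    then show "s \<in> B" unfolding B_def using s by blast
  qed
  \<comment> \<open>Everything other than the label \<open>l\<close>; this set is closed because
    only finitely many labels occur.\<close>
  let ?R = "B \<union> (\<Union>l'\<in>region_label ` {..<9} - {l}. A l')"
  have cR: "closed ?R" by (intro closed_Un cB closed_UN finite_Diff finite_imageI finite_lessThan) (simp add: cA)
  have cover: "{0..1} \<subseteq> A l \<union> ?R"
  proof
    fix t :: real assume t: "t \<in> {0..1}"
    obtain p where p: "nodal_quartic p (c t)" using nod[OF t] by blast
    from nodal_quartic.labelled_or_nonreal[OF p] show "t \<in> A l \<union> ?R"
    proof
      assume "\<exists>l'. labelled (c t) l'"
      then obtain l' where l': "labelled (c t) l'" ..
      obtain k where "k < 9" "l' = region_label k" using labelled_region[OF l'] by blast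
      then show ?thesis using l' t unfolding A_def by blast
    qed (use t in \<open>simp add: B_def\<close>)
  qed
  have disj: "A l \<inter> ?R \<inter> {0..1} = {}" unfolding A_def B_def using labelled_same labelled_real by blast
  have ne: "A l \<inter> {0..1} \<noteq> {}" unfolding A_def using lab by force
  have "A l \<inter> {0..1} = {} \<or> ?R \<inter> {0..1} = {}"
    by (rule connected_closedD[OF _ disj cover cA cR]) simp
  then have "?R \<inter> {0..1} = {}" using ne by blast
  moreover have one: "(1::real) \<in> {0..1}" by simp
  ultimately have "(1::real) \<in> A l" using subsetD[OF cover one] by (meson UnE disjoint_iff)
  then show ?thesis unfolding A_def by blast
qed

section \<open>The nine rigid isotopy classes\<close>

definition label_class :: "nat \<Rightarrow> 3 cproj set set" where
  "label_class k = {C. \<exists>c. real_plane_curve 4 c C \<and> labelled c (region_label k)}"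

lemma ccurve_label_class:
  assumes "k < 9" "q \<in> region k" "0 < rdet r1 r2 r3"
  shows "ccurve r1 r2 r3 q \<in> label_class k" "real_nodal_curve 4 (ccurve r1 r2 r3 q)"
proof -
  have "rdet r1 r2 r3 \<noteq> 0" "cgood q" "clabel q = region_label k" using assms(3) region_spec[OF assms(2,1)] by auto
  from ccurve_model[OF this(1,2)] this(3)
  show "ccurve r1 r2 r3 q \<in> label_class k" "real_nodal_curve 4 (ccurve r1 r2 r3 q)"
    unfolding label_class_def by auto
qed

lemma label_class_normal_form:
  assumes "C \<in> label_class k" "k < 9"
  shows "\<exists>q\<in>region k. \<exists>r1 r2 r3. 0 < rdet r1 r2 r3 \<and> C = ccurve r1 r2 r3 q"
proof -
  obtain c where c: "real_plane_curve 4 c C" "labelled c (region_label k)" using assms(1) unfolding label_class_def by blast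
  obtain k' where "k' < 9" "region_label k = region_label k'" and ex: "\<exists>q\<in>region k'. \<exists>r1 r2 r3. 0 < rdet r1 r2 r3 \<and> C = ccurve r1 r2 r3 q"
    using labelled_normal_form[OF c] by (elim exE conjE) (rule that)
  then have "k = k'" using region_label_inj assms(2) by blast
  then show ?thesis using ex by simp
qed

lemma real_nodal_label_classes: "{C. real_nodal_curve 4 C} = (\<Union>k<9. label_class k)"
proof (intro equalityI subsetI)
  fix C assume "C \<in> {C. real_nodal_curve 4 C}"
  then obtain c l where c: "real_plane_curve 4 c C" "labelled c l" using real_nodal_labelled by blast
  from labelled_region[OF c(2)] c show "C \<in> (\<Union>k<9. label_class k)" unfolding label_class_def by blast
next
  fix C assume "C \<in> (\<Union>k<9. label_class k)"
  then obtain k where k: "k < 9" "C \<in> label_class k" by auto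
  from label_class_normal_form[OF k(2,1)] ccurve_label_class(2)[OF k(1)] show "C \<in> {C. real_nodal_curve 4 C}" by blast
qed

lemma isotopy_preserves_class:
  assumes "rigidly_isotopic 4 C D" "C \<in> label_class k"
  shows "D \<in> label_class k"
proof -
  obtain G c where G: "\<forall>t\<in>{0..1::real}. nodal_curve 4 (G t) \<and> real_plane_curve 4 (c t) (G t)"
    and cont: "\<forall>i j. i + j \<le> 4 \<longrightarrow> continuous_on {0..1} (\<lambda>t. c t i j)" and ends: "G 0 = C" "G 1 = D"
    using assms(1) unfolding rigidly_isotopic_def by (elim exE conjE) (rule that)
  have G01: "nodal_curve 4 C" "real_plane_curve 4 (c 0) C" "real_plane_curve 4 (c 1) D" using G ends by force+
  have nod: "\<exists>p. nodal_quartic p (c t)" if "t \<in> {0..1}" for t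
    using nodal_curve_quartic[of "G t" "c t"] G that by blast
  obtain c' where c': "real_plane_curve 4 c' C" "labelled c' (region_label k)" using assms(2) unfolding label_class_def by blast
  obtain p y1 y2 y3 where "quartic_frame p c' y1 y2 y3" using c'(2) unfolding labelled_def by blast
  then interpret F: quartic_frame p c' y1 y2 y3 .
  \<comment> \<open>The isotopy starts with its own equation \<open>c 0\<close> of \<open>C\<close>,
    which has to be shown to carry the label found for \<open>c'\<close>.\<close>
  have "rat_quartic p (c 0)"
    using F.ncr F.zeros G01(2) real_plane_curve_zeros[OF c'(1)] real_plane_curve_zeros[OF G01(2)]
    unfolding rat_quartic_def real_plane_curve_def by simp
  then have "\<forall>x\<in>singular_points 4 (c 0). node 4 p x \<and> real_point x"
    using nodal_transfer[OF F.rat_quartic_axioms, of "c 0" "\<lambda>x. node 4 p x \<and> real_point x"] F.all_singular_real F.nodal_quartic_axioms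
    unfolding nodal_quartic_def nodal_quartic_axioms_def by blast
  then interpret N: nodal_quartic p "c 0"
    using \<open>rat_quartic p (c 0)\<close> by (simp add: nodal_quartic_def nodal_quartic_axioms_def)
  obtain z1 z2 z3 where "quartic_frame p (c 0) z1 z2 z3"
    by (rule N.real_frame_exists) (use \<open>\<forall>x\<in>singular_points 4 (c 0). node 4 p x \<and> real_point x\<close> in blast)+
  then obtain l where l: "labelled (c 0) l" unfolding labelled_def by blast
  then have "l = region_label k" using labelled_unique[OF G01(2) c'(1) l c'(2)] by blast
  then have "labelled (c 1) (region_label k)" using label_constant[of c, OF nod] cont l by blast
  then show ?thesis unfolding label_class_def using G01(3) by blast
qed

text \<open>\<open>rigid_isotopy\<close> relates all nodal curves, so the image of \<open>C\<close>
  might contain curves with nonreal nodes; invariance of the label rules these out. Conversely,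
  curves of equal label have normal forms in one path connected region.\<close>

lemma isotopy_class:
  assumes "C \<in> label_class k" "k < 9"
  shows "rigid_isotopy 4 `` {C} = label_class k"
proof (intro equalityI subsetI)
  fix D assume "D \<in> rigid_isotopy 4 `` {C}"
  then show "D \<in> label_class k" using isotopy_preserves_class assms(1) unfolding rigid_isotopy_def by blast
next
  fix D assume D: "D \<in> label_class k"
  obtain q r1 r2 r3 where C: "q \<in> region k" "0 < rdet r1 r2 r3" "C = ccurve r1 r2 r3 q"
    using label_class_normal_form[OF assms] by (elim bexE exE conjE) (rule that)
  obtain q' t1 t2 t3 where D: "q' \<in> region k" "0 < rdet t1 t2 t3" "D = ccurve t1 t2 t3 q'"
    using label_class_normal_form[OF D assms(2)] by (elim bexE exE conjE) (rule that)
  show "D \<in> rigid_isotopy 4 `` {C}"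
    using region_isotopic[OF assms(2) C(1) D(1) C(2) D(2)] unfolding C(3) D(3) rigid_isotopy_def by blast
qed

lemma label_class_nonempty: "k < 9 \<Longrightarrow> label_class k \<noteq> {}"
proof -
  assume k: "k < 9"
  obtain q where q: "q \<in> region k" using region_nonempty by blast
  have "0 < rdet (axis 1 1) (axis 2 1) (axis 3 1)" unfolding rdet_def by (simp add: axis_def)
  from ccurve_label_class(1)[OF k q this] show ?thesis by blast
qed

lemma label_class_inj: "inj_on label_class {..<9}"
proof (rule inj_onI)
  fix k k' assume k: "k \<in> {..<9}" "k' \<in> {..<9}" and e: "label_class k = label_class k'"
  obtain C where "C \<in> label_class k" using label_class_nonempty k(1) by blast
  then obtain c c' where "real_plane_curve 4 c C" "real_plane_curve 4 c' C" "labelled c (region_label k)" "labelled c' (region_label k')"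
    using e unfolding label_class_def by blast
  then have "region_label k = region_label k'" by (rule labelled_unique)
  then show "k = k'" using region_label_inj k by blast
qed

theorem mainTheorem2:
  shows "card ({C. real_nodal_curve 4 C} // rigid_isotopy 4) = 9"
proof -
  have "{C. real_nodal_curve 4 C} // rigid_isotopy 4 = label_class ` {..<9}"
  proof (intro equalityI subsetI)
    fix X assume "X \<in> {C. real_nodal_curve 4 C} // rigid_isotopy 4"
    then obtain C where "C \<in> (\<Union>k<9. label_class k)" "X = rigid_isotopy 4 `` {C}"
      unfolding real_nodal_label_classes by (rule quotientE)
    then show "X \<in> label_class ` {..<9}" using isotopy_class by auto
  next
    fix X assume "X \<in> label_class ` {..<9}"
    then obtain k where k: "k < 9" "X = label_class k" by auto
    obtain C where C: "C \<in> label_class k" using label_class_nonempty[OF k(1)] by blast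
    have "C \<in> {C. real_nodal_curve 4 C}" unfolding real_nodal_label_classes using C k(1) by auto
    from quotientI[OF this, of "rigid_isotopy 4"] show "X \<in> {C. real_nodal_curve 4 C} // rigid_isotopy 4"
      using isotopy_class[OF C k(1)] k(2) by simp
  qed
  then show ?thesis using card_image[OF label_class_inj] by simp
qed

end
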